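(* Let $A,B>0$ be real constants such that for every $T\ge 3$ one has $$|\zeta(\sigma+iy)|\le A\,T^{B(1-\sigma)^{3/2}}\log^{2/3}T\qquad\text{whenever } 1\le |y|\le T \text{ and } \tfrac12\le\sigma\le 1 .$$ Then there exists $t_0$ such that for all real $t\ge t_0$ the Riemann zeta-function $\zeta$ has no zero $\beta+it$ with $$\beta\ \ge\ 1-\frac{0.055127}{(B\log t)^{2/3}(\log\log t)^{1/3}} .$$
   Context: $\zeta$ denotes the Riemann zeta-function, $\log^{2/3}T=(\log T)^{2/3}$. *)

theory Defs
  imports "HOL-Complex_Analysis.Complex_Analysis"
begin

text \<open>
  The Riemann zeta function is the analytic continuation of the Dirichlet series to the plane
  punctured at 1. The value at the pole is set to 0 only to make the function unique.
\<close>

definition is_zeta :: "(complex \<Rightarrow> complex) \<Rightarrow> bool" where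
  "is_zeta f \<longleftrightarrow>
     f holomorphic_on (- {1}) \<and>
     (\<forall>s. Re s > 1 \<longrightarrow> (\<lambda>n. of_nat (Suc n) powr (- s)) sums f s) \<and>
     f 1 = 0"

definition zeta :: "complex \<Rightarrow> complex" where
  "zeta = (THE f. is_zeta f)"

lemma is_zeta_unique:
  assumes "is_zeta f" "is_zeta g"
  shows   "f = g"
proof
  fix z
  show "f z = g z"
  proof (cases "z = 1")
    case False
    show ?thesis
    proof (rule analytic_continuation_open[of "{s. Re s > 1}" "- {1}" f g])
      show "open {s. Re s > 1}" by (rule open_halfspace_Re_gt)
      show "{s. Re s > 1} \<noteq> {}" by (auto intro: exI[of _ 2])
      show "connected (- {1 :: complex})" by (rule connected_punctured_universe) auto
    qed (use assms False in \<open>auto simp: is_zeta_def intro: sums_unique2\<close>)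
  qed (use assms in \<open>auto simp: is_zeta_def\<close>)
qed

lemma series_holomorphic_halfplane:
  fixes f :: "nat \<Rightarrow> complex \<Rightarrow> complex"
  assumes holo: "\<And>n. f n holomorphic_on {s. Re s > a}"
    and cont: "continuous_on UNIV (C :: complex \<Rightarrow> real)"
    and bound: "\<And>n s. Re s > a \<Longrightarrow> norm (f n s) \<le> C s * real (Suc n) powr (- (Re s + b))"
    and ab: "a + b \<ge> 1"
  shows "(\<lambda>s. \<Sum>n. f n s) holomorphic_on {s. Re s > a}"
    and "Re s > a \<Longrightarrow> summable (\<lambda>n. f n s)"
proof -
  have *: "summable (\<lambda>n. M * real (Suc n) powr (- c))" if "c > 1" for M c :: real
    using that summable_real_powr_iff[of "-c"]
    by (intro summable_mult) (subst summable_Suc_iff, auto)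
  show "summable (\<lambda>n. f n s)" if "Re s > a"
    by (rule summable_comparison_test'[OF *[of "Re s + b" "C s"], of 0])
       (use that ab bound[of s] in auto)
  show "(\<lambda>s. \<Sum>n. f n s) holomorphic_on {s. Re s > a}"
  proof (rule holomorphic_uniform_sequence)
    show "open {s. Re s > a}" by (rule open_halfspace_Re_gt)
    show "(\<lambda>s. \<Sum>i<n. f i s) holomorphic_on {s. Re s > a}" for n
      by (intro holomorphic_on_sum holo)
    fix z assume z: "z \<in> {s. Re s > a}"
    define d where "d = (Re z - a) / 2"
    have d: "d > 0" using z by (simp add: d_def)
    have Re_ge: "Re x \<ge> a + d" if "x \<in> cball z d" for x
      using that abs_Re_le_cmod[of "z - x"] by (auto simp: dist_norm d_def abs_le_iff field_simps)
    have "compact (C ` cball z d)"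
      by (intro compact_continuous_image continuous_on_subset[OF cont]) auto
    then obtain M where M: "\<And>x. x \<in> cball z d \<Longrightarrow> C x \<le> M" and "M \<ge> 0"
      unfolding compact_eq_bounded_closed bounded_pos
      by (metis abs_ge_self order.trans image_eqI less_imp_le real_norm_def)
    have "uniform_limit (cball z d) (\<lambda>n s. \<Sum>i<n. f i s) (\<lambda>s. \<Sum>n. f n s) sequentially"
    proof (rule Weierstrass_m_test)
      show "summable (\<lambda>n. M * real (Suc n) powr (- (a + d + b)))"
        using *[of "a + d + b" M] d ab by linarith
      fix n x assume x: "x \<in> cball z d"
      have "norm (f n x) \<le> C x * real (Suc n) powr (- (Re x + b))"
        using Re_ge[OF x] d by (intro bound) auto
      also have "\<dots> \<le> M * real (Suc n) powr (- (a + d + b))"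
        using M[OF x] Re_ge[OF x] \<open>M \<ge> 0\<close> by (intro mult_mono powr_mono) auto
      finally show "norm (f n x) \<le> \<dots>" .
    qed
    moreover have "cball z d \<subseteq> {s. Re s > a}" using Re_ge d by fastforce
    ultimately show "\<exists>d>0. cball z d \<subseteq> {s. Re s > a} \<and>
        uniform_limit (cball z d) (\<lambda>n s. \<Sum>i<n. f i s) (\<lambda>s. \<Sum>n. f n s) sequentially"
      using d by blast
  qed
qed

definition ffact :: "nat \<Rightarrow> complex \<Rightarrow> complex" where
  "ffact i s = (\<Prod>k<i. 1 - s - of_nat k)"

lemma ffact_holomorphic: "ffact i holomorphic_on S"
  unfolding ffact_def by (intro holomorphic_intros)

text \<open>The error of the Taylor expansion of \<open>x powr (1 - s)\<close> at \<open>n + 1\<close>, evaluated at \<open>n + 2\<close>.\<close>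

definition zeta_rem :: "nat \<Rightarrow> nat \<Rightarrow> complex \<Rightarrow> complex" where
  "zeta_rem K n s = of_nat (Suc (Suc n)) powr (1 - s) -
     (\<Sum>i\<le>K. ffact i s / fact i * of_nat (Suc n) powr (1 - s - of_nat i))"

lemma norm_zeta_rem_le:
  assumes "Re s > 1 - real K"
  shows   "norm (zeta_rem K n s) \<le>
             norm (ffact (Suc K) s) / fact K * real (Suc n) powr (- (Re s + real K))"
proof -
  define N where "N = real (Suc n)"
  have N: "N \<ge> 1" by (simp add: N_def)
  define S where "S = complex_of_real ` {N..N + 1}"
  define f where "f = (\<lambda>i x. ffact i s * x powr (1 - s - of_nat i))"
  have "convex S"
    unfolding S_def
    by (rule convex_linear_image) (auto intro: bounded_linear.linear bounded_linear_of_real)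
  have "norm (f 0 (of_real (N + 1)) -
          (\<Sum>i\<le>K. f i (of_real N) * (of_real (N + 1) - of_real N) ^ i / fact i))
        \<le> (norm (ffact (Suc K) s) * N powr (- (Re s + real K))) *
          norm (of_real (N + 1) - of_real N :: complex) ^ Suc K / fact K"
  proof (rule complex_Taylor[OF \<open>convex S\<close>])
    fix i x assume x: "x \<in> S"
    then obtain t where t: "x = of_real t" "t \<ge> N" by (auto simp: S_def)
    have "((\<lambda>x. x powr (1 - s - of_nat i)) has_field_derivative
            (1 - s - of_nat i) * x powr (1 - s - of_nat i - 1)) (at x)"
      using t N by (intro has_field_derivative_powr) auto
    hence "(f i has_field_derivative ffact i s *
            ((1 - s - of_nat i) * x powr (1 - s - of_nat i - 1))) (at x)"
      unfolding f_def by (rule DERIV_cmult)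
    also have "ffact i s * ((1 - s - of_nat i) * x powr (1 - s - of_nat i - 1)) = f (Suc i) x"
      by (simp add: f_def ffact_def algebra_simps)
    finally show "(f i has_field_derivative f (Suc i) x) (at x within S)"
      by (rule has_field_derivative_at_within)
  next
    fix x assume "x \<in> S"
    then obtain t where t: "x = of_real t" "t \<ge> N" by (auto simp: S_def)
    have "norm (f (Suc K) x) = norm (ffact (Suc K) s) * t powr (- (Re s + real K))"
      using t N by (simp add: f_def norm_mult norm_powr_real_powr algebra_simps)
    also have "\<dots> \<le> norm (ffact (Suc K) s) * N powr (- (Re s + real K))"
      using t N assms by (intro mult_left_mono powr_mono2') auto
    finally show "norm (f (Suc K) x) \<le> \<dots>" .
  qed (unfold S_def, (rule imageI; simp)+)
  also have "f 0 (of_real (N + 1)) -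
          (\<Sum>i\<le>K. f i (of_real N) * (of_real (N + 1) - of_real N) ^ i / fact i) = zeta_rem K n s"
    by (simp add: zeta_rem_def f_def N_def ffact_def add_ac)
  finally show ?thesis by (simp add: N_def)
qed

lemma zeta_rem_series:
  shows "(\<lambda>s. \<Sum>n. zeta_rem K n s) holomorphic_on {s. Re s > 1 - real K}"
    and "Re s > 1 - real K \<Longrightarrow> summable (\<lambda>n. zeta_rem K n s)"
proof -
  have holo: "zeta_rem K n holomorphic_on {s. Re s > 1 - real K}" for n
    unfolding zeta_rem_def by (intro holomorphic_intros ffact_holomorphic) auto
  have cont: "continuous_on UNIV (\<lambda>s. norm (ffact (Suc K) s) / fact K)"
    by (intro continuous_intros holomorphic_on_imp_continuous_on ffact_holomorphic) auto
  show "(\<lambda>s. \<Sum>n. zeta_rem K n s) holomorphic_on {s. Re s > 1 - real K}"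
    by (rule series_holomorphic_halfplane[OF holo cont norm_zeta_rem_le]) auto
  show "Re s > 1 - real K \<Longrightarrow> summable (\<lambda>n. zeta_rem K n s)"
    by (rule series_holomorphic_halfplane[OF holo cont norm_zeta_rem_le]) auto
qed

definition dirichlet_zeta :: "complex \<Rightarrow> complex" where
  "dirichlet_zeta s = (\<Sum>n. of_nat (Suc n) powr (- s))"

lemma dirichlet_zeta:
  shows "dirichlet_zeta holomorphic_on {s. Re s > 1}"
    and "Re s > 1 \<Longrightarrow> (\<lambda>n. of_nat (Suc n) powr (- s)) sums dirichlet_zeta s"
proof -
  have holo: "(\<lambda>s. of_nat (Suc n) powr (- s)) holomorphic_on {s. Re s > 1}" for n
    by (intro holomorphic_intros)
  have cont: "continuous_on UNIV (\<lambda>_ :: complex. 1 :: real)" by simp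
  have bound: "norm (of_nat (Suc n) powr (- s) :: complex) \<le>
                 1 * real (Suc n) powr (- (Re s + 0))" for n s
    using norm_powr_real_powr[of "of_nat (Suc n)" "-s"] by (simp del: of_nat_Suc)
  show "dirichlet_zeta holomorphic_on {s. Re s > 1}"
    unfolding dirichlet_zeta_def[abs_def]
    by (rule series_holomorphic_halfplane[OF holo cont bound]) auto
  have "summable (\<lambda>n. of_nat (Suc n) powr (- s) :: complex)" if "Re s > 1"
    by (rule series_holomorphic_halfplane[OF holo cont bound]) (use that in auto)
  thus "Re s > 1 \<Longrightarrow> (\<lambda>n. of_nat (Suc n) powr (- s)) sums dirichlet_zeta s"
    unfolding dirichlet_zeta_def by (rule summable_sums)
qed

lemma dirichlet_zeta_recurrence:
  assumes s: "Re s > 1"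
  shows "(s - 1) * dirichlet_zeta s = 1 + (\<Sum>n. zeta_rem (Suc K) n s) -
           (\<Sum>i<K. ffact (Suc i) s / fact (Suc (Suc i)) *
             ((s + of_nat (Suc i) - 1) * dirichlet_zeta (s + of_nat (Suc i))))"
proof -
  let ?g = "\<lambda>n. of_nat (Suc n) powr (1 - s) :: complex"
  have "(\<lambda>n. complex_of_real (real (Suc n)) powr (1 - s)) \<longlonglongrightarrow> 0"
    using s by (intro tendsto_neg_powr_complex_of_real
      filterlim_compose[OF filterlim_real_sequentially filterlim_Suc]) auto
  hence "?g \<longlonglongrightarrow> 0" by (simp del: of_nat_Suc)
  from telescope_sums[OF this]
  have 1: "(\<lambda>n. ?g (Suc n) - ?g n) sums (-1)" by simp
  have 2: "(\<lambda>n. zeta_rem (Suc K) n s + (\<Sum>i<Suc K. ffact (Suc i) s / fact (Suc i) *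
             of_nat (Suc n) powr (- (s + of_nat i)))) sums
           ((\<Sum>n. zeta_rem (Suc K) n s) +
             (\<Sum>i<Suc K. ffact (Suc i) s / fact (Suc i) * dirichlet_zeta (s + of_nat i)))"
    using s by (intro sums_add summable_sums zeta_rem_series sums_sum sums_mult dirichlet_zeta) auto
  have "zeta_rem (Suc K) n s + (\<Sum>i<Suc K. ffact (Suc i) s / fact (Suc i) *
             of_nat (Suc n) powr (- (s + of_nat i))) = ?g (Suc n) - ?g n" for n
  proof -
    have "(\<Sum>i\<le>Suc K. ffact i s / fact i * of_nat (Suc n) powr (1 - s - of_nat i)) =
          ?g n + (\<Sum>i<Suc K. ffact (Suc i) s / fact (Suc i) *
             of_nat (Suc n) powr (- (s + of_nat i)))"
      unfolding lessThan_Suc_atMost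
      by (subst sum.atMost_Suc_shift) (simp add: ffact_def algebra_simps)
    thus ?thesis by (simp add: zeta_rem_def)
  qed
  with 1 2 have "-1 = (\<Sum>n. zeta_rem (Suc K) n s) +
      (\<Sum>i<Suc K. ffact (Suc i) s / fact (Suc i) * dirichlet_zeta (s + of_nat i))"
    using sums_unique2 by (simp only:) 
  also have "(\<Sum>i<Suc K. ffact (Suc i) s / fact (Suc i) * dirichlet_zeta (s + of_nat i)) =
     (1 - s) * dirichlet_zeta s +
     (\<Sum>i<K. ffact (Suc (Suc i)) s / fact (Suc (Suc i)) * dirichlet_zeta (s + of_nat (Suc i)))"
    by (subst sum.lessThan_Suc_shift) (simp add: ffact_def)
  also have "(\<Sum>i<K. ffact (Suc (Suc i)) s / fact (Suc (Suc i)) *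
                dirichlet_zeta (s + of_nat (Suc i))) =
     - (\<Sum>i<K. ffact (Suc i) s / fact (Suc (Suc i)) *
             ((s + of_nat (Suc i) - 1) * dirichlet_zeta (s + of_nat (Suc i))))"
    unfolding sum_negf [symmetric]
  proof (intro sum.cong refl)
    fix i
    have *: "ffact (Suc (Suc i)) s = - (ffact (Suc i) s * (s + of_nat (Suc i) - 1))"
      unfolding ffact_def by (subst prod.lessThan_Suc) (simp add: algebra_simps)
    show "ffact (Suc (Suc i)) s / fact (Suc (Suc i)) * dirichlet_zeta (s + of_nat (Suc i)) =
      - (ffact (Suc i) s / fact (Suc (Suc i)) *
             ((s + of_nat (Suc i) - 1) * dirichlet_zeta (s + of_nat (Suc i))))"
      unfolding * by (simp add: divide_simps del: fact_Suc of_nat_Suc)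
  qed
  finally show ?thesis by (simp add: algebra_simps)
qed

lemma zeta_continuation_halfplane:
  "\<exists>g. g holomorphic_on {s. Re s > 1 - real K} \<and>
       (\<forall>s. Re s > 1 \<longrightarrow> g s = (s - 1) * dirichlet_zeta s)"
proof (induction K)
  case 0
  show ?case
    by (rule exI[of _ "\<lambda>s. (s - 1) * dirichlet_zeta s"])
       (auto intro!: holomorphic_intros dirichlet_zeta)
next
  case (Suc K)
  then obtain g where g: "g holomorphic_on {s. Re s > 1 - real K}"
    and eq: "\<And>s. Re s > 1 \<Longrightarrow> g s = (s - 1) * dirichlet_zeta s" by blast
  define h where "h = (\<lambda>s. 1 + (\<Sum>n. zeta_rem (Suc K) n s) -
           (\<Sum>i<K. ffact (Suc i) s / fact (Suc (Suc i)) * g (s + of_nat (Suc i))))"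
  have "(\<lambda>s. g (s + of_nat (Suc i))) holomorphic_on {s. Re s > 1 - real (Suc K)}" for i
    by (rule holomorphic_on_compose_gen[OF _ g, unfolded o_def]) (auto intro!: holomorphic_intros)
  hence "h holomorphic_on {s. Re s > 1 - real (Suc K)}"
    unfolding h_def by (intro holomorphic_intros zeta_rem_series ffact_holomorphic) auto
  moreover have "h s = (s - 1) * dirichlet_zeta s" if "Re s > 1" for s
    unfolding h_def dirichlet_zeta_recurrence[OF that, of K] using that by (simp add: eq)
  ultimately show ?case by blast
qed

lemma is_zeta_exists: "\<exists>f. is_zeta f"
proof -
  from zeta_continuation_halfplane obtain g where
    holo: "\<And>K. g K holomorphic_on {s. Re s > 1 - real K}" and
    eq: "\<And>K s. Re s > 1 \<Longrightarrow> g K s = (s - 1) * dirichlet_zeta s"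
    by metis
  have agree: "g K s = g L s" if "Re s > 1 - real K" "Re s > 1 - real L" for K L s
  proof (rule analytic_continuation_open[of "{s. Re s > 1}"
           "{s. Re s > 1 - real K} \<inter> {s. Re s > 1 - real L}" "g K" "g L"])
    show "open {s. Re s > 1}" "open ({s. Re s > 1 - real K} \<inter> {s. Re s > 1 - real L})"
      by (intro open_Int open_halfspace_Re_gt)+
    show "{s. Re s > 1} \<noteq> {}" by (auto intro: exI[of _ 2])
    show "connected ({s. Re s > 1 - real K} \<inter> {s. Re s > 1 - real L})"
      by (intro convex_connected convex_Int convex_halfspace_Re_gt)
  qed (use that in \<open>auto simp: eq intro: holomorphic_on_subset[OF holo]\<close>)
  define G where "G = (\<lambda>s. g (nat \<lceil>2 - Re s\<rceil>) s)"
  have G: "G s = g K s" if "Re s > 1 - real K" for s K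
    unfolding G_def by (rule agree) (use that in linarith)+
  define f where "f = (\<lambda>s. G s / (s - 1))"
  have "G holomorphic_on (\<Union>K. {s. Re s > 1 - real K})"
  proof (rule holomorphic_on_UN_open)
    show "G holomorphic_on {s. Re s > 1 - real K}" for K
      using holo[of K] by (rule holomorphic_transform) (auto simp: G)
  qed (rule open_halfspace_Re_gt)
  moreover have "s \<in> (\<Union>K. {s. Re s > 1 - real K})" for s
    using reals_Archimedean2[of "1 - Re s"] by (auto simp: algebra_simps)
  hence "(\<Union>K. {s. Re s > 1 - real K}) = UNIV" by blast
  ultimately have "G holomorphic_on UNIV" by simp
  hence "f holomorphic_on - {1}"
    unfolding f_def by (intro holomorphic_intros) (auto intro: holomorphic_on_subset)
  moreover have "f s = dirichlet_zeta s" if "Re s > 1" for s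
    using that G[of 0 s] eq[of s 0] by (auto simp: f_def)
  hence "\<forall>s. Re s > 1 \<longrightarrow> (\<lambda>n. of_nat (Suc n) powr (- s)) sums f s"
    using dirichlet_zeta(2) by simp
  moreover have "f 1 = 0" by (simp add: f_def)
  ultimately show ?thesis unfolding is_zeta_def by blast
qed

lemma is_zeta_zeta: "is_zeta zeta"
  unfolding zeta_def
proof (rule theI'[of is_zeta])
  show "\<exists>!f. is_zeta f" using is_zeta_exists is_zeta_unique by blast
qed

end

theory Submission
  imports Defs "HOL-Number_Theory.Prime_Powers"
begin

text \<open>
  The zero detector of Heath-Brown and Ford. Let $\mu(t) = c\,(B\log t)^{-2/3}(\log\log t)^{-1/3}$ and suppose
  there are zeros $\beta+it$ with $1-\beta\le\mu(t)$ and $t$ arbitrarily large; choose one for which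
  $(1-\beta)/\mu(t)$ is almost as small as its limit inferior. Take a non-negative finite exponential sum
  $f(y)=\sum_k c_k e^{-a_k y}$ and a non-negative cosine polynomial $\sum_j b_j\cos j\theta$. Then
  $0\le\sum_n\Lambda(n)n^{-1+x\mu}f(\mu\log n)\sum_j b_j\cos(jt\log n)$, and the right-hand side is
  a combination of values of $-\zeta'/\zeta$ at the points $1+\mu(a_k-x)+ijt$.

  For $j\ge 1$ the strip of half-width $\eta$ around $\Re s=1$ is parametrised by the unit disc through
  $u\mapsto 1+ijt+(4\eta/\pi)\arctan u$, where the differentiated Poisson--Jensen formula expresses $\zeta'/\zeta$ by
  zeros and by $\log|\zeta|$ on a circle of radius $R<1$ close to 1. All zeros contribute with the
  same sign, and the chosen one contributes the Laplace transform of $f$. On the left half of the circle $|\zeta|$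
  is bounded by hypothesis. On the right half all $j$ are treated together: the arc is close to the line
  $\Re s=1+\eta$, where $\log\zeta$ is a Dirichlet series with non-negative coefficients, so the cosine
  polynomial applies once more and only the term $j=0$, of size $\log(1/\eta)$, survives. With
  $\eta=(6/5)^2(\log\log t/(B\log t))^{2/3}$ all main terms have the same order, and for suitable $f$ and $b_j$ their
  comparison fails, by a margin of $0.13\%$, when $c=0.055127$.
\<close>

section \<open>A Poisson--Jensen formula for the logarithmic derivative\<close>

text \<open>All estimates live on the scale \<open>ln (ln t)\<close>. In the disc the width \<mu>
  appears as \<epsilon> = pi \<mu> / (4 \<eta>), a constant divided by \<open>ln (ln t)\<close>,
  while the bound for \<open>ln |zeta|\<close> on the left arc and the quantity
  \<open>ln (1 / \<eta>)\<close> on the right one are multiples of \<open>ln (ln t)\<close> up to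
  bounded errors. After multiplication by \<epsilon> the main terms become constants and every
  bounded error disappears; hence the uniform but unspecified constants throughout. A finite
  exponential sum for f keeps the prime sum a finite combination of values of -zeta'/zeta, taken at
  disc points of size O(\<epsilon>), where first-order expansions of the kernels suffice. Yet only
  radius 1 is mapped onto the line \<open>Re s = 1 + \<eta>\<close>, on which the terms of the
  Dirichlet series can be summed over j. So log zeta is carried from radius R to radius 1 at a cost
  of order (1 - R) / (cos t)^2, which forces a cut-off cos t >= \<delta>. Both \<delta> and a lower
  bound R0 for R are fixed, according to the margin, before t tends to infinity.\<close>

lemma has_integral_periodic_shift:
  fixes f :: "real \<Rightarrow> 'a :: banach"
  assumes "(f has_integral I) {0..2 * pi}" "\<And>t. f (t + 2 * pi) = f t"
  shows "(f has_integral I) {- pi / 2..3 * pi / 2}"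
proof -
  have int: "f integrable_on {0..2 * pi}" using assms(1) by blast
  have i1: "f integrable_on {0..3 * pi / 2}" and i2: "f integrable_on {3 * pi / 2..2 * pi}"
    by (rule integrable_subinterval_real[OF int]; simp)+
  have h1: "(f has_integral integral {0..3 * pi / 2} f) {0..3 * pi / 2}" using i1 by blast
  have h2: "(f has_integral integral {3 * pi / 2..2 * pi} f) {3 * pi / 2..2 * pi}" using i2 by blast
  have "I = integral {0..3 * pi / 2} f + integral {3 * pi / 2..2 * pi} f"
    by (rule has_integral_unique[OF assms(1) has_integral_combine[OF _ _ h1 h2]]) auto
  moreover have "((\<lambda>x. f (x + 2 * pi)) has_integral integral {3 * pi / 2..2 * pi} f)
      {3 * pi / 2 - 2 * pi..2 * pi - 2 * pi}"
    by (rule has_integral_shift_real_ivl[OF h2])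
  hence "(f has_integral integral {3 * pi / 2..2 * pi} f) {- pi / 2..0}"
    by (simp add: assms(2)[unfolded mult.commute[of 2]] field_simps)
  hence "(f has_integral integral {3 * pi / 2..2 * pi} f + integral {0..3 * pi / 2} f) {- pi / 2..3 * pi / 2}"
    by (intro has_integral_combine[OF _ _ _ h1]) auto
  ultimately show ?thesis by (simp add: add.commute)
qed

lemma has_contour_integral_circlepath_iff:
  "(f has_contour_integral I) (circlepath 0 R) \<longleftrightarrow>
     ((\<lambda>t. f (R * cis t) * (R * cis t)) has_integral (- \<i> * I)) {0..2 * pi}"
proof -
  have "(f has_contour_integral I) (circlepath 0 R) \<longleftrightarrow>
     ((\<lambda>t. f (R * cis t) * R * \<i> * cis t) has_integral I) {0..2 * pi}"
    unfolding circlepath_def by (subst has_contour_integral_part_circlepath_iff) auto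
  also have "\<dots> \<longleftrightarrow> ((\<lambda>t. - \<i> * (f (R * cis t) * R * \<i> * cis t)) has_integral (- \<i> * I)) {0..2 * pi}"
    using has_integral_mult_right[of "\<lambda>t. f (R * cis t) * R * \<i> * cis t" I "{0..2*pi}" "-\<i>"]
      has_integral_mult_right[of "\<lambda>t. - \<i> * (f (R * cis t) * R * \<i> * cis t)" "- \<i> * I" "{0..2*pi}" "\<i>"]
    by (auto simp: algebra_simps)
  also have "(\<lambda>t. - \<i> * (f (R * cis t) * R * \<i> * cis t)) = (\<lambda>t. f (R * cis t) * (R * cis t))"
    by (auto simp: algebra_simps)
  finally show ?thesis .
qed

text \<open>On \<open>norm w = R\<close> Cauchy's formula for L' has the kernel w / (w - u)^2. The
  integral of L against R^2 w / (R^2 - cnj u w)^2 vanishes, since this kernel has no pole in the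
  disc, and the conjugate of the kernel on the circle is again w / (w - u)^2. Adding the conjugate
  relation replaces L by L + cnj L = 2 Re L.\<close>

lemma schwarz_derivative:
  fixes R r :: real and u :: complex
  assumes L: "L holomorphic_on ball 0 r" and R: "0 < R" "R < r" "norm u < R"
  shows "((\<lambda>t. 2 * of_real (Re (L (R * cis t))) * (R * cis t) / (R * cis t - u)\<^sup>2) has_integral
           2 * pi * deriv L u) {- pi / 2..3 * pi / 2}"
proof -
  define w where "w = (\<lambda>t. of_real R * cis t)"
  have wn: "norm (w t) = R" for t using R by (simp add: w_def norm_mult)
  have contL: "continuous_on (cball 0 R) L" and holL: "L holomorphic_on ball 0 R"
    using R by (auto intro!: holomorphic_on_imp_continuous_on holomorphic_on_subset[OF L])
  have uin: "u \<in> ball 0 R" using R by simp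
  have "(L has_field_derivative deriv L u) (at u)"
    using holomorphic_derivI[OF holL _ uin] by simp
  from DERIV_unique[OF this Cauchy_derivative_integral_circlepath(2)[OF contL holL uin]]
  have ci: "((\<lambda>w. L w / (w - u)\<^sup>2) has_contour_integral (2 * pi * \<i> * deriv L u)) (circlepath 0 R)"
    using Cauchy_derivative_integral_circlepath(1)[OF contL holL uin]
    by (simp add: has_contour_integral_integral field_simps)
  have 1: "((\<lambda>t. L (w t) / (w t - u)\<^sup>2 * w t) has_integral 2 * pi * deriv L u) {0..2 * pi}"
  proof -
    have "- \<i> * (2 * pi * \<i> * d) = 2 * pi * d" for d :: complex by (simp add: algebra_simps)
    note * = this[of "deriv L u"]
    from ci show ?thesis unfolding has_contour_integral_circlepath_iff w_def * by simp
  qed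
  \<comment> \<open>The zero of R^2 - cnj u z has modulus R^2 / |u|. The number 2 R^2 / (|u| + R)
    lies between R and that modulus, and it makes sense for u = 0 as well.\<close>
  define r' where "r' = min r (2 * R\<^sup>2 / (norm u + R))"
  have "norm u + R > 0" using R by (simp add: add_nonneg_pos)
  hence r': "R < r'" using R by (auto simp: r'_def field_simps power2_eq_square)
  have nz: "of_real (R\<^sup>2) - cnj u * z \<noteq> 0" if "z \<in> ball 0 r'" for z
  proof
    assume "of_real (R\<^sup>2) - cnj u * z = 0"
    hence "norm (of_real (R\<^sup>2) :: complex) = norm u * norm z" by (metis complex_mod_cnj eq_iff_diff_eq_0 norm_mult)
    hence eq: "R\<^sup>2 = norm u * norm z" by (simp add: norm_power)
    have "norm z < 2 * R\<^sup>2 / (norm u + R)" using that by (simp add: r'_def)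
    hence "norm z * (norm u + R) < 2 * R\<^sup>2" using \<open>norm u + R > 0\<close> by (simp add: field_simps)
    hence "norm z * R < norm u * norm z" using eq by (simp add: algebra_simps)
    moreover have "norm u * norm z \<le> R * norm z" using R by (intro mult_right_mono) auto
    ultimately show False by (simp add: mult.commute)
  qed
  have "((\<lambda>z. L z * of_real (R\<^sup>2) / (of_real (R\<^sup>2) - cnj u * z)\<^sup>2) has_contour_integral 0) (circlepath 0 R)"
  proof (rule Cauchy_theorem_convex_simple)
    show "(\<lambda>z. L z * of_real (R\<^sup>2) / (of_real (R\<^sup>2) - cnj u * z)\<^sup>2) holomorphic_on ball 0 r'"
      using nz by (intro holomorphic_intros holomorphic_on_subset[OF L]) (auto simp: r'_def)
    show "path_image (circlepath 0 R) \<subseteq> ball 0 r'" using R r' by auto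
  qed auto
  hence "((\<lambda>t. L (w t) * of_real (R\<^sup>2) / (of_real (R\<^sup>2) - cnj u * w t)\<^sup>2 * w t) has_integral 0) {0..2 * pi}"
    unfolding has_contour_integral_circlepath_iff w_def by simp
  note zz = this
  have 2: "((\<lambda>t. cnj (L (w t) * of_real (R\<^sup>2) / (of_real (R\<^sup>2) - cnj u * w t)\<^sup>2 * w t)) has_integral cnj 0) {0..2 * pi}"
    using has_integral_linear[OF zz bounded_linear_cnj] by (simp only: o_def)
  have conjeq: "cnj (L (w t) * of_real (R\<^sup>2) / (of_real (R\<^sup>2) - cnj u * w t)\<^sup>2 * w t) = cnj (L (w t)) * (w t / (w t - u)\<^sup>2)" for t
  proof -
    have R2: "of_real (R\<^sup>2) = w t * cnj (w t)" by (simp only: complex_norm_square[symmetric] wn)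
    have w0: "w t \<noteq> 0" using wn[of t] R by auto
    have wu: "w t \<noteq> u" using wn[of t] R by auto
    have e: "of_real (R\<^sup>2) - u * cnj (w t) = cnj (w t) * (w t - u)" unfolding R2 by (simp add: algebra_simps)
    have "cnj (L (w t) * of_real (R\<^sup>2) / (of_real (R\<^sup>2) - cnj u * w t)\<^sup>2 * w t) =
       cnj (L (w t)) * of_real (R\<^sup>2) / (of_real (R\<^sup>2) - u * cnj (w t))\<^sup>2 * cnj (w t)"
      by simp
    also have "\<dots> = cnj (L (w t)) * (w t * cnj (w t)) / (cnj (w t) * (w t - u))\<^sup>2 * cnj (w t)"
      unfolding e by (simp only: R2)
    also have "\<dots> = cnj (L (w t)) * (w t / (w t - u)\<^sup>2)"
    proof -
      have "c * (x * y) / (y * d)\<^sup>2 * y = c * (x / d\<^sup>2)" if "y \<noteq> 0" "d \<noteq> 0" for c x y d :: complex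
        using that by (simp add: power2_eq_square field_simps)
      thus ?thesis using w0 wu by simp
    qed
    finally show ?thesis .
  qed
  from has_integral_add[OF 1 2]
  have "((\<lambda>t. L (w t) / (w t - u)\<^sup>2 * w t + cnj (L (w t)) * (w t / (w t - u)\<^sup>2)) has_integral 2 * pi * deriv L u) {0..2 * pi}"
    unfolding conjeq by simp
  also have "(\<lambda>t. L (w t) / (w t - u)\<^sup>2 * w t + cnj (L (w t)) * (w t / (w t - u)\<^sup>2)) =
             (\<lambda>t. 2 * of_real (Re (L (w t))) * w t / (w t - u)\<^sup>2)"
  proof
    fix t
    have "L (w t) / (w t - u)\<^sup>2 * w t + cnj (L (w t)) * (w t / (w t - u)\<^sup>2) = (L (w t) + cnj (L (w t))) * (w t / (w t - u)\<^sup>2)"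
      by (simp add: algebra_simps add_divide_distrib)
    thus "L (w t) / (w t - u)\<^sup>2 * w t + cnj (L (w t)) * (w t / (w t - u)\<^sup>2) = 2 * of_real (Re (L (w t))) * w t / (w t - u)\<^sup>2"
      by (simp add: complex_add_cnj)
  qed
  \<comment> \<open>Starting at - pi / 2 makes the right half (cos t >= 0) and the left half of the
    circle two adjacent intervals.\<close>
  finally show ?thesis unfolding w_def
  proof (rule has_integral_periodic_shift)
    have "cis (t + 2 * pi) = cis t" for t by (simp add: complex_eq_iff)
    thus "2 * of_real (Re (L (R * cis (t + 2 * pi)))) * (R * cis (t + 2 * pi)) / (R * cis (t + 2 * pi) - u)\<^sup>2 =
          2 * of_real (Re (L (R * cis t))) * (R * cis t) / (R * cis t - u)\<^sup>2" for t
      by (simp only:)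
  qed
qed

text \<open>The local factor \<open>zor_poly\<close> at \<open>b\<close> is glued to the quotient
  away from \<open>b\<close>, which makes the factorisation valid on all of \<open>S\<close>. A
  point \<open>b\<close> that is no zero is allowed and gets \<open>m = 0\<close>.\<close>

lemma holomorphic_factor_one_zero:
  fixes h :: "complex \<Rightarrow> complex"
  assumes h: "h holomorphic_on S" and S: "open S" "connected S" and b: "b \<in> S" and nz: "\<exists>w\<in>S. h w \<noteq> 0"
  obtains m k where "k holomorphic_on S" "k b \<noteq> 0" "\<And>w. w \<in> S \<Longrightarrow> h w = (w - b) ^ m * k w"
proof -
  from zorder_exist_zero[OF h S b nz] obtain s where s: "s > 0" "cball b s \<subseteq> S"
     "zor_poly h b holomorphic_on cball b s"
     "\<And>w. w \<in> cball b s \<Longrightarrow> h w = zor_poly h b w * (w - b) ^ nat (zorder h b) \<and> zor_poly h b w \<noteq> 0" by blast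
  define m where "m = nat (zorder h b)"
  define k where "k = (\<lambda>w. if w = b then zor_poly h b b else h w / (w - b) ^ m)"
  have k1: "k w = zor_poly h b w" if "w \<in> cball b s" for w
    using s(4)[OF that] by (auto simp: k_def m_def)
  have "k holomorphic_on (ball b s \<union> (S - {b}))"
  proof (rule holomorphic_on_Un)
    show "k holomorphic_on ball b s"
      by (rule holomorphic_transform[OF holomorphic_on_subset[OF s(3)]]) (auto simp: k1)
    have "(\<lambda>w. h w / (w - b) ^ m) holomorphic_on S - {b}"
      by (intro holomorphic_intros holomorphic_on_subset[OF h]) auto
    thus "k holomorphic_on (S - {b})"
      by (rule holomorphic_transform) (auto simp: k_def)
  qed (use S in auto)
  moreover have "ball b s \<union> (S - {b}) = S" using s by auto
  ultimately have "k holomorphic_on S" by simp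
  moreover have "k b \<noteq> 0" using s(4)[of b] s(1) by (auto simp: k_def)
  moreover have "h w = (w - b) ^ m * k w" if "w \<in> S" for w
    using s(4)[of b] s(1) by (cases "w = b") (auto simp: k_def m_def)
  ultimately show ?thesis using that by blast
qed

lemma holomorphic_factor_zeros:
  fixes g :: "complex \<Rightarrow> complex"
  assumes g: "g holomorphic_on S" and S: "open S" "connected S" and nz: "\<exists>w\<in>S. g w \<noteq> 0"
    and "finite Z" "Z \<subseteq> S"
  shows "\<exists>n h. h holomorphic_on S \<and> (\<forall>\<alpha>\<in>Z. h \<alpha> \<noteq> 0) \<and> (\<forall>w\<in>S. g w = (\<Prod>\<alpha>\<in>Z. (w - \<alpha>) ^ n \<alpha>) * h w)"
  using assms(5,6)
proof (induction Z rule: finite_induct)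
  case empty
  show ?case using g by auto
next
  case (insert b Z)
  then have "\<exists>n h. h holomorphic_on S \<and> (\<forall>\<alpha>\<in>Z. h \<alpha> \<noteq> 0) \<and> (\<forall>w\<in>S. g w = (\<Prod>\<alpha>\<in>Z. (w - \<alpha>) ^ n \<alpha>) * h w)"
    by blast
  then obtain n h where h: "h holomorphic_on S" and "\<forall>\<alpha>\<in>Z. h \<alpha> \<noteq> 0"
      and "\<forall>w\<in>S. g w = (\<Prod>\<alpha>\<in>Z. (w - \<alpha>) ^ n \<alpha>) * h w" by (elim exE conjE) (rule that)
  hence h: "h holomorphic_on S" "\<And>\<alpha>. \<alpha> \<in> Z \<Longrightarrow> h \<alpha> \<noteq> 0"
      "\<And>w. w \<in> S \<Longrightarrow> g w = (\<Prod>\<alpha>\<in>Z. (w - \<alpha>) ^ n \<alpha>) * h w" by blast+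
  have ex: "\<exists>w\<in>S. h w \<noteq> 0" using nz h(3) by auto
  have bS: "b \<in> S" using insert.prems by simp
  obtain m k where k: "k holomorphic_on S" "k b \<noteq> 0" "\<And>w. w \<in> S \<Longrightarrow> h w = (w - b) ^ m * k w"
    by (rule holomorphic_factor_one_zero[OF h(1) S bS ex]) (rule that, assumption+)
  have "g w = (\<Prod>\<alpha>\<in>insert b Z. (w - \<alpha>) ^ (n(b := m)) \<alpha>) * k w" if "w \<in> S" for w
  proof -
    have "(\<Prod>\<alpha>\<in>Z. (w - \<alpha>) ^ (n(b := m)) \<alpha>) = (\<Prod>\<alpha>\<in>Z. (w - \<alpha>) ^ n \<alpha>)"
      using insert.hyps by (intro prod.cong) auto
    thus ?thesis using insert.hyps h(3)[OF that] k(3)[OF that] by (simp add: algebra_simps)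
  qed
  moreover have "k \<alpha> \<noteq> 0" if "\<alpha> \<in> insert b Z" for \<alpha>
    using that k h(2)[of \<alpha>] insert.prems by auto
  ultimately show ?case using k(1) by blast
qed

lemma has_field_derivative_prod_power:
  fixes f :: "'i \<Rightarrow> complex \<Rightarrow> complex"
  assumes "finite Z" "\<And>i. i \<in> Z \<Longrightarrow> (f i has_field_derivative f' i) (at u)" "\<And>i. i \<in> Z \<Longrightarrow> f i u \<noteq> 0"
  shows "((\<lambda>w. \<Prod>i\<in>Z. f i w ^ n i) has_field_derivative
            (\<Prod>i\<in>Z. f i u ^ n i) * (\<Sum>i\<in>Z. of_nat (n i) * (f' i / f i u))) (at u)"
  using assms
proof (induction Z rule: finite_induct)
  case (insert b Z)
  have 1: "((\<lambda>w. f b w ^ n b) has_field_derivative f b u ^ n b * (of_nat (n b) * (f' b / f b u))) (at u)"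
    using insert.prems(1)[of b] insert.prems(2)[of b]
    by (cases "n b") (auto intro!: derivative_eq_intros simp: field_simps simp flip: power_Suc)
  show ?case
    using DERIV_mult[OF 1 insert.IH[OF insert.prems]] insert.hyps
    by (simp add: algebra_simps)
qed auto

text \<open>Each factor w - \<alpha> is replaced by (R^2 - cnj \<alpha> w) / R, which has the same
  modulus on the circle and no zero in the closed disc. The resulting \<open>H\<close> has a
  holomorphic logarithm, to which \<open>schwarz_derivative\<close> applies; the difference of the
  two logarithmic derivatives gives the sum over zeros. The multiplicities are chosen before
  \<open>u\<close>, because the formula is later summed over several points.\<close>

theorem poisson_jensen_derivative:
  fixes g :: "complex \<Rightarrow> complex" and R r :: real
  assumes g: "g holomorphic_on ball 0 r" and R: "0 < R" "R < r"
    and nz: "\<And>w. norm w = R \<Longrightarrow> g w \<noteq> 0"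
  defines "Z \<equiv> {\<alpha> \<in> ball 0 R. g \<alpha> = 0}"
  shows "finite Z" and "\<exists>n. (\<forall>\<alpha>\<in>Z. n \<alpha> > 0) \<and> (\<forall>u. norm u < R \<longrightarrow> g u \<noteq> 0 \<longrightarrow>
     ((\<lambda>t. 2 * of_real (ln (norm (g (R * cis t)))) * (R * cis t) / (R * cis t - u)\<^sup>2) has_integral
       2 * pi * (deriv g u / g u - (\<Sum>\<alpha>\<in>Z. of_nat (n \<alpha>) *
           (of_real (R\<^sup>2 - (norm \<alpha>)\<^sup>2) / ((u - \<alpha>) * (of_real (R\<^sup>2) - cnj \<alpha> * u))))))
       {- pi / 2..3 * pi / 2})"
proof -
  have ex: "\<exists>w\<in>ball 0 r. g w \<noteq> 0" using nz[of "of_real R"] R by (intro bexI[of _ "of_real R"]) auto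
  have "finite {\<alpha> \<in> cball 0 R. g \<alpha> = 0}"
  proof (cases "\<exists>w\<in>ball 0 r. g w = 0")
    case True
    have "\<not> g constant_on ball 0 r" using True ex unfolding constant_on_def by metis
    thus ?thesis
      using R by (intro holomorphic_compact_finite_zeros[OF g]) auto
  next
    case False
    hence "{\<alpha> \<in> cball 0 R. g \<alpha> = 0} = {}" using R by auto
    thus ?thesis by (simp only: finite.emptyI)
  qed
  moreover have "{\<alpha> \<in> cball 0 R. g \<alpha> = 0} = Z" unfolding Z_def using nz by (auto simp: less_le)
  ultimately show fin: "finite Z" by simp
  have "Z \<subseteq> ball 0 r" using R by (auto simp: Z_def)
  from holomorphic_factor_zeros[OF g open_ball connected_ball ex fin this]
  obtain n h where "h holomorphic_on ball 0 r" "\<forall>\<alpha>\<in>Z. h \<alpha> \<noteq> 0"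
      "\<forall>w\<in>ball 0 r. g w = (\<Prod>\<alpha>\<in>Z. (w - \<alpha>) ^ n \<alpha>) * h w" by (elim exE conjE) (rule that)
  hence h: "h holomorphic_on ball 0 r" "\<And>\<alpha>. \<alpha> \<in> Z \<Longrightarrow> h \<alpha> \<noteq> 0"
      "\<And>w. w \<in> ball 0 r \<Longrightarrow> g w = (\<Prod>\<alpha>\<in>Z. (w - \<alpha>) ^ n \<alpha>) * h w" by blast+
  have hnz: "h w \<noteq> 0" if "norm w \<le> R" for w
  proof
    assume 0: "h w = 0"
    hence "g w = 0" using h(3)[of w] that R by auto
    moreover from this have "norm w < R" using nz[of w] that by (auto simp: less_le)
    ultimately have "w \<in> Z" by (auto simp: Z_def)
    thus False using h(2) 0 by auto
  qed
  have npos: "n \<alpha> > 0" if "\<alpha> \<in> Z" for \<alpha>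
  proof (rule ccontr)
    assume "\<not> n \<alpha> > 0"
    hence "g \<alpha> \<noteq> 0" using h(3)[of \<alpha>] h(2)[OF that] that R fin by (auto simp: Z_def)
    thus False using that by (auto simp: Z_def)
  qed
  define b where "b = (\<lambda>\<alpha> w. (of_real (R\<^sup>2) - cnj \<alpha> * w) / of_real R)"
  define H where "H = (\<lambda>w. (\<Prod>\<alpha>\<in>Z. b \<alpha> w ^ n \<alpha>) * h w)"
  have bnz: "b \<alpha> w \<noteq> 0" if "\<alpha> \<in> Z" "norm w \<le> R" for \<alpha> w
  proof
    assume "b \<alpha> w = 0"
    hence "of_real (R\<^sup>2) = cnj \<alpha> * w" using R by (simp add: b_def)
    hence "norm (of_real (R\<^sup>2) :: complex) = norm (cnj \<alpha> * w)" by (rule arg_cong)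
    hence "R\<^sup>2 = norm \<alpha> * norm w" by (simp add: norm_mult norm_power)
    also have "\<dots> \<le> norm \<alpha> * R" using that by (intro mult_left_mono) auto
    also have "\<dots> < R * R" using that R by (intro mult_strict_right_mono) (auto simp: Z_def)
    finally show False by (simp add: power2_eq_square)
  qed
  have Hhol: "H holomorphic_on ball 0 r" unfolding H_def b_def
    using R by (intro holomorphic_intros h(1)) auto
  have Hnz: "H w \<noteq> 0" if "norm w \<le> R" for w using bnz hnz that fin by (auto simp: H_def)
  have normH: "norm (H w) = norm (g w)" if "norm w = R" for w
  proof -
    have "norm (b \<alpha> w) = norm (w - \<alpha>)" for \<alpha>
    proof -
      have "of_real (R\<^sup>2) = w * cnj w" using that by (simp add: complex_norm_square[symmetric])
      hence "of_real (R\<^sup>2) - cnj \<alpha> * w = w * cnj (w - \<alpha>)" by (simp add: algebra_simps)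
      thus ?thesis using that R by (simp add: b_def norm_mult norm_divide del: complex_cnj_diff)
    qed
    thus ?thesis using h(3)[of w] that R by (simp add: H_def norm_mult norm_power flip: prod_norm)
  qed
  \<comment> \<open>The logarithm has to be holomorphic beyond the circle, so the zero-free closed
    disc is enlarged to a concentric open one.\<close>
  have "open (ball 0 r \<inter> H -` (- {0}))"
    by (rule continuous_open_preimage) (use Hhol in \<open>auto intro: holomorphic_on_imp_continuous_on\<close>)
  moreover have "cball 0 R \<subseteq> ball 0 r \<inter> H -` (- {0})" using R Hnz by auto
  ultimately obtain e where e: "e > 0" "(\<Union>x\<in>cball 0 R. ball x e) \<subseteq> ball 0 r \<inter> H -` (- {0})"
    using compact_subset_open_imp_ball_epsilon_subset[OF compact_cball, of "ball 0 r \<inter> H -` (- {0})" 0 R] by metis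
  have sub: "ball 0 (R + e) \<subseteq> ball 0 r \<inter> H -` (- {0})"
  proof
    fix w :: complex assume w: "w \<in> ball 0 (R + e)"
    show "w \<in> ball 0 r \<inter> H -` (- {0})"
    proof (cases "norm w \<le> R")
      case False
      \<comment> \<open>Radial projection to the circle; it moves \<open>w\<close> by less than
        \<open>e\<close>.\<close>
      define x where "x = of_real (R / norm w) * w"
      have "w \<noteq> 0" using False R by auto
      hence nx: "norm x = R" using False R by (simp add: x_def norm_mult norm_divide)
      have "w - x = of_real (1 - R / norm w) * w" by (simp add: x_def algebra_simps)
      hence "norm (w - x) = \<bar>1 - R / norm w\<bar> * norm w" by (simp only: norm_mult norm_of_real)
      moreover have "R / norm w < 1" using False R \<open>w \<noteq> 0\<close> by (simp add: divide_less_eq)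
      ultimately have "norm (w - x) = norm w - R" using \<open>w \<noteq> 0\<close> by (simp add: algebra_simps)
      hence "w \<in> ball x e" using w by (simp add: dist_norm norm_minus_commute)
      hence "w \<in> (\<Union>x\<in>cball 0 R. ball x e)" using nx by (intro UN_I[of x]) auto
      thus ?thesis using e(2) by blast
    qed (use e R Hnz in auto)
  qed
  obtain L where L: "L holomorphic_on ball 0 (R + e)" "\<And>z. z \<in> ball 0 (R + e) \<Longrightarrow> H z = exp (L z)"
  proof (rule contractible_imp_holomorphic_log)
    show "H holomorphic_on ball 0 (R + e)" using Hhol sub by (auto intro: holomorphic_on_subset)
    show "contractible (ball 0 (R + e) :: complex set)" by (rule convex_imp_contractible) auto
    show "H z \<noteq> 0" if "z \<in> ball 0 (R + e)" for z using sub that by auto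
  qed blast
  have "((\<lambda>t. 2 * of_real (ln (norm (g (R * cis t)))) * (R * cis t) / (R * cis t - u)\<^sup>2) has_integral
       2 * pi * (deriv g u / g u - (\<Sum>\<alpha>\<in>Z. of_nat (n \<alpha>) *
           (of_real (R\<^sup>2 - (norm \<alpha>)\<^sup>2) / ((u - \<alpha>) * (of_real (R\<^sup>2) - cnj \<alpha> * u))))))
       {- pi / 2..3 * pi / 2}" if u: "norm u < R" "g u \<noteq> 0" for u
  proof -
    have "Re (L (R * cis t)) = ln (norm (g (R * cis t)))" for t
    proof -
      have "norm (of_real R * cis t) = R" using R by (simp add: norm_mult)
      hence "norm (g (R * cis t)) = exp (Re (L (R * cis t)))"
        using normH[of "R * cis t"] L(2)[of "R * cis t"] e by simp
      thus ?thesis by simp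
    qed
    hence int: "((\<lambda>t. 2 * of_real (ln (norm (g (R * cis t)))) * (R * cis t) / (R * cis t - u)\<^sup>2) has_integral
       2 * pi * deriv L u) {- pi / 2..3 * pi / 2}"
      using schwarz_derivative[OF L(1), of R u] R e u by simp
    have uin: "u \<in> ball 0 r" "u \<in> ball 0 (R + e)" using u R e by auto
    have ua: "u - \<alpha> \<noteq> 0" if "\<alpha> \<in> Z" for \<alpha> using u that by (auto simp: Z_def)
    have hd: "(h has_field_derivative deriv h u) (at u)"
      by (rule holomorphic_derivI[OF h(1) _ uin(1)]) auto
    have "((\<lambda>w. (\<Prod>\<alpha>\<in>Z. (w - \<alpha>) ^ n \<alpha>) * h w) has_field_derivative
        (\<Prod>\<alpha>\<in>Z. (u - \<alpha>) ^ n \<alpha>) * (\<Sum>\<alpha>\<in>Z. of_nat (n \<alpha>) * (1 / (u - \<alpha>))) * h u + deriv h u * (\<Prod>\<alpha>\<in>Z. (u - \<alpha>) ^ n \<alpha>)) (at u)"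
      by (intro DERIV_mult hd has_field_derivative_prod_power fin) (use ua in \<open>auto intro!: derivative_eq_intros\<close>)
    hence gd: "(g has_field_derivative
        (\<Prod>\<alpha>\<in>Z. (u - \<alpha>) ^ n \<alpha>) * (\<Sum>\<alpha>\<in>Z. of_nat (n \<alpha>) * (1 / (u - \<alpha>))) * h u + deriv h u * (\<Prod>\<alpha>\<in>Z. (u - \<alpha>) ^ n \<alpha>)) (at u)"
      by (rule has_field_derivative_transform_within_open[OF _ open_ball uin(1)]) (rule h(3)[symmetric])
    hence dg: "deriv g u / g u = (\<Sum>\<alpha>\<in>Z. of_nat (n \<alpha>) * (1 / (u - \<alpha>))) + deriv h u / h u"
    proof -
      have "(p * s * c + d * p) / (p * c) = s + d / c" if "p \<noteq> 0" "c \<noteq> 0" for p s c d :: complex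
        using that by (simp add: add_divide_distrib)
      moreover have "(\<Prod>\<alpha>\<in>Z. (u - \<alpha>) ^ n \<alpha>) \<noteq> 0" using ua fin by auto
      ultimately show ?thesis
        using DERIV_imp_deriv[OF gd] h(3)[OF uin(1)] hnz[of u] u by simp
    qed
    have bd: "(b \<alpha> has_field_derivative (- cnj \<alpha> / of_real R)) (at u)" for \<alpha>
      unfolding b_def using R by (auto intro!: derivative_eq_intros simp: field_simps)
    have Hd1: "(H has_field_derivative
        (\<Prod>\<alpha>\<in>Z. b \<alpha> u ^ n \<alpha>) * (\<Sum>\<alpha>\<in>Z. of_nat (n \<alpha>) * ((- cnj \<alpha> / of_real R) / b \<alpha> u)) * h u + deriv h u * (\<Prod>\<alpha>\<in>Z. b \<alpha> u ^ n \<alpha>)) (at u)"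
      unfolding H_def
      by (rule DERIV_mult[OF has_field_derivative_prod_power[OF fin bd bnz] hd]) (use u in auto)
    have Hd2: "(H has_field_derivative exp (L u) * deriv L u) (at u)"
    proof -
      have "(L has_field_derivative deriv L u) (at u)" by (rule holomorphic_derivI[OF L(1) _ uin(2)]) auto
      hence "((\<lambda>w. exp (L w)) has_field_derivative exp (L u) * deriv L u) (at u)"
        by (auto intro!: derivative_eq_intros)
      thus ?thesis
        by (rule has_field_derivative_transform_within_open[OF _ open_ball uin(2)]) (rule L(2)[symmetric])
    qed
    define P where "P = (\<Prod>\<alpha>\<in>Z. b \<alpha> u ^ n \<alpha>)"
    define S where "S = (\<Sum>\<alpha>\<in>Z. of_nat (n \<alpha>) * ((- cnj \<alpha> / of_real R) / b \<alpha> u))"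
    have HP: "H u = P * h u" by (simp add: H_def P_def)
    have "exp (L u) * deriv L u = P * S * h u + deriv h u * P"
      using DERIV_unique[OF Hd2 Hd1] unfolding P_def S_def .
    moreover have eP: "exp (L u) = P * h u" using L(2)[OF uin(2)] HP by simp
    ultimately have eq: "P * h u * deriv L u = P * S * h u + deriv h u * P" by simp
    have nzs: "P \<noteq> 0" "h u \<noteq> 0" using Hnz[of u] u HP by auto
    have "deriv L u = (P * h u * deriv L u) / (P * h u)" using nzs by simp
    also have "\<dots> = S + deriv h u / h u" unfolding eq using nzs by (simp add: add_divide_distrib)
    finally have "deriv L u = S + deriv h u / h u" .
    hence dL: "deriv L u = (\<Sum>\<alpha>\<in>Z. of_nat (n \<alpha>) * ((- cnj \<alpha> / of_real R) / b \<alpha> u)) + deriv h u / h u"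
      unfolding S_def .
    have "(\<Sum>\<alpha>\<in>Z. of_nat (n \<alpha>) * ((- cnj \<alpha> / of_real R) / b \<alpha> u)) =
       (\<Sum>\<alpha>\<in>Z. of_nat (n \<alpha>) * (1 / (u - \<alpha>))) - (\<Sum>\<alpha>\<in>Z. of_nat (n \<alpha>) *
           (of_real (R\<^sup>2 - (norm \<alpha>)\<^sup>2) / ((u - \<alpha>) * (of_real (R\<^sup>2) - cnj \<alpha> * u))))"
      unfolding sum_subtractf[symmetric] right_diff_distrib[symmetric]
    proof (intro sum.cong refl arg_cong[where f = "\<lambda>x. of_nat (n _) * x"])
      fix \<alpha> assume a: "\<alpha> \<in> Z"
      define d where "d = of_real (R\<^sup>2) - cnj \<alpha> * u"
      have d: "d \<noteq> 0" using bnz[OF a, of u] u by (auto simp: b_def d_def)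
      have "of_real ((norm \<alpha>)\<^sup>2) = \<alpha> * cnj \<alpha>" by (rule complex_norm_square)
      hence num: "of_real (R\<^sup>2 - (norm \<alpha>)\<^sup>2) = d + cnj \<alpha> * (u - \<alpha>)"
        unfolding of_real_diff by (simp add: d_def algebra_simps)
      have "- cnj \<alpha> / of_real R / b \<alpha> u = - cnj \<alpha> / d"
        using R by (simp add: b_def d_def)
      also have "\<dots> = 1 / (u - \<alpha>) - (d + cnj \<alpha> * (u - \<alpha>)) / ((u - \<alpha>) * d)"
        using d ua[OF a] by (simp add: add_divide_distrib)
      finally show "- cnj \<alpha> / of_real R / b \<alpha> u = 1 / (u - \<alpha>) - of_real (R\<^sup>2 - (norm \<alpha>)\<^sup>2) / ((u - \<alpha>) * (of_real (R\<^sup>2) - cnj \<alpha> * u))"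
        by (simp only: num d_def)
    qed
    with dL dg have "deriv L u = deriv g u / g u - (\<Sum>\<alpha>\<in>Z. of_nat (n \<alpha>) *
           (of_real (R\<^sup>2 - (norm \<alpha>)\<^sup>2) / ((u - \<alpha>) * (of_real (R\<^sup>2) - cnj \<alpha> * u))))" by simp
    with int show ?thesis by simp
  qed
  with npos show "\<exists>n. (\<forall>\<alpha>\<in>Z. n \<alpha> > 0) \<and> (\<forall>u. norm u < R \<longrightarrow> g u \<noteq> 0 \<longrightarrow>
     ((\<lambda>t. 2 * of_real (ln (norm (g (R * cis t)))) * (R * cis t) / (R * cis t - u)\<^sup>2) has_integral
       2 * pi * (deriv g u / g u - (\<Sum>\<alpha>\<in>Z. of_nat (n \<alpha>) *
           (of_real (R\<^sup>2 - (norm \<alpha>)\<^sup>2) / ((u - \<alpha>) * (of_real (R\<^sup>2) - cnj \<alpha> * u))))))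
       {- pi / 2..3 * pi / 2})" by blast
qed

section \<open>The Dirichlet series of the logarithm of zeta\<close>

abbreviation zeta_halfplane :: "complex set" where "zeta_halfplane \<equiv> {s. Re s > 1}"

lemma zeta_sums: "Re s > 1 \<Longrightarrow> (\<lambda>n. of_nat (Suc n) powr (- s)) sums zeta s"
  using is_zeta_zeta by (auto simp: is_zeta_def)

lemma zeta_holomorphic: "zeta holomorphic_on - {1}"
  using is_zeta_zeta by (auto simp: is_zeta_def)

definition dirichlet_series :: "(nat \<Rightarrow> real) \<Rightarrow> complex \<Rightarrow> complex" where
  "dirichlet_series a s = (\<Sum>n. of_real (a (Suc n)) * of_nat (Suc n) powr (- s))"

lemma norm_of_nat_powr: "n > 0 \<Longrightarrow> norm (of_nat n powr s :: complex) = real n powr Re s"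
  using norm_powr_real_powr[of "of_nat n" s] by simp

lemma summable_ln_powr:
  assumes "x > (1 :: real)"
  shows "summable (\<lambda>n. (ln (real (Suc n)) + 1) * real (Suc n) powr (- x))"
proof -
  define d where "d = (x - 1) / 2"
  have d: "d > 0" using assms by (simp add: d_def)
  show ?thesis
  proof (rule summable_comparison_test')
    show "summable (\<lambda>n. (1 / d + 1) * real (Suc n) powr (- (1 + d)))"
      using summable_real_powr_iff[of "- (1 + d)"] d
      by (intro summable_mult) (subst summable_Suc_iff, auto)
    fix n :: nat
    define m where "m = real (Suc n)"
    have m: "m \<ge> 1" by (simp add: m_def)
    have "ln m + 1 \<le> (1 / d + 1) * m powr d"
    proof -
      have "ln m \<le> m powr d / d" using ln_powr_bound[of m d] m d by simp
      moreover have "1 \<le> m powr d" using m d by (simp add: ge_one_powr_ge_zero)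
      ultimately show ?thesis by (simp add: algebra_simps)
    qed
    hence "(ln m + 1) * m powr (- x) \<le> (1 / d + 1) * m powr d * m powr (- x)"
      by (intro mult_right_mono) auto
    also have "\<dots> = (1 / d + 1) * m powr (- (1 + d))"
      by (simp add: mult.assoc flip: powr_add) (simp add: d_def field_simps)
    finally show "norm ((ln (real (Suc n)) + 1) * real (Suc n) powr (- x)) \<le> (1 / d + 1) * real (Suc n) powr (- (1 + d))"
      using m by (simp add: m_def abs_mult)
  qed
qed

text \<open>One bound covers the coefficients 1, ln n, \<open>mangoldt\<close> and
  \<open>logcoeff\<close> at once.\<close>

locale log_dirichlet =
  fixes a :: "nat \<Rightarrow> real"
  assumes bnd: "\<And>n. n > 0 \<Longrightarrow> \<bar>a n\<bar> \<le> ln (real n) + 1"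
begin

lemma summable_norm:
  assumes "Re s > 1"
  shows "summable (\<lambda>n. norm (of_real (a (Suc n)) * of_nat (Suc n) powr (- s) :: complex))"
proof (rule summable_comparison_test'[OF summable_ln_powr[OF assms]])
  fix n show "norm (norm (of_real (a (Suc n)) * of_nat (Suc n) powr (- s) :: complex)) \<le> (ln (real (Suc n)) + 1) * real (Suc n) powr (- Re s)"
    unfolding norm_mult using bnd[of "Suc n"]
    by (simp add: norm_of_nat_powr norm_mult mult_right_mono del: of_nat_Suc)
qed

lemma summable: "Re s > 1 \<Longrightarrow> summable (\<lambda>n. of_real (a (Suc n)) * of_nat (Suc n) powr (- s) :: complex)"
  by (rule summable_norm_cancel[OF summable_norm])

lemma sums: "Re s > 1 \<Longrightarrow> (\<lambda>n. of_real (a (Suc n)) * of_nat (Suc n) powr (- s)) sums dirichlet_series a s"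
  unfolding dirichlet_series_def by (rule summable_sums[OF summable])

text \<open>The coefficients \<open>- a n * ln n\<close> may violate the bound of the locale.
  Convergence of the differentiated series is therefore a conclusion of its own, read off from the
  locally uniform limit of the partial sums.\<close>

lemma has_derivative:
  assumes s: "Re s > 1"
  shows "(dirichlet_series a has_field_derivative dirichlet_series (\<lambda>n. - a n * ln (real n)) s) (at s)"
    and "(\<lambda>n. of_real (- a (Suc n) * ln (real (Suc n))) * of_nat (Suc n) powr (- s)) sums dirichlet_series (\<lambda>n. - a n * ln (real n)) s"
proof -
  define F where "F = (\<lambda>n s. \<Sum>i<n. of_real (a (Suc i)) * of_nat (Suc i) powr (- s) :: complex)"
  define F' where "F' = (\<lambda>n s. \<Sum>i<n. of_real (- a (Suc i) * ln (real (Suc i))) * of_nat (Suc i) powr (- s) :: complex)"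
  have op: "open zeta_halfplane" by (rule open_halfspace_Re_gt)
  have der: "(F n has_field_derivative F' n z) (at z)" for n z
    unfolding F_def F'_def
  proof (rule DERIV_sum)
    fix i
    have "((\<lambda>w. of_nat (Suc i) powr (- w)) has_field_derivative Ln (of_nat (Suc i)) * of_nat (Suc i) powr (- z) * (- 1)) (at z)"
      by (rule DERIV_chain2[OF has_field_derivative_powr_right]) (auto intro!: derivative_eq_intros simp del: of_nat_Suc)
    from DERIV_cmult[OF this, of "of_real (a (Suc i))"]
    show "((\<lambda>w. of_real (a (Suc i)) * of_nat (Suc i) powr (- w)) has_field_derivative
        of_real (- a (Suc i) * ln (real (Suc i))) * of_nat (Suc i) powr (- z)) (at z)"
      by (simp add: Ln_of_nat mult.assoc del: of_nat_Suc)
  qed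
  have ul: "\<exists>d>0. cball z d \<subseteq> zeta_halfplane \<and> uniform_limit (cball z d) F (dirichlet_series a) sequentially" if z: "z \<in> zeta_halfplane" for z
  proof -
    define d where "d = (Re z - 1) / 2"
    have d: "d > 0" using z by (simp add: d_def)
    have Re_ge: "Re x \<ge> 1 + d" if "x \<in> cball z d" for x
      using that abs_Re_le_cmod[of "z - x"] by (auto simp: dist_norm d_def abs_le_iff field_simps)
    have "uniform_limit (cball z d) (\<lambda>n s. \<Sum>i<n. of_real (a (Suc i)) * of_nat (Suc i) powr (- s))
        (\<lambda>s. \<Sum>n. of_real (a (Suc n)) * of_nat (Suc n) powr (- s)) sequentially"
    proof (rule Weierstrass_m_test)
      show "summable (\<lambda>n. (ln (real (Suc n)) + 1) * real (Suc n) powr (- (1 + d)))"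
        by (rule summable_ln_powr) (use d in auto)
      fix n x assume x: "x \<in> cball z d"
      have "norm (of_real (a (Suc n)) * of_nat (Suc n) powr (- x) :: complex) \<le> (ln (real (Suc n)) + 1) * real (Suc n) powr (- Re x)"
        unfolding norm_mult using bnd[of "Suc n"]
        by (simp add: norm_of_nat_powr norm_mult mult_right_mono del: of_nat_Suc)
      also have "\<dots> \<le> (ln (real (Suc n)) + 1) * real (Suc n) powr (- (1 + d))"
        using Re_ge[OF x] by (intro mult_left_mono powr_mono) (auto simp: add_nonneg_nonneg)
      finally show "norm (of_real (a (Suc n)) * of_nat (Suc n) powr (- x) :: complex) \<le> \<dots>" .
    qed
    moreover have "cball z d \<subseteq> zeta_halfplane" using Re_ge d by fastforce
    ultimately show ?thesis using d unfolding F_def dirichlet_series_def[abs_def] by blast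
  qed
  obtain g where g: "\<And>x. x \<in> zeta_halfplane \<Longrightarrow> (dirichlet_series a has_field_derivative g x) (at x) \<and> (\<lambda>n. F' n x) \<longlonglongrightarrow> g x"
  proof -
    have "\<exists>g. \<forall>x\<in>zeta_halfplane. (dirichlet_series a has_field_derivative g x) (at x) \<and> ((\<lambda>n. F' n x) \<longlongrightarrow> g x) sequentially"
    proof (rule has_complex_derivative_uniform_sequence[OF op])
      show "(F n has_field_derivative F' n x) (at x)" if "x \<in> zeta_halfplane" for n x by (rule der)
      show "\<exists>d>0. cball x d \<subseteq> zeta_halfplane \<and> uniform_limit (cball x d) F (dirichlet_series a) sequentially" if "x \<in> zeta_halfplane" for x
        by (rule ul[OF that])
    qed
    thus ?thesis using that by blast
  qed
  have "(\<lambda>n. F' n s) \<longlonglongrightarrow> g s" using g s by auto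
  hence sm: "(\<lambda>n. of_real (- a (Suc n) * ln (real (Suc n))) * of_nat (Suc n) powr (- s)) sums g s"
    unfolding F'_def sums_def .
  hence gs: "g s = dirichlet_series (\<lambda>n. - a n * ln (real n)) s" unfolding dirichlet_series_def by (rule sums_unique)
  show "(dirichlet_series a has_field_derivative dirichlet_series (\<lambda>n. - a n * ln (real n)) s) (at s)"
    using g s unfolding gs[symmetric] by auto
  show "(\<lambda>n. of_real (- a (Suc n) * ln (real (Suc n))) * of_nat (Suc n) powr (- s)) sums dirichlet_series (\<lambda>n. - a n * ln (real n)) s"
    using sm unfolding gs .
qed

end

text \<open>Absolute convergence permits regrouping the double series by n = d e. The case of
  interest is Lambda convolved with 1, which yields the series of zeta'/zeta.\<close>

lemma dirichlet_convolution_one: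
  fixes a :: "nat \<Rightarrow> real"
  assumes a: "log_dirichlet a" and nn: "\<And>n. a n \<ge> 0" and s: "Re s > 1"
    and bL: "log_dirichlet (\<lambda>n. \<Sum>d | d dvd n. a d)"
  shows "dirichlet_series a s * zeta s = dirichlet_series (\<lambda>n. \<Sum>d | d dvd n. a d) s"
proof -
  interpret a: log_dirichlet a by fact
  interpret o: log_dirichlet "\<lambda>_. 1" by unfold_locales (auto simp: Suc_le_eq)
  define A where "A = (\<lambda>n. of_real (a n) * of_nat n powr (- s) :: complex)"
  define B where "B = (\<lambda>n. of_nat n powr (- s) :: complex)"
  have z1: "zeta s = dirichlet_series (\<lambda>_. 1) s"
    using sums_unique[OF zeta_sums[OF s]] by (simp add: dirichlet_series_def)
  have hs: "(f has_sum S) {0<..}" if "summable (\<lambda>n. norm (f (Suc n)))" "(\<lambda>n. f (Suc n)) sums S" for f :: "nat \<Rightarrow> complex" and S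
  proof -
    have "((\<lambda>n. f (Suc n)) has_sum S) UNIV"
      using that by (rule norm_summable_imp_has_sum)
    hence "(f has_sum S) (Suc ` UNIV)" by (subst has_sum_reindex) (auto simp: o_def)
    moreover have "range Suc = {0<..}" using gr0_conv_Suc by auto
    ultimately show ?thesis by simp
  qed
  have hA: "(A has_sum dirichlet_series a s) {0<..}" unfolding A_def
    by (rule hs[OF a.summable_norm[OF s] a.sums[OF s]])
  have hB: "(B has_sum zeta s) {0<..}" unfolding B_def
    using hs[of "\<lambda>n. of_nat n powr (- s)" "zeta s"] o.summable_norm[OF s] zeta_sums[OF s] by simp
  have nA: "(\<lambda>n. norm (A n)) summable_on {0<..}" and nB: "(\<lambda>n. norm (B n)) summable_on {0<..}"
    using hA hB by (auto simp: summable_on_iff_abs_summable_on_complex[symmetric] has_sum_imp_summable)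
  have AB: "((\<lambda>(x, y). A x * B y) has_sum dirichlet_series a s * zeta s) ({0<..} \<times> {0<..})"
  proof -
    have "(\<lambda>p. norm (A (fst p) * B (snd p))) summable_on ({0<..} \<times> {0<..})"
    proof (rule summable_on_SigmaI)
      show "((\<lambda>y. norm (A (fst (x, y)) * B (snd (x, y)))) has_sum norm (A x) * infsum (\<lambda>n. norm (B n)) {0<..}) {0<..}" for x
        using has_sum_cmult_right[OF has_sum_infsum[OF nB], of "norm (A x)"] by (simp add: norm_mult)
      show "(\<lambda>x. norm (A x) * infsum (\<lambda>n. norm (B n)) {0<..}) summable_on {0<..}"
        by (rule summable_on_cmult_left[OF nA])
    qed auto
    hence sm: "(\<lambda>(x, y). A x * B y) summable_on ({0<..} \<times> {0<..})"
      unfolding case_prod_unfold by (rule abs_summable_summable)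
    show ?thesis
    proof (rule has_sum_SigmaI[OF _ _ sm])
      show "((\<lambda>y. case (x, y) of (x, y) \<Rightarrow> A x * B y) has_sum A x * zeta s) {0<..}" for x
        using has_sum_cmult_right[OF hB, of "A x"] by simp
      show "((\<lambda>x. A x * zeta s) has_sum dirichlet_series a s * zeta s) {0<..}"
        by (rule has_sum_cmult_left[OF hA])
    qed
  qed
  have bij: "bij_betw (\<lambda>(n, d). (d, n div d)) (SIGMA n:{0<..}. {d. d dvd n}) ({0<..} \<times> {0<..} :: (nat \<times> nat) set)"
    by (rule bij_betwI[where g = "\<lambda>(d, e). (d * e, d)"])
       (auto elim!: dvdE intro: Nat.gr0I)
  have "((\<lambda>p. case (case p of (n, d) \<Rightarrow> (d, n div d)) of (x, y) \<Rightarrow> A x * B y) has_sum dirichlet_series a s * zeta s) (SIGMA n:{0<..}. {d. d dvd n})"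
    using AB has_sum_reindex_bij_betw[OF bij, of "\<lambda>(x, y). A x * B y" "dirichlet_series a s * zeta s"] by simp
  hence "((\<lambda>(n, d). A d * B (n div d)) has_sum dirichlet_series a s * zeta s) (SIGMA n:{0<..}. {d. d dvd n})"
    by (simp add: case_prod_unfold)
  hence "((\<lambda>n. \<Sum>d | d dvd n. A d * B (n div d)) has_sum dirichlet_series a s * zeta s) {0<..}"
    by (rule has_sum_SigmaD) (auto intro!: has_sum_finite)
  also have "?this \<longleftrightarrow> ((\<lambda>n. of_real (\<Sum>d | d dvd n. a d) * of_nat n powr (- s)) has_sum dirichlet_series a s * zeta s) {0<..}"
  proof (rule has_sum_cong)
    fix n :: nat assume n: "n \<in> {0<..}"
    have "A d * B (n div d) = of_real (a d) * of_nat n powr (- s)" if dn: "d dvd n" for d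
    proof -
      obtain e where e: "n = d * e" using dn unfolding dvd_def by blast
      have "(of_nat d * of_nat e :: complex) powr (- s) = of_nat d powr (- s) * of_nat e powr (- s)"
        using powr_times_real[of "of_nat d" "of_nat e" "- s"] by simp
      thus ?thesis using n e by (simp add: A_def B_def)
    qed
    thus "(\<Sum>d | d dvd n. A d * B (n div d)) = of_real (\<Sum>d | d dvd n. a d) * of_nat n powr (- s)"
      by (simp add: sum_distrib_right)
  qed
  finally have fin: "((\<lambda>n. of_real (\<Sum>d | d dvd n. a d) * of_nat n powr (- s)) has_sum dirichlet_series a s * zeta s) {0<..}" .
  moreover have "((\<lambda>n. of_real (\<Sum>d | d dvd n. a d) * of_nat n powr (- s)) has_sum dirichlet_series (\<lambda>n. \<Sum>d | d dvd n. a d) s) {0<..}"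
    by (rule hs[OF log_dirichlet.summable_norm[OF bL s] log_dirichlet.sums[OF bL s]])
  ultimately show ?thesis by (rule has_sum_unique)
qed

text \<open>At \<open>n = 1\<close> the quotient is \<open>0 / 0 = 0\<close>, as it should be.\<close>

definition logcoeff :: "nat \<Rightarrow> real" where "logcoeff n = mangoldt n / ln (real n)"

lemma logcoeff_bounds: "0 \<le> logcoeff n" "logcoeff n \<le> 1"
proof -
  show "0 \<le> logcoeff n"
    by (cases "n = 0") (auto simp: logcoeff_def mangoldt_nonneg Suc_le_eq)
  show "logcoeff n \<le> 1"
  proof (cases "n \<ge> 2")
    case True
    thus ?thesis using mangoldt_le[of n] by (simp add: logcoeff_def)
  next
    case False
    hence "n = 0 \<or> n = 1" by auto
    thus ?thesis by (auto simp: logcoeff_def)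
  qed
qed

lemma logcoeff_mangoldt: "logcoeff n * ln (real n) = mangoldt n"
proof (cases "n \<ge> 2")
  case True
  thus ?thesis by (simp add: logcoeff_def)
next
  case False
  hence "n = 0 \<or> n = 1" by auto
  thus ?thesis by (auto simp: logcoeff_def)
qed

interpretation log_series: log_dirichlet logcoeff
proof
  fix n :: nat assume "n > 0"
  hence "ln (real n) \<ge> 0" by (simp add: Suc_le_eq)
  thus "\<bar>logcoeff n\<bar> \<le> ln (real n) + 1" using logcoeff_bounds[of n] by simp
qed

interpretation mangoldt_series: log_dirichlet mangoldt
proof
  fix n :: nat assume "n > 0"
  thus "\<bar>mangoldt n\<bar> \<le> ln (real n) + 1" using mangoldt_le[of n] by simp
qed

text \<open>Lambda convolved with 1 is ln, by \<open>mangoldt_sum\<close>, and termwise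
  differentiation of zeta produces the coefficients - ln n.\<close>

lemma zeta_deriv_mangoldt:
  assumes s: "Re s > 1"
  shows "(zeta has_field_derivative - (dirichlet_series mangoldt s * zeta s)) (at s)"
proof -
  interpret o: log_dirichlet "\<lambda>_. 1" by unfold_locales (auto simp: Suc_le_eq)
  have "dirichlet_series mangoldt s * zeta s = dirichlet_series (\<lambda>n. \<Sum>d | d dvd n. mangoldt d) s"
  proof (rule dirichlet_convolution_one[OF mangoldt_series.log_dirichlet_axioms mangoldt_nonneg s])
    show "log_dirichlet (\<lambda>n. \<Sum>d | d dvd n. mangoldt d)"
      by unfold_locales (simp add: mangoldt_sum Suc_le_eq)
  qed
  also have "\<dots> = dirichlet_series (\<lambda>n. ln (real n)) s"
    unfolding dirichlet_series_def using mangoldt_sum[where 'a = real] by (simp del: of_nat_Suc)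
  finally have 1: "dirichlet_series mangoldt s * zeta s = dirichlet_series (\<lambda>n. ln (real n)) s" .
  have "(\<lambda>n. of_real (ln (real (Suc n))) * of_nat (Suc n) powr (- s)) sums (- dirichlet_series (\<lambda>n. - 1 * ln (real n)) s)"
    using sums_minus[OF o.has_derivative(2)[OF s]] by (simp del: of_nat_Suc)
  from sums_unique[OF this] have "dirichlet_series (\<lambda>n. - 1 * ln (real n)) s = - dirichlet_series (\<lambda>n. ln (real n)) s"
    unfolding dirichlet_series_def[of "\<lambda>n. ln (real n)"] by (metis minus_minus)
  with 1 o.has_derivative(1)[OF s] have "(dirichlet_series (\<lambda>_. 1) has_field_derivative - (dirichlet_series mangoldt s * zeta s)) (at s)"
    by simp
  thus ?thesis
  proof (rule has_field_derivative_transform_within_open)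
    show "open zeta_halfplane" by (rule open_halfspace_Re_gt)
    show "dirichlet_series (\<lambda>_. 1) z = zeta z" if "z \<in> zeta_halfplane" for z
      using sums_unique[OF zeta_sums[of z]] that by (simp add: dirichlet_series_def)
  qed (use s in auto)
qed

text \<open>
  Integrating \<open>zeta' = - M zeta\<close> avoids the Euler product; the constant \<open>c\<close> is in fact 1, but only
  its being non-zero matters.
\<close>

lemma zeta_exp_log: "\<exists>c. c \<noteq> 0 \<and> (\<forall>s. Re s > 1 \<longrightarrow> zeta s = c * exp (dirichlet_series logcoeff s))"
proof -
  have dD: "(dirichlet_series logcoeff has_field_derivative - dirichlet_series mangoldt s) (at s)" if s: "Re s > 1" for s
  proof -
    have "dirichlet_series (\<lambda>n. - logcoeff n * ln (real n)) s = - dirichlet_series mangoldt s"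
      unfolding minus_mult_left[symmetric] logcoeff_mangoldt dirichlet_series_def
      using suminf_minus[OF mangoldt_series.summable[OF s]] by simp
    thus ?thesis using log_series.has_derivative(1)[OF s] by simp
  qed
  have "((\<lambda>s. zeta s * exp (- dirichlet_series logcoeff s)) has_field_derivative 0) (at s)" if s: "Re s > 1" for s
    by (rule derivative_eq_intros zeta_deriv_mangoldt dD s refl)+ (simp add: algebra_simps)
  moreover have "convex zeta_halfplane" by (rule convex_halfspace_Re_gt)
  ultimately obtain c where c: "\<And>s. Re s > 1 \<Longrightarrow> zeta s * exp (- dirichlet_series logcoeff s) = c"
    using has_field_derivative_zero_constant[of zeta_halfplane "\<lambda>s. zeta s * exp (- dirichlet_series logcoeff s)"]
    by (auto intro: has_field_derivative_at_within)
  have "c \<noteq> 0"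
  proof
    assume "c = 0"
    hence "zeta 2 = 0" using c[of 2] by simp
    hence "(\<lambda>n. of_nat (Suc n) powr (- 2 :: complex)) sums 0" using zeta_sums[of 2] by simp
    hence "(\<lambda>n. Re (of_nat (Suc n) powr (- 2 :: complex))) sums Re 0" by (rule sums_Re)
    moreover have "Re (of_nat (Suc n) powr (- 2 :: complex)) = real (Suc n) powr (- 2)" for n
    proof -
      have "of_nat (Suc n) powr (- 2 :: complex) = of_real (real (Suc n) powr (- 2))"
        using powr_of_real[of "real (Suc n)" "- 2"] by (simp del: of_nat_Suc)
      thus ?thesis by (simp only: Re_complex_of_real)
    qed
    ultimately have "(\<lambda>n. real (Suc n) powr (- 2)) sums 0" by simp
    thus False
      using suminf_pos[of "\<lambda>n. real (Suc n) powr (- 2)"] by (auto simp: sums_iff)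
  qed
  moreover have "zeta s = c * exp (dirichlet_series logcoeff s)" if "Re s > 1" for s
    using c[OF that] by (metis exp_minus_inverse mult.assoc mult.commute mult.right_neutral)
  ultimately show ?thesis by blast
qed

text \<open>The case K = 0 of \<open>dirichlet_zeta_recurrence\<close> expresses (s - 1) zeta s as 1
  plus a series of remainders that converges for \<open>Re s > 0\<close>. At s = 1 each remainder
  vanishes, so the residue is 1.\<close>

lemma zeta_pole_factor:
  "\<exists>h. h holomorphic_on {s. Re s > 0} \<and> (\<forall>s. Re s > 0 \<longrightarrow> s \<noteq> 1 \<longrightarrow> h s = (s - 1) * zeta s) \<and> h 1 = 1"
proof -
  define h where "h = (\<lambda>s. 1 + (\<Sum>n. zeta_rem (Suc 0) n s))"
  have hol: "h holomorphic_on {s. Re s > 0}"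
    unfolding h_def using zeta_rem_series(1)[of "Suc 0"] by (intro holomorphic_intros) simp
  moreover have "h s = (s - 1) * zeta s" if "Re s > 0" "s \<noteq> 1" for s
  proof (rule analytic_continuation_open[of zeta_halfplane "{s. Re s > 0} - {1}" h "\<lambda>s. (s - 1) * zeta s"])
    show "open zeta_halfplane" "open ({s. Re s > 0} - {1 :: complex})"
      by (auto intro!: open_halfspace_Re_gt open_Diff)
    show "zeta_halfplane \<noteq> {}" by (auto intro: exI[of _ 2])
    show "connected ({s. Re s > 0} - {1 :: complex})"
      by (rule connected_open_delete) (auto intro: open_halfspace_Re_gt convex_connected convex_halfspace_Re_gt)
    show "h holomorphic_on {s. Re s > 0} - {1}" by (rule holomorphic_on_subset[OF hol]) auto
    show "(\<lambda>s. (s - 1) * zeta s) holomorphic_on {s. Re s > 0} - {1}"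
      by (intro holomorphic_intros holomorphic_on_subset[OF zeta_holomorphic]) auto
    fix z assume z: "z \<in> zeta_halfplane"
    have "dirichlet_zeta z = zeta z"
      using sums_unique2[OF dirichlet_zeta(2) zeta_sums, of z] z by auto
    thus "h z = (z - 1) * zeta z"
      using dirichlet_zeta_recurrence[of z 0] z by (simp add: h_def)
  qed (use that in auto)
  moreover have "zeta_rem (Suc 0) n 1 = 0" for n
    by (simp add: zeta_rem_def ffact_def del: of_nat_Suc)
  hence "h 1 = 1" by (simp add: h_def)
  ultimately show ?thesis using hol by (intro exI[of _ h]) auto
qed

lemma zeta_nonzero_gt1: "Re s > 1 \<Longrightarrow> zeta s \<noteq> 0"
  using zeta_exp_log by auto

lemma mangoldt_series_pole:
  assumes h: "h holomorphic_on {s. Re s > 0}" "\<And>s. Re s > 0 \<Longrightarrow> s \<noteq> 1 \<Longrightarrow> h s = (s - 1) * zeta s"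
    and s: "Re s > 1"
  shows "dirichlet_series mangoldt s = 1 / (s - 1) - deriv h s / h s"
proof -
  have s1: "s \<noteq> 1" using s by auto
  have "((\<lambda>s. (s - 1) * zeta s) has_field_derivative 1 * zeta s + - (dirichlet_series mangoldt s * zeta s) * (s - 1)) (at s)"
    by (rule DERIV_mult[OF _ zeta_deriv_mangoldt[OF s]]) (auto intro!: derivative_eq_intros)
  hence "(h has_field_derivative 1 * zeta s + - (dirichlet_series mangoldt s * zeta s) * (s - 1)) (at s)"
  proof (rule has_field_derivative_transform_within_open[where S = "zeta_halfplane"])
    show "(z - 1) * zeta z = h z" if "z \<in> zeta_halfplane" for z
      using h(2)[of z] that by (cases "z = 1") auto
  qed (use s in \<open>auto intro: open_halfspace_Re_gt\<close>)
  hence "deriv h s = zeta s - dirichlet_series mangoldt s * zeta s * (s - 1)"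
    by (simp add: DERIV_imp_deriv)
  moreover have "h s = (s - 1) * zeta s" using h(2)[of s] s s1 by auto
  ultimately show ?thesis using zeta_nonzero_gt1[OF s] s1 by (simp add: diff_divide_distrib)
qed

text \<open>Serves the term j = 0 of the detector, the only one whose sample points approach the
  pole.\<close>

lemma mangoldt_series_near_1:
  obtains C r where "r > 0" "\<And>s. Re s > 1 \<Longrightarrow> norm (s - 1) < r \<Longrightarrow> norm (dirichlet_series mangoldt s - 1 / (s - 1)) \<le> C"
proof -
  obtain h where h: "h holomorphic_on {s. Re s > 0}" "\<And>s. Re s > 0 \<Longrightarrow> s \<noteq> 1 \<Longrightarrow> h s = (s - 1) * zeta s" "h 1 = 1"
    using zeta_pole_factor by blast
  have op: "open {s. Re s > 0}" by (rule open_halfspace_Re_gt)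
  have "isCont (\<lambda>s. deriv h s / h s) 1"
    using holomorphic_deriv[OF h(1) op] h(1,3)
    by (intro continuous_intros) (auto intro!: continuous_on_interior[of "{s. Re s > 0}"] holomorphic_on_imp_continuous_on simp: interior_open op)
  then obtain r where r: "r > 0" "\<And>s. dist s 1 < r \<Longrightarrow> dist (deriv h s / h s) (deriv h 1 / h 1) < 1"
    unfolding continuous_at_eps_delta by (metis zero_less_one)
  show ?thesis
  proof (rule that[OF r(1)])
    fix s assume s: "Re s > 1" "norm (s - 1) < r"
    have "norm (deriv h s / h s) \<le> norm (deriv h 1 / h 1) + 1"
      using r(2)[of s] s(2) norm_triangle_ineq2[of "deriv h s / h s" "deriv h 1 / h 1"] by (simp add: dist_norm)
    thus "norm (dirichlet_series mangoldt s - 1 / (s - 1)) \<le> norm (deriv h 1 / h 1) + 1"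
      using mangoldt_series_pole[OF h(1,2) s(1)] by simp
  qed
qed

lemma norm_dirichlet_series_le:
  assumes "log_dirichlet a" "\<And>n. a n \<ge> 0" "Re s > 1"
  shows "norm (dirichlet_series a s) \<le> Re (dirichlet_series a (of_real (Re s)))" "dirichlet_series a (of_real (Re s)) \<in> \<real>"
proof -
  have tm: "(of_real (a (Suc n)) * of_nat (Suc n) powr (- of_real (Re s)) :: complex) = of_real (norm (of_real (a (Suc n)) * of_nat (Suc n) powr (- s) :: complex))" for n
    using assms(2)[of "Suc n"] powr_of_real[of "real (Suc n)" "- Re s"]
    by (simp add: norm_mult norm_of_nat_powr del: of_nat_Suc)
  have eq: "dirichlet_series a (of_real (Re s)) = of_real (\<Sum>n. norm (of_real (a (Suc n)) * of_nat (Suc n) powr (- s) :: complex))"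
    unfolding dirichlet_series_def tm by (rule suminf_of_real[OF log_dirichlet.summable_norm[OF assms(1,3)], symmetric])
  show "norm (dirichlet_series a s) \<le> Re (dirichlet_series a (of_real (Re s)))"
    unfolding eq Re_complex_of_real unfolding dirichlet_series_def
    by (rule summable_norm[OF log_dirichlet.summable_norm[OF assms(1,3)]])
  show "dirichlet_series a (of_real (Re s)) \<in> \<real>" unfolding eq by simp
qed

text \<open>On the real segment from 1 to 2 the function (s - 1) zeta s and its logarithmic
  derivative are bounded by compactness; non-negative coefficients carry the bounds over to complex
  s. The real part of the series differs from \<open>ln |zeta|\<close> only by the constant
  \<open>ln |c|\<close> of \<open>zeta_exp_log\<close>.\<close>

lemma log_zeta_bounds:
  obtains C where "C > 0"
    "\<And>s. 1 < Re s \<Longrightarrow> Re s \<le> 2 \<Longrightarrow> norm (dirichlet_series logcoeff s) \<le> ln (1 / (Re s - 1)) + C"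
    "\<And>s. 1 < Re s \<Longrightarrow> Re s \<le> 2 \<Longrightarrow> \<bar>ln (norm (zeta s))\<bar> \<le> ln (1 / (Re s - 1)) + C"
    "\<And>s. Re s > 1 \<Longrightarrow> \<bar>ln (norm (zeta s)) - Re (dirichlet_series logcoeff s)\<bar> \<le> C"
    "\<And>s. 1 < Re s \<Longrightarrow> Re s \<le> 2 \<Longrightarrow> norm (dirichlet_series mangoldt s) \<le> C / (Re s - 1)"
proof -
  obtain h where h: "h holomorphic_on {s. Re s > 0}" "\<And>s. Re s > 0 \<Longrightarrow> s \<noteq> 1 \<Longrightarrow> h s = (s - 1) * zeta s" "h 1 = 1"
    using zeta_pole_factor by blast
  obtain c where c: "c \<noteq> 0" "\<And>s. Re s > 1 \<Longrightarrow> zeta s = c * exp (dirichlet_series logcoeff s)"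
    using zeta_exp_log by blast
  have op: "open {s. Re s > 0}" by (rule open_halfspace_Re_gt)
  have hnz: "h (of_real x) \<noteq> 0" if "x \<in> {1..2}" for x :: real
  proof (cases "x = 1")
    case False
    thus ?thesis using h(2)[of "of_real x"] zeta_nonzero_gt1[of "of_real x"] that by auto
  qed (use h in auto)
  have c1: "continuous_on {1..2} (\<lambda>x. h (of_real x))"
    by (rule continuous_on_compose2[OF holomorphic_on_imp_continuous_on[OF h(1)]]) (auto intro!: continuous_intros)
  have c2: "continuous_on {1..2} (\<lambda>x. deriv h (of_real x) / h (of_real x))"
    by (intro continuous_on_divide c1 continuous_on_compose2[OF holomorphic_on_imp_continuous_on[OF holomorphic_deriv[OF h(1) op]]])
       (use hnz in \<open>auto intro!: continuous_intros\<close>)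
  obtain C1 where C1: "C1 > 0" "\<And>x. x \<in> {1..2} \<Longrightarrow> norm (h (of_real x)) \<le> C1"
    using compact_imp_bounded[OF compact_continuous_image[OF c1]] by (auto simp: bounded_pos)
  obtain C2 where C2: "C2 > 0" "\<And>x. x \<in> {1..2} \<Longrightarrow> norm (deriv h (of_real x) / h (of_real x)) \<le> C2"
    using compact_imp_bounded[OF compact_continuous_image[OF c2]] by (auto simp: bounded_pos)
  \<comment> \<open>\<open>ln |c|\<close> enters twice: when the series is bounded through zeta on
    the real axis, and when zeta is bounded through the series again.\<close>
  define C where "C = \<bar>ln C1\<bar> + 2 * \<bar>ln (norm c)\<bar> + C2 + 1"
  have Cpos: "C > 0" using C2(1) by (simp add: C_def)
  have lz: "ln (norm (zeta s)) = ln (norm c) + Re (dirichlet_series logcoeff s)" if "Re s > 1" for s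
    using c(2)[OF that] c(1) by (simp add: norm_mult ln_mult)
  have A: "norm (dirichlet_series logcoeff s) \<le> ln (1 / (Re s - 1)) + (C - \<bar>ln (norm c)\<bar>)" if s: "1 < Re s" "Re s \<le> 2" for s
  proof -
    define x where "x = Re s"
    have x: "1 < x" "x \<le> 2" using s by (auto simp: x_def)
    have "norm (zeta (of_real x)) = norm (h (of_real x)) / (x - 1)"
    proof -
      have "norm (of_real x - 1 :: complex) = x - 1"
        using x norm_of_real[of "x - 1", where 'a = complex] by simp
      moreover have "h (of_real x) = (of_real x - 1) * zeta (of_real x)" using h(2)[of "of_real x"] x by auto
      ultimately show ?thesis using x by (simp add: norm_mult)
    qed
    also have "\<dots> \<le> C1 / (x - 1)" using C1(2)[of x] x by (intro divide_right_mono) auto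
    finally have "ln (norm (zeta (of_real x))) \<le> ln (C1 / (x - 1))"
      using zeta_nonzero_gt1[of "of_real x"] x C1 by (subst ln_le_cancel_iff) auto
    also have "\<dots> = ln C1 + ln (1 / (x - 1))" using C1 x by (simp add: ln_div)
    finally have "Re (dirichlet_series logcoeff (of_real x)) \<le> ln C1 + ln (1 / (x - 1)) - ln (norm c)"
      using lz[of "of_real x"] x by simp
    hence "Re (dirichlet_series logcoeff (of_real x)) \<le> ln (1 / (x - 1)) + (C - \<bar>ln (norm c)\<bar>)" using C2(1) by (simp add: C_def)
    thus ?thesis using norm_dirichlet_series_le(1)[OF log_series.log_dirichlet_axioms logcoeff_bounds(1) s(1)] by (simp add: x_def)
  qed
  show ?thesis
  proof (rule that[OF Cpos])
    fix s assume s: "1 < Re s" "Re s \<le> 2"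
    show "norm (dirichlet_series logcoeff s) \<le> ln (1 / (Re s - 1)) + C" using A[OF s] by simp
    show "\<bar>ln (norm (zeta s))\<bar> \<le> ln (1 / (Re s - 1)) + C"
      using A[OF s] lz[OF s(1)] abs_Re_le_cmod[of "dirichlet_series logcoeff s"] by linarith
    define x where "x = Re s"
    have x: "1 < x" "x \<le> 2" using s by (auto simp: x_def)
    have "norm (dirichlet_series mangoldt s) \<le> norm (dirichlet_series mangoldt (of_real x))"
      using norm_dirichlet_series_le(1)[OF mangoldt_series.log_dirichlet_axioms mangoldt_nonneg s(1)] complex_Re_le_cmod unfolding x_def
      by (rule order_trans)
    also have "dirichlet_series mangoldt (of_real x) = 1 / (of_real x - 1) - deriv h (of_real x) / h (of_real x)"
      by (rule mangoldt_series_pole[OF h(1,2)]) (use x in auto)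
    also have "norm \<dots> \<le> norm (1 / (of_real x - 1) :: complex) + C2"
      using C2(2)[of x] x norm_triangle_ineq4[of "1 / (of_real x - 1)" "deriv h (of_real x) / h (of_real x)"] by simp
    also have "norm (1 / (of_real x - 1) :: complex) = 1 / (x - 1)"
      using x norm_of_real[of "x - 1", where 'a = complex] by (simp add: norm_divide)
    also have "1 / (x - 1) + C2 \<le> C / (x - 1)"
    proof -
      have "C2 * (x - 1) \<le> C2 * 1" using C2(1) x by (intro mult_left_mono) auto
      hence "1 + C2 * (x - 1) \<le> C" by (simp add: C_def)
      hence "(1 + C2 * (x - 1)) / (x - 1) \<le> C / (x - 1)" using x by (intro divide_right_mono) auto
      thus ?thesis using x by (simp add: add_divide_distrib)
    qed
    finally show "norm (dirichlet_series mangoldt s) \<le> C / (Re s - 1)" by (simp add: x_def)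
  next
    fix s assume "1 < Re s"
    thus "\<bar>ln (norm (zeta s)) - Re (dirichlet_series logcoeff s)\<bar> \<le> C"
      using lz[of s] C2(1) by (simp add: C_def)
  qed
qed

section \<open>The arctangent as a conformal map of the disc onto a strip\<close>

text \<open>1 + u^2 lies in the disc of radius 1 about 1, and inversion maps this disc onto the
  half-plane of real part greater than 1 / 2.\<close>

lemma Re_inverse_one_plus_sq:
  fixes u :: complex
  assumes "norm u < 1"
  shows "Re (inverse (1 + u\<^sup>2)) \<ge> 1 / 2"
proof -
  define w where "w = 1 + u\<^sup>2"
  have "norm (w - 1) < 1" using assms by (simp add: w_def norm_power power_less_one_iff)
  hence "(norm (w - 1))\<^sup>2 < 1" by (simp add: power_less_one_iff)
  hence *: "(norm w)\<^sup>2 < 2 * Re w" unfolding cmod_power2 by (simp add: power2_eq_square algebra_simps)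
  hence "w \<noteq> 0" by auto
  hence "(norm w)\<^sup>2 > 0" by simp
  hence "Re w / (norm w)\<^sup>2 \<ge> 1 / 2" using * by (simp add: field_simps)
  thus ?thesis unfolding w_def[symmetric] by (simp add: cmod_power2)
qed

text \<open>\<open>Arctan u\<close> is \<i> / 2 times the logarithm of this Moebius quotient
  \<open>w\<close>, which maps the disc to the right half-plane and the open right semicircle to the
  negative imaginary axis. The second hypothesis keeps \<open>u\<close> away from the pole \<i>. The
  two formulas locate the argument of \<open>w\<close> and thus the real part of the
  arctangent.\<close>

lemma Arctan_Ln_arg:
  fixes u :: complex
  assumes "norm u \<le> 1" "norm u = 1 \<Longrightarrow> Re u > 0"
  defines "w \<equiv> (1 - \<i> * u) / (1 + \<i> * u)"
  shows "Re w = (1 - (norm u)\<^sup>2) / (norm (1 + \<i> * u))\<^sup>2" "Im w = - 2 * Re u / (norm (1 + \<i> * u))\<^sup>2" "1 + \<i> * u \<noteq> 0"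
proof -
  show nz: "1 + \<i> * u \<noteq> 0"
  proof
    assume "1 + \<i> * u = 0"
    hence "u = \<i>" by (simp add: complex_eq_iff)
    thus False using assms(2) by simp
  qed
  define N where "N = (norm (1 + \<i> * u))\<^sup>2"
  have "w = ((1 - \<i> * u) * cnj (1 + \<i> * u)) / of_real N"
  proof -
    have cn: "cnj (1 + \<i> * u) \<noteq> 0" using nz by (simp only: complex_cnj_zero_iff) simp
    show ?thesis unfolding w_def N_def complex_norm_square by (rule mult_divide_mult_cancel_right[OF cn, symmetric])
  qed
  moreover have "Re ((1 - \<i> * u) * cnj (1 + \<i> * u)) = 1 - (norm u)\<^sup>2"
    unfolding cmod_power2 by (simp add: power2_eq_square algebra_simps)
  moreover have "Im ((1 - \<i> * u) * cnj (1 + \<i> * u)) = - 2 * Re u"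
    by (simp add: algebra_simps)
  ultimately show "Re w = (1 - (norm u)\<^sup>2) / (norm (1 + \<i> * u))\<^sup>2" "Im w = - 2 * Re u / (norm (1 + \<i> * u))\<^sup>2"
    unfolding N_def[symmetric] by (simp_all only: Re_divide_of_real Im_divide_of_real)
qed

lemma abs_Re_Arctan_less:
  assumes "norm u < 1"
  shows "\<bar>Re (Arctan u)\<bar> < pi / 4"
proof -
  define w where "w = (1 - \<i> * u) / (1 + \<i> * u)"
  have "Re w > 0" unfolding w_def using Arctan_Ln_arg(1,3)[of u] assms by (simp add: power_less_one_iff)
  hence "\<bar>Im (Ln w)\<bar> < pi / 2" by (rule Re_Ln_pos_lt_imp)
  moreover have "Re (Arctan u) = - Im (Ln w) / 2" by (simp add: Arctan_def w_def)
  ultimately show ?thesis by simp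
qed

lemma Re_Arctan_unit:
  assumes "norm u = 1" "Re u > 0"
  shows "Re (Arctan u) = pi / 4"
proof -
  define w where "w = (1 - \<i> * u) / (1 + \<i> * u)"
  define r where "r = - Im w"
  have nz: "1 + \<i> * u \<noteq> 0" using Arctan_Ln_arg(3)[of u] assms by auto
  have "Re w = 0" unfolding w_def using Arctan_Ln_arg(1)[of u] assms by auto
  hence weq: "w = of_real r * (- \<i>)" by (simp add: complex_eq_iff r_def)
  have "Im w = - 2 * Re u / (norm (1 + \<i> * u))\<^sup>2"
    unfolding w_def using Arctan_Ln_arg(2)[of u] assms by auto
  hence "r > 0" using nz assms(2) by (simp add: r_def)
  hence "Ln w = of_real (ln r) + Ln (- \<i>)" unfolding weq by (subst Ln_times_of_real) (auto simp: Ln_of_real)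
  hence "Im (Ln w) = - pi / 2" by simp
  moreover have "Re (Arctan u) = - Im (Ln w) / 2" by (simp add: Arctan_def w_def)
  ultimately show ?thesis by simp
qed

lemma Arctan_neg:
  assumes "norm u < 1"
  shows "Arctan (- u) = - Arctan u"
proof -
  have "u\<^sup>2 \<noteq> - 1" using assms by (metis norm_minus_cancel norm_one norm_power order_less_irrefl power_one one_power2 power_less_one_iff zero_less_numeral norm_ge_zero)
  hence "tan (Arctan u) = u" by (rule tan_Arctan)
  hence "Arctan (- u) = Arctan (tan (- Arctan u))" by simp
  also have "\<dots> = - Arctan u"
    by (rule Arctan_tan) (use abs_Re_Arctan_less[OF assms] pi_gt_zero in simp)
  finally show ?thesis .
qed

text \<open>\<open>Re (Arctan u)\<close> vanishes on the imaginary axis inside the disc, and along a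
  horizontal segment its derivative is Re (1 / (1 + z^2)) >= 1 / 2.\<close>

lemma Re_Arctan_ge:
  assumes "norm u < 1" "Re u \<ge> 0"
  shows "Re (Arctan u) \<ge> Re u / 2"
proof -
  define y where "y = Im u"
  define \<phi> where "\<phi> = (\<lambda>x. Re (Arctan (Complex x y)) - x / 2)"
  have ny: "norm (Complex x y) < 1" if "x \<in> {0..Re u}" for x
  proof -
    have "x\<^sup>2 \<le> (Re u)\<^sup>2" using that by (intro power_mono) auto
    hence "norm (Complex x y) \<le> norm u" by (simp add: cmod_def y_def)
    thus ?thesis using assms by simp
  qed
  have 0: "\<phi> 0 = 0"
  proof -
    have y: "\<bar>y\<bar> < 1" using ny[of 0] assms by (simp add: cmod_def)
    have "Arctan (Complex 0 y) = \<i> / 2 * Ln (of_real ((1 + y) / (1 - y)))"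
      by (simp add: Arctan_def Complex_eq algebra_simps)
    also have "Ln (of_real ((1 + y) / (1 - y))) = of_real (ln ((1 + y) / (1 - y)))"
      using y by (intro Ln_of_real) auto
    finally have "Re (Arctan (Complex 0 y)) = Re (\<i> / 2 * of_real (ln ((1 + y) / (1 - y))))" by (rule arg_cong)
    thus ?thesis by (simp add: \<phi>_def)
  qed
  have "\<phi> 0 \<le> \<phi> (Re u)"
  proof (rule DERIV_nonneg_imp_nondecreasing[OF assms(2)])
    fix x assume x: "0 \<le> x" "x \<le> Re u"
    let ?z = "Complex x y"
    have n: "norm ?z < 1" using ny x by auto
    have "(Arctan has_field_derivative inverse (1 + ?z\<^sup>2)) (at ?z)"
      by (rule has_field_derivative_Arctan) (use n in \<open>simp add: cmod_def\<close>)
    moreover have "((\<lambda>x. Complex x y) has_vector_derivative 1) (at x)"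
      unfolding Complex_eq by (auto intro!: derivative_eq_intros)
    ultimately have "((Arctan \<circ> (\<lambda>x. Complex x y)) has_vector_derivative (1 * inverse (1 + ?z\<^sup>2))) (at x)"
      by (intro field_vector_diff_chain_at) auto
    hence "((\<lambda>x. Re (Arctan (Complex x y))) has_real_derivative Re (inverse (1 + ?z\<^sup>2))) (at x)"
      unfolding has_real_derivative_iff_has_vector_derivative
      using bounded_linear.has_vector_derivative[OF bounded_linear_Re] by (fastforce simp: o_def)
    hence "(\<phi> has_real_derivative Re (inverse (1 + ?z\<^sup>2)) - 1 / 2) (at x)"
      unfolding \<phi>_def by (rule DERIV_diff) (auto intro!: derivative_eq_intros)
    thus "\<exists>y. (\<phi> has_real_derivative y) (at x) \<and> 0 \<le> y"
      using Re_inverse_one_plus_sq[OF n] by (intro exI[of _ "Re (inverse (1 + ?z\<^sup>2)) - 1 / 2"]) simp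
  qed
  thus ?thesis unfolding 0 by (simp add: \<phi>_def y_def)
qed

lemma Arctan_holomorphic_ball: "Arctan holomorphic_on ball 0 1"
proof (rule holomorphic_on_Arctan)
  fix s :: complex assume "s \<in> ball 0 1" "Re s = 0"
  thus "\<bar>Im s\<bar> < 1" by (simp add: cmod_def)
qed

text \<open>The contribution of a single n to log zeta on the right arc, with l = (4 \<eta> / pi) ln
  n. The derivative at 0 of exp (- l arctan u) is - l; the Schwarz formula writes it as an integral
  over a circle of radius r < 1, and since arctan is odd, pairing t with t + pi folds this into the
  integral of cos t sinh (l Re A) cos (l Im A) over the right half, of value pi l r / 2. As r tends
  to 1, Re A tends to the constant pi / 4, so the factor sinh comes out and a non-negative integral
  remains.\<close>

lemma poisson_arc_positive:
  fixes l :: real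
  assumes "l \<ge> 0"
  defines "f \<equiv> (\<lambda>t. cos t * Re (exp (- of_real l * Arctan (cis t))))"
  shows "f integrable_on {- pi / 2..pi / 2}" "integral {- pi / 2..pi / 2} f \<ge> 0"
proof -
  define A where "A = (\<lambda>r t. Arctan (of_real r * cis t))"
  define F where "F = (\<lambda>r t. cos t * (sinh (l * Re (A r t)) * cos (l * Im (A r t))))"
  have cont_ball: "continuous_on UNIV (A r)" if "0 \<le> r" "r < 1" for r
    unfolding A_def using that
    by (intro continuous_on_compose2[OF holomorphic_on_imp_continuous_on[OF Arctan_holomorphic_ball]])
       (auto intro!: continuous_intros simp: norm_mult)
  have val: "(F r has_integral (pi * l * r / 2)) {- pi / 2..pi / 2}" if r: "0 < r" "r < 1" for r
  proof -
    define Q where "Q = (\<lambda>u. exp (- of_real l * Arctan u))"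
    have Qh: "Q holomorphic_on ball 0 1" unfolding Q_def
      by (intro holomorphic_intros Arctan_holomorphic_ball)
    have dQ: "deriv Q 0 = - of_real l"
    proof -
      have "(Arctan has_field_derivative inverse (1 + 0\<^sup>2)) (at 0)"
        by (rule has_field_derivative_Arctan) auto
      hence "(Q has_field_derivative exp (- of_real l * Arctan 0) * (- of_real l * inverse (1 + 0\<^sup>2))) (at 0)"
        unfolding Q_def by (auto intro!: derivative_eq_intros)
      thus ?thesis by (simp add: DERIV_imp_deriv)
    qed
    have "((\<lambda>t. 2 * of_real (Re (Q (r * cis t))) * (r * cis t) / (r * cis t - 0)\<^sup>2) has_integral
             2 * pi * deriv Q 0) {- pi / 2..3 * pi / 2}"
      by (rule schwarz_derivative[OF Qh]) (use r in auto)
    from has_integral_linear[OF this bounded_linear_Re]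
    have "((\<lambda>t. Re (2 * of_real (Re (Q (r * cis t))) * (r * cis t) / (r * cis t)\<^sup>2)) has_integral (- 2 * pi * l)) {- pi / 2..3 * pi / 2}"
      by (simp add: o_def dQ)
    also have "(\<lambda>t. Re (2 * of_real (Re (Q (r * cis t))) * (r * cis t) / (r * cis t)\<^sup>2)) = (\<lambda>t. 2 / r * (cos t * Re (Q (r * cis t))))"
    proof
      fix t
      have "2 * of_real (Re (Q (r * cis t))) * (r * cis t) / (r * cis t)\<^sup>2 = of_real (2 * Re (Q (r * cis t)) / r) * cis (- t)"
        using r by (simp add: power2_eq_square field_simps cis_mult)
      thus "Re (2 * of_real (Re (Q (r * cis t))) * (r * cis t) / (r * cis t)\<^sup>2) = 2 / r * (cos t * Re (Q (r * cis t)))"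
        by (simp only: Re_complex_of_real times_complex.sel Im_complex_of_real cis.sel) simp
    qed
    finally have 1: "((\<lambda>t. 2 / r * (cos t * Re (Q (r * cis t)))) has_integral (- 2 * pi * l)) {- pi / 2..3 * pi / 2}" .
    have full: "((\<lambda>t. cos t * Re (Q (r * cis t))) has_integral (- pi * l * r)) {- pi / 2..3 * pi / 2}"
      using has_integral_mult_right[OF 1, of "r / 2"] r by (simp add: mult_ac)
    have contq: "continuous_on UNIV (\<lambda>t. cos t * Re (Q (r * cis t)))"
      using cont_ball[of r] r unfolding Q_def A_def by (intro continuous_intros) auto
    define I1 I2 where "I1 = integral {- pi / 2..pi / 2} (\<lambda>t. cos t * Re (Q (r * cis t)))" and
      "I2 = integral {pi / 2..3 * pi / 2} (\<lambda>t. cos t * Re (Q (r * cis t)))"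
    have h1: "((\<lambda>t. cos t * Re (Q (r * cis t))) has_integral I1) {- pi / 2..pi / 2}"
      and h2: "((\<lambda>t. cos t * Re (Q (r * cis t))) has_integral I2) {pi / 2..3 * pi / 2}"
      unfolding I1_def I2_def
      by (intro integrable_integral integrable_continuous_real continuous_on_subset[OF contq]; simp)+
    have sum: "I1 + I2 = - pi * l * r"
      by (rule has_integral_unique[OF has_integral_combine[OF _ _ h1 h2] full]) auto
    have "((\<lambda>t. cos (t + pi) * Re (Q (r * cis (t + pi)))) has_integral I2) {pi / 2 - pi..3 * pi / 2 - pi}"
      by (rule has_integral_shift_real_ivl[OF h2])
    moreover have "cis (t + pi) = - cis t" for t by (simp add: complex_eq_iff)
    ultimately have "((\<lambda>t. - (cos t * Re (Q (- (r * cis t))))) has_integral I2) {- pi / 2..pi / 2}"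
      by (simp add: field_simps)
    from has_integral_add[OF h1 this] sum
    have "((\<lambda>t. cos t * Re (Q (r * cis t)) + - (cos t * Re (Q (- (r * cis t))))) has_integral (- pi * l * r)) {- pi / 2..pi / 2}" by simp
    from has_integral_mult_right[OF this, of "- 1 / 2"]
    have "((\<lambda>t. - 1 / 2 * (cos t * Re (Q (r * cis t)) + - (cos t * Re (Q (- (r * cis t)))))) has_integral (pi * l * r / 2)) {- pi / 2..pi / 2}"
      by simp
    also have "(\<lambda>t. - 1 / 2 * (cos t * Re (Q (r * cis t)) + - (cos t * Re (Q (- (r * cis t)))))) = F r"
    proof
      fix t
      have "Q (- (r * cis t)) = exp (of_real l * A r t)" "Q (r * cis t) = exp (- (of_real l * A r t))"
        using Arctan_neg[of "r * cis t"] r by (simp_all add: Q_def A_def norm_mult)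
      thus "- 1 / 2 * (cos t * Re (Q (r * cis t)) + - (cos t * Re (Q (- (r * cis t))))) = F r t"
        by (simp add: F_def Re_exp sinh_def field_simps)
    qed
    finally show ?thesis .
  qed
  define G where "G = (\<lambda>t. cos t * (sinh (l * pi / 4) * cos (l * Im (A 1 t))))"
  define rr where "rr = (\<lambda>k. 1 - 1 / (real k + 2))"
  have rr: "0 < rr k" "rr k < 1" for k by (auto simp: rr_def field_simps)
  have rlim: "rr \<longlonglongrightarrow> 1" unfolding rr_def by real_asymp
  have cosnn: "cos t \<ge> 0" if "t \<in> {- pi / 2..pi / 2}" for t using that by (intro cos_ge_zero) auto
  have d1: "F (rr k) integrable_on {- pi / 2..pi / 2}" for k using val[OF rr] by blast
  have d2: "(\<lambda>_. sinh (l * pi / 4)) integrable_on {- pi / 2..pi / 2}" by (rule integrable_const_ivl)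
  \<comment> \<open>Near \<i> and -\<i> the imaginary part of the arctangent is unbounded, but it
    enters only through a cosine; the real part stays below pi / 4.\<close>
  have d3: "norm (F (rr k) t) \<le> sinh (l * pi / 4)" if "t \<in> {- pi / 2..pi / 2}" for k t
    proof -
      have "\<bar>l * Re (A (rr k) t)\<bar> \<le> l * pi / 4"
        using abs_Re_Arctan_less[of "rr k * cis t"] rr[of k] assms(1) mult_left_mono[of "\<bar>Re (A (rr k) t)\<bar>" "pi / 4" l]
        by (simp add: A_def norm_mult abs_mult)
      hence "\<bar>sinh (l * Re (A (rr k) t))\<bar> \<le> sinh (l * pi / 4)"
        by (metis sinh_real_abs sinh_real_le_iff)
      moreover have "\<bar>F (rr k) t\<bar> = \<bar>cos t\<bar> * \<bar>cos (l * Im (A (rr k) t))\<bar> * \<bar>sinh (l * Re (A (rr k) t))\<bar>"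
        by (simp add: F_def abs_mult)
      moreover have "\<bar>cos t\<bar> * \<bar>cos (l * Im (A (rr k) t))\<bar> \<le> 1 * 1" by (intro mult_mono) auto
      ultimately show ?thesis
        using mult_mono[of "\<bar>cos t\<bar> * \<bar>cos (l * Im (A (rr k) t))\<bar>" 1 "\<bar>sinh (l * Re (A (rr k) t))\<bar>" "sinh (l * pi / 4)"] by simp
    qed
  have d4: "(\<lambda>k. F (rr k) t) \<longlonglongrightarrow> G t" if t: "t \<in> {- pi / 2..pi / 2}" for t
    proof (cases "cos t = 0")
      case True
      thus ?thesis by (simp add: F_def G_def)
    next
      case False
      hence ct: "cos t > 0" using cosnn[OF t] by simp
      have "isCont Arctan (cis t)" by (rule continuous_at_Arctan) (use ct in auto)
      moreover have "(\<lambda>k. of_real (rr k) * cis t) \<longlonglongrightarrow> of_real 1 * cis t"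
        by (intro tendsto_intros rlim)
      ultimately have lim: "(\<lambda>k. A (rr k) t) \<longlonglongrightarrow> A 1 t"
        unfolding A_def using isCont_tendsto_compose[of "cis t" Arctan] by fastforce
      have "Re (A 1 t) = pi / 4" unfolding A_def using ct by (intro Re_Arctan_unit) auto
      moreover have "(\<lambda>k. F (rr k) t) \<longlonglongrightarrow> cos t * (sinh (l * Re (A 1 t)) * cos (l * Im (A 1 t)))"
        unfolding F_def by (intro tendsto_intros lim)
      ultimately show ?thesis unfolding G_def by (simp only: times_divide_eq_right)
    qed
  note dc = dominated_convergence[OF d1 d2 d3 d4]
  have inteq: "integral {- pi / 2..pi / 2} (F (rr k)) = pi * l * rr k / 2" for k using val[OF rr] by (rule integral_unique)
  have "(\<lambda>k. pi * l * rr k / 2) \<longlonglongrightarrow> integral {- pi / 2..pi / 2} G" using dc(2) unfolding inteq .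
  moreover have "(\<lambda>k. pi * l * rr k / 2) \<longlonglongrightarrow> pi * l * 1 / 2" by (intro tendsto_intros rlim) auto
  ultimately have "integral {- pi / 2..pi / 2} G = pi * l * 1 / 2" by (rule LIMSEQ_unique)
  hence IG: "integral {- pi / 2..pi / 2} G = pi * l / 2" by simp
  define e where "e = (\<lambda>t. cos t * cos (l * Im (A 1 t)))"
  have fe: "f t = exp (- l * pi / 4) * e t" if "t \<in> {- pi / 2..pi / 2}" for t
  proof (cases "cos t = 0")
    case False
    hence ct: "cos t > 0" using cosnn[OF that] by simp
    have "Re (A 1 t) = pi / 4" unfolding A_def using ct by (intro Re_Arctan_unit) auto
    thus ?thesis by (simp add: f_def e_def A_def Re_exp)
  qed (simp add: f_def e_def)
  have "e integrable_on {- pi / 2..pi / 2} \<and> integral {- pi / 2..pi / 2} e \<ge> 0"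
  proof (cases "l = 0")
    case True
    hence "e = cos" by (simp add: e_def)
    thus ?thesis using cosnn by (auto intro!: integrable_continuous_real continuous_intros integral_nonneg)
  next
    case False
    hence sp: "sinh (l * pi / 4) > 0" using assms(1) by simp
    have eG: "e = (\<lambda>t. inverse (sinh (l * pi / 4)) * G t)" using sp by (auto simp: e_def G_def field_simps)
    have "(e has_integral inverse (sinh (l * pi / 4)) * (pi * l / 2)) {- pi / 2..pi / 2}"
      unfolding eG by (rule has_integral_mult_right) (use dc(1) IG in \<open>auto simp: has_integral_integrable_integral\<close>)
    moreover have "inverse (sinh (l * pi / 4)) * (pi * l / 2) \<ge> 0" using sp assms(1) by simp
    ultimately show ?thesis by (auto simp: has_integral_integrable_integral)
  qed
  then obtain J where J: "(e has_integral J) {- pi / 2..pi / 2}" "J \<ge> 0" by (auto simp: has_integral_integrable_integral)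
  have "(f has_integral exp (- l * pi / 4) * J) {- pi / 2..pi / 2}"
    by (rule has_integral_eq[OF _ has_integral_mult_right[OF J(1)]]) (simp add: fe)
  thus "f integrable_on {- pi / 2..pi / 2}" "integral {- pi / 2..pi / 2} f \<ge> 0"
    using J(2) by (auto simp: has_integral_integrable_integral)
qed

section \<open>Smoothing functions and the boundary kernel\<close>

lemma tan_approx:
  "\<exists>B>0. \<forall>z :: complex. norm z \<le> 1 \<longrightarrow> norm (tan z - z) \<le> B * (norm z)\<^sup>2"
proof -
  define S where "S = cball (0 :: complex) 1"
  have nz: "cos z \<noteq> 0" if "z \<in> S" for z :: complex
  proof
    assume "cos z = 0"
    then obtain n :: int where n: "z = of_int n * of_real pi + of_real pi / 2" unfolding cos_eq_0 by auto
    hence "z = of_real (of_int n * pi + pi / 2)" by simp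
    hence "norm z = \<bar>of_int n * pi + pi / 2\<bar>" by (metis norm_of_real)
    moreover have "\<bar>of_int n * pi + pi / 2\<bar> > 1"
    proof (cases "n \<ge> 0")
      case True
      hence "of_int n * pi \<ge> 0" by simp
      thus ?thesis using pi_gt3 by linarith
    next
      case False
      hence "of_int n \<le> (-1 :: real)" by linarith
      hence "of_int n * pi \<le> (-1) * pi" by (intro mult_right_mono) auto
      thus ?thesis using pi_gt3 by linarith
    qed
    ultimately show False using that by (simp add: S_def)
  qed
  define f where "f = (\<lambda>i z. if i = 0 then tan z else if i = Suc 0 then 1 + (tan z)\<^sup>2 else 2 * tan z * (1 + (tan z)\<^sup>2 :: complex))"
  have dtan: "(tan has_field_derivative 1 + (tan z)\<^sup>2) (at z within S)" if "z \<in> S" for z :: complex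
  proof -
    have "inverse ((cos z)\<^sup>2) = 1 + (tan z)\<^sup>2"
    proof -
      have eq: "1 + (tan z)\<^sup>2 = ((cos z)\<^sup>2 + (sin z)\<^sup>2) / (cos z)\<^sup>2" unfolding tan_def power_divide add_divide_distrib using nz[OF that] by simp
      show ?thesis unfolding eq by (simp only: sin_cos_squared_add2 inverse_eq_divide)
    qed
    thus ?thesis using DERIV_tan[OF nz[OF that]] has_field_derivative_at_within by metis
  qed
  have "continuous_on S (\<lambda>z. 2 * tan z * (1 + (tan z)\<^sup>2 :: complex))"
    by (intro continuous_intros DERIV_continuous_on[OF dtan])
  hence "bounded ((\<lambda>z. 2 * tan z * (1 + (tan z)\<^sup>2 :: complex)) ` S)"
    by (intro compact_imp_bounded compact_continuous_image) (auto simp: S_def)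
  then obtain B where B: "B > 0" "\<And>z. z \<in> S \<Longrightarrow> norm (2 * tan z * (1 + (tan z)\<^sup>2 :: complex)) \<le> B"
    by (auto simp: bounded_pos)
  have "norm (tan z - z) \<le> B * (norm z)\<^sup>2" if "norm z \<le> 1" for z :: complex
  proof -
    have "norm (f 0 z - (\<Sum>i\<le>1. f i 0 * (z - 0) ^ i / fact i)) \<le> B * norm (z - 0) ^ Suc 1 / fact 1"
    proof (rule complex_Taylor)
      show "convex S" "0 \<in> S" "z \<in> S" using that by (auto simp: S_def)
      show "norm (f (Suc 1) x) \<le> B" if "x \<in> S" for x using B(2)[OF that] by (simp add: f_def)
      fix i x assume i: "i \<le> (1 :: nat)" and x: "x \<in> S"
      show "(f i has_field_derivative f (Suc i) x) (at x within S)"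
      proof (cases "i = 0")
        case True
        thus ?thesis using dtan[OF x] by (simp add: f_def[abs_def])
      next
        case False
        hence "i = Suc 0" using i by auto
        moreover have "((\<lambda>z. 1 + (tan z)\<^sup>2) has_field_derivative 2 * tan x * (1 + (tan x)\<^sup>2)) (at x within S)"
          by (rule derivative_eq_intros dtan x refl)+ simp
        ultimately show ?thesis by (simp add: f_def[abs_def])
      qed
    qed
    thus ?thesis by (simp add: f_def power2_eq_square)
  qed
  with B(1) show ?thesis by blast
qed

lemma norm_Arctan_le: "norm u \<le> 1 / 2 \<Longrightarrow> norm (Arctan u) \<le> 2 * norm u"
proof -
  assume u: "norm u \<le> 1 / 2"
  have "norm (Arctan u - Arctan 0) \<le> 2 * norm (u - 0)"
  proof (rule field_differentiable_bound[of "cball 0 (1/2)"])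
    fix z :: complex assume z: "z \<in> cball 0 (1 / 2)"
    have "(Arctan has_field_derivative inverse (1 + z\<^sup>2)) (at z)"
      by (rule has_field_derivative_Arctan) (use z in \<open>auto simp: cmod_def\<close>)
    thus "(Arctan has_field_derivative inverse (1 + z\<^sup>2)) (at z within cball 0 (1 / 2))"
      by (rule has_field_derivative_at_within)
    have "(norm z)\<^sup>2 \<le> (1 / 2)\<^sup>2" using z by (intro power_mono) auto
    hence "norm (z\<^sup>2) \<le> 1 / 4" by (simp add: norm_power power_divide)
    hence "norm (1 + z\<^sup>2) \<ge> 1 / 2" using norm_triangle_ineq2[of 1 "- z\<^sup>2"] by simp
    thus "norm (inverse (1 + z\<^sup>2)) \<le> 2" using le_imp_inverse_le[of "1/2" "norm (1 + z\<^sup>2)"] by (simp add: norm_inverse)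
  qed (use u in auto)
  thus ?thesis by simp
qed

text \<open>Taylor expansion in \<open>u\<close> up to first order. Summed against \<open>c\<close>,
  the orders 0 and 1 become \<open>f0\<close> and \<open>sigma x\<close>. The constant is (9 / 2) /
  (1 / 64): a bound for the cubic numerator over one for w^2 (w - u)^2.\<close>

lemma kernel_term_approx:
  fixes u w :: complex
  assumes w: "norm w \<ge> 1 / 2" "norm w \<le> 1" and u: "norm u \<le> 1 / 4"
  shows "norm ((1 + u\<^sup>2) * w / (w - u)\<^sup>2 - (1 / w + 2 * u / w\<^sup>2)) \<le> 288 * (norm u)\<^sup>2"
proof -
  have wu: "norm (w - u) \<ge> 1 / 4" using norm_triangle_ineq2[of w u] w u by linarith
  hence nz: "w \<noteq> 0" "w - u \<noteq> 0" using w by auto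
  have eq: "(1 + u\<^sup>2) * w / (w - u)\<^sup>2 - (1 / w + 2 * u / w\<^sup>2) = u\<^sup>2 * (w ^ 3 + 3 * w - 2 * u) / (w\<^sup>2 * (w - u)\<^sup>2)"
  proof -
    have "1 / w + 2 * u / w\<^sup>2 = (w + 2 * u) / w\<^sup>2" using nz by (simp add: power2_eq_square add_divide_distrib)
    hence "(1 + u\<^sup>2) * w / (w - u)\<^sup>2 - (1 / w + 2 * u / w\<^sup>2) = ((1 + u\<^sup>2) * w * w\<^sup>2 - (w + 2 * u) * (w - u)\<^sup>2) / (w\<^sup>2 * (w - u)\<^sup>2)"
      using nz by (simp add: diff_frac_eq mult_ac)
    also have "(1 + u\<^sup>2) * w * w\<^sup>2 - (w + 2 * u) * (w - u)\<^sup>2 = u\<^sup>2 * (w ^ 3 + 3 * w - 2 * u)"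
      by (simp add: power2_eq_square power3_eq_cube algebra_simps)
    finally show ?thesis .
  qed
  have "norm (w ^ 3 + 3 * w - 2 * u) \<le> norm (w ^ 3) + norm (3 * w) + norm (2 * u)"
    by (meson norm_triangle_ineq norm_triangle_ineq4 add_right_mono order_trans)
  also have "\<dots> \<le> 1 + 3 + 1 / 2"
    using w u power_le_one[of "norm w" 3] by (intro add_mono) (auto simp: norm_mult norm_power)
  finally have n1: "norm (w ^ 3 + 3 * w - 2 * u) \<le> 9 / 2" by simp
  have "(1 / 2)\<^sup>2 * (1 / 4)\<^sup>2 \<le> (norm w)\<^sup>2 * (norm (w - u))\<^sup>2"
    using w wu by (intro mult_mono power_mono) auto
  hence n2: "norm (w\<^sup>2 * (w - u)\<^sup>2) \<ge> 1 / 64" by (simp add: norm_mult norm_power power2_eq_square)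
  have "norm (u\<^sup>2 * (w ^ 3 + 3 * w - 2 * u) / (w\<^sup>2 * (w - u)\<^sup>2)) \<le> ((norm u)\<^sup>2 * (9 / 2)) / (1 / 64)"
    unfolding norm_divide norm_mult[of "u\<^sup>2"] norm_power[of u]
    by (intro frac_le mult_left_mono n1) (use n2 in auto)
  thus ?thesis unfolding eq by simp
qed

text \<open>With p = u / \<alpha> and q = cnj \<alpha> u / R^2 the term is a multiple of (1 + u^2) /
  ((1 - p) (1 - q)), which is 1 + p + q up to second order. The bound is relative to \<alpha>, which
  may itself be as small as a multiple of \<epsilon>.\<close>

lemma zero_term_approx:
  fixes u \<alpha> :: complex and R :: real
  assumes R: "R \<ge> 1 / 2" "R \<le> 1" and \<alpha>: "\<alpha> \<noteq> 0" "norm \<alpha> \<le> 1" and u: "norm u \<le> norm \<alpha> / 2" "norm u \<le> 1 / 8"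
  shows "norm ((1 + u\<^sup>2) / ((u - \<alpha>) * (of_real (R\<^sup>2) - cnj \<alpha> * u)) +
           (1 / \<alpha> + u * (1 / \<alpha>\<^sup>2 + cnj \<alpha> / (\<alpha> * of_real (R\<^sup>2)))) / of_real (R\<^sup>2)) \<le> 544 * ((norm u)\<^sup>2 / (norm \<alpha>) ^ 3)"
proof -
  define p where "p = u / \<alpha>"
  define q where "q = cnj \<alpha> * u / of_real (R\<^sup>2)"
  have R2: "R\<^sup>2 \<ge> 1 / 4" using power_mono[of "1/2" R 2] R by (simp add: power2_eq_square)
  have R0: "of_real (R\<^sup>2) \<noteq> (0 :: complex)" using R by simp
  have np: "norm p = norm u / norm \<alpha>" by (simp add: p_def norm_divide)
  have p: "norm p \<le> 1 / 2" using u \<alpha> by (simp add: np field_simps)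
  have nq: "norm q \<le> 4 * norm u"
  proof -
    have "norm q = norm \<alpha> * norm u / R\<^sup>2" by (simp add: q_def norm_divide norm_mult norm_power)
    also have "\<dots> \<le> (1 * norm u) / (1 / 4)" using \<alpha> R2 by (intro frac_le mult_right_mono) auto
    finally show ?thesis by simp
  qed
  have q: "norm q \<le> 1 / 2" using nq u by linarith
  have up: "norm u \<le> norm p" using \<alpha> by (simp add: np pos_le_divide_eq mult_left_le)
  have np1: "norm (1 - p) \<ge> 1 / 2" using norm_triangle_ineq2[of 1 p] p by simp
  have nq1: "norm (1 - q) \<ge> 1 / 2" using norm_triangle_ineq2[of 1 q] q by simp
  have nz: "1 - p \<noteq> 0" "1 - q \<noteq> 0" using np1 nq1 by auto
  have den: "(u - \<alpha>) * (of_real (R\<^sup>2) - cnj \<alpha> * u) = - \<alpha> * of_real (R\<^sup>2) * ((1 - p) * (1 - q))"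
    using \<alpha> R0 by (simp add: p_def q_def field_simps del: of_real_power)
  have "u * (1 / \<alpha>\<^sup>2 + cnj \<alpha> / (\<alpha> * of_real (R\<^sup>2))) = (p + q) / \<alpha>"
    using \<alpha> R0 by (simp add: p_def q_def power2_eq_square field_simps del: of_real_power)
  hence s: "(1 / \<alpha> + u * (1 / \<alpha>\<^sup>2 + cnj \<alpha> / (\<alpha> * of_real (R\<^sup>2)))) / of_real (R\<^sup>2) = (1 + p + q) / (\<alpha> * of_real (R\<^sup>2))"
    by (simp add: add_divide_distrib[symmetric] add.assoc del: of_real_power)
  define E where "E = (1 + u\<^sup>2) / ((1 - p) * (1 - q)) - (1 + p + q)"
  have "(1 + u\<^sup>2) / ((u - \<alpha>) * (of_real (R\<^sup>2) - cnj \<alpha> * u)) +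
           (1 / \<alpha> + u * (1 / \<alpha>\<^sup>2 + cnj \<alpha> / (\<alpha> * of_real (R\<^sup>2)))) / of_real (R\<^sup>2) = - E / (\<alpha> * of_real (R\<^sup>2))"
    unfolding s den E_def by (simp add: diff_divide_distrib minus_divide_left[symmetric] mult_ac del: of_real_power)
  hence eq: "norm ((1 + u\<^sup>2) / ((u - \<alpha>) * (of_real (R\<^sup>2) - cnj \<alpha> * u)) +
           (1 / \<alpha> + u * (1 / \<alpha>\<^sup>2 + cnj \<alpha> / (\<alpha> * of_real (R\<^sup>2)))) / of_real (R\<^sup>2)) = norm E / (norm \<alpha> * R\<^sup>2)"
    by (simp add: norm_divide norm_mult norm_power)
  have E: "E = (u\<^sup>2 + (p + q)\<^sup>2 - p * q * (1 + p + q)) / ((1 - p) * (1 - q))"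
  proof -
    define D where "D = (1 - p) * (1 - q)"
    have "D \<noteq> 0" using nz by (simp add: D_def)
    hence "E = ((1 + u\<^sup>2) - (1 + p + q) * D) / D" unfolding E_def D_def[symmetric] by (simp add: diff_divide_distrib)
    also have "(1 + u\<^sup>2) - (1 + p + q) * D = u\<^sup>2 + (p + q)\<^sup>2 - p * q * (1 + p + q)"
      by (simp add: D_def power2_eq_square algebra_simps)
    finally show ?thesis by (simp only: D_def)
  qed
  have qp: "norm q \<le> 4 * norm p" using nq up by linarith
  have "norm (u\<^sup>2 + (p + q)\<^sup>2 - p * q * (1 + p + q)) \<le> norm (u\<^sup>2) + norm ((p + q)\<^sup>2) + norm (p * q * (1 + p + q))"
    by (meson norm_triangle_ineq norm_triangle_ineq4 add_right_mono order_trans)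
  also have "\<dots> \<le> (norm p)\<^sup>2 + (5 * norm p)\<^sup>2 + (norm p * (4 * norm p)) * 2"
  proof (intro add_mono)
    show "norm (u\<^sup>2) \<le> (norm p)\<^sup>2" using up by (simp add: norm_power power_mono)
    have "norm (p + q) \<le> 5 * norm p" using norm_triangle_ineq[of p q] qp by linarith
    thus "norm ((p + q)\<^sup>2) \<le> (5 * norm p)\<^sup>2" by (simp only: norm_power) (intro power_mono; simp)
    have "norm (1 + p + q) \<le> norm (1 + p) + norm q" by (rule norm_triangle_ineq)
    also have "norm (1 + p) \<le> 1 + norm p" using norm_triangle_ineq[of 1 p] by simp
    finally have "norm (1 + p + q) \<le> 2" using p q by simp
    thus "norm (p * q * (1 + p + q)) \<le> (norm p * (4 * norm p)) * 2"
      unfolding norm_mult using qp by (intro mult_mono) auto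
  qed
  also have "\<dots> = 34 * (norm p)\<^sup>2" by (simp add: power2_eq_square)
  finally have n1: "norm (u\<^sup>2 + (p + q)\<^sup>2 - p * q * (1 + p + q)) \<le> 34 * (norm p)\<^sup>2" .
  have "(1 / 2) * (1 / 2) \<le> norm (1 - p) * norm (1 - q)" using np1 nq1 by (intro mult_mono) auto
  hence "norm E \<le> (34 * (norm p)\<^sup>2) / (1 / 4)"
    unfolding E norm_divide by (intro frac_le n1) (auto simp: norm_mult)
  hence nE: "norm E \<le> 136 * (norm p)\<^sup>2" by simp
  have "norm E / (norm \<alpha> * R\<^sup>2) \<le> (136 * (norm p)\<^sup>2) / (norm \<alpha> * (1 / 4))"
    using nE R2 \<alpha> by (intro frac_le mult_left_mono) auto
  also have "\<dots> = 544 * ((norm u)\<^sup>2 / (norm \<alpha>) ^ 3)"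
    using \<alpha> by (simp add: np power_divide power2_eq_square power3_eq_cube)
  finally show ?thesis unfolding eq .
qed

text \<open>
  The smoothing function is \<open>f t = (\<Sum>k\<in>I. c k * exp (- a k * t))\<close>; thus \<open>f0 = f 0\<close>, \<open>S1 = - f' 0\<close>, and \<open>F\<close>
  below is the Laplace transform of \<open>f\<close>. The condition \<open>S1 > f0\<close> makes the kernel \<open>K\<close> non-positive on the left
  half of the circle.
\<close>

locale smoothing =
  fixes I :: "nat set" and c a :: "nat \<Rightarrow> complex" and f0 S1 :: real
  assumes fin: "finite I"
    and a_gt: "\<And>k. k \<in> I \<Longrightarrow> Re (a k) > 1"
    and sum_c: "(\<Sum>k\<in>I. c k) = of_real f0" and f0: "f0 > 0"
    and sum_ca: "(\<Sum>k\<in>I. c k * a k) = of_real S1" and S1: "S1 > f0"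
    and F_pos: "\<And>z. Re z \<ge> 0 \<Longrightarrow> Re (\<Sum>k\<in>I. c k / (z + a k)) > 0"
    and f_nonneg: "\<And>t :: real. t \<ge> 0 \<Longrightarrow> (\<Sum>k\<in>I. c k * exp (- (a k * of_real t))) \<in> \<real>"
      "\<And>t :: real. t \<ge> 0 \<Longrightarrow> Re (\<Sum>k\<in>I. c k * exp (- (a k * of_real t))) \<ge> 0"
begin

definition F :: "complex \<Rightarrow> complex" where "F z = (\<Sum>k\<in>I. c k / (z + a k))"

text \<open>
  The parameter of \<open>1 + \<mu> (a k - x)\<close> under \<open>u \<mapsto> 1 + (4 \<eta> / \<pi>) arctan u\<close>, where \<open>\<epsilon> = \<pi> \<mu> / (4 \<eta>)\<close>.
\<close>

definition disc_point :: "real \<Rightarrow> real \<Rightarrow> nat \<Rightarrow> complex" where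
  "disc_point \<epsilon> x k = tan (of_real \<epsilon> * (a k - of_real x))"

definition coeff_norm :: real where "coeff_norm = (\<Sum>k\<in>I. norm (c k))"

lemma coeff_norm_nonneg: "coeff_norm \<ge> 0" by (simp add: coeff_norm_def sum_nonneg)

lemma norm_weighted_sum_le:
  assumes "\<And>k. k \<in> I \<Longrightarrow> norm (g k - h k) \<le> M"
  shows "norm ((\<Sum>k\<in>I. c k * g k) - (\<Sum>k\<in>I. c k * h k)) \<le> coeff_norm * M"
proof -
  have "norm ((\<Sum>k\<in>I. c k * g k) - (\<Sum>k\<in>I. c k * h k)) = norm (\<Sum>k\<in>I. c k * (g k - h k))"
    by (simp add: sum_subtractf right_diff_distrib)
  also have "\<dots> \<le> (\<Sum>k\<in>I. norm (c k) * M)"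
    by (intro sum_norm_le) (auto simp: norm_mult intro!: mult_left_mono assms)
  finally show ?thesis by (simp add: coeff_norm_def sum_distrib_right)
qed

lemma disc_point_approx:
  "\<exists>C \<epsilon>0. C \<ge> 1 \<and> \<epsilon>0 > 0 \<and> (\<forall>\<epsilon> x k. 0 < \<epsilon> \<longrightarrow> \<epsilon> < \<epsilon>0 \<longrightarrow> 0 \<le> x \<longrightarrow> x \<le> 1 \<longrightarrow> k \<in> I \<longrightarrow>
     norm (disc_point \<epsilon> x k - of_real \<epsilon> * (a k - of_real x)) \<le> C * \<epsilon>\<^sup>2 \<and> norm (disc_point \<epsilon> x k) \<le> C * \<epsilon> \<and>
     norm (of_real \<epsilon> * (a k - of_real x)) \<le> 1)"
proof -
  obtain B where B: "B > 0" "\<And>z :: complex. norm z \<le> 1 \<Longrightarrow> norm (tan z - z) \<le> B * (norm z)\<^sup>2"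
    using tan_approx by blast
  define A where "A = (\<Sum>k\<in>I. norm (a k)) + 1"
  have A1: "A \<ge> 1" by (simp add: A_def sum_nonneg)
  define C where "C = A + B * A\<^sup>2"
  have CA: "C \<ge> A" "C \<ge> B * A\<^sup>2" using B A1 by (auto simp: C_def)
  show ?thesis
  proof (rule exI[of _ C], rule exI[of _ "1 / A"], intro conjI allI impI)
    show "C \<ge> 1" "1 / A > 0" using CA A1 by auto
    fix \<epsilon> x :: real and k assume e: "0 < \<epsilon>" "\<epsilon> < 1 / A" and x: "0 \<le> x" "x \<le> 1" and k: "k \<in> I"
    define z where "z = of_real \<epsilon> * (a k - of_real x)"
    have "norm (a k) \<le> (\<Sum>k\<in>I. norm (a k))" by (intro member_le_sum k fin) auto
    hence "norm (a k - of_real x) \<le> A" using norm_triangle_ineq4[of "a k" "of_real x"] x by (simp add: A_def)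
    hence zn: "norm z \<le> \<epsilon> * A" using e by (simp add: z_def norm_mult)
    also have "\<epsilon> * A \<le> 1" using e A1 by (simp add: field_simps)
    finally have z1: "norm z \<le> 1" .
    have "norm (tan z - z) \<le> B * (norm z)\<^sup>2" by (rule B(2)[OF z1])
    also have "\<dots> \<le> B * (\<epsilon> * A)\<^sup>2" using zn B by (intro mult_left_mono power_mono) auto
    finally have 1: "norm (tan z - z) \<le> B * A\<^sup>2 * \<epsilon>\<^sup>2" by (simp add: power_mult_distrib mult_ac)
    also have "\<dots> \<le> C * \<epsilon>\<^sup>2" using CA by (intro mult_right_mono) auto
    finally show "norm (disc_point \<epsilon> x k - of_real \<epsilon> * (a k - of_real x)) \<le> C * \<epsilon>\<^sup>2"
      by (simp add: disc_point_def z_def)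
    have "\<epsilon> \<le> 1" using e A1 by (metis divide_le_eq_1_pos less_imp_le order_trans less_le_trans zero_less_one)
    hence "\<epsilon>\<^sup>2 \<le> \<epsilon>" using e by (simp add: power2_eq_square mult_left_le)
    hence "B * A\<^sup>2 * \<epsilon>\<^sup>2 \<le> B * A\<^sup>2 * \<epsilon>" using B by (intro mult_left_mono) auto
    hence "norm (tan z) \<le> \<epsilon> * A + B * A\<^sup>2 * \<epsilon>"
      using 1 zn norm_triangle_ineq2[of "tan z" z] by linarith
    thus "norm (disc_point \<epsilon> x k) \<le> C * \<epsilon>" by (simp add: disc_point_def z_def C_def algebra_simps)
    show "norm (of_real \<epsilon> * (a k - of_real x)) \<le> 1" using z1 by (simp add: z_def)
  qed
qed

text \<open>Minus the derivative at t = 0 of exp (x t) f t, the smoothing function whose exponents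
  are a k - x in place of a k.\<close>

definition sigma :: "real \<Rightarrow> real" where "sigma x = S1 - x * f0"

lemma sigma_bounds: "0 \<le> x \<Longrightarrow> x \<le> 1 \<Longrightarrow> S1 - f0 \<le> sigma x \<and> sigma x \<le> S1"
  using f0 by (simp add: sigma_def mult_left_le_one_le)

lemma sum_c_affine: "(\<Sum>k\<in>I. c k * (of_real \<epsilon> * (a k - of_real x))) = of_real (\<epsilon> * sigma x)"
proof -
  have "(\<Sum>k\<in>I. c k * (of_real \<epsilon> * (a k - of_real x))) = of_real \<epsilon> * ((\<Sum>k\<in>I. c k * a k) - of_real x * (\<Sum>k\<in>I. c k))"
    by (simp add: sum_subtractf sum_distrib_left algebra_simps)
  thus ?thesis unfolding sum_c sum_ca by (simp add: sigma_def)
qed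

text \<open>
  The weights of \<open>ln \<bar>g\<bar>\<close> on the circle of radius \<open>R\<close> and (as \<open>zero_kernel\<close>, later) of a zero \<open>\<alpha>\<close> when the Poisson--Jensen
  formula is summed over the points \<open>disc_point \<epsilon> x k\<close>; the factor \<open>1 + u\<^sup>2\<close> comes from the derivative of the arctangent.
\<close>

definition K :: "real \<Rightarrow> real \<Rightarrow> real \<Rightarrow> real \<Rightarrow> real" where
  "K \<epsilon> x R t = Re (\<Sum>k\<in>I. c k * ((1 + (disc_point \<epsilon> x k)\<^sup>2) * (R * cis t) / (R * cis t - disc_point \<epsilon> x k)\<^sup>2))"

lemma K_approx:
  "\<exists>C \<epsilon>0. C > 0 \<and> \<epsilon>0 > 0 \<and> (\<forall>\<epsilon> x R t. 0 < \<epsilon> \<longrightarrow> \<epsilon> < \<epsilon>0 \<longrightarrow> 0 \<le> x \<longrightarrow> x \<le> 1 \<longrightarrow> 1 / 2 \<le> R \<longrightarrow> R \<le> 1 \<longrightarrow>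
     \<bar>K \<epsilon> x R t - (f0 * cos t / R + 2 * \<epsilon> * sigma x * cos (2 * t) / R\<^sup>2)\<bar> \<le> C * \<epsilon>\<^sup>2)"
proof -
  obtain C e0 where C: "C \<ge> 1" "e0 > 0" and up: "\<And>\<epsilon> x k. 0 < \<epsilon> \<Longrightarrow> \<epsilon> < e0 \<Longrightarrow> 0 \<le> x \<Longrightarrow> x \<le> 1 \<Longrightarrow> k \<in> I \<Longrightarrow>
     norm (disc_point \<epsilon> x k - of_real \<epsilon> * (a k - of_real x)) \<le> C * \<epsilon>\<^sup>2 \<and> norm (disc_point \<epsilon> x k) \<le> C * \<epsilon>"
    using disc_point_approx by blast
  define e1 where "e1 = min e0 (1 / (4 * C))"
  define D where "D = coeff_norm * (288 * C\<^sup>2 + 8 * C) + 1"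
  have D: "D > 0" using coeff_norm_nonneg C by (simp add: D_def add_nonneg_pos)
  show ?thesis
  proof (rule exI[of _ D], rule exI[of _ e1], intro conjI allI impI D)
    show "e1 > 0" using C by (simp add: e1_def)
    fix \<epsilon> x R t :: real assume e: "0 < \<epsilon>" "\<epsilon> < e1" and x: "0 \<le> x" "x \<le> 1" and R: "1 / 2 \<le> R" "R \<le> 1"
    define w where "w = of_real R * cis t"
    have w: "norm w \<ge> 1 / 2" "norm w \<le> 1" using R by (auto simp: w_def norm_mult)
    have w0: "w \<noteq> 0" using w by auto
    define g where "g = (\<lambda>k. (1 + (disc_point \<epsilon> x k)\<^sup>2) * w / (w - disc_point \<epsilon> x k)\<^sup>2)"
    define h where "h = (\<lambda>k. 1 / w + 2 * (of_real \<epsilon> * (a k - of_real x)) / w\<^sup>2)"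
    have b: "norm (g k - h k) \<le> (288 * C\<^sup>2 + 8 * C) * \<epsilon>\<^sup>2" if k: "k \<in> I" for k
    proof -
      let ?u = "disc_point \<epsilon> x k"
      have u: "norm (?u - of_real \<epsilon> * (a k - of_real x)) \<le> C * \<epsilon>\<^sup>2" "norm ?u \<le> C * \<epsilon>"
        using up[of \<epsilon> x k] e x k by (auto simp: e1_def)
      have "\<epsilon> < 1 / (4 * C)" using e by (simp add: e1_def)
      hence "C * \<epsilon> \<le> 1 / 4" using C by (simp add: field_simps)
      hence "norm (g k - (1 / w + 2 * ?u / w\<^sup>2)) \<le> 288 * (norm ?u)\<^sup>2"
        unfolding g_def using u by (intro kernel_term_approx w) auto
      also have "\<dots> \<le> 288 * (C * \<epsilon>)\<^sup>2" using u by (intro mult_left_mono power_mono) auto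
      finally have 1: "norm (g k - (1 / w + 2 * ?u / w\<^sup>2)) \<le> 288 * C\<^sup>2 * \<epsilon>\<^sup>2" by (simp add: power_mult_distrib)
      have "(1 / w + 2 * ?u / w\<^sup>2) - h k = 2 * (?u - of_real \<epsilon> * (a k - of_real x)) / w\<^sup>2"
        by (simp add: h_def right_diff_distrib diff_divide_distrib)
      hence "norm ((1 / w + 2 * ?u / w\<^sup>2) - h k) = 2 * norm (?u - of_real \<epsilon> * (a k - of_real x)) / (norm w)\<^sup>2"
        by (simp only: norm_divide norm_mult norm_power norm_numeral)
      also have "\<dots> \<le> 2 * (C * \<epsilon>\<^sup>2) / (1 / 2)\<^sup>2"
        using u w C by (intro frac_le mult_left_mono power_mono) auto
      finally have 2: "norm ((1 / w + 2 * ?u / w\<^sup>2) - h k) \<le> 8 * C * \<epsilon>\<^sup>2" by (simp add: power2_eq_square)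
      have "norm (g k - h k) \<le> norm (g k - (1 / w + 2 * ?u / w\<^sup>2)) + norm ((1 / w + 2 * ?u / w\<^sup>2) - h k)"
        using norm_triangle_ineq[of "g k - (1 / w + 2 * ?u / w\<^sup>2)" "(1 / w + 2 * ?u / w\<^sup>2) - h k"] by simp
      with 1 2 show ?thesis by (simp add: algebra_simps)
    qed
    have "c k * h k = c k * (1 / w) + (c k * (of_real \<epsilon> * (a k - of_real x))) * (2 / w\<^sup>2)" for k
      unfolding h_def by (simp add: distrib_left)
    note hk = this
    have "(\<Sum>k\<in>I. c k * h k) = (\<Sum>k\<in>I. c k * (1 / w) + (c k * (of_real \<epsilon> * (a k - of_real x))) * (2 / w\<^sup>2))"
      by (rule sum.cong[OF refl hk])
    also have "\<dots> = (\<Sum>k\<in>I. c k) * (1 / w) + (\<Sum>k\<in>I. c k * (of_real \<epsilon> * (a k - of_real x))) * (2 / w\<^sup>2)"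
      by (simp only: sum.distrib sum_distrib_right)
    finally have sh: "(\<Sum>k\<in>I. c k * h k) = of_real f0 * (1 / w) + of_real (\<epsilon> * sigma x) * (2 / w\<^sup>2)"
      unfolding sum_c sum_c_affine .
    have "w * (of_real (1 / R) * cis (- t)) = 1" using R by (simp add: w_def cis_mult)
    hence w1: "1 / w = of_real (1 / R) * cis (- t)" by (metis nonzero_divide_eq_eq mult.commute w0)
    have "1 / w\<^sup>2 = (1 / w)\<^sup>2" by (simp add: power_divide)
    also have "\<dots> = of_real (1 / R\<^sup>2) * cis (- (2 * t))"
      unfolding w1 power_mult_distrib by (simp add: power_divide) (simp add: power2_eq_square cis_mult)
    finally have w2: "1 / w\<^sup>2 = of_real (1 / R\<^sup>2) * cis (- (2 * t))" .
    have "(\<Sum>k\<in>I. c k * h k) = of_real (f0 / R) * cis (- t) + of_real (2 * \<epsilon> * sigma x / R\<^sup>2) * cis (- (2 * t))"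
    proof -
      have "2 / w\<^sup>2 = 2 * (1 / w\<^sup>2)" by simp
      thus ?thesis unfolding sh w1 w2 by simp
    qed
    hence "Re (\<Sum>k\<in>I. c k * h k) = Re (of_real (f0 / R) * cis (- t) + of_real (2 * \<epsilon> * sigma x / R\<^sup>2) * cis (- (2 * t)))"
      by (rule arg_cong)
    also have "\<dots> = f0 * cos t / R + 2 * \<epsilon> * sigma x * cos (2 * t) / R\<^sup>2"
      by (simp only: plus_complex.sel times_complex.sel cis.sel Re_complex_of_real Im_complex_of_real) simp
    finally have "Re (\<Sum>k\<in>I. c k * h k) = f0 * cos t / R + 2 * \<epsilon> * sigma x * cos (2 * t) / R\<^sup>2" .
    moreover have "\<bar>Re ((\<Sum>k\<in>I. c k * g k) - (\<Sum>k\<in>I. c k * h k))\<bar> \<le> coeff_norm * ((288 * C\<^sup>2 + 8 * C) * \<epsilon>\<^sup>2)"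
      using norm_weighted_sum_le[of g h "(288 * C\<^sup>2 + 8 * C) * \<epsilon>\<^sup>2"] b abs_Re_le_cmod order_trans by blast
    moreover have "coeff_norm * ((288 * C\<^sup>2 + 8 * C) * \<epsilon>\<^sup>2) \<le> D * \<epsilon>\<^sup>2" by (simp add: D_def algebra_simps)
    moreover have "K \<epsilon> x R t = Re (\<Sum>k\<in>I. c k * g k)" by (simp add: K_def g_def w_def)
    ultimately show "\<bar>K \<epsilon> x R t - (f0 * cos t / R + 2 * \<epsilon> * sigma x * cos (2 * t) / R\<^sup>2)\<bar> \<le> D * \<epsilon>\<^sup>2" by simp
  qed
qed

text \<open>The leading term f0 cos t / R has the right sign on the left half but vanishes at its
  ends. There the next term decides: by cos (2 t) = 2 (cos t)^2 - 1 it contains - 2 \<epsilon> sigma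
  x / R^2, which is at most - \<epsilon> (S1 - f0) and absorbs the error of order \<epsilon>^2; its
  other part is dominated by the leading term.\<close>

lemma K_bounds:
  "\<exists>C \<epsilon>0. C > 0 \<and> \<epsilon>0 > 0 \<and> (\<forall>\<epsilon> x R t. 0 < \<epsilon> \<longrightarrow> \<epsilon> < \<epsilon>0 \<longrightarrow> 0 \<le> x \<longrightarrow> x \<le> 1 \<longrightarrow> 1 / 2 \<le> R \<longrightarrow> R \<le> 1 \<longrightarrow>
     \<bar>K \<epsilon> x R t - f0 * cos t / R\<bar> \<le> C * \<epsilon> \<and> (cos t \<le> 0 \<longrightarrow> K \<epsilon> x R t \<le> 0))"
proof -
  obtain C e0 where C: "C > 0" "e0 > 0" and ap: "\<And>\<epsilon> x R t. 0 < \<epsilon> \<Longrightarrow> \<epsilon> < e0 \<Longrightarrow> 0 \<le> x \<Longrightarrow> x \<le> 1 \<Longrightarrow> 1 / 2 \<le> R \<Longrightarrow> R \<le> 1 \<Longrightarrow>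
     \<bar>K \<epsilon> x R t - (f0 * cos t / R + 2 * \<epsilon> * sigma x * cos (2 * t) / R\<^sup>2)\<bar> \<le> C * \<epsilon>\<^sup>2"
    using K_approx by blast
  define s0 where "s0 = S1 - f0"
  have s0: "s0 > 0" using S1 by (simp add: s0_def)
  have S1p: "S1 > 0" using S1 f0 by simp
  \<comment> \<open>\<open>s0 / C\<close> makes the quadratic error smaller than \<epsilon> s0;
    \<open>f0 / (16 * S1)\<close> keeps the factor multiplying cos t non-negative.\<close>
  define e1 where "e1 = Min {e0, 1, s0 / C, f0 / (16 * S1)}"
  have e1: "e1 > 0" using C s0 f0 S1p by (simp add: e1_def)
  define D where "D = 8 * S1 + C"
  show ?thesis
  proof (rule exI[of _ D], rule exI[of _ e1], intro conjI allI impI)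
    show "D > 0" using C S1p by (simp add: D_def)
    show "e1 > 0" by fact
    fix \<epsilon> x R t :: real assume e: "0 < \<epsilon>" "\<epsilon> < e1" and x: "0 \<le> x" "x \<le> 1" and R: "1 / 2 \<le> R" "R \<le> 1"
    have ee: "\<epsilon> < e0" "\<epsilon> < 1" "\<epsilon> < s0 / C" "\<epsilon> < f0 / (16 * S1)" using e by (auto simp: e1_def)
    have sg: "s0 \<le> sigma x" "sigma x \<le> S1" using sigma_bounds[OF x] by (auto simp: s0_def)
    have R2: "R\<^sup>2 \<ge> 1 / 4" "R\<^sup>2 \<le> 1" using power_mono[of "1/2" R 2] R by (auto simp: power2_eq_square mult_le_one)
    have Rp: "R > 0" using R by simp
    define Y where "Y = 2 * \<epsilon> * sigma x * cos (2 * t) / R\<^sup>2"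
    define P where "P = f0 * cos t / R"
    have A: "\<bar>K \<epsilon> x R t - (P + Y)\<bar> \<le> C * \<epsilon>\<^sup>2" using ap[OF e(1) ee(1) x R, of t] unfolding P_def Y_def .
    have "\<bar>Y\<bar> \<le> 8 * S1 * \<epsilon>"
    proof -
      have "\<bar>Y\<bar> = (2 * \<epsilon> * sigma x * \<bar>cos (2 * t)\<bar>) / R\<^sup>2"
        using e sg s0 by (simp add: Y_def abs_mult)
      also have "\<dots> \<le> 2 * \<epsilon> * S1 * 1 / (1 / 4)"
        using e sg s0 R2 S1p by (intro frac_le mult_mono) auto
      finally show ?thesis by (simp add: mult_ac)
    qed
    moreover have "C * \<epsilon>\<^sup>2 \<le> C * \<epsilon>" using ee e C by (simp add: power2_eq_square)
    ultimately show "\<bar>K \<epsilon> x R t - f0 * cos t / R\<bar> \<le> D * \<epsilon>"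
      using A unfolding P_def[symmetric] D_def distrib_right by linarith
    assume ct: "cos t \<le> 0"
    have c2: "cos (2 * t) = 2 * (cos t)\<^sup>2 - 1" by (rule cos_double_cos)
    have eq: "P + Y = cos t * ((f0 * R + 4 * \<epsilon> * sigma x * cos t) / R\<^sup>2) - 2 * \<epsilon> * sigma x / R\<^sup>2"
      unfolding P_def Y_def c2 using Rp by (simp add: field_simps power2_eq_square)
    have "4 * \<epsilon> * sigma x * (- cos t) \<le> 4 * \<epsilon> * S1 * 1"
      using e sg s0 ct cos_ge_minus_one[of t] by (intro mult_mono) auto
    also have "\<dots> \<le> f0 / 4" using ee S1p by (simp add: field_simps)
    also have "\<dots> \<le> f0 * R" using R f0 by simp
    finally have "f0 * R + 4 * \<epsilon> * sigma x * cos t \<ge> 0" by simp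
    hence "cos t * ((f0 * R + 4 * \<epsilon> * sigma x * cos t) / R\<^sup>2) \<le> 0"
      using ct by (intro mult_nonpos_nonneg divide_nonneg_nonneg) auto
    moreover have "2 * \<epsilon> * sigma x / R\<^sup>2 \<ge> \<epsilon> * s0"
    proof -
      have "\<epsilon> * s0 \<le> 2 * \<epsilon> * sigma x" using e sg s0 by (simp add: mult_mono)
      also have "2 * \<epsilon> * sigma x \<le> 2 * \<epsilon> * sigma x / R\<^sup>2"
        using R2 e sg s0 Rp by (simp add: pos_le_divide_eq mult_left_le)
      finally show ?thesis .
    qed
    moreover have "C * \<epsilon>\<^sup>2 \<le> \<epsilon> * s0"
    proof -
      have "C * \<epsilon> \<le> s0" using ee(3) C by (simp add: field_simps)
      thus ?thesis using e mult_left_mono[of "C * \<epsilon>" s0 \<epsilon>] by (simp add: power2_eq_square mult_ac)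
    qed
    moreover have "k \<le> 0" if "q \<le> 0" "es \<le> w" "ce \<le> es" "\<bar>k - py\<bar> \<le> ce" "py = q - w" for k q es w ce py :: real
      using that by linarith
    ultimately show "K \<epsilon> x R t \<le> 0" using A eq by blast
  qed
qed

end

section \<open>Sign and size of the contribution of a zero\<close>

context smoothing
begin

text \<open>
  A zero far from the origin (on the scale \<open>\<epsilon>\<close>) is controlled by \<open>- Re (1 / \<alpha>) \<ge> 0\<close>, one close to it by the
  positivity of \<open>Re F\<close>.
\<close>

definition zero_kernel :: "real \<Rightarrow> real \<Rightarrow> real \<Rightarrow> complex \<Rightarrow> real" where
  "zero_kernel \<epsilon> x R \<alpha> = Re (\<Sum>k\<in>I. c k * ((1 + (disc_point \<epsilon> x k)\<^sup>2) / ((disc_point \<epsilon> x k - \<alpha>) * (of_real (R\<^sup>2) - cnj \<alpha> * disc_point \<epsilon> x k))))"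

text \<open>To first order the kernel is (f0 \<xi> / r^2 - \<epsilon> sigma x Re q) / R^2 with r =
  |\<alpha>| and \<xi> = - Re \<alpha>. Near the imaginary axis \<xi> gives nothing, but there Re q
  is negative: in general - Re q >= 1 / r^2 - 10 \<xi> / r^3. The loss 10 \<xi> / r^3 is covered by
  the first term and the error O(\<epsilon>^2 / r^3) by \<epsilon> sigma x / r^2, as soon as r is a
  large multiple of \<epsilon>.\<close>

lemma zero_kernel_far:
  "\<exists>M \<epsilon>0. M > 0 \<and> \<epsilon>0 > 0 \<and> (\<forall>\<epsilon> x R \<alpha>. 0 < \<epsilon> \<longrightarrow> \<epsilon> < \<epsilon>0 \<longrightarrow> 0 \<le> x \<longrightarrow> x \<le> 1 \<longrightarrow> 1 / 2 \<le> R \<longrightarrow> R \<le> 1 \<longrightarrow>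
     M * \<epsilon> \<le> norm \<alpha> \<longrightarrow> norm \<alpha> \<le> 1 \<longrightarrow> Re \<alpha> \<le> 0 \<longrightarrow> zero_kernel \<epsilon> x R \<alpha> \<ge> 0)"
proof -
  obtain C e0 where C: "C \<ge> 1" "e0 > 0" and up: "\<And>\<epsilon> x k. 0 < \<epsilon> \<Longrightarrow> \<epsilon> < e0 \<Longrightarrow> 0 \<le> x \<Longrightarrow> x \<le> 1 \<Longrightarrow> k \<in> I \<Longrightarrow>
     norm (disc_point \<epsilon> x k - of_real \<epsilon> * (a k - of_real x)) \<le> C * \<epsilon>\<^sup>2 \<and> norm (disc_point \<epsilon> x k) \<le> C * \<epsilon>"
    using disc_point_approx by blast
  define s0 where "s0 = S1 - f0"
  have s0: "s0 > 0" using S1 by (simp add: s0_def)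
  have S1p: "S1 > 0" using S1 f0 by simp
  define D where "D = coeff_norm * (544 * C\<^sup>2 + 20 * C)"
  have D0: "D \<ge> 0" using coeff_norm_nonneg C by (simp add: D_def)
  \<comment> \<open>The three summands respectively place the disc points within |\<alpha>| / 2, let
    f0 \<xi> / r^2 cover the loss 10 \<epsilon> sigma x \<xi> / r^3, and let \<epsilon> s0 / r^2
    cover the error term with constant \<open>D\<close>.\<close>
  define M where "M = 2 * C + 10 * S1 / f0 + D / s0"
  have M: "M \<ge> 2 * C" "M \<ge> 10 * S1 / f0" "M \<ge> D / s0" "M > 0"
    using C D0 s0 S1p f0 by (auto simp: M_def add_nonneg_nonneg intro!: add_pos_nonneg)
  define e1 where "e1 = min e0 (1 / (8 * C))"
  show ?thesis
  proof (rule exI[of _ M], rule exI[of _ e1], intro conjI allI impI)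
    show "M > 0" "e1 > 0" using M C by (auto simp: e1_def)
    fix \<epsilon> x R :: real and \<alpha> :: complex
    assume e: "0 < \<epsilon>" "\<epsilon> < e1" and x: "0 \<le> x" "x \<le> 1" and R: "1 / 2 \<le> R" "R \<le> 1"
      and \<alpha>: "M * \<epsilon> \<le> norm \<alpha>" "norm \<alpha> \<le> 1" "Re \<alpha> \<le> 0"
    define r where "r = norm \<alpha>"
    have "M * \<epsilon> > 0" using M e by simp
    hence r: "r > 0" "r \<le> 1" "M * \<epsilon> \<le> r" using \<alpha> by (auto simp: r_def)
    have a0: "\<alpha> \<noteq> 0" using r by (auto simp: r_def)
    have R2: "R\<^sup>2 \<ge> 1 / 4" "R\<^sup>2 \<le> 1" using power_mono[of "1/2" R 2] R by (auto simp: power2_eq_square mult_le_one)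
    have R0: "R\<^sup>2 > 0" using R2 by linarith
    define q where "q = 1 / \<alpha>\<^sup>2 + cnj \<alpha> / (\<alpha> * of_real (R\<^sup>2))"
    define T where "T = (\<lambda>k. (1 + (disc_point \<epsilon> x k)\<^sup>2) / ((disc_point \<epsilon> x k - \<alpha>) * (of_real (R\<^sup>2) - cnj \<alpha> * disc_point \<epsilon> x k)))"
    define H where "H = (\<lambda>k. - (1 / \<alpha> + (of_real \<epsilon> * (a k - of_real x)) * q) / of_real (R\<^sup>2))"
    have qn: "norm q \<le> 5 / r\<^sup>2"
    proof -
      have "norm q \<le> norm (1 / \<alpha>\<^sup>2) + norm (cnj \<alpha> / (\<alpha> * of_real (R\<^sup>2)))" unfolding q_def by (rule norm_triangle_ineq)
      also have "norm (cnj \<alpha> / (\<alpha> * of_real (R\<^sup>2))) = 1 / R\<^sup>2" using a0 by (simp add: norm_divide norm_mult norm_power)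
      also have "norm (1 / \<alpha>\<^sup>2) = 1 / r\<^sup>2" by (simp add: norm_divide norm_power r_def)
      also have "1 / R\<^sup>2 \<le> 4" using R2 R0 by (simp add: pos_divide_le_eq)
      also have "4 \<le> 4 / r\<^sup>2" using r by (simp add: pos_le_divide_eq power_le_one)
      finally show ?thesis by simp
    qed
    have b: "norm (T k - H k) \<le> (544 * C\<^sup>2 + 20 * C) * (\<epsilon>\<^sup>2 / r ^ 3)" if k: "k \<in> I" for k
    proof -
      let ?u = "disc_point \<epsilon> x k" and ?l = "of_real \<epsilon> * (a k - of_real x)"
      have u: "norm (?u - ?l) \<le> C * \<epsilon>\<^sup>2" "norm ?u \<le> C * \<epsilon>"
        using up[of \<epsilon> x k] e x k by (auto simp: e1_def)
      have "\<epsilon> < 1 / (8 * C)" using e by (simp add: e1_def)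
      hence "C * \<epsilon> \<le> 1 / 8" using C by (simp add: field_simps)
      hence u8: "norm ?u \<le> 1 / 8" using u by linarith
      have "2 * C * \<epsilon> \<le> M * \<epsilon>" using M e by (intro mult_right_mono) auto
      hence u2: "norm ?u \<le> norm \<alpha> / 2" using u r by (simp add: r_def)
      have "norm (T k + (1 / \<alpha> + ?u * q) / of_real (R\<^sup>2)) \<le> 544 * ((norm ?u)\<^sup>2 / (norm \<alpha>) ^ 3)"
        unfolding T_def q_def by (rule zero_term_approx[OF R a0 \<alpha>(2) u2 u8])
      also have "\<dots> \<le> 544 * ((C * \<epsilon>)\<^sup>2 / r ^ 3)"
        unfolding r_def using u by (intro mult_left_mono divide_right_mono power_mono) auto
      finally have 1: "norm (T k + (1 / \<alpha> + ?u * q) / of_real (R\<^sup>2)) \<le> 544 * C\<^sup>2 * (\<epsilon>\<^sup>2 / r ^ 3)"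
        by (simp add: power_mult_distrib)
      have "T k - H k = (T k + (1 / \<alpha> + ?u * q) / of_real (R\<^sup>2)) - (?u - ?l) * q / of_real (R\<^sup>2)"
        unfolding H_def by (simp add: diff_divide_distrib add_divide_distrib left_diff_distrib del: of_real_power)
      hence "norm (T k - H k) \<le> norm (T k + (1 / \<alpha> + ?u * q) / of_real (R\<^sup>2)) + norm ((?u - ?l) * q / of_real (R\<^sup>2))"
        by (simp only: norm_triangle_ineq4)
      also have "norm ((?u - ?l) * q / of_real (R\<^sup>2)) = norm (?u - ?l) * norm q / R\<^sup>2"
        by (simp only: norm_divide norm_mult norm_of_real) simp
      also have "\<dots> \<le> ((C * \<epsilon>\<^sup>2) * (5 / r\<^sup>2)) / (1 / 4)"
        using u qn R2 C by (intro frac_le mult_mono) auto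
      also have "\<dots> = 20 * C * (\<epsilon>\<^sup>2 * (1 / r\<^sup>2))" by simp
      also have "\<dots> \<le> 20 * C * (\<epsilon>\<^sup>2 * (1 / r ^ 3))"
        using r C power_decreasing[of 2 3 r] by (intro mult_left_mono divide_left_mono) auto
      finally show ?thesis using 1 by (simp add: algebra_simps)
    qed
    have "c k * H k = - (c k * (1 / \<alpha>) + (c k * (of_real \<epsilon> * (a k - of_real x))) * q) / of_real (R\<^sup>2)" for k
    proof -
      have "y * (- (v + l * q) / d) = - (y * v + (y * l) * q) / d" for y v l q d :: complex
        by (cases "d = 0") (simp_all add: field_simps)
      thus ?thesis unfolding H_def .
    qed
    note Hk = this
    have sH: "(\<Sum>k\<in>I. c k * H k) = - (of_real f0 * (1 / \<alpha>) + of_real (\<epsilon> * sigma x) * q) / of_real (R\<^sup>2)"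
      unfolding Hk sum_divide_distrib[symmetric] sum_negf sum.distrib sum_distrib_right[symmetric] sum_c sum_c_affine ..
    define xi where "xi = - Re \<alpha>"
    have xi: "0 \<le> xi" "xi \<le> r" using \<alpha>(3) abs_Re_le_cmod[of \<alpha>] by (auto simp: xi_def r_def)
    have r2: "(Re \<alpha>)\<^sup>2 + (Im \<alpha>)\<^sup>2 = r\<^sup>2" by (simp add: r_def cmod_power2)
    have inv: "1 / \<alpha> = cnj \<alpha> / of_real (r\<^sup>2)"
    proof -
      have "of_real (r\<^sup>2) = \<alpha> * cnj \<alpha>" unfolding r_def by (rule complex_norm_square)
      thus ?thesis using a0 by simp
    qed
    have Re1: "Re (1 / \<alpha>) = - xi / r\<^sup>2" unfolding inv Re_divide_of_real by (simp add: xi_def)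
    have Re_c2: "Re ((cnj \<alpha>)\<^sup>2) = 2 * xi\<^sup>2 - r\<^sup>2"
      using r2 by (simp add: power2_eq_square xi_def)
    have "q = (cnj \<alpha>)\<^sup>2 / of_real (r\<^sup>2 * r\<^sup>2) + (cnj \<alpha>)\<^sup>2 / of_real (r\<^sup>2 * R\<^sup>2)"
    proof -
      have "1 / \<alpha>\<^sup>2 = (1 / \<alpha>)\<^sup>2" by (simp add: power_divide)
      also have "\<dots> = (cnj \<alpha>)\<^sup>2 / of_real (r\<^sup>2 * r\<^sup>2)" unfolding inv by (simp add: power2_eq_square)
      finally have 1: "1 / \<alpha>\<^sup>2 = (cnj \<alpha>)\<^sup>2 / of_real (r\<^sup>2 * r\<^sup>2)" .
      have "cnj \<alpha> / (\<alpha> * of_real (R\<^sup>2)) = cnj \<alpha> * (1 / \<alpha>) / of_real (R\<^sup>2)" by simp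
      also have "\<dots> = (cnj \<alpha>)\<^sup>2 / of_real (r\<^sup>2 * R\<^sup>2)" unfolding inv by (simp add: power2_eq_square)
      finally show ?thesis unfolding q_def 1 by simp
    qed
    hence Req: "Re q = (2 * xi\<^sup>2 - r\<^sup>2) * (1 / (r\<^sup>2 * r\<^sup>2) + 1 / (r\<^sup>2 * R\<^sup>2))"
      by (simp only: plus_complex.sel Re_divide_of_real Re_c2) (simp add: distrib_left)
    define s where "s = sigma x"
    have s: "s0 \<le> s" "s \<le> S1" using sigma_bounds[OF x] by (auto simp: s0_def s_def)
    have ReH: "Re (\<Sum>k\<in>I. c k * H k) = (f0 * xi / r\<^sup>2 - \<epsilon> * s * Re q) / R\<^sup>2"
      unfolding sH Re_divide_of_real uminus_complex.sel plus_complex.sel times_complex.sel Re_complex_of_real Im_complex_of_real Re1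
      by (simp add: s_def)
    have up': "- Re q \<ge> 1 / r\<^sup>2 - 10 * xi / r ^ 3"
    proof -
      have "(1 / (r\<^sup>2 * r\<^sup>2) + 1 / (r\<^sup>2 * R\<^sup>2)) * r\<^sup>2 = 1 / r\<^sup>2 + 1 / R\<^sup>2" using r R0 by (simp add: field_simps)
      moreover have "(1 / (r\<^sup>2 * r\<^sup>2) + 1 / (r\<^sup>2 * R\<^sup>2)) * (2 * xi\<^sup>2) \<le> 10 * xi / r ^ 3"
      proof -
        have "1 / (r\<^sup>2 * R\<^sup>2) \<le> 1 / (r\<^sup>2 * (r\<^sup>2 * (1 / 4)))"
        proof (intro divide_left_mono mult_left_mono)
          have "r\<^sup>2 \<le> 1" using r by (simp add: power_le_one)
          thus "r\<^sup>2 * (1 / 4) \<le> R\<^sup>2" using R2 by linarith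
        qed (use r R0 in auto)
        hence "1 / (r\<^sup>2 * r\<^sup>2) + 1 / (r\<^sup>2 * R\<^sup>2) \<le> 5 / (r\<^sup>2 * r\<^sup>2)" by simp
        hence "(1 / (r\<^sup>2 * r\<^sup>2) + 1 / (r\<^sup>2 * R\<^sup>2)) * (2 * xi\<^sup>2) \<le> (5 / (r\<^sup>2 * r\<^sup>2)) * (2 * (xi * r))"
          using xi by (intro mult_mono) (auto simp: power2_eq_square mult_left_mono)
        also have "\<dots> = 10 * xi / r ^ 3" using r by (simp add: power2_eq_square power3_eq_cube)
        finally show ?thesis .
      qed
      moreover have "1 / R\<^sup>2 \<ge> 0" by simp
      moreover have gen: "- ((2 * y - n) * X) = X * n - X * (2 * y)" for y n X :: real by (simp add: algebra_simps)
      ultimately show ?thesis unfolding Req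
        using gen[of "xi\<^sup>2" "r\<^sup>2" "1 / (r\<^sup>2 * r\<^sup>2) + 1 / (r\<^sup>2 * R\<^sup>2)"] by linarith
    qed
    have "\<epsilon> * s * (1 / r\<^sup>2 - 10 * xi / r ^ 3) \<le> \<epsilon> * s * (- Re q)"
      using e s s0 by (intro mult_left_mono up') auto
    moreover have "\<epsilon> * s * (10 * xi / r ^ 3) \<le> f0 * xi / r\<^sup>2"
    proof -
      have "10 * S1 / f0 * \<epsilon> \<le> r" using M(2) r(3) e mult_right_mono[OF M(2), of \<epsilon>] by linarith
      hence "10 * S1 * \<epsilon> \<le> f0 * r" using f0 by (simp add: field_simps)
      moreover have "10 * \<epsilon> * s \<le> 10 * \<epsilon> * S1" using s e by simp
      ultimately have "10 * \<epsilon> * s \<le> f0 * r" by (simp add: mult_ac)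
      hence "(10 * \<epsilon> * s) * (xi / r ^ 3) \<le> (f0 * r) * (xi / r ^ 3)" using xi r by (intro mult_right_mono) auto
      thus ?thesis using r by (simp add: power2_eq_square power3_eq_cube mult_ac)
    qed
    moreover have "\<epsilon> * s * (1 / r\<^sup>2) \<ge> D * (\<epsilon>\<^sup>2 / r ^ 3)"
    proof -
      have "D / s0 * \<epsilon> \<le> r" using M(3) r(3) e mult_right_mono[OF M(3), of \<epsilon>] by linarith
      hence "D * \<epsilon> \<le> s0 * r" using s0 by (simp add: field_simps)
      also have "\<dots> \<le> s * r" using s r by simp
      finally have "(D * \<epsilon>) * (\<epsilon> / r ^ 3) \<le> (s * r) * (\<epsilon> / r ^ 3)" using e r by (intro mult_right_mono) auto
      thus ?thesis using r by (simp add: power2_eq_square power3_eq_cube mult_ac)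
    qed
    ultimately have main: "f0 * xi / r\<^sup>2 - \<epsilon> * s * Re q \<ge> D * (\<epsilon>\<^sup>2 / r ^ 3)"
      unfolding right_diff_distrib by linarith
    have "D * (\<epsilon>\<^sup>2 / r ^ 3) \<le> (f0 * xi / r\<^sup>2 - \<epsilon> * s * Re q) / R\<^sup>2"
    proof -
      have nn: "0 \<le> D * (\<epsilon>\<^sup>2 / r ^ 3)" using D0 r by simp
      have "D * (\<epsilon>\<^sup>2 / r ^ 3) * R\<^sup>2 \<le> D * (\<epsilon>\<^sup>2 / r ^ 3) * 1" using nn R2 by (intro mult_left_mono) auto
      thus ?thesis using main R0 by (simp only: pos_le_divide_eq mult_1_right)
    qed
    moreover have "\<bar>Re ((\<Sum>k\<in>I. c k * T k) - (\<Sum>k\<in>I. c k * H k))\<bar> \<le> coeff_norm * ((544 * C\<^sup>2 + 20 * C) * (\<epsilon>\<^sup>2 / r ^ 3))"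
      using norm_weighted_sum_le[of T H "(544 * C\<^sup>2 + 20 * C) * (\<epsilon>\<^sup>2 / r ^ 3)"] b abs_Re_le_cmod order_trans by blast
    moreover have "coeff_norm * ((544 * C\<^sup>2 + 20 * C) * (\<epsilon>\<^sup>2 / r ^ 3)) = D * (\<epsilon>\<^sup>2 / r ^ 3)" by (simp add: D_def)
    moreover have "zero_kernel \<epsilon> x R \<alpha> = Re (\<Sum>k\<in>I. c k * T k)" by (simp add: zero_kernel_def T_def)
    ultimately show "zero_kernel \<epsilon> x R \<alpha> \<ge> 0" unfolding ReH[symmetric] by (simp only: minus_complex.sel)
  qed
qed

lemma zero_kernel_near:
  assumes N: "N > 0"
  shows "\<exists>C \<epsilon>0. C > 0 \<and> \<epsilon>0 > 0 \<and> (\<forall>\<epsilon> x R z. 0 < \<epsilon> \<longrightarrow> \<epsilon> < \<epsilon>0 \<longrightarrow> 0 \<le> x \<longrightarrow> x \<le> 1 \<longrightarrow> 1 / 2 \<le> R \<longrightarrow> R \<le> 1 \<longrightarrow>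
     Re z \<ge> 0 \<longrightarrow> norm z \<le> N \<longrightarrow> \<bar>zero_kernel \<epsilon> x R (tan (- of_real \<epsilon> * (z + of_real x))) - Re (F z) / (\<epsilon> * R\<^sup>2)\<bar> \<le> C)"
proof -
  obtain C e0 where C: "C \<ge> 1" "e0 > 0" and up: "\<And>\<epsilon> x k. 0 < \<epsilon> \<Longrightarrow> \<epsilon> < e0 \<Longrightarrow> 0 \<le> x \<Longrightarrow> x \<le> 1 \<Longrightarrow> k \<in> I \<Longrightarrow>
     norm (disc_point \<epsilon> x k - of_real \<epsilon> * (a k - of_real x)) \<le> C * \<epsilon>\<^sup>2 \<and> norm (disc_point \<epsilon> x k) \<le> C * \<epsilon>"
    using disc_point_approx by blast
  obtain B where B: "B > 0" "\<And>z :: complex. norm z \<le> 1 \<Longrightarrow> norm (tan z - z) \<le> B * (norm z)\<^sup>2"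
    using tan_approx by blast
  define A where "A = N + 1"
  have A: "A > 1" using N by (simp add: A_def)
  define G where "G = C + B * A\<^sup>2 + A"
  have "B * A\<^sup>2 > 0" using A B by simp
  hence G: "G \<ge> 1" "G \<ge> C" "G \<ge> C + B * A\<^sup>2" "G \<ge> B * A\<^sup>2 + A" using C A unfolding G_def by linarith+
  define D where "D = coeff_norm * (8 * G + 128 * G\<^sup>2) + 1"
  have D: "D > 0" using coeff_norm_nonneg G by (simp add: D_def add_nonneg_pos)
  define e1 where "e1 = Min {e0, 1, 1 / A, 1 / (4 * G)}"
  show ?thesis
  proof (rule exI[of _ D], rule exI[of _ e1], intro conjI allI impI D)
    show "e1 > 0" using C A G by (simp add: e1_def)
    fix \<epsilon> x R :: real and z :: complex
    assume e: "0 < \<epsilon>" "\<epsilon> < e1" and x: "0 \<le> x" "x \<le> 1" and R: "1 / 2 \<le> R" "R \<le> 1"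
      and z: "Re z \<ge> 0" "norm z \<le> N"
    have ee: "\<epsilon> < e0" "\<epsilon> < 1" "\<epsilon> < 1 / A" "\<epsilon> < 1 / (4 * G)" using e by (auto simp: e1_def)
    have eA: "\<epsilon> * A \<le> 1" using ee A by (simp add: field_simps)
    have eG: "G * \<epsilon> \<le> 1 / 4" using ee G by (simp add: field_simps)
    define \<zeta> where "\<zeta> = - of_real \<epsilon> * (z + of_real x)"
    define \<alpha> where "\<alpha> = tan \<zeta>"
    have "norm (z + of_real x) \<le> A" using norm_triangle_ineq[of z "of_real x"] z x by (simp add: A_def)
    hence zn: "norm \<zeta> \<le> \<epsilon> * A" using e by (simp add: \<zeta>_def norm_mult)
    hence "norm (\<alpha> - \<zeta>) \<le> B * (norm \<zeta>)\<^sup>2" unfolding \<alpha>_def using eA by (intro B(2)) simp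
    also have "\<dots> \<le> B * (\<epsilon> * A)\<^sup>2" using zn B by (intro mult_left_mono power_mono) auto
    finally have az: "norm (\<alpha> - \<zeta>) \<le> B * A\<^sup>2 * \<epsilon>\<^sup>2" by (simp add: power_mult_distrib mult_ac)
    have e2: "\<epsilon>\<^sup>2 \<le> \<epsilon>" using e ee by (simp add: power2_eq_square)
    have an: "norm \<alpha> \<le> G * \<epsilon>"
    proof -
      have "norm \<alpha> \<le> norm (\<alpha> - \<zeta>) + norm \<zeta>" using norm_triangle_ineq[of "\<alpha> - \<zeta>" \<zeta>] by simp
      also have "\<dots> \<le> B * A\<^sup>2 * \<epsilon>\<^sup>2 + \<epsilon> * A" using az zn by linarith
      also have "\<dots> \<le> B * A\<^sup>2 * \<epsilon> + \<epsilon> * A" using B e2 e A by (intro add_mono mult_left_mono) auto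
      also have "\<dots> = (B * A\<^sup>2 + A) * \<epsilon>" by (simp add: algebra_simps)
      also have "\<dots> \<le> G * \<epsilon>" using G e by (intro mult_right_mono) auto
      finally show ?thesis .
    qed
    have R2: "R\<^sup>2 \<ge> 1 / 4" "R\<^sup>2 \<le> 1" using power_mono[of "1/2" R 2] R by (auto simp: power2_eq_square mult_le_one)
    define T where "T = (\<lambda>k. (1 + (disc_point \<epsilon> x k)\<^sup>2) / ((disc_point \<epsilon> x k - \<alpha>) * (of_real (R\<^sup>2) - cnj \<alpha> * disc_point \<epsilon> x k)))"
    define H where "H = (\<lambda>k. 1 / (of_real \<epsilon> * (z + a k)) * (1 / of_real (R\<^sup>2)))"
    have b: "norm (T k - H k) \<le> 8 * G + 128 * G\<^sup>2" if k: "k \<in> I" for k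
    proof -
      let ?u = "disc_point \<epsilon> x k"
      define d where "d = ?u - \<alpha>"
      define m where "m = of_real \<epsilon> * (z + a k)"
      define v where "v = (1 + ?u\<^sup>2) / (of_real (R\<^sup>2) - cnj \<alpha> * ?u)"
      define w where "w = 1 / (of_real (R\<^sup>2) :: complex)"
      have u: "norm (?u - of_real \<epsilon> * (a k - of_real x)) \<le> C * \<epsilon>\<^sup>2" "norm ?u \<le> C * \<epsilon>"
        using up[of \<epsilon> x k] e ee x k by auto
      have uG: "norm ?u \<le> G * \<epsilon>" using u(2) G(2) e mult_right_mono[OF G(2), of \<epsilon>] by linarith
      have "d - m = (?u - of_real \<epsilon> * (a k - of_real x)) - (\<alpha> - \<zeta>)" by (simp add: d_def m_def \<zeta>_def algebra_simps)
      hence "norm (d - m) \<le> C * \<epsilon>\<^sup>2 + B * A\<^sup>2 * \<epsilon>\<^sup>2"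
        using norm_triangle_ineq4[of "?u - of_real \<epsilon> * (a k - of_real x)" "\<alpha> - \<zeta>"] u(1) az by simp
      also have "\<dots> = (C + B * A\<^sup>2) * \<epsilon>\<^sup>2" by (simp add: algebra_simps)
      also have "\<dots> \<le> G * \<epsilon>\<^sup>2" using G by (intro mult_right_mono) auto
      finally have dm: "norm (d - m) \<le> G * \<epsilon>\<^sup>2" .
      have "norm (z + a k) \<ge> 1" using complex_Re_le_cmod[of "z + a k"] z a_gt[OF k] by simp
      hence mn: "norm m \<ge> \<epsilon>" using e by (simp add: m_def norm_mult)
      have "G * \<epsilon>\<^sup>2 \<le> \<epsilon> / 2" using eG e mult_right_mono[OF eG, of \<epsilon>] by (simp add: power2_eq_square)
      hence dn: "norm d \<ge> \<epsilon> / 2" using dm mn norm_triangle_ineq2[of m "m - d"] by (simp add: norm_minus_commute)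
      have nz: "d \<noteq> 0" "m \<noteq> 0" using dn mn e by auto
      have "1 / d - 1 / m = (m - d) / (d * m)" using nz by (simp add: field_simps)
      hence "norm (1 / d - 1 / m) = norm (d - m) / (norm d * norm m)" by (simp add: norm_divide norm_mult norm_minus_commute)
      also have "\<dots> \<le> (G * \<epsilon>\<^sup>2) / (\<epsilon> / 2 * \<epsilon>)" using dm dn mn e G by (intro frac_le mult_mono) auto
      also have "\<dots> = 2 * G" using e by (simp add: power2_eq_square)
      finally have 1: "norm (1 / d - 1 / m) \<le> 2 * G" .
      have "norm (cnj \<alpha> * ?u) \<le> (G * \<epsilon>) * (G * \<epsilon>)" unfolding norm_mult using an uG G e by (intro mult_mono) auto
      also have "\<dots> \<le> (1 / 4) * (1 / 4)" using eG G e by (intro mult_mono) auto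
      finally have "norm (of_real (R\<^sup>2) - cnj \<alpha> * ?u) \<ge> 1 / 8"
        using norm_triangle_ineq2[of "of_real (R\<^sup>2)" "cnj \<alpha> * ?u"] R2 by (simp add: norm_power)
      hence den: "norm (of_real (R\<^sup>2) - cnj \<alpha> * ?u) \<ge> 1 / 8" .
      hence dnz: "of_real (R\<^sup>2) - cnj \<alpha> * ?u \<noteq> 0" by auto
      have Rnz: "of_real (R\<^sup>2) \<noteq> (0 :: complex)" using R by simp
      have "v - w = (of_real (R\<^sup>2) * ?u\<^sup>2 + cnj \<alpha> * ?u) / (of_real (R\<^sup>2) * (of_real (R\<^sup>2) - cnj \<alpha> * ?u))"
        unfolding v_def w_def using dnz Rnz by (simp add: diff_frac_eq algebra_simps del: of_real_power)
      hence "norm (v - w) = norm (of_real (R\<^sup>2) * ?u\<^sup>2 + cnj \<alpha> * ?u) / (R\<^sup>2 * norm (of_real (R\<^sup>2) - cnj \<alpha> * ?u))"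
        by (simp add: norm_divide norm_mult norm_power)
      also have "\<dots> \<le> (2 * G\<^sup>2 * \<epsilon>\<^sup>2) / (1 / 4 * (1 / 8))"
      proof (intro frac_le mult_mono)
        have "norm (of_real (R\<^sup>2) * ?u\<^sup>2 + cnj \<alpha> * ?u) \<le> R\<^sup>2 * (norm ?u)\<^sup>2 + norm \<alpha> * norm ?u"
          using norm_triangle_ineq[of "of_real (R\<^sup>2) * ?u\<^sup>2" "cnj \<alpha> * ?u"] by (simp add: norm_mult norm_power)
        also have "\<dots> \<le> 1 * (G * \<epsilon>)\<^sup>2 + (G * \<epsilon>) * (G * \<epsilon>)"
          using R2 uG an G e by (intro add_mono mult_mono power_mono) auto
        finally show "norm (of_real (R\<^sup>2) * ?u\<^sup>2 + cnj \<alpha> * ?u) \<le> 2 * G\<^sup>2 * \<epsilon>\<^sup>2" by (simp add: power2_eq_square mult_ac)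
      qed (use R2 den in auto)
      finally have 2: "norm (v - w) \<le> 64 * G\<^sup>2 * \<epsilon>\<^sup>2" by simp
      have "T k - H k = 1 / d * (v - w) + (1 / d - 1 / m) * w"
      proof -
        have "T k = 1 / d * v" by (simp add: T_def d_def v_def)
        moreover have "H k = 1 / m * w" by (simp add: H_def m_def w_def)
        moreover have "x * v - y * w = x * (v - w) + (x - y) * w" for x y :: complex by (simp add: algebra_simps)
        ultimately show ?thesis by (simp only:)
      qed
      hence "norm (T k - H k) \<le> norm (1 / d) * norm (v - w) + norm (1 / d - 1 / m) * norm w"
        by (metis norm_mult norm_triangle_ineq)
      also have "norm (1 / d) * norm (v - w) \<le> (2 / \<epsilon>) * (64 * G\<^sup>2 * \<epsilon>\<^sup>2)"
      proof (intro mult_mono 2)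
        show "norm (1 / d) \<le> 2 / \<epsilon>" using dn e frac_le[of 1 1 "\<epsilon> / 2" "norm d"] by (simp add: norm_divide)
      qed (use e in auto)
      also have "(2 / \<epsilon>) * (64 * G\<^sup>2 * \<epsilon>\<^sup>2) = 128 * G\<^sup>2 * \<epsilon>" using e by (simp add: power2_eq_square)
      also have "\<dots> \<le> 128 * G\<^sup>2 * 1" using ee by (intro mult_left_mono) auto
      also have "norm (1 / d - 1 / m) * norm w \<le> (2 * G) * 4"
      proof (intro mult_mono 1)
        show "norm w \<le> 4" using R2 frac_le[of 1 1 "1 / 4" "R\<^sup>2"] by (simp add: w_def norm_divide norm_power)
      qed (use G in auto)
      finally show ?thesis by simp
    qed
    have "c k * H k = (c k / (z + a k)) * (1 / of_real (\<epsilon> * R\<^sup>2))" for k unfolding H_def by simp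
    note Hk = this
    have sH: "(\<Sum>k\<in>I. c k * H k) = F z / of_real (\<epsilon> * R\<^sup>2)"
      unfolding Hk sum_distrib_right[symmetric] F_def[symmetric] by simp
    have "\<bar>Re ((\<Sum>k\<in>I. c k * T k) - (\<Sum>k\<in>I. c k * H k))\<bar> \<le> coeff_norm * (8 * G + 128 * G\<^sup>2)"
      using norm_weighted_sum_le[of T H "8 * G + 128 * G\<^sup>2"] b abs_Re_le_cmod order_trans by blast
    moreover have "zero_kernel \<epsilon> x R \<alpha> = Re (\<Sum>k\<in>I. c k * T k)" by (simp add: zero_kernel_def T_def)
    ultimately show "\<bar>zero_kernel \<epsilon> x R (tan (- of_real \<epsilon> * (z + of_real x))) - Re (F z) / (\<epsilon> * R\<^sup>2)\<bar> \<le> D"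
      unfolding sH minus_complex.sel Re_divide_of_real \<alpha>_def[unfolded \<zeta>_def, symmetric] by (simp add: D_def)
  qed
qed

lemma F_lower_bound: "\<exists>m>0. \<forall>z. Re z \<ge> 0 \<longrightarrow> norm z \<le> N \<longrightarrow> Re (F z) \<ge> m"
proof (cases "N \<ge> 0")
  case True
  define S where "S = {z :: complex. Re z \<ge> 0} \<inter> cball 0 N"
  have "compact S" unfolding S_def by (intro closed_Int_compact closed_halfspace_Re_ge compact_cball)
  moreover have "0 \<in> S" using True by (simp add: S_def)
  moreover have "z + a k \<noteq> 0" if "z \<in> S" "k \<in> I" for z k
    using a_gt[OF that(2)] that(1) by (auto simp: S_def complex_eq_iff)
  hence "continuous_on S (\<lambda>z. Re (F z))" unfolding F_def by (intro continuous_intros) auto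
  ultimately obtain z0 where z0: "z0 \<in> S" "\<And>z. z \<in> S \<Longrightarrow> Re (F z0) \<le> Re (F z)"
    using continuous_attains_inf[of S "\<lambda>z. Re (F z)"] by blast
  have "Re (F z0) > 0" using F_pos[of z0] z0(1) by (simp add: S_def F_def)
  thus ?thesis using z0(2) by (intro exI[of _ "Re (F z0)"]) (auto simp: S_def)
next
  case False
  thus ?thesis by (intro exI[of _ 1]) (auto dest: order_trans[OF norm_ge_zero])
qed

lemma zero_kernel_nonneg:
  "\<exists>\<epsilon>0>0. \<forall>\<epsilon> x R \<alpha>. 0 < \<epsilon> \<longrightarrow> \<epsilon> < \<epsilon>0 \<longrightarrow> 0 \<le> x \<longrightarrow> x \<le> 1 \<longrightarrow> 1 / 2 \<le> R \<longrightarrow> R \<le> 1 \<longrightarrow>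
     norm \<alpha> < 1 \<longrightarrow> Re (Arctan \<alpha>) \<le> - (\<epsilon> * x) \<longrightarrow> zero_kernel \<epsilon> x R \<alpha> \<ge> 0"
proof -
  obtain M e1 where M: "M > 0" "e1 > 0" and far: "\<And>\<epsilon> x R \<alpha>. 0 < \<epsilon> \<Longrightarrow> \<epsilon> < e1 \<Longrightarrow> 0 \<le> x \<Longrightarrow> x \<le> 1 \<Longrightarrow> 1 / 2 \<le> R \<Longrightarrow> R \<le> 1 \<Longrightarrow>
     M * \<epsilon> \<le> norm \<alpha> \<Longrightarrow> norm \<alpha> \<le> 1 \<Longrightarrow> Re \<alpha> \<le> 0 \<Longrightarrow> zero_kernel \<epsilon> x R \<alpha> \<ge> 0"
    using zero_kernel_far by blast
  \<comment> \<open>A zero with |\<alpha>| < M \<epsilon> has |Arctan \<alpha>| <= 2 M \<epsilon>,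
    so its rescaled position \<open>z\<close> has modulus at most 2 M + 1.\<close>
  define N where "N = 2 * M + 1"
  have N: "N > 0" using M by (simp add: N_def)
  obtain C e2 where C: "C > 0" "e2 > 0" and near: "\<And>\<epsilon> x R z. 0 < \<epsilon> \<Longrightarrow> \<epsilon> < e2 \<Longrightarrow> 0 \<le> x \<Longrightarrow> x \<le> 1 \<Longrightarrow> 1 / 2 \<le> R \<Longrightarrow> R \<le> 1 \<Longrightarrow>
     Re z \<ge> 0 \<Longrightarrow> norm z \<le> N \<Longrightarrow> \<bar>zero_kernel \<epsilon> x R (tan (- of_real \<epsilon> * (z + of_real x))) - Re (F z) / (\<epsilon> * R\<^sup>2)\<bar> \<le> C"
    using zero_kernel_near[OF N] by blast
  obtain m where m: "m > 0" "\<And>z. Re z \<ge> 0 \<Longrightarrow> norm z \<le> N \<Longrightarrow> Re (F z) \<ge> m" using F_lower_bound by blast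
  \<comment> \<open>For \<epsilon> < m / C the main term Re (F z) / (\<epsilon> R^2) exceeds the
    bounded error \<open>C\<close>.\<close>
  define e3 where "e3 = Min {e1, e2, 1 / (2 * M), m / C}"
  show ?thesis
  proof (rule exI[of _ e3], intro conjI allI impI)
    show "e3 > 0" using M C m by (simp add: e3_def)
    fix \<epsilon> x R :: real and \<alpha> :: complex
    assume e: "0 < \<epsilon>" "\<epsilon> < e3" and x: "0 \<le> x" "x \<le> 1" and R: "1 / 2 \<le> R" "R \<le> 1"
      and \<alpha>: "norm \<alpha> < 1" "Re (Arctan \<alpha>) \<le> - (\<epsilon> * x)"
    have ee: "\<epsilon> < e1" "\<epsilon> < e2" "\<epsilon> < 1 / (2 * M)" "\<epsilon> < m / C" using e by (auto simp: e3_def)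
    have "\<epsilon> * x \<ge> 0" using e x by simp
    show "zero_kernel \<epsilon> x R \<alpha> \<ge> 0"
    proof (cases "M * \<epsilon> \<le> norm \<alpha>")
      case True
      have "Re \<alpha> \<le> 0" using Re_Arctan_ge[OF \<alpha>(1)] \<alpha>(2) \<open>\<epsilon> * x \<ge> 0\<close> by linarith
      thus ?thesis using far[OF e(1) ee(1) x R True] \<alpha> by simp
    next
      case False
      define z where "z = - Arctan \<alpha> / of_real \<epsilon> - of_real x"
      have "M * \<epsilon> \<le> 1 / 2" using ee M by (simp add: field_simps)
      hence "norm \<alpha> \<le> 1 / 2" using False by simp
      hence "norm (Arctan \<alpha>) \<le> 2 * (M * \<epsilon>)" using norm_Arctan_le[of \<alpha>] False by simp
      hence "norm (Arctan \<alpha> / of_real \<epsilon>) \<le> 2 * M" using e by (simp add: norm_divide field_simps)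
      hence zN: "norm z \<le> N" using norm_triangle_ineq4[of "- Arctan \<alpha> / of_real \<epsilon>" "of_real x"] x
        by (simp add: z_def N_def norm_divide)
      have "\<epsilon> * Re z = - Re (Arctan \<alpha>) - \<epsilon> * x" using e by (simp add: z_def field_simps)
      hence "\<epsilon> * Re z \<ge> 0" using \<alpha>(2) by simp
      hence zR: "Re z \<ge> 0" using e by (simp add: zero_le_mult_iff)
      have "- of_real \<epsilon> * (z + of_real x) = Arctan \<alpha>" using e by (simp add: z_def)
      moreover have "tan (Arctan \<alpha>) = \<alpha>"
      proof (rule tan_Arctan)
        have "norm (\<alpha>\<^sup>2) < 1" using \<alpha>(1) by (simp add: norm_power power_less_one_iff)
        thus "\<alpha>\<^sup>2 \<noteq> -1" by auto
      qed
      ultimately have "zero_kernel \<epsilon> x R \<alpha> \<ge> Re (F z) / (\<epsilon> * R\<^sup>2) - C"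
        using near[OF e(1) ee(2) x R zR zN] by simp
      moreover have "Re (F z) / (\<epsilon> * R\<^sup>2) \<ge> C"
      proof -
        have "R\<^sup>2 \<le> 1" using R by (simp add: power_le_one)
        hence "C * (\<epsilon> * R\<^sup>2) \<le> C * \<epsilon> * 1" using C e by simp
        also have "\<dots> \<le> m" using ee C by (simp add: field_simps)
        also have "m \<le> Re (F z)" by (rule m(2)[OF zR zN])
        finally show ?thesis using e R by (simp add: pos_le_divide_eq)
      qed
      ultimately show ?thesis by simp
    qed
  qed
qed

end

section \<open>The smoothed Poisson--Jensen inequality for one function\<close>

context smoothing
begin

lemma F_le_coeff_norm: "Re z \<ge> 0 \<Longrightarrow> Re (F z) \<le> coeff_norm"
proof -
  assume z: "Re z \<ge> 0"
  have "Re (F z) \<le> norm (F z)" by (rule complex_Re_le_cmod)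
  also have "\<dots> \<le> coeff_norm" unfolding F_def coeff_norm_def
  proof (intro sum_norm_le)
    fix k assume k: "k \<in> I"
    have "norm (z + a k) \<ge> 1" using complex_Re_le_cmod[of "z + a k"] z a_gt[OF k] by simp
    hence "norm (c k) / norm (z + a k) \<le> norm (c k) / 1" by (intro divide_left_mono) auto
    thus "norm (c k / (z + a k)) \<le> norm (c k)" by (simp add: norm_divide)
  qed
  finally show ?thesis .
qed

text \<open>\<open>g\<close> stands for zeta composed with the map of the disc onto a strip at one
  height. The integral over the right arc is left unevaluated, because a good estimate exists only
  for the combination over all heights. \<open>Zs\<close> is the total contribution of the zeros:
  non-negative at each height, and at least F z0 / \<epsilon> up to a constant if a zero sits at the
  prescribed real point.\<close>

lemma local_bound:
  "\<exists>C \<epsilon>0. C > 0 \<and> \<epsilon>0 > 0 \<and> (\<forall>\<epsilon> x R r g U. 0 < \<epsilon> \<longrightarrow> \<epsilon> < \<epsilon>0 \<longrightarrow> 0 \<le> x \<longrightarrow> x \<le> 1 \<longrightarrow> 1 / 2 \<le> R \<longrightarrow> R < 1 \<longrightarrow> R < r \<longrightarrow>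
     g holomorphic_on ball 0 r \<longrightarrow> (\<forall>w. norm w = R \<longrightarrow> g w \<noteq> 0) \<longrightarrow>
     (\<forall>\<alpha>. norm \<alpha> < R \<longrightarrow> g \<alpha> = 0 \<longrightarrow> Re (Arctan \<alpha>) \<le> - (\<epsilon> * x)) \<longrightarrow>
     0 \<le> U \<longrightarrow> (\<forall>w. norm w = R \<longrightarrow> Re w \<le> 0 \<longrightarrow> norm (g w) \<le> exp U) \<longrightarrow>
     (\<lambda>t. ln (norm (g (R * cis t))) * K \<epsilon> x R t) integrable_on {- pi / 2..pi / 2} \<and>
     (\<exists>Zs. Zs \<ge> 0 \<and> (\<forall>z0. 0 \<le> z0 \<longrightarrow> z0 \<le> 1 \<longrightarrow> g (tan (- of_real (\<epsilon> * (z0 + x)))) = 0 \<longrightarrow> Zs \<ge> Re (F (of_real z0)) / \<epsilon> - C) \<and>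
     Re (\<Sum>k\<in>I. c k * ((1 + (disc_point \<epsilon> x k)\<^sup>2) * - (deriv g (disc_point \<epsilon> x k) / g (disc_point \<epsilon> x k)))) \<le>
       (U * (2 * f0 / R + C * \<epsilon>) - integral {- pi / 2..pi / 2} (\<lambda>t. ln (norm (g (R * cis t))) * K \<epsilon> x R t)) / pi - Zs))"
proof -
  obtain C1 e1 where C1: "C1 \<ge> 1" "e1 > 0" and up: "\<And>\<epsilon> x k. 0 < \<epsilon> \<Longrightarrow> \<epsilon> < e1 \<Longrightarrow> 0 \<le> x \<Longrightarrow> x \<le> 1 \<Longrightarrow> k \<in> I \<Longrightarrow>
     norm (disc_point \<epsilon> x k) \<le> C1 * \<epsilon> \<and> norm (of_real \<epsilon> * (a k - of_real x)) \<le> 1"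
    using disc_point_approx by blast
  obtain C2 e2 where C2: "C2 > 0" "e2 > 0" and KB: "\<And>\<epsilon> x R t. 0 < \<epsilon> \<Longrightarrow> \<epsilon> < e2 \<Longrightarrow> 0 \<le> x \<Longrightarrow> x \<le> 1 \<Longrightarrow> 1 / 2 \<le> R \<Longrightarrow> R \<le> 1 \<Longrightarrow>
     \<bar>K \<epsilon> x R t - f0 * cos t / R\<bar> \<le> C2 * \<epsilon> \<and> (cos t \<le> 0 \<longrightarrow> K \<epsilon> x R t \<le> 0)"
    using K_bounds by blast
  obtain e3 where e3: "e3 > 0" and zn: "\<And>\<epsilon> x R \<alpha>. 0 < \<epsilon> \<Longrightarrow> \<epsilon> < e3 \<Longrightarrow> 0 \<le> x \<Longrightarrow> x \<le> 1 \<Longrightarrow> 1 / 2 \<le> R \<Longrightarrow> R \<le> 1 \<Longrightarrow>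
     norm \<alpha> < 1 \<Longrightarrow> Re (Arctan \<alpha>) \<le> - (\<epsilon> * x) \<Longrightarrow> zero_kernel \<epsilon> x R \<alpha> \<ge> 0"
    using zero_kernel_nonneg by blast
  obtain C4 e4 where C4: "C4 > 0" "e4 > 0" and near: "\<And>\<epsilon> x R z. 0 < \<epsilon> \<Longrightarrow> \<epsilon> < e4 \<Longrightarrow> 0 \<le> x \<Longrightarrow> x \<le> 1 \<Longrightarrow> 1 / 2 \<le> R \<Longrightarrow> R \<le> 1 \<Longrightarrow>
     Re z \<ge> 0 \<Longrightarrow> norm z \<le> 1 \<Longrightarrow> \<bar>zero_kernel \<epsilon> x R (tan (- of_real \<epsilon> * (z + of_real x))) - Re (F z) / (\<epsilon> * R\<^sup>2)\<bar> \<le> C4"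
    using zero_kernel_near[of 1] by auto
  obtain B where B: "B > 0" "\<And>z :: complex. norm z \<le> 1 \<Longrightarrow> norm (tan z - z) \<le> B * (norm z)\<^sup>2"
    using tan_approx by blast
  define G where "G = 2 + 4 * B"
  have G: "G > 2" using B by (simp add: G_def)
  define C where "C = pi * C2 + C4 + 4 * G\<^sup>2 * coeff_norm + 1"
  have Cg: "C \<ge> pi * C2" "C \<ge> C4 + 4 * G\<^sup>2 * coeff_norm" "C > 0"
    using C2 C4 coeff_norm_nonneg by (auto simp: C_def intro!: add_pos_nonneg add_nonneg_nonneg)
  define e0 where "e0 = Min {e1, e2, e3, e4, 1 / (2 * C1), 1 / (2 * G), 1}"
  show ?thesis
  proof (rule exI[of _ C], rule exI[of _ e0], intro conjI[of "C > 0"] conjI[of "e0 > 0"] allI impI)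
    show "C > 0" "e0 > 0" using Cg C1 C2 e3 C4 G by (auto simp: e0_def)
    fix \<epsilon> x R r U :: real and g :: "complex \<Rightarrow> complex"
    assume e: "0 < \<epsilon>" "\<epsilon> < e0" and x: "0 \<le> x" "x \<le> 1" and R: "1 / 2 \<le> R" "R < 1" "R < r"
      and g: "g holomorphic_on ball 0 r" and nz: "\<forall>w. norm w = R \<longrightarrow> g w \<noteq> 0"
      and zer: "\<forall>\<alpha>. norm \<alpha> < R \<longrightarrow> g \<alpha> = 0 \<longrightarrow> Re (Arctan \<alpha>) \<le> - (\<epsilon> * x)"
      and U: "0 \<le> U" "\<forall>w. norm w = R \<longrightarrow> Re w \<le> 0 \<longrightarrow> norm (g w) \<le> exp U"
    have em: "e0 \<le> y" if "y \<in> {e1, e2, e3, e4, 1 / (2 * C1), 1 / (2 * G), 1}" for y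
      unfolding e0_def by (rule Min_le[OF _ that]) simp
    have ee: "\<epsilon> < e1" "\<epsilon> < e2" "\<epsilon> < e3" "\<epsilon> < e4" "\<epsilon> < 1 / (2 * C1)" "\<epsilon> < 1 / (2 * G)" "\<epsilon> < 1"
      by (rule less_le_trans[OF e(2)], rule em, simp)+
    have R1: "R \<le> 1" "R > 0" using R by auto
    have R2: "R\<^sup>2 \<ge> 1 / 4" "R\<^sup>2 \<le> 1" using power_mono[of "1/2" R 2] R by (auto simp: power2_eq_square mult_le_one)
    define Z where "Z = {\<alpha> \<in> ball 0 R. g \<alpha> = 0}"
    have finZ: "finite Z" unfolding Z_def by (rule poisson_jensen_derivative(1)[OF g R1(2) R(3)]) (use nz in auto)
    have nz': "\<And>w. norm w = R \<Longrightarrow> g w \<noteq> 0" using nz by blast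
    have PJex: "\<exists>n. (\<forall>\<alpha>\<in>Z. n \<alpha> > (0 :: nat)) \<and> (\<forall>u. norm u < R \<longrightarrow> g u \<noteq> 0 \<longrightarrow>
     ((\<lambda>t. 2 * of_real (ln (norm (g (R * cis t)))) * (R * cis t) / (R * cis t - u)\<^sup>2) has_integral
       2 * pi * (deriv g u / g u - (\<Sum>\<alpha>\<in>Z. of_nat (n \<alpha>) *
           (of_real (R\<^sup>2 - (norm \<alpha>)\<^sup>2) / ((u - \<alpha>) * (of_real (R\<^sup>2) - cnj \<alpha> * u))))))
       {- pi / 2..3 * pi / 2})"
      unfolding Z_def by (rule poisson_jensen_derivative(2)[OF g R1(2) R(3) nz'])
    obtain n where n: "\<forall>\<alpha>\<in>Z. n \<alpha> > (0 :: nat)" and PJ': "\<forall>u. norm u < R \<longrightarrow> g u \<noteq> 0 \<longrightarrow>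
     ((\<lambda>t. 2 * of_real (ln (norm (g (R * cis t)))) * (R * cis t) / (R * cis t - u)\<^sup>2) has_integral
       2 * pi * (deriv g u / g u - (\<Sum>\<alpha>\<in>Z. of_nat (n \<alpha>) *
           (of_real (R\<^sup>2 - (norm \<alpha>)\<^sup>2) / ((u - \<alpha>) * (of_real (R\<^sup>2) - cnj \<alpha> * u))))))
       {- pi / 2..3 * pi / 2}"
      by (rule exE[OF PJex]) (elim conjE, rule that, assumption+)
    note PJ = PJ'[rule_format]
    define u where "u = disc_point \<epsilon> x"
    have un: "norm (u k) < R" "g (u k) \<noteq> 0" if k: "k \<in> I" for k
    proof -
      have "C1 * \<epsilon> < 1 / 2" using ee C1 by (simp add: field_simps)
      thus un: "norm (u k) < R" using up[OF e(1) ee(1) x k] R by (simp add: u_def)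
      \<comment> \<open>In the coordinate \<open>Arctan\<close> the sample points have positive real
        part, the zeros non-positive real part.\<close>
      define z where "z = of_real \<epsilon> * (a k - of_real x)"
      have Rz: "Re z > 0" using e a_gt[OF k] x by (simp add: z_def)
      have "norm z \<le> 1" using up[OF e(1) ee(1) x k] by (simp add: z_def)
      hence "\<bar>Re z\<bar> < pi / 2" using abs_Re_le_cmod[of z] pi_gt3 by linarith
      hence "Arctan (u k) = z" unfolding u_def disc_point_def z_def[symmetric] by (rule Arctan_tan)
      moreover have "\<epsilon> * x \<ge> 0" using e x by simp
      ultimately show "g (u k) \<noteq> 0" using zer un Rz by force
    qed
    define lg where "lg = (\<lambda>t. ln (norm (g (R * cis t))))"
    define T where "T = (\<lambda>\<alpha> k. (1 + (u k)\<^sup>2) / ((u k - \<alpha>) * (of_real (R\<^sup>2) - cnj \<alpha> * u k)))"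
    define LD where "LD = (\<Sum>k\<in>I. c k * ((1 + (u k)\<^sup>2) * (deriv g (u k) / g (u k))))"
    define ZZ where "ZZ = (\<Sum>\<alpha>\<in>Z. real (n \<alpha>) * (R\<^sup>2 - (norm \<alpha>)\<^sup>2) * zero_kernel \<epsilon> x R \<alpha>)"
    have int: "((\<lambda>t. lg t * K \<epsilon> x R t) has_integral pi * (Re LD - ZZ)) {- pi / 2..3 * pi / 2}"
    proof -
      have "((\<lambda>t. \<Sum>k\<in>I. (c k * (1 + (u k)\<^sup>2) / 2) * (2 * of_real (lg t) * (R * cis t) / (R * cis t - u k)\<^sup>2)) has_integral
         (\<Sum>k\<in>I. (c k * (1 + (u k)\<^sup>2) / 2) * (2 * pi * (deriv g (u k) / g (u k) - (\<Sum>\<alpha>\<in>Z. of_nat (n \<alpha>) *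
           (of_real (R\<^sup>2 - (norm \<alpha>)\<^sup>2) / ((u k - \<alpha>) * (of_real (R\<^sup>2) - cnj \<alpha> * u k)))))))) {- pi / 2..3 * pi / 2}"
        unfolding lg_def by (intro has_integral_sum fin has_integral_mult_right PJ un)
      also have "(\<lambda>t. \<Sum>k\<in>I. (c k * (1 + (u k)\<^sup>2) / 2) * (2 * of_real (lg t) * (R * cis t) / (R * cis t - u k)\<^sup>2)) =
         (\<lambda>t. of_real (lg t) * (\<Sum>k\<in>I. c k * ((1 + (u k)\<^sup>2) * (R * cis t) / (R * cis t - u k)\<^sup>2)))"
        by (simp add: sum_distrib_left mult_ac)
      also have "(\<Sum>k\<in>I. (c k * (1 + (u k)\<^sup>2) / 2) * (2 * pi * (deriv g (u k) / g (u k) - (\<Sum>\<alpha>\<in>Z. of_nat (n \<alpha>) *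
           (of_real (R\<^sup>2 - (norm \<alpha>)\<^sup>2) / ((u k - \<alpha>) * (of_real (R\<^sup>2) - cnj \<alpha> * u k))))))) =
         of_real pi * (LD - (\<Sum>k\<in>I. \<Sum>\<alpha>\<in>Z. of_real (real (n \<alpha>) * (R\<^sup>2 - (norm \<alpha>)\<^sup>2)) * (c k * T \<alpha> k)))"
        unfolding LD_def sum_subtractf[symmetric] sum_distrib_left[of "of_real pi"]
      proof (rule sum.cong[OF refl])
        fix k
        have eqs: "(\<Sum>\<alpha>\<in>Z. of_real (real (n \<alpha>) * (R\<^sup>2 - (norm \<alpha>)\<^sup>2)) * (c k * T \<alpha> k)) =
           c k * (1 + (u k)\<^sup>2) * (\<Sum>\<alpha>\<in>Z. of_nat (n \<alpha>) * (of_real (R\<^sup>2 - (norm \<alpha>)\<^sup>2) / ((u k - \<alpha>) * (of_real (R\<^sup>2) - cnj \<alpha> * u k))))"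
          unfolding sum_distrib_left
        proof (rule sum.cong[OF refl])
          fix \<alpha>
          have gen: "of_real (real m * y) * (v * (q / d)) = v * q * (of_nat m * (of_real y / d))" for m y and v q d :: complex
            by simp
          show "of_real (real (n \<alpha>) * (R\<^sup>2 - (norm \<alpha>)\<^sup>2)) * (c k * T \<alpha> k) = c k * (1 + (u k)\<^sup>2) * (of_nat (n \<alpha>) *
              (of_real (R\<^sup>2 - (norm \<alpha>)\<^sup>2) / ((u k - \<alpha>) * (of_real (R\<^sup>2) - cnj \<alpha> * u k))))"
            unfolding T_def by (rule gen)
        qed
        have gen: "(v * q / 2) * (of_real (2 * p) * (l - s)) = of_real p * (v * (q * l) - v * q * s)" for v q l s :: complex and p :: real
          by (simp add: algebra_simps)
        show "(c k * (1 + (u k)\<^sup>2) / 2) * (2 * pi * (deriv g (u k) / g (u k) - (\<Sum>\<alpha>\<in>Z. of_nat (n \<alpha>) *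
           (of_real (R\<^sup>2 - (norm \<alpha>)\<^sup>2) / ((u k - \<alpha>) * (of_real (R\<^sup>2) - cnj \<alpha> * u k)))))) =
           of_real pi * (c k * ((1 + (u k)\<^sup>2) * (deriv g (u k) / g (u k))) - (\<Sum>\<alpha>\<in>Z. of_real (real (n \<alpha>) * (R\<^sup>2 - (norm \<alpha>)\<^sup>2)) * (c k * T \<alpha> k)))"
          unfolding eqs by (rule gen)
      qed
      finally have "((\<lambda>t. Re (of_real (lg t) * (\<Sum>k\<in>I. c k * ((1 + (u k)\<^sup>2) * (R * cis t) / (R * cis t - u k)\<^sup>2)))) has_integral
          Re (of_real pi * (LD - (\<Sum>k\<in>I. \<Sum>\<alpha>\<in>Z. of_real (real (n \<alpha>) * (R\<^sup>2 - (norm \<alpha>)\<^sup>2)) * (c k * T \<alpha> k))))) {- pi / 2..3 * pi / 2}"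
        using has_integral_linear[OF _ bounded_linear_Re] unfolding o_def by blast
      moreover have "Re (\<Sum>k\<in>I. \<Sum>\<alpha>\<in>Z. of_real (real (n \<alpha>) * (R\<^sup>2 - (norm \<alpha>)\<^sup>2)) * (c k * T \<alpha> k)) = ZZ"
      proof -
        have "(\<Sum>k\<in>I. \<Sum>\<alpha>\<in>Z. of_real (real (n \<alpha>) * (R\<^sup>2 - (norm \<alpha>)\<^sup>2)) * (c k * T \<alpha> k)) =
              (\<Sum>\<alpha>\<in>Z. of_real (real (n \<alpha>) * (R\<^sup>2 - (norm \<alpha>)\<^sup>2)) * (\<Sum>k\<in>I. c k * T \<alpha> k))"
          by (subst sum.swap) (simp only: sum_distrib_left)
        thus ?thesis unfolding ZZ_def zero_kernel_def T_def u_def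
          by (simp only: Re_sum times_complex.sel Re_complex_of_real Im_complex_of_real mult_zero_left diff_zero)
      qed
      moreover have "Re (of_real y * q) = y * Re q" for y q by simp
      ultimately show ?thesis unfolding K_def u_def[symmetric] by (simp only: minus_complex.sel)
    qed
    have znn: "zero_kernel \<epsilon> x R \<alpha> \<ge> 0" if "\<alpha> \<in> Z" for \<alpha>
      using zn[OF e(1) ee(3) x R(1) R1(1), of \<alpha>] that zer R1 by (auto simp: Z_def)
    have tnn: "real (n \<alpha>) * (R\<^sup>2 - (norm \<alpha>)\<^sup>2) * zero_kernel \<epsilon> x R \<alpha> \<ge> 0" if "\<alpha> \<in> Z" for \<alpha>
    proof -
      have "(norm \<alpha>)\<^sup>2 \<le> R\<^sup>2" using that by (intro power_mono) (auto simp: Z_def)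
      thus ?thesis using znn[OF that] by simp
    qed
    have ZZ0: "ZZ \<ge> 0" unfolding ZZ_def by (intro sum_nonneg tnn)
    \<comment> \<open>The weight of the zero is R^2 - |\<alpha>|^2 = R^2 - O(\<epsilon>^2), its
      kernel Re (F z0) / (\<epsilon> R^2) + O(1); the factors R^2 cancel in the product. All other
      zeros are dropped by positivity, and so are further multiples of this one.\<close>
    have ZZ1: "ZZ \<ge> Re (F (of_real z0)) / \<epsilon> - C" if z0: "0 \<le> z0" "z0 \<le> 1" "g (tan (- of_real (\<epsilon> * (z0 + x)))) = 0" for z0
    proof -
      define \<alpha> where "\<alpha> = tan (- of_real \<epsilon> * (of_real z0 + of_real x) :: complex)"
      have aeq: "\<alpha> = tan (- of_real (\<epsilon> * (z0 + x)))" by (simp add: \<alpha>_def)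
      define \<zeta> where "\<zeta> = (- of_real (\<epsilon> * (z0 + x)) :: complex)"
      have "norm \<zeta> = \<epsilon> * (z0 + x)" using e z0 x by (simp add: \<zeta>_def norm_mult del: of_real_mult of_real_add)
      also have "\<dots> \<le> \<epsilon> * 2" using e z0 x by (intro mult_left_mono) auto
      finally have zn': "norm \<zeta> \<le> 2 * \<epsilon>" by simp
      have eG: "G * \<epsilon> < 1 / 2" using ee G by (simp add: field_simps)
      moreover have "2 * \<epsilon> \<le> G * \<epsilon>" using G e by simp
      ultimately have "norm (tan \<zeta> - \<zeta>) \<le> B * (norm \<zeta>)\<^sup>2" using zn' by (intro B(2)) linarith
      also have "\<dots> \<le> B * (2 * \<epsilon>)\<^sup>2" using zn' B by (intro mult_left_mono power_mono) auto
      also have "\<dots> \<le> 4 * B * \<epsilon>" using B e ee by (simp add: power2_eq_square mult_left_le)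
      finally have an: "norm \<alpha> \<le> G * \<epsilon>"
        unfolding aeq \<zeta>_def[symmetric] G_def using zn' norm_triangle_ineq2[of "tan \<zeta>" \<zeta>] by (simp add: algebra_simps)
      have aZ: "\<alpha> \<in> Z" using an eG R z0(3) unfolding Z_def aeq[symmetric] by simp
      define q where "q = (norm \<alpha>)\<^sup>2"
      have q: "q \<le> G\<^sup>2 * \<epsilon>\<^sup>2" using an power_mono[of "norm \<alpha>" "G * \<epsilon>" 2] by (simp add: q_def power_mult_distrib)
      have q0: "q \<ge> 0" by (simp add: q_def)
      have qR: "q \<le> R\<^sup>2" using aZ unfolding q_def by (intro power_mono) (auto simp: Z_def)
      define Fz where "Fz = Re (F (of_real z0))"
      have Fz: "Fz \<le> coeff_norm" unfolding Fz_def by (rule F_le_coeff_norm) (use z0 in simp)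
      have Fz0: "Fz > 0" using F_pos[of "of_real z0"] z0 by (simp add: Fz_def F_def)
      have zk: "zero_kernel \<epsilon> x R \<alpha> \<ge> Fz / (\<epsilon> * R\<^sup>2) - C4"
        using near[OF e(1) ee(4) x R(1) R1(1), of "of_real z0"] z0 unfolding \<alpha>_def Fz_def by simp
      have "Fz / \<epsilon> - C \<le> (R\<^sup>2 - q) * (Fz / (\<epsilon> * R\<^sup>2) - C4)"
      proof -
        have gen: "A - C \<le> X" if "X = A - Bq - Cq" "Cq \<le> C4 * 1" "Bq \<le> t" "t = w" "w \<le> v * 1" "C \<ge> C4 + v" for A X Bq Cq t w v :: real
          using that by linarith
        have "(R\<^sup>2 - q) * (Fz / (\<epsilon> * R\<^sup>2) - C4) = Fz / \<epsilon> - q * Fz / (\<epsilon> * R\<^sup>2) - C4 * (R\<^sup>2 - q)"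
          using e R1 by (simp add: field_simps)
        moreover have "C4 * (R\<^sup>2 - q) \<le> C4 * 1" using C4 R2 q0 by (intro mult_left_mono) auto
        moreover have "q * Fz / (\<epsilon> * R\<^sup>2) \<le> (G\<^sup>2 * \<epsilon>\<^sup>2 * coeff_norm) / (\<epsilon> * (1 / 4))"
          using q q0 Fz Fz0 e R2 coeff_norm_nonneg by (intro frac_le mult_mono mult_left_mono) auto
        moreover have "(G\<^sup>2 * \<epsilon>\<^sup>2 * coeff_norm) / (\<epsilon> * (1 / 4)) = 4 * G\<^sup>2 * coeff_norm * \<epsilon>" using e by (simp add: power2_eq_square)
        moreover have "4 * G\<^sup>2 * coeff_norm * \<epsilon> \<le> 4 * G\<^sup>2 * coeff_norm * 1" using ee coeff_norm_nonneg by (intro mult_left_mono) auto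
        ultimately show ?thesis using Cg(2) by (rule gen)
      qed
      also have "\<dots> \<le> (R\<^sup>2 - q) * zero_kernel \<epsilon> x R \<alpha>" using zk qR by (intro mult_left_mono) auto
      also have "\<dots> \<le> real (n \<alpha>) * ((R\<^sup>2 - q) * zero_kernel \<epsilon> x R \<alpha>)"
        using n aZ znn[OF aZ] qR mult_right_mono[of 1 "real (n \<alpha>)" "(R\<^sup>2 - q) * zero_kernel \<epsilon> x R \<alpha>"] by (simp add: Suc_le_eq)
      also have "\<dots> \<le> ZZ"
        unfolding ZZ_def q_def
        using member_le_sum[of \<alpha> Z "\<lambda>\<alpha>. real (n \<alpha>) * (R\<^sup>2 - (norm \<alpha>)\<^sup>2) * zero_kernel \<epsilon> x R \<alpha>"] aZ finZ tnn
        by (simp add: mult.assoc)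
      finally show ?thesis by (simp add: Fz_def)
    qed
    define h where "h = (\<lambda>t. lg t * K \<epsilon> x R t)"
    have inth: "h integrable_on {- pi / 2..3 * pi / 2}" using int unfolding h_def by blast
    have ir: "h integrable_on {- pi / 2..pi / 2}" and il: "h integrable_on {pi / 2..3 * pi / 2}"
      by (rule integrable_subinterval_real[OF inth]; simp)+
    have tot: "integral {- pi / 2..pi / 2} h + integral {pi / 2..3 * pi / 2} h = pi * (Re LD - ZZ)"
      using has_integral_unique[OF has_integral_combine[OF _ _ integrable_integral[OF ir] integrable_integral[OF il]] int[folded h_def]]
      by simp
    \<comment> \<open>Only an upper bound for \<open>ln |g|\<close> is available here, since zeros
      may lie close to the circle; the sign of \<open>K\<close> makes it sufficient. The integral of
      - cos over the left half is 2.\<close>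
    have left: "- integral {pi / 2..3 * pi / 2} h \<le> U * (2 * f0 / R + C * \<epsilon>)"
    proof -
      define k where "k = (\<lambda>t. U * (C2 * \<epsilon>) + U * (f0 / R) * (- cos t))"
      have ik: "(k has_integral (3 * pi / 2 - pi / 2) * (U * (C2 * \<epsilon>)) + U * (f0 / R) * 2) {pi / 2..3 * pi / 2}"
      proof -
        have s: "sin (3 * pi / 2) = - 1" using sin_periodic_pi[of "pi / 2"] by (simp add: field_simps)
        have "((\<lambda>t. - cos t) has_integral (- sin (3 * pi / 2) - (- sin (pi / 2)))) {pi / 2..3 * pi / 2}"
          by (rule fundamental_theorem_of_calculus) (auto intro!: derivative_eq_intros simp flip: has_real_derivative_iff_has_vector_derivative)
        hence "((\<lambda>t. - cos t) has_integral 2) {pi / 2..3 * pi / 2}" unfolding s by simp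
        thus ?thesis unfolding k_def
          using has_integral_const_real[of "U * (C2 * \<epsilon>)" "pi / 2" "3 * pi / 2"]
          by (intro has_integral_add has_integral_mult_right) auto
      qed
      have "- h t \<le> k t" if t: "t \<in> {pi / 2..3 * pi / 2}" for t
      proof -
        have ct: "cos t \<le> 0"
        proof -
          have "cos (t - pi) \<ge> 0" using t by (intro cos_ge_zero) auto
          thus ?thesis by simp
        qed
        have nw: "norm (R * cis t) = R" "Re (R * cis t) \<le> 0" using R1 ct by (auto simp: norm_mult mult_nonneg_nonpos)
        have "g (R * cis t) \<noteq> 0" "norm (g (R * cis t)) \<le> exp U" using nz U(2) nw by blast+
        hence lU: "lg t \<le> U" unfolding lg_def by (metis exp_gt_zero ln_exp ln_le_cancel_iff zero_less_norm_iff)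
        have Kn: "K \<epsilon> x R t \<le> 0" "- K \<epsilon> x R t \<le> f0 * (- cos t) / R + C2 * \<epsilon>"
        proof -
          have kb: "\<bar>K \<epsilon> x R t - f0 * cos t / R\<bar> \<le> C2 * \<epsilon>" "K \<epsilon> x R t \<le> 0"
            using KB[OF e(1) ee(2) x R(1) R1(1), of t] ct by auto
          have "f0 * (- cos t) / R = - (f0 * cos t / R)" by simp
          moreover have "- k \<le> z + c'" if "z = - y" "\<bar>k - y\<bar> \<le> c'" for k y z c' :: real using that by linarith
          ultimately show "K \<epsilon> x R t \<le> 0" "- K \<epsilon> x R t \<le> f0 * (- cos t) / R + C2 * \<epsilon>" using kb by blast+
        qed
        have "- h t = lg t * (- K \<epsilon> x R t)" by (simp add: h_def)
        also have "\<dots> \<le> U * (- K \<epsilon> x R t)" using lU Kn by (intro mult_right_mono) auto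
        also have "\<dots> \<le> U * (f0 * (- cos t) / R + C2 * \<epsilon>)" using Kn U by (intro mult_left_mono) auto
        finally show ?thesis by (simp add: k_def algebra_simps)
      qed
      hence "integral {pi / 2..3 * pi / 2} (\<lambda>t. - h t) \<le> integral {pi / 2..3 * pi / 2} k"
        using il ik by (intro integral_le integrable_neg) auto
      also have "integral {pi / 2..3 * pi / 2} k = pi * (U * (C2 * \<epsilon>)) + U * (f0 / R) * 2"
        using integral_unique[OF ik] by simp
      also have "\<dots> \<le> U * (2 * f0 / R + C * \<epsilon>)"
      proof -
        have "U * ((pi * C2) * \<epsilon>) \<le> U * (C * \<epsilon>)" using Cg U e by (intro mult_left_mono mult_right_mono) auto
        thus ?thesis by (simp add: algebra_simps)
      qed
      finally show ?thesis using il by simp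
    qed
    have "Re (\<Sum>k\<in>I. c k * ((1 + (u k)\<^sup>2) * - (deriv g (u k) / g (u k)))) = - Re LD"
      by (simp add: LD_def sum_negf)
    moreover have "- Re LD \<le> (U * (2 * f0 / R + C * \<epsilon>) - integral {- pi / 2..pi / 2} h) / pi - ZZ"
    proof -
      have "pi * (- Re LD) \<le> U * (2 * f0 / R + C * \<epsilon>) - integral {- pi / 2..pi / 2} h - pi * ZZ"
        using tot left by (simp add: algebra_simps)
      hence "(pi * (- Re LD)) / pi \<le> (U * (2 * f0 / R + C * \<epsilon>) - integral {- pi / 2..pi / 2} h - pi * ZZ) / pi"
        by (intro divide_right_mono) auto
      thus ?thesis by (simp add: diff_divide_distrib)
    qed
    ultimately have fin1: "Re (\<Sum>k\<in>I. c k * ((1 + (u k)\<^sup>2) * - (deriv g (u k) / g (u k)))) \<le>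
       (U * (2 * f0 / R + C * \<epsilon>) - integral {- pi / 2..pi / 2} h) / pi - ZZ" by simp
    show "(\<lambda>t. ln (norm (g (R * cis t))) * K \<epsilon> x R t) integrable_on {- pi / 2..pi / 2} \<and>
     (\<exists>Zs. Zs \<ge> 0 \<and> (\<forall>z0. 0 \<le> z0 \<longrightarrow> z0 \<le> 1 \<longrightarrow> g (tan (- of_real (\<epsilon> * (z0 + x)))) = 0 \<longrightarrow> Zs \<ge> Re (F (of_real z0)) / \<epsilon> - C) \<and>
     Re (\<Sum>k\<in>I. c k * ((1 + (disc_point \<epsilon> x k)\<^sup>2) * - (deriv g (disc_point \<epsilon> x k) / g (disc_point \<epsilon> x k)))) \<le>
       (U * (2 * f0 / R + C * \<epsilon>) - integral {- pi / 2..pi / 2} (\<lambda>t. ln (norm (g (R * cis t))) * K \<epsilon> x R t)) / pi - Zs)"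
      using ir fin1 ZZ0 ZZ1 unfolding h_def lg_def u_def by blast
  qed
qed

end

section \<open>The right half of the circle\<close>

lemma sin_ge_half: "0 \<le> s \<Longrightarrow> s \<le> pi / 2 \<Longrightarrow> sin s \<ge> s / 2"
proof (cases "s \<le> pi / 3")
  case True
  assume s: "0 \<le> s"
  have "sin 0 - 0 / 2 \<le> sin s - s / 2"
  proof (rule DERIV_nonneg_imp_nondecreasing[OF s])
    fix x assume x: "0 \<le> x" "x \<le> s"
    have "cos x \<ge> cos (pi / 3)" using x True by (intro cos_monotone_0_pi_le) auto
    hence "cos x - 1 / 2 \<ge> 0" by (simp add: cos_60)
    thus "\<exists>y. ((\<lambda>a. sin a - a / 2) has_real_derivative y) (at x) \<and> 0 \<le> y"
      by (intro exI[of _ "cos x - 1 / 2"]) (auto intro!: derivative_eq_intros)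
  qed
  thus ?thesis by simp
next
  case False
  assume s: "0 \<le> s" "s \<le> pi / 2"
  have "sin s \<ge> sin (pi / 3)" using False s by (intro sin_monotone_2pi_le) auto
  moreover have "sin (pi / 3) \<ge> (8 / 10 :: real)"
    unfolding sin_60 using real_le_rsqrt[of "16 / 10" 3] by (simp add: power2_eq_square)
  moreover have "pi / 4 \<le> 8 / 10" using pi_approx by simp
  ultimately show ?thesis using s by linarith
qed

text \<open>An integrable majorant of \<open>ln (1 / cos t)\<close> up to a factor.\<close>

definition arc_majorant :: "real \<Rightarrow> real" where
  "arc_majorant t = 2 * ((t + pi / 2) powr (- 1 / 2) + (pi / 2 - t) powr (- 1 / 2))"

lemma arc_majorant_integral: "\<exists>W. (arc_majorant has_integral W) {- pi / 2..pi / 2}"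
proof -
  have 1: "((\<lambda>x :: real. x powr (- 1 / 2)) has_integral pi powr (- 1 / 2 + 1) / (- 1 / 2 + 1)) {0..pi}"
    by (rule has_integral_powr_from_0) auto
  from has_integral_shift_real_ivl[OF this, of "pi / 2"]
  have 2: "((\<lambda>x. (x + pi / 2) powr (- 1 / 2)) has_integral pi powr (- 1 / 2 + 1) / (- 1 / 2 + 1)) {- pi / 2..pi / 2}"
    by simp
  from has_integral_reflect_real[of "\<lambda>x. (x + pi / 2) powr (- 1 / 2)" _ "pi / 2" "- pi / 2"] 2
  have 3: "((\<lambda>x. (- x + pi / 2) powr (- 1 / 2)) has_integral pi powr (- 1 / 2 + 1) / (- 1 / 2 + 1)) {- pi / 2..pi / 2}"
    by simp
  from has_integral_mult_right[OF has_integral_add[OF 2 3], of 2] show ?thesis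
    unfolding arc_majorant_def[abs_def] by (auto simp: algebra_simps)
qed

lemma arc_majorant_nonneg: "arc_majorant t \<ge> 0" by (simp add: arc_majorant_def)

lemma ln_inverse_cos_le_arc_majorant:
  assumes "t \<in> {- pi / 2..pi / 2}" "cos t > 0"
  shows "ln (1 / cos t) \<le> 2 * arc_majorant t"
proof -
  define s where "s = pi / 2 - \<bar>t\<bar>"
  have s: "0 \<le> s" "s \<le> pi / 2" using assms(1) by (auto simp: s_def)
  have cs: "cos t = sin s" unfolding s_def by (cases "t \<ge> 0") (simp_all add: sin_diff sin_add)
  hence "s \<noteq> 0" using assms(2) by auto
  hence s0: "s > 0" using s by simp
  have "ln (1 / cos t) = - ln (cos t)" using assms(2) by (simp add: ln_div)
  also have "\<dots> \<le> - ln (s / 2)" using sin_ge_half[OF s] s0 assms(2) cs by simp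
  also have "\<dots> = 2 * ln (sqrt (2 / s))" using s0 by (simp add: ln_sqrt ln_div)
  also have "\<dots> \<le> 2 * (sqrt (2 / s) - 1)" using s0 by (intro mult_left_mono ln_le_minus_one) auto
  also have "\<dots> \<le> 2 * (sqrt 2 * s powr (- 1 / 2))"
    using s0 by (simp add: real_sqrt_divide powr_minus_divide powr_half_sqrt[symmetric])
  also have "\<dots> \<le> 2 * (2 * s powr (- 1 / 2))"
    using sqrt2_less_2 by (intro mult_left_mono mult_right_mono) auto
  also have "\<dots> \<le> 2 * arc_majorant t" unfolding arc_majorant_def s_def by (cases "t \<ge> 0") (simp_all add: add.commute)
  finally show ?thesis .
qed

definition shift :: "real \<Rightarrow> real \<Rightarrow> complex \<Rightarrow> complex" where
  "shift \<eta> y u = 1 + \<i> * of_real y + of_real (4 * \<eta> / pi) * Arctan u"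

lemma Re_shift: "Re (shift \<eta> y u) = 1 + 4 * \<eta> / pi * Re (Arctan u)"
  by (simp add: shift_def)

text \<open>On smaller circles the distance to the line \<open>Re s = 1\<close> degenerates like cos
  t towards the ends of the arc, which is where \<open>ln (1 / cos t)\<close> and its majorant come
  from.\<close>

lemma shift_right:
  fixes \<eta> R t y :: real
  assumes "0 < \<eta>" "1 / 2 \<le> R" "R \<le> 1" "cos t > 0"
  shows "Re (shift \<eta> y (R * cis t)) \<ge> 1 + \<eta> / pi * cos t" "Re (shift \<eta> y (R * cis t)) \<le> 1 + \<eta>"
    "R = 1 \<Longrightarrow> Re (shift \<eta> y (R * cis t)) = 1 + \<eta>"
proof -
  have A: "Re (Arctan (R * cis t)) \<ge> cos t / 4 \<and> Re (Arctan (R * cis t)) \<le> pi / 4 \<and> (R = 1 \<longrightarrow> Re (Arctan (R * cis t)) = pi / 4)"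
  proof (cases "R = 1")
    case True
    have "Re (Arctan (cis t)) = pi / 4" by (rule Re_Arctan_unit) (use assms in auto)
    moreover have "cos t / 4 \<le> pi / 4" using cos_le_one[of t] pi_gt3 by linarith
    ultimately show ?thesis using True by simp
  next
    case False
    hence n: "norm (R * cis t) < 1" using assms by (simp add: norm_mult)
    have "Re (R * cis t) / 2 \<le> Re (Arctan (R * cis t))"
      using assms by (intro Re_Arctan_ge[OF n]) auto
    moreover have "cos t / 4 \<le> Re (R * cis t) / 2" using assms mult_right_mono[of "1/2" R "cos t"] by simp
    ultimately show ?thesis using abs_Re_Arctan_less[OF n] False by auto
  qed
  have p: "4 * \<eta> / pi > 0" using assms by simp
  have "4 * \<eta> / pi * (cos t / 4) \<le> 4 * \<eta> / pi * Re (Arctan (R * cis t))" using A p by (intro mult_left_mono) auto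
  thus "Re (shift \<eta> y (R * cis t)) \<ge> 1 + \<eta> / pi * cos t" unfolding Re_shift by simp
  have "4 * \<eta> / pi * Re (Arctan (R * cis t)) \<le> 4 * \<eta> / pi * (pi / 4)" using A p by (intro mult_left_mono) auto
  thus "Re (shift \<eta> y (R * cis t)) \<le> 1 + \<eta>" unfolding Re_shift by simp
  show "Re (shift \<eta> y (R * cis t)) = 1 + \<eta>" if "R = 1"
  proof -
    have e: "Re (Arctan (R * cis t)) = pi / 4" using A that by blast
    show ?thesis unfolding Re_shift e by simp
  qed
qed

lemma dirichlet_series_log_derivative:
  assumes s: "Re s > 1"
  shows "(dirichlet_series logcoeff has_field_derivative - dirichlet_series mangoldt s) (at s)"
proof -
  have "dirichlet_series (\<lambda>n. - logcoeff n * ln (real n)) s = - dirichlet_series mangoldt s"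
    unfolding minus_mult_left[symmetric] logcoeff_mangoldt dirichlet_series_def
    using suminf_minus[OF mangoldt_series.summable[OF s]] by simp
  thus ?thesis using log_series.has_derivative(1)[OF s] by simp
qed

text \<open>A predicate lets one constant serve five estimates. The last one compares radius R with
  radius 1, whose image is the line \<open>Re s = 1 + \<eta>\<close>.\<close>

definition arc_bound :: "real \<Rightarrow> real \<Rightarrow> real \<Rightarrow> real \<Rightarrow> real \<Rightarrow> bool" where
  "arc_bound C \<eta> y R t \<longleftrightarrow> \<bar>ln (norm (zeta (shift \<eta> y (R * cis t))))\<bar> \<le> ln (1 / \<eta>) + C + 2 * arc_majorant t \<and>
     \<bar>Re (dirichlet_series logcoeff (shift \<eta> y (R * cis t)))\<bar> \<le> ln (1 / \<eta>) + C + 2 * arc_majorant t \<and>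
     \<bar>ln (norm (zeta (shift \<eta> y (R * cis t)))) - Re (dirichlet_series logcoeff (shift \<eta> y (R * cis t)))\<bar> \<le> C \<and>
     \<bar>Re (dirichlet_series logcoeff (shift \<eta> y (cis t)))\<bar> \<le> ln (1 / \<eta>) + C \<and>
     \<bar>Re (dirichlet_series logcoeff (shift \<eta> y (R * cis t))) - Re (dirichlet_series logcoeff (shift \<eta> y (cis t)))\<bar> \<le> C * (1 - R) / (cos t)\<^sup>2"

text \<open>For the last estimate log zeta is integrated along the radial segment from radius R to
  radius 1. The series of zeta'/zeta is at most C0 / (Re s - 1) <= C0 pi / (\<eta> cos t), and |1 +
  u^2| = |u| |u + 1 / u| >= cos t; this explains the square of cos t. The factor \<eta> cancels
  against the derivative of \<open>shift\<close>, so \<open>C\<close> is uniform in \<eta> and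
  y.\<close>

lemma right_arc_pointwise:
  "\<exists>C>0. \<forall>\<eta> y R t. 0 < \<eta> \<longrightarrow> \<eta> \<le> 1 \<longrightarrow> 1 / 2 \<le> R \<longrightarrow> R \<le> 1 \<longrightarrow> t \<in> {- pi / 2..pi / 2} \<longrightarrow> cos t > 0 \<longrightarrow>
     arc_bound C \<eta> y R t"
proof -
  obtain C0 where C0: "C0 > 0"
    "\<And>s. 1 < Re s \<Longrightarrow> Re s \<le> 2 \<Longrightarrow> norm (dirichlet_series logcoeff s) \<le> ln (1 / (Re s - 1)) + C0"
    "\<And>s. 1 < Re s \<Longrightarrow> Re s \<le> 2 \<Longrightarrow> \<bar>ln (norm (zeta s))\<bar> \<le> ln (1 / (Re s - 1)) + C0"
    "\<And>s. Re s > 1 \<Longrightarrow> \<bar>ln (norm (zeta s)) - Re (dirichlet_series logcoeff s)\<bar> \<le> C0"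
    "\<And>s. 1 < Re s \<Longrightarrow> Re s \<le> 2 \<Longrightarrow> norm (dirichlet_series mangoldt s) \<le> C0 / (Re s - 1)"
    by (rule log_zeta_bounds) (rule that, assumption+)
  define C where "C = 4 * C0 + ln pi"
  have lp: "ln pi > 0" using pi_gt3 by simp
  have C: "C > 0" "C \<ge> C0 + ln pi" "C \<ge> 4 * C0" "C \<ge> C0" using C0(1) lp unfolding C_def by linarith+
  show ?thesis
  proof (rule exI[of _ C], intro conjI[of "C > 0"] allI impI C(1))
    fix \<eta> y R t :: real assume h: "0 < \<eta>" "\<eta> \<le> 1" "1 / 2 \<le> R" "R \<le> 1" "t \<in> {- pi / 2..pi / 2}" "cos t > 0"
    define s where "s = shift \<eta> y (R * cis t)"
    have pc: "\<eta> / pi * cos t > 0" using h by simp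
    have s: "Re s \<ge> 1 + \<eta> / pi * cos t" "Re s \<le> 1 + \<eta>"
      unfolding s_def by (rule shift_right(1,2)[OF h(1,3,4,6)])+
    have s12: "1 < Re s" "Re s \<le> 2" using s pc h by linarith+
    have "1 / (Re s - 1) \<le> 1 / (\<eta> / pi * cos t)" using s pc by (intro frac_le) auto
    hence "ln (1 / (Re s - 1)) \<le> ln (1 / (\<eta> / pi * cos t))"
      using s12 pc by (intro ln_mono) auto
    also have "\<dots> = ln (1 / \<eta>) + ln pi + ln (1 / cos t)" using h by (simp add: ln_div ln_mult)
    finally have L: "ln (1 / (Re s - 1)) \<le> ln (1 / \<eta>) + ln pi + 2 * arc_majorant t"
      using ln_inverse_cos_le_arc_majorant[OF h(5,6)] by simp
    define s1 where "s1 = shift \<eta> y (cis t)"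
    have s1: "Re s1 = 1 + \<eta>" using shift_right(3)[of \<eta> 1 t y] h by (simp add: s1_def)
    have diff: "norm (dirichlet_series logcoeff s - dirichlet_series logcoeff s1) \<le> (4 * C0 / (cos t)\<^sup>2) * norm (R * cis t - cis t)"
      unfolding s_def s1_def
    proof (rule field_differentiable_bound[where f = "\<lambda>u. dirichlet_series logcoeff (shift \<eta> y u)" and S = "closed_segment (R * cis t) (cis t)"])
      fix u assume "u \<in> closed_segment (of_real R * cis t) (cis t)"
      then obtain v where v: "0 \<le> v" "v \<le> 1" "u = (1 - v) *\<^sub>R (of_real R * cis t) + v *\<^sub>R cis t"
        by (auto simp: in_segment)
      define \<rho> where "\<rho> = (1 - v) * R + v"
      have u: "u = of_real \<rho> * cis t" using v(3) by (simp add: \<rho>_def scaleR_conv_of_real algebra_simps)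
      have \<rho>1: "\<rho> \<le> 1" using v h mult_left_mono[of R 1 "1 - v"] by (simp add: \<rho>_def)
      have \<rho>2: "\<rho> \<ge> 1 / 2" using v h mult_left_mono[of "1/2" R "1 - v"] by (simp add: \<rho>_def)
      have Ru: "Re u > 0" using u \<rho>2 h by simp
      have sb: "Re (shift \<eta> y u) \<ge> 1 + \<eta> / pi * cos t" "Re (shift \<eta> y u) \<le> 1 + \<eta>"
        unfolding u by (rule shift_right(1,2)[OF h(1) \<rho>2 \<rho>1 h(6)])+
      hence s12': "1 < Re (shift \<eta> y u)" "Re (shift \<eta> y u) \<le> 2" using pc h by linarith+
      have dA: "(Arctan has_field_derivative inverse (1 + u\<^sup>2)) (at u)"
        by (rule has_field_derivative_Arctan) (use Ru in auto)
      have "(shift \<eta> y has_field_derivative of_real (4 * \<eta> / pi) * inverse (1 + u\<^sup>2)) (at u)"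
        unfolding shift_def[abs_def] by (rule derivative_eq_intros dA refl)+ simp
      hence "((\<lambda>u. dirichlet_series logcoeff (shift \<eta> y u)) has_field_derivative - dirichlet_series mangoldt (shift \<eta> y u) * (of_real (4 * \<eta> / pi) * inverse (1 + u\<^sup>2))) (at u)"
        by (rule DERIV_chain2[where f = "dirichlet_series logcoeff" and g = "shift \<eta> y", OF dirichlet_series_log_derivative[OF s12'(1)]])
      thus "((\<lambda>u. dirichlet_series logcoeff (shift \<eta> y u)) has_field_derivative - dirichlet_series mangoldt (shift \<eta> y u) * (of_real (4 * \<eta> / pi) * inverse (1 + u\<^sup>2))) (at u within closed_segment (R * cis t) (cis t))"
        by (rule has_field_derivative_at_within)
      have 1: "norm (dirichlet_series mangoldt (shift \<eta> y u)) \<le> C0 / (\<eta> / pi * cos t)"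
        using sb pc C0(1) by (intro order.trans[OF C0(5)[OF s12']] frac_le) auto
      have u0: "u \<noteq> 0" using Ru by auto
      have "1 + u\<^sup>2 = u * (u + 1 / u)" using u0 by (simp add: field_simps power2_eq_square)
      moreover have "Re (u + 1 / u) = (\<rho> + 1 / \<rho>) * cos t"
      proof -
        have "1 / u = of_real (1 / \<rho>) * cis (- t)"
        proof -
          have "u * (of_real (1 / \<rho>) * cis (- t)) = 1" using u \<rho>2 by (simp add: cis_mult)
          thus ?thesis using u0 by (metis nonzero_divide_eq_eq mult.commute)
        qed
        hence "Re (u + 1 / u) = Re (of_real \<rho> * cis t) + Re (of_real (1 / \<rho>) * cis (- t))" using u by (simp only: plus_complex.sel)
        thus ?thesis by (simp add: distrib_right)
      qed
      moreover have "norm u = \<rho>" using u \<rho>2 by (simp add: norm_mult)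
      ultimately have "norm (1 + u\<^sup>2) \<ge> \<rho> * ((\<rho> + 1 / \<rho>) * cos t)"
        using complex_Re_le_cmod[of "u + 1 / u"] \<rho>2 by (simp add: norm_mult mult_left_mono)
      moreover have "\<rho> * ((\<rho> + 1 / \<rho>) * cos t) = (\<rho> * \<rho> + 1) * cos t" using \<rho>2 by (simp add: field_simps)
      moreover have "1 * cos t \<le> (\<rho> * \<rho> + 1) * cos t" using h by (intro mult_right_mono) auto
      ultimately have 2: "norm (1 + u\<^sup>2) \<ge> cos t" by linarith
      have "norm (- dirichlet_series mangoldt (shift \<eta> y u) * (of_real (4 * \<eta> / pi) * inverse (1 + u\<^sup>2))) =
          norm (dirichlet_series mangoldt (shift \<eta> y u)) * ((4 * \<eta> / pi) * (1 / norm (1 + u\<^sup>2)))"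
        using h by (simp add: norm_mult norm_inverse norm_divide inverse_eq_divide)
      also have "\<dots> \<le> (C0 / (\<eta> / pi * cos t)) * ((4 * \<eta> / pi) * (1 / cos t))"
        using 1 2 h pc C0(1) by (intro mult_mono mult_left_mono frac_le) auto
      also have "\<dots> = 4 * C0 / (cos t)\<^sup>2" using h by (simp add: power2_eq_square)
      finally show "norm (- dirichlet_series mangoldt (shift \<eta> y u) * (of_real (4 * \<eta> / pi) * inverse (1 + u\<^sup>2))) \<le> 4 * C0 / (cos t)\<^sup>2" .
    qed auto
    have "of_real R * cis t - cis t = of_real (R - 1) * cis t" by (simp add: algebra_simps)
    hence "norm (of_real R * cis t - cis t) = 1 - R" using h by (simp add: norm_mult del: of_real_diff)
    with diff have "\<bar>Re (dirichlet_series logcoeff s - dirichlet_series logcoeff s1)\<bar> \<le> (4 * C0 / (cos t)\<^sup>2) * (1 - R)"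
      using abs_Re_le_cmod[of "dirichlet_series logcoeff s - dirichlet_series logcoeff s1"] by simp
    also have "\<dots> = (4 * C0) * ((1 - R) / (cos t)\<^sup>2)" by simp
    also have "\<dots> \<le> C * ((1 - R) / (cos t)\<^sup>2)" using C h by (intro mult_right_mono) auto
    finally have d: "\<bar>Re (dirichlet_series logcoeff s) - Re (dirichlet_series logcoeff s1)\<bar> \<le> C * (1 - R) / (cos t)\<^sup>2" by simp
    have "\<bar>Re (dirichlet_series logcoeff s1)\<bar> \<le> ln (1 / \<eta>) + C0"
      using C0(2)[of s1] s1 h abs_Re_le_cmod[of "dirichlet_series logcoeff s1"] by simp
    thus "arc_bound C \<eta> y R t"
      unfolding arc_bound_def s_def[symmetric] s1_def[symmetric]
      using C0(2)[OF s12] C0(3)[OF s12] C0(4)[OF s12(1)] L C d abs_Re_le_cmod[of "dirichlet_series logcoeff s"] by linarith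
  qed
qed

text \<open>Allows the values at t and - t on the unit arc to be paired.\<close>

lemma Arctan_cis_minus:
  assumes "cos t > 0"
  shows "Arctan (cis (- t)) = cnj (Arctan (cis t))"
proof -
  define u where "u = cis t"
  have n: "norm u = 1" "Re u > 0" using assms by (auto simp: u_def)
  have "u\<^sup>2 \<noteq> -1"
  proof
    assume "u\<^sup>2 = -1"
    hence "(u - \<i>) * (u + \<i>) = 0" by (simp add: algebra_simps power2_eq_square)
    hence "u = \<i> \<or> u = - \<i>" by (metis mult_eq_0_iff right_minus_eq eq_neg_iff_add_eq_0)
    thus False using n by auto
  qed
  hence "tan (Arctan u) = u" by (rule tan_Arctan)
  hence "tan (cnj (Arctan u)) = cnj u" by (simp flip: cnj_tan)
  hence "Arctan (cnj u) = Arctan (tan (cnj (Arctan u)))" by simp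
  also have "\<dots> = cnj (Arctan u)"
    by (rule Arctan_tan) (simp add: Re_Arctan_unit[OF n])
  finally show ?thesis by (simp add: u_def cis_cnj)
qed

text \<open>At the ends of the arc \<open>cis t\<close> is a singularity of \<open>Arctan\<close>,
  so continuity is known on the open interval only.\<close>

lemma integrable_bounded_continuous_Ioo:
  fixes f :: "real \<Rightarrow> real"
  assumes "continuous_on {a<..<b} f" "\<And>t. t \<in> {a<..<b} \<Longrightarrow> \<bar>f t\<bar> \<le> B"
  shows "f integrable_on {a..b}"
proof -
  have "f integrable_on {a<..<b}"
  proof (rule measurable_bounded_by_integrable_imp_integrable)
    show "f \<in> borel_measurable (lebesgue_on {a<..<b})"
      by (rule continuous_imp_measurable_on_sets_lebesgue[OF assms(1)]) auto
    show "(\<lambda>_. B) integrable_on {a<..<b}"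
      using integrable_const_ivl[of B a b] by (simp add: integrable_on_Icc_iff_Ioo)
  qed (use assms in auto)
  thus ?thesis by (simp add: integrable_on_Icc_iff_Ioo)
qed

text \<open>Separates the phase, which depends on the height y, from the factor \<open>E\<close>,
  which depends on t alone and is therefore common to all terms of the cosine polynomial.\<close>

lemma shift_cis_term:
  assumes "0 < \<eta>" "cos t > 0"
  defines "E \<equiv> (\<lambda>n. exp (- of_real (4 * \<eta> / pi * ln (real (Suc n))) * Arctan (cis t)))"
  shows "of_nat (Suc n) powr (- shift \<eta> y (cis t)) = of_real (1 / real (Suc n)) * cis (- (y * ln (real (Suc n)))) * E n"
    "norm (E n) = real (Suc n) powr (- \<eta>)"
proof -
  have "of_nat (Suc n) powr (- shift \<eta> y (cis t)) = exp (- shift \<eta> y (cis t) * of_real (ln (real (Suc n))))"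
    by (simp add: powr_def Ln_of_nat del: of_nat_Suc)
  also have "- shift \<eta> y (cis t) * of_real (ln (real (Suc n))) =
      of_real (- ln (real (Suc n))) + \<i> * of_real (- (y * ln (real (Suc n)))) + (- of_real (4 * \<eta> / pi * ln (real (Suc n))) * Arctan (cis t))"
    by (simp add: shift_def algebra_simps del: of_nat_Suc)
  also have "exp \<dots> = exp (of_real (- ln (real (Suc n)))) * exp (\<i> * of_real (- (y * ln (real (Suc n))))) * E n"
    unfolding E_def exp_add ..
  also have "exp (of_real (- ln (real (Suc n)))) = (of_real (1 / real (Suc n)) :: complex)"
    unfolding exp_of_real by (simp add: exp_minus inverse_eq_divide del: of_nat_Suc)
  finally show "of_nat (Suc n) powr (- shift \<eta> y (cis t)) = of_real (1 / real (Suc n)) * cis (- (y * ln (real (Suc n)))) * E n"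
    by (simp only: cis_conv_exp)
  have "Re (Arctan (cis t)) = pi / 4" by (rule Re_Arctan_unit) (use assms in auto)
  hence e: "Re (- of_real (4 * \<eta> / pi * ln (real (Suc n))) * Arctan (cis t)) = - (4 * \<eta> / pi * ln (real (Suc n))) * (pi / 4)"
    by (simp only: times_complex.sel uminus_complex.sel Re_complex_of_real Im_complex_of_real)
  have "norm (E n) = exp (- (\<eta> * ln (real (Suc n))))" unfolding E_def norm_exp_eq_Re e by simp
  thus "norm (E n) = real (Suc n) powr (- \<eta>)" by (simp add: powr_def)
qed

text \<open>Adding the values at t and - t cancels the products of sines with Im E. What remains of
  the n-th term, summed over j, is a non-negative coefficient times the cosine polynomial at \<tau>
  ln n times cos t Re E, whose integral is non-negative by \<open>poisson_arc_positive\<close>.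
  Dominated convergence justifies the termwise integration, with a majorant of size
  n^(-1-\<eta>).\<close>

lemma arc_positivity:
  fixes b :: "nat \<Rightarrow> real" and \<eta> \<tau> :: real
  assumes \<eta>: "0 < \<eta>" "\<eta> \<le> 1" and b: "\<And>j. b j \<ge> 0" and P: "\<And>\<theta>. (\<Sum>j\<le>N. b j * cos (real j * \<theta>)) \<ge> 0"
  defines "h \<equiv> (\<lambda>j t. cos t * Re (dirichlet_series logcoeff (shift \<eta> (real j * \<tau>) (cis t))))"
  shows "h j integrable_on {- pi / 2..pi / 2}" "(\<Sum>j\<le>N. b j * integral {- pi / 2..pi / 2} (h j)) \<ge> 0"
proof -
  let ?I = "{- pi / 2..pi / 2}"
  obtain C where C: "C > 0" and Cb: "\<And>y t. t \<in> ?I \<Longrightarrow> cos t > 0 \<Longrightarrow> \<bar>Re (dirichlet_series logcoeff (shift \<eta> y (cis t)))\<bar> \<le> ln (1 / \<eta>) + C"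
  proof -
    from right_arc_pointwise obtain C where C: "C > 0" "\<forall>\<eta> y R t. 0 < \<eta> \<longrightarrow> \<eta> \<le> 1 \<longrightarrow> 1 / 2 \<le> R \<longrightarrow> R \<le> 1 \<longrightarrow> t \<in> ?I \<longrightarrow> cos t > 0 \<longrightarrow> arc_bound C \<eta> y R t" by blast
    show ?thesis
    proof (rule that[OF C(1)])
      fix y t assume t: "t \<in> ?I" "cos t > 0"
      have "arc_bound C \<eta> y 1 t" using C(2)[rule_format, OF \<eta> _ _ t] by simp
      thus "\<bar>Re (dirichlet_series logcoeff (shift \<eta> y (cis t)))\<bar> \<le> ln (1 / \<eta>) + C" by (simp add: arc_bound_def)
    qed
  qed
  have cpos: "cos t > 0" if "t \<in> {- pi / 2<..<pi / 2}" for t using that by (intro cos_gt_zero_pi) auto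
  have cases_t: "cos t = 0 \<or> cos t > 0" if "t \<in> ?I" for t
    using cos_ge_zero[of t] that by (auto simp: less_le)
  show int: "h j integrable_on ?I" for j
  proof (rule integrable_bounded_continuous_Ioo)
    have cA: "continuous_on {- pi / 2<..<pi / 2} (\<lambda>t. Arctan (cis t))"
      by (intro continuous_on_compose2[of "{z. Re z > 0}" Arctan _ cis] continuous_on_Arctan)
         (use cpos in \<open>auto intro!: continuous_intros\<close>)
    have cD: "continuous_on zeta_halfplane (dirichlet_series logcoeff)"
      by (rule continuous_at_imp_continuous_on) (auto intro!: DERIV_isCont[OF dirichlet_series_log_derivative])
    have "continuous_on {- pi / 2<..<pi / 2} (\<lambda>t. dirichlet_series logcoeff (shift \<eta> (real j * \<tau>) (cis t)))"
    proof (rule continuous_on_compose2[OF cD])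
      show "continuous_on {- pi / 2<..<pi / 2} (\<lambda>t. shift \<eta> (real j * \<tau>) (cis t))"
        unfolding shift_def by (intro continuous_intros cA)
      show "(\<lambda>t. shift \<eta> (real j * \<tau>) (cis t)) ` {- pi / 2<..<pi / 2} \<subseteq> zeta_halfplane"
        using shift_right(3)[of \<eta> 1 _ "real j * \<tau>"] \<eta> cpos by auto
    qed
    thus "continuous_on {- pi / 2<..<pi / 2} (h j)" unfolding h_def by (intro continuous_intros)
    fix t assume t: "t \<in> {- pi / 2<..<pi / 2}"
    have "\<bar>h j t\<bar> = cos t * \<bar>Re (dirichlet_series logcoeff (shift \<eta> (real j * \<tau>) (cis t)))\<bar>"
      using cpos[OF t] by (simp add: h_def abs_mult)
    also have "\<dots> \<le> 1 * \<bar>Re (dirichlet_series logcoeff (shift \<eta> (real j * \<tau>) (cis t)))\<bar>" by (intro mult_right_mono) auto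
    also have "\<dots> \<le> ln (1 / \<eta>) + C" using Cb[of t] t cpos[OF t] by auto
    finally show "\<bar>h j t\<bar> \<le> ln (1 / \<eta>) + C" .
  qed
  define l where "l = (\<lambda>n. 4 * \<eta> / pi * ln (real (Suc n)))"
  have l0: "l n \<ge> 0" for n using \<eta> by (simp add: l_def)
  define E where "E = (\<lambda>n t. exp (- of_real (l n) * Arctan (cis t)))"
  define w where "w = (\<lambda>n. logcoeff (Suc n) / real (Suc n))"
  have w: "0 \<le> w n" "w n \<le> 1 / real (Suc n)" for n
    using logcoeff_bounds[of "Suc n"] by (auto simp: w_def divide_right_mono)
  define p where "p = (\<lambda>n. \<Sum>j\<le>N. b j * cos (real j * \<tau> * ln (real (Suc n))))"
  have p0: "p n \<ge> 0" for n using P[of "\<tau> * ln (real (Suc n))"] by (simp add: p_def mult.assoc)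
  define Bs where "Bs = (\<Sum>j\<le>N. b j)"
  have Bs0: "Bs \<ge> 0" unfolding Bs_def by (intro sum_nonneg b)
  have pB: "p n \<le> Bs" for n unfolding p_def Bs_def by (intro sum_mono) (use b in \<open>auto intro: mult_left_le\<close>)
  define q where "q = (\<lambda>n t. 2 * w n * p n * (cos t * Re (E n t)))"
  define G where "G = (\<lambda>t. \<Sum>j\<le>N. b j * h j t)"
  have qint: "q n integrable_on ?I" "integral ?I (q n) \<ge> 0" for n
  proof -
    have "(q n has_integral 2 * w n * p n * integral ?I (\<lambda>t. cos t * Re (E n t))) ?I"
      unfolding q_def E_def by (rule has_integral_mult_right[OF integrable_integral[OF poisson_arc_positive(1)[OF l0]]])
    moreover have "2 * w n * p n * integral ?I (\<lambda>t. cos t * Re (E n t)) \<ge> 0"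
      using poisson_arc_positive(2)[OF l0[of n]] w(1)[of n] p0[of n] unfolding E_def by simp
    ultimately show "q n integrable_on ?I" "integral ?I (q n) \<ge> 0" by (auto simp only: has_integral_integrable_integral)
  qed
  have qb: "\<bar>q n t\<bar> \<le> 2 * Bs * real (Suc n) powr (- (1 + \<eta>))" if t: "t \<in> ?I" for n t
  proof (cases "cos t > 0")
    case True
    have nE: "norm (E n t) = real (Suc n) powr (- \<eta>)"
      unfolding E_def l_def by (rule shift_cis_term(2)[OF \<eta>(1) True])
    have "\<bar>q n t\<bar> = 2 * (w n * p n * (cos t * \<bar>Re (E n t)\<bar>))"
      using w(1)[of n] p0[of n] True by (simp add: q_def abs_mult)
    also have "\<dots> \<le> 2 * ((1 / real (Suc n)) * Bs * (1 * real (Suc n) powr (- \<eta>)))"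
      using w[of n] p0[of n] pB[of n] Bs0 True abs_Re_le_cmod[of "E n t"] unfolding nE by (intro mult_left_mono mult_mono) auto
    also have "\<dots> = 2 * Bs * (real (Suc n) powr (- 1) * real (Suc n) powr (- \<eta>))" by (simp add: powr_minus_divide del: of_nat_Suc)
    also have "real (Suc n) powr (- 1) * real (Suc n) powr (- \<eta>) = real (Suc n) powr (- (1 + \<eta>))"
      unfolding powr_add[symmetric] minus_add_distrib ..
    finally show ?thesis .
  next
    case False
    hence "cos t = 0" using cases_t[OF t] by auto
    thus ?thesis using Bs0 by (simp add: q_def)
  qed
  have sm: "summable (\<lambda>n. 2 * Bs * real (Suc n) powr (- (1 + \<eta>)))"
    using summable_real_powr_iff[of "- (1 + \<eta>)"] \<eta> by (intro summable_mult) (subst summable_Suc_iff, auto)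
  have lim: "(\<lambda>n. q n t) sums (G t + G (- t))" if t: "t \<in> ?I" for t
  proof (cases "cos t > 0")
    case False
    hence "cos t = 0" using cases_t[OF t] by auto
    thus ?thesis by (simp add: q_def G_def h_def)
  next
    case True
    have hs: "(\<lambda>n. 2 * w n * cos (real j * \<tau> * ln (real (Suc n))) * (cos t * Re (E n t))) sums (h j t + h j (- t))" for j
    proof -
      define y where "y = real j * \<tau>"
      have trm: "Re (of_real (logcoeff (Suc n)) * of_nat (Suc n) powr (- shift \<eta> y (cis s))) =
         w n * (cos (y * ln (real (Suc n))) * Re (E n s) + sin (y * ln (real (Suc n))) * Im (E n s))" if "cos s > 0" for n s
      proof -
        have gen: "Re (of_real v * (of_real (1 / m) * cis (- x) * z)) = v / m * (cos x * Re z + sin x * Im z)" for v m x z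
        proof -
          have "of_real v * (of_real (1 / m) * cis (- x) * z) = of_real (v / m) * (cis (- x) * z)" by simp
          hence "Re (of_real v * (of_real (1 / m) * cis (- x) * z)) = Re (of_real (v / m) * (cis (- x) * z))" by (rule arg_cong)
          also have "\<dots> = v / m * (cos x * Re z + sin x * Im z)"
            by (simp only: times_complex.sel Re_complex_of_real Im_complex_of_real cis.sel cos_minus sin_minus) simp
          finally show ?thesis .
        qed
        show ?thesis unfolding shift_cis_term(1)[OF \<eta>(1) that] E_def l_def w_def by (rule gen)
      qed
      have sms: "(\<lambda>n. w n * (cos (y * ln (real (Suc n))) * Re (E n s) + sin (y * ln (real (Suc n))) * Im (E n s))) sums Re (dirichlet_series logcoeff (shift \<eta> y (cis s)))" if "cos s > 0" for s
      proof -
        have "Re (shift \<eta> y (cis s)) > 1" using shift_right(3)[of \<eta> 1 s y] \<eta> that by simp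
        from sums_Re[OF log_series.sums[OF this]] show ?thesis unfolding trm[OF that] .
      qed
      have Em: "E n (- t) = cnj (E n t)" for n
        unfolding E_def Arctan_cis_minus[OF True] by (simp add: exp_cnj)
      have "(\<lambda>n. w n * (cos (y * ln (real (Suc n))) * Re (E n t) + sin (y * ln (real (Suc n))) * Im (E n t)) +
           w n * (cos (y * ln (real (Suc n))) * Re (E n (- t)) + sin (y * ln (real (Suc n))) * Im (E n (- t)))) sums
         (Re (dirichlet_series logcoeff (shift \<eta> y (cis t))) + Re (dirichlet_series logcoeff (shift \<eta> y (cis (- t)))))"
        by (intro sums_add sms) (use True in auto)
      from sums_mult[OF this, of "cos t"] show ?thesis
        unfolding h_def y_def[symmetric] Em by (simp add: algebra_simps)
    qed
    have "(\<lambda>n. \<Sum>j\<le>N. b j * (2 * w n * cos (real j * \<tau> * ln (real (Suc n))) * (cos t * Re (E n t)))) sums (\<Sum>j\<le>N. b j * (h j t + h j (- t)))"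
      by (intro sums_sum sums_mult hs)
    moreover have "(\<Sum>j\<le>N. b j * (2 * w n * cos (real j * \<tau> * ln (real (Suc n))) * (cos t * Re (E n t)))) = q n t" for n
      by (simp add: q_def p_def sum_distrib_left sum_distrib_right mult_ac)
    moreover have "(\<Sum>j\<le>N. b j * (h j t + h j (- t))) = G t + G (- t)"
      by (simp add: G_def sum.distrib distrib_left)
    ultimately show ?thesis by simp
  qed
  define S where "S = (\<Sum>n. 2 * Bs * real (Suc n) powr (- (1 + \<eta>)))"
  have d1: "(\<lambda>t. \<Sum>n<k. q n t) integrable_on ?I" for k by (intro integrable_sum qint) auto
  have d2: "(\<lambda>_. S) integrable_on ?I" by (rule integrable_const_ivl)
  have d3: "norm (\<Sum>n<k. q n t) \<le> S" if t: "t \<in> ?I" for k t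
  proof -
    have "norm (\<Sum>n<k. q n t) \<le> (\<Sum>n<k. 2 * Bs * real (Suc n) powr (- (1 + \<eta>)))"
      using qb[OF t] by (intro sum_norm_le) auto
    also have "\<dots> \<le> S" unfolding S_def using Bs0 by (intro sum_le_suminf sm) auto
    finally show ?thesis .
  qed
  have d4: "(\<lambda>k. \<Sum>n<k. q n t) \<longlonglongrightarrow> G t + G (- t)" if "t \<in> ?I" for t
    using lim[OF that] unfolding sums_def .
  note dc = dominated_convergence[OF d1 d2 d3 d4]
  have "integral ?I (\<lambda>t. \<Sum>n<k. q n t) \<ge> 0" for k
  proof -
    have e: "integral ?I (\<lambda>t. \<Sum>n<k. q n t) = (\<Sum>n<k. integral ?I (q n))"
      by (rule integral_sum) (rule finite_lessThan, rule qint(1))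
    show ?thesis unfolding e by (rule sum_nonneg) (rule qint(2))
  qed
  hence pos: "integral ?I (\<lambda>t. G t + G (- t)) \<ge> 0" using LIMSEQ_le_const[OF dc(2)] by blast
  have G: "(G has_integral (\<Sum>j\<le>N. b j * integral ?I (h j))) ?I"
    unfolding G_def by (intro has_integral_sum has_integral_mult_right integrable_integral int) auto
  hence "((\<lambda>t. G (- t)) has_integral (\<Sum>j\<le>N. b j * integral ?I (h j))) ?I"
    using has_integral_reflect_real[of G _ "pi / 2" "- pi / 2"] by simp
  from integral_unique[OF has_integral_add[OF G this]] pos
  show "(\<Sum>j\<le>N. b j * integral ?I (h j)) \<ge> 0" by simp
qed

section \<open>The right arc summed over all heights, and positivity of the smoothed prime
  sum\<close>

context smoothing
begin

text \<open>Where cos t >= \<delta>, passing from radius R to radius 1 costs at most C (1 - R) /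
  \<delta>^2; where cos t < \<delta>, the trivial bound of order ln (1 / \<eta>) is damped by the
  factor cos t of the kernel. \<open>arc_positivity\<close> then trades the terms 1 <= j <= N for
  the term j = 0, whose integral is at most 2 (ln (1 / \<eta>) + C) because cos has integral 2 over
  the arc.\<close>

lemma right_bound:
  fixes b :: "nat \<Rightarrow> real" and N :: nat
  assumes b: "\<And>j. b j \<ge> 0" and P: "\<And>\<theta>. (\<Sum>j\<le>N. b j * cos (real j * \<theta>)) \<ge> 0"
  shows "\<exists>M \<epsilon>0. M > 0 \<and> \<epsilon>0 > 0 \<and> (\<forall>\<epsilon> x R \<delta> \<eta> \<tau>. 0 < \<epsilon> \<longrightarrow> \<epsilon> < \<epsilon>0 \<longrightarrow> 0 \<le> x \<longrightarrow> x \<le> 1 \<longrightarrow> 1 / 2 \<le> R \<longrightarrow> R \<le> 1 \<longrightarrow>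
     0 < \<delta> \<longrightarrow> 0 < \<eta> \<longrightarrow> \<eta> \<le> 1 \<longrightarrow>
     (\<forall>j\<in>{1..N}. (\<lambda>t. ln (norm (zeta (shift \<eta> (real j * \<tau>) (R * cis t)))) * K \<epsilon> x R t) integrable_on {- pi / 2..pi / 2}) \<longrightarrow>
     (\<Sum>j=1..N. b j * - integral {- pi / 2..pi / 2} (\<lambda>t. ln (norm (zeta (shift \<eta> (real j * \<tau>) (R * cis t)))) * K \<epsilon> x R t)) \<le>
       2 * f0 / R * b 0 * ln (1 / \<eta>) + M * (1 + (1 - R) / \<delta>\<^sup>2 + (\<delta> + \<epsilon>) * (ln (1 / \<eta>) + 1)))"
proof -
  obtain CK e0 where CK: "CK > 0" "e0 > 0" and KB: "\<And>\<epsilon> x R t. 0 < \<epsilon> \<Longrightarrow> \<epsilon> < e0 \<Longrightarrow> 0 \<le> x \<Longrightarrow> x \<le> 1 \<Longrightarrow> 1 / 2 \<le> R \<Longrightarrow> R \<le> 1 \<Longrightarrow>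
     \<bar>K \<epsilon> x R t - f0 * cos t / R\<bar> \<le> CK * \<epsilon>"
    using K_bounds by blast
  obtain C where C: "C > 0" and AB: "\<And>\<eta> y R t. 0 < \<eta> \<Longrightarrow> \<eta> \<le> 1 \<Longrightarrow> 1 / 2 \<le> R \<Longrightarrow> R \<le> 1 \<Longrightarrow>
     t \<in> {- pi / 2..pi / 2} \<Longrightarrow> cos t > 0 \<Longrightarrow> arc_bound C \<eta> y R t"
    using right_arc_pointwise by blast
  obtain W where W: "(arc_majorant has_integral W) {- pi / 2..pi / 2}" using arc_majorant_integral by blast
  have W0: "W \<ge> 0" using has_integral_nonneg[OF W] arc_majorant_nonneg by blast
  define Bs where "Bs = (\<Sum>j=1..N. b j)"
  have Bs0: "Bs \<ge> 0" unfolding Bs_def by (intro sum_nonneg b)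
  define Q where "Q = 2 * f0 * (C + 1) + CK * (C + 1)"
  define Q3 where "Q3 = 4 * f0 + 2 * CK"
  define M where "M = 4 * f0 * b 0 * C + Bs * (pi * (4 * Q) + Q3 * W) + 1"
  have Q0: "Q \<ge> 0" "Q3 \<ge> 0" using f0 C CK by (auto simp: Q_def Q3_def)
  have MM: "M > 0" "M \<ge> 4 * f0 * b 0 * C + Bs * (pi * (4 * Q) + Q3 * W)"
    using f0 b[of 0] C Bs0 Q0 W0 by (auto simp: M_def intro!: add_nonneg_pos add_nonneg_nonneg mult_nonneg_nonneg)
  show ?thesis
  proof (rule exI[of _ M], rule exI[of _ e0], intro conjI[of "M > 0"] conjI[of "e0 > 0"] allI impI MM CK)
    fix \<epsilon> x R \<delta> \<eta> \<tau> :: real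
    assume e: "0 < \<epsilon>" "\<epsilon> < e0" and x: "0 \<le> x" "x \<le> 1" and R: "1 / 2 \<le> R" "R \<le> 1" and \<delta>: "0 < \<delta>"
      and \<eta>: "0 < \<eta>" "\<eta> \<le> 1"
      and int: "\<forall>j\<in>{1..N}. (\<lambda>t. ln (norm (zeta (shift \<eta> (real j * \<tau>) (R * cis t)))) * K \<epsilon> x R t) integrable_on {- pi / 2..pi / 2}"
    let ?I = "{- pi / 2..pi / 2}"
    define l where "l = ln (1 / \<eta>)"
    have l: "l \<ge> 0" using \<eta> by (simp add: l_def)
    have Rp: "R > 0" using R by simp
    define f where "f = f0 / R"
    have f: "0 \<le> f" "f \<le> 2 * f0" using R f0 by (auto simp: f_def field_simps)
    define h where "h = (\<lambda>j t. cos t * Re (dirichlet_series logcoeff (shift \<eta> (real j * \<tau>) (cis t))))"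
    define g where "g = (\<lambda>j t. ln (norm (zeta (shift \<eta> (real j * \<tau>) (R * cis t)))) * K \<epsilon> x R t)"
    have hint: "h j integrable_on ?I" for j unfolding h_def by (rule arc_positivity(1)[OF \<eta> b P])
    have hpos: "(\<Sum>j\<le>N. b j * integral ?I (h j)) \<ge> 0" unfolding h_def by (rule arc_positivity(2)[OF \<eta> b P])
    define c2 where "c2 = f * (C + C * (1 - R) / \<delta>\<^sup>2 + \<delta> * (2 * l + 2 * C)) + CK * \<epsilon> * (l + C)"
    define c3 where "c3 = f * (2 * \<delta>) + 2 * CK * \<epsilon>"
    have pt: "- g j t \<le> - f * h j t + c2 + c3 * arc_majorant t" if t: "t \<in> {- pi / 2<..<pi / 2}" for j t
    proof -
      have ct: "cos t > 0" using t by (intro cos_gt_zero_pi) auto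
      define z d0 d1 where "z = ln (norm (zeta (shift \<eta> (real j * \<tau>) (R * cis t))))"
        and "d0 = Re (dirichlet_series logcoeff (shift \<eta> (real j * \<tau>) (R * cis t)))"
        and "d1 = Re (dirichlet_series logcoeff (shift \<eta> (real j * \<tau>) (cis t)))"
      have ab: "\<bar>z\<bar> \<le> l + C + 2 * arc_majorant t" "\<bar>d0\<bar> \<le> l + C + 2 * arc_majorant t" "\<bar>z - d0\<bar> \<le> C" "\<bar>d1\<bar> \<le> l + C"
          "\<bar>d0 - d1\<bar> \<le> C * (1 - R) / (cos t)\<^sup>2"
        using AB[OF \<eta> R _ ct, of "real j * \<tau>"] t unfolding arc_bound_def z_def d0_def d1_def l_def by auto
      have o: "arc_majorant t \<ge> 0" by (rule arc_majorant_nonneg)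
      have r1: "C * (1 - R) / \<delta>\<^sup>2 \<ge> 0" using C R by simp
      have dd: "cos t * \<bar>d0 - d1\<bar> \<le> C * (1 - R) / \<delta>\<^sup>2 + \<delta> * (2 * l + 2 * C + 2 * arc_majorant t)"
      proof (cases "cos t \<ge> \<delta>")
        case True
        have "\<bar>d0 - d1\<bar> \<le> C * (1 - R) / \<delta>\<^sup>2"
          using ab(5) by (rule order_trans) (use True \<delta> C R in \<open>intro frac_le power_mono; simp\<close>)
        moreover have "cos t * \<bar>d0 - d1\<bar> \<le> 1 * \<bar>d0 - d1\<bar>" by (intro mult_right_mono) auto
        moreover have "\<delta> * (2 * l + 2 * C + 2 * arc_majorant t) \<ge> 0" using \<delta> l C o by simp
        moreover have gen: "p \<le> A \<Longrightarrow> q \<le> 1 * p \<Longrightarrow> 0 \<le> E \<Longrightarrow> q \<le> A + E" for p q A E :: real by simp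
        ultimately show ?thesis by (intro gen)
      next
        case False
        have "\<bar>d0 - d1\<bar> \<le> 2 * l + 2 * C + 2 * arc_majorant t" using ab(2,4) by linarith
        hence "cos t * \<bar>d0 - d1\<bar> \<le> \<delta> * (2 * l + 2 * C + 2 * arc_majorant t)" using False ct \<delta> by (intro mult_mono) auto
        thus ?thesis using r1 by linarith
      qed
      have "- z \<le> - d1 + \<bar>d0 - d1\<bar> + C" using ab(3) by linarith
      hence "cos t * (- z) \<le> cos t * (- d1 + \<bar>d0 - d1\<bar> + C)" using ct by (intro mult_left_mono) auto
      also have "\<dots> = - (cos t * d1) + cos t * \<bar>d0 - d1\<bar> + cos t * C" by (simp add: algebra_simps)
      also have "\<dots> \<le> - (cos t * d1) + (C * (1 - R) / \<delta>\<^sup>2 + \<delta> * (2 * l + 2 * C + 2 * arc_majorant t)) + 1 * C"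
        using dd C by (intro add_mono mult_right_mono) auto
      finally have cz: "f * (cos t * (- z)) \<le> f * (- (cos t * d1) + (C * (1 - R) / \<delta>\<^sup>2 + \<delta> * (2 * l + 2 * C + 2 * arc_majorant t)) + C)"
        using f by (intro mult_left_mono) auto
      define k where "k = K \<epsilon> x R t - f * cos t"
      have k: "\<bar>k\<bar> \<le> CK * \<epsilon>" using KB[OF e x R, of t] by (simp add: k_def f_def)
      have "- z * k \<le> \<bar>k\<bar> * \<bar>z\<bar>" by (metis abs_ge_self abs_minus_cancel abs_mult mult.commute)
      also have "\<dots> \<le> (CK * \<epsilon>) * (l + C + 2 * arc_majorant t)" using k ab(1) CK e by (intro mult_mono) auto
      finally have zk: "- z * k \<le> (CK * \<epsilon>) * (l + C + 2 * arc_majorant t)" .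
      have "- g j t = f * (cos t * (- z)) + - z * k" by (simp add: g_def z_def k_def algebra_simps)
      also have "\<dots> \<le> f * (- (cos t * d1) + (C * (1 - R) / \<delta>\<^sup>2 + \<delta> * (2 * l + 2 * C + 2 * arc_majorant t)) + C) + (CK * \<epsilon>) * (l + C + 2 * arc_majorant t)"
        using cz zk by (rule add_mono)
      also have "\<dots> = - f * h j t + c2 + c3 * arc_majorant t" by (simp add: c2_def c3_def h_def d1_def algebra_simps)
      finally show ?thesis .
    qed
    have one: "- integral ?I (g j) \<le> - f * integral ?I (h j) + pi * c2 + c3 * W" if j: "j \<in> {1..N}" for j
    proof -
      have gi: "g j integrable_on ?I" using int j unfolding g_def by blast
      have Hi: "((\<lambda>t. - f * h j t + c2 + c3 * arc_majorant t) has_integral - f * integral ?I (h j) + (pi / 2 - - pi / 2) * c2 + c3 * W) ?I"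
        using has_integral_const_real[of c2 "- pi / 2" "pi / 2"]
        by (intro has_integral_add has_integral_mult_right integrable_integral hint W) auto
      \<comment> \<open>The pointwise estimate needs cos t > 0 and fails to cover the end points;
        open and closed interval have the same integral.\<close>
      have "integral {- pi / 2<..<pi / 2} (\<lambda>t. - g j t) \<le> integral {- pi / 2<..<pi / 2} (\<lambda>t. - f * h j t + c2 + c3 * arc_majorant t)"
        using gi Hi pt by (intro integral_le) (auto simp: integrable_on_open_interval_real intro: integrable_neg)
      hence "integral ?I (\<lambda>t. - g j t) \<le> integral ?I (\<lambda>t. - f * h j t + c2 + c3 * arc_majorant t)"
        by (simp only: integral_open_interval_real)
      also have "\<dots> = - f * integral ?I (h j) + pi * c2 + c3 * W" using integral_unique[OF Hi] by simp
      finally show ?thesis using gi by simp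
    qed
    have h0: "integral ?I (h 0) \<le> 2 * (l + C)"
    proof -
      have ci: "((\<lambda>t. (l + C) * cos t) has_integral (l + C) * 2) ?I"
      proof (rule has_integral_mult_right)
        have "(cos has_integral (sin (pi / 2) - sin (- pi / 2))) ?I"
          by (rule fundamental_theorem_of_calculus) (auto intro!: derivative_eq_intros simp flip: has_real_derivative_iff_has_vector_derivative)
        thus "(cos has_integral 2) ?I" by simp
      qed
      have "h 0 t \<le> (l + C) * cos t" if t: "t \<in> ?I" for t
      proof (cases "cos t > 0")
        case True
        have "\<bar>Re (dirichlet_series logcoeff (shift \<eta> (real 0 * \<tau>) (cis t)))\<bar> \<le> l + C"
          using AB[OF \<eta> R t True, of "real 0 * \<tau>"] unfolding arc_bound_def l_def by blast
        hence "cos t * Re (dirichlet_series logcoeff (shift \<eta> (real 0 * \<tau>) (cis t))) \<le> cos t * (l + C)"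
          using True by (intro mult_left_mono) auto
        thus ?thesis unfolding h_def by (simp only: mult.commute[of _ "cos t"])
      next
        case False
        hence "cos t = 0" using cos_ge_zero[of t] t by auto
        thus ?thesis by (simp add: h_def)
      qed
      hence "integral ?I (h 0) \<le> integral ?I (\<lambda>t. (l + C) * cos t)"
        using ci by (intro integral_le hint) auto
      thus ?thesis using integral_unique[OF ci] by simp
    qed
    have split: "(\<Sum>j\<le>N. b j * integral ?I (h j)) = b 0 * integral ?I (h 0) + (\<Sum>j=1..N. b j * integral ?I (h j))"
      by (simp add: sum.atMost_shift atLeast0AtMost[symmetric] sum.atLeast_Suc_atMost lessThan_atLeast0 sum.shift_bounds_Suc_ivl sum.atLeast1_atMost_eq)
    have "b 0 * integral ?I (h 0) \<le> b 0 * (2 * (l + C))" using h0 b[of 0] by (intro mult_left_mono) auto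
    hence neg: "- (\<Sum>j=1..N. b j * integral ?I (h j)) \<le> b 0 * (2 * (l + C))" using hpos split by linarith
    have "(\<Sum>j=1..N. b j * - integral ?I (g j)) \<le> (\<Sum>j=1..N. b j * (- f * integral ?I (h j) + pi * c2 + c3 * W))"
      by (intro sum_mono mult_left_mono one b) auto
    also have "\<dots> = f * - (\<Sum>j=1..N. b j * integral ?I (h j)) + Bs * (pi * c2 + c3 * W)"
      by (simp add: Bs_def sum_distrib_left sum_distrib_right sum.distrib[symmetric] sum_negf[symmetric] algebra_simps)
    also have "\<dots> \<le> f * (b 0 * (2 * (l + C))) + Bs * (pi * c2 + c3 * W)"
      using neg f by (intro add_right_mono mult_left_mono) auto
    also have "\<dots> \<le> 2 * f0 / R * b 0 * l + M * (1 + (1 - R) / \<delta>\<^sup>2 + (\<delta> + \<epsilon>) * (l + 1))"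
    proof -
      define X where "X = 1 + (1 - R) / \<delta>\<^sup>2 + (\<delta> + \<epsilon>) * (l + 1)"
      have q: "(1 - R) / \<delta>\<^sup>2 \<ge> 0" "(\<delta> + \<epsilon>) * (l + 1) \<ge> 0" using R \<delta> e l by auto
      have X1: "X \<ge> 1" "X \<ge> (1 - R) / \<delta>\<^sup>2" "X \<ge> (\<delta> + \<epsilon>) * (l + 1)" using q by (auto simp: X_def)
      have X2: "X \<ge> \<delta> * (l + 1)" "X \<ge> \<epsilon> * (l + 1)"
        using X1(3) \<delta> e l by (auto simp: distrib_right intro: order_trans[rotated])
      have Xd: "X \<ge> \<delta> + \<epsilon>"
        by (rule order_trans[OF _ X1(3)]) (use \<delta> e l mult_left_mono[of 1 "l + 1" "\<delta> + \<epsilon>"] in simp)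
      have a1: "f * (C + C * (1 - R) / \<delta>\<^sup>2 + \<delta> * (2 * l + 2 * C)) \<le> (2 * f0) * ((C + 1) * (4 * X))"
      proof (intro mult_mono f)
        have "C * (1 - R) / \<delta>\<^sup>2 \<le> C * X" using X1(2) C mult_left_mono[OF X1(2), of C] by simp
        moreover have "C * 1 \<le> C * X" using X1 C by (intro mult_left_mono) auto
        moreover have "\<delta> * (2 * l + 2 * C) \<le> (C + 1) * (2 * X)"
        proof -
          have "2 * l + 2 * C \<le> (C + 1) * (2 * (l + 1))" using C l by (simp add: algebra_simps)
          hence "\<delta> * (2 * l + 2 * C) \<le> \<delta> * ((C + 1) * (2 * (l + 1)))" using \<delta> by (intro mult_left_mono) auto
          also have "\<dots> = (C + 1) * (2 * (\<delta> * (l + 1)))" by simp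
          also have "\<dots> \<le> (C + 1) * (2 * X)" using X2 C by (intro mult_left_mono) auto
          finally show ?thesis .
        qed
        ultimately have "C + C * (1 - R) / \<delta>\<^sup>2 + \<delta> * (2 * l + 2 * C) \<le> C * X + C * X + (C + 1) * (2 * X)" by linarith
        also have "\<dots> \<le> (C + 1) * (4 * X)" using C X1 by (simp add: algebra_simps)
        finally show "C + C * (1 - R) / \<delta>\<^sup>2 + \<delta> * (2 * l + 2 * C) \<le> (C + 1) * (4 * X)" .
      qed (use C \<delta> l R f0 in auto)
      have a2: "CK * \<epsilon> * (l + C) \<le> CK * ((C + 1) * (4 * X))"
      proof -
        have "l + C \<le> (C + 1) * (l + 1)" using C l by (simp add: algebra_simps)
        hence "CK * (\<epsilon> * (l + C)) \<le> CK * (\<epsilon> * ((C + 1) * (l + 1)))" using CK e by (intro mult_left_mono) auto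
        also have "\<dots> = CK * ((C + 1) * (\<epsilon> * (l + 1)))" by simp
        also have "\<dots> \<le> CK * ((C + 1) * (4 * X))" using CK C X2 X1 by (intro mult_left_mono) auto
        finally show ?thesis by (simp add: mult.assoc)
      qed
      have c2b: "c2 \<le> 4 * Q * X" using a1 a2 by (simp add: c2_def Q_def algebra_simps)
      have c3b: "c3 \<le> Q3 * X"
      proof -
        have "f * (2 * \<delta>) \<le> 2 * f0 * (2 * X)" using f \<delta> Xd e f0 by (intro mult_mono) auto
        moreover have "2 * CK * \<epsilon> \<le> 2 * CK * X" using CK Xd \<delta> by (intro mult_left_mono) auto
        ultimately show ?thesis by (simp add: c3_def Q3_def algebra_simps)
      qed
      have "Bs * (pi * c2 + c3 * W) \<le> Bs * (pi * (4 * Q * X) + (Q3 * X) * W)"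
        using Bs0 W0 c2b c3b by (intro mult_left_mono add_mono mult_right_mono) auto
      moreover have "f * (b 0 * (2 * (l + C))) \<le> 2 * f0 / R * b 0 * l + 4 * f0 * b 0 * C * X"
      proof -
        have "f * (b 0 * (2 * C)) \<le> 2 * f0 * (b 0 * (2 * C))" using f b[of 0] C by (intro mult_right_mono) auto
        also have "\<dots> = 4 * f0 * b 0 * C * 1" by simp
        also have "\<dots> \<le> 4 * f0 * b 0 * C * X" using X1 f0 b[of 0] C by (intro mult_left_mono) auto
        finally show ?thesis by (simp add: f_def algebra_simps)
      qed
      moreover have "(4 * f0 * b 0 * C + Bs * (pi * (4 * Q) + Q3 * W)) * X \<le> M * X"
        using MM X1 by (intro mult_right_mono) auto
      ultimately show ?thesis unfolding X_def[symmetric] by (simp add: algebra_simps)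
    qed
    finally show "(\<Sum>j=1..N. b j * - integral ?I (\<lambda>t. ln (norm (zeta (shift \<eta> (real j * \<tau>) (R * cis t)))) * K \<epsilon> x R t)) \<le>
       2 * f0 / R * b 0 * ln (1 / \<eta>) + M * (1 + (1 - R) / \<delta>\<^sup>2 + (\<delta> + \<epsilon>) * (ln (1 / \<eta>) + 1))"
      unfolding g_def l_def .
  qed
qed

definition sample_point :: "real \<Rightarrow> real \<Rightarrow> nat \<Rightarrow> complex" where
  "sample_point \<mu> x k = 1 + of_real \<mu> * (a k - of_real x)"

lemma smoothed_positivity:
  fixes b :: "nat \<Rightarrow> real" and N :: nat
  assumes b: "\<And>j. b j \<ge> 0" and P: "\<And>\<theta>. (\<Sum>j\<le>N. b j * cos (real j * \<theta>)) \<ge> 0"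
    and \<mu>: "\<mu> > 0" and x: "x \<le> 1"
  shows "(\<Sum>j\<le>N. b j * Re (\<Sum>k\<in>I. c k * dirichlet_series mangoldt (sample_point \<mu> x k + \<i> * of_real (real j * t)))) \<ge> 0"
proof -
  define s where "s = (\<lambda>j k. sample_point \<mu> x k + \<i> * of_real (real j * t))"
  have Re_s: "Re (s j k) > 1" if "k \<in> I" for j k
    using a_gt[OF that] \<mu> x by (simp add: s_def sample_point_def)
  define f where "f = (\<lambda>n. \<Sum>k\<in>I. c k * exp (- (a k * of_real (\<mu> * ln (real (Suc n))))))"
  have f: "f n \<in> \<real>" "Re (f n) \<ge> 0" for n
    unfolding f_def using f_nonneg[of "\<mu> * ln (real (Suc n))"] \<mu> by auto
  define v where "v = (\<lambda>n. mangoldt (Suc n) * exp (- ((1 - \<mu> * x) * ln (real (Suc n)))) :: real)"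
  have v: "v n \<ge> 0" for n by (simp add: v_def mangoldt_nonneg)
  have trm: "(\<Sum>k\<in>I. c k * (of_real (mangoldt (Suc n)) * of_nat (Suc n) powr (- s j k))) =
      of_real (v n) * cis (- (real j * (t * ln (real (Suc n))))) * f n" for n j
    unfolding f_def sum_distrib_left
  proof (rule sum.cong[OF refl])
    fix k
    let ?l = "ln (real (Suc n))"
    have "of_nat (Suc n) powr (- s j k) = exp (- s j k * of_real ?l)"
      by (simp add: powr_def Ln_of_nat del: of_nat_Suc)
    also have "- s j k * of_real ?l = of_real (- ((1 - \<mu> * x) * ?l)) + \<i> * of_real (- (real j * (t * ?l))) + - (a k * of_real (\<mu> * ?l))"
      by (simp add: s_def sample_point_def algebra_simps del: of_nat_Suc)
    also have "exp \<dots> = of_real (exp (- ((1 - \<mu> * x) * ?l))) * cis (- (real j * (t * ?l))) * exp (- (a k * of_real (\<mu> * ?l)))"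
      unfolding exp_add exp_of_real cis_conv_exp ..
    finally have e: "of_nat (Suc n) powr (- s j k) = of_real (exp (- ((1 - \<mu> * x) * ?l))) * cis (- (real j * (t * ?l))) * exp (- (a k * of_real (\<mu> * ?l)))" .
    show "c k * (of_real (mangoldt (Suc n)) * of_nat (Suc n) powr (- s j k)) =
       of_real (v n) * cis (- (real j * (t * ?l))) * (c k * exp (- (a k * of_real (\<mu> * ?l))))"
      unfolding e v_def of_real_mult by (simp only: mult_ac)
  qed
  have S: "(\<lambda>n. \<Sum>j\<le>N. b j * Re (\<Sum>k\<in>I. c k * (of_real (mangoldt (Suc n)) * of_nat (Suc n) powr (- s j k)))) sums
     (\<Sum>j\<le>N. b j * Re (\<Sum>k\<in>I. c k * dirichlet_series mangoldt (s j k)))"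
    by (intro sums_sum sums_mult sums_Re mangoldt_series.sums Re_s)
  have nn: "(\<Sum>j\<le>N. b j * Re (\<Sum>k\<in>I. c k * (of_real (mangoldt (Suc n)) * of_nat (Suc n) powr (- s j k)))) \<ge> 0" for n
  proof -
    have "Re (of_real (v n) * cis (- (real j * (t * ln (real (Suc n))))) * f n) = v n * Re (f n) * cos (real j * (t * ln (real (Suc n))))" for j
    proof -
      obtain r where r: "f n = of_real r" using f(1)[of n] by (auto elim: Reals_cases)
      show ?thesis unfolding r by simp
    qed
    hence "(\<Sum>j\<le>N. b j * Re (\<Sum>k\<in>I. c k * (of_real (mangoldt (Suc n)) * of_nat (Suc n) powr (- s j k)))) =
       v n * Re (f n) * (\<Sum>j\<le>N. b j * cos (real j * (t * ln (real (Suc n)))))"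
      unfolding trm by (simp only: sum_distrib_left) (simp only: mult_ac)
    thus ?thesis using v f(2) P[of "t * ln (real (Suc n))"] by simp
  qed
  have "0 \<le> (\<Sum>j\<le>N. b j * Re (\<Sum>k\<in>I. c k * dirichlet_series mangoldt (s j k)))"
    unfolding sums_unique[OF S] by (rule suminf_nonneg[OF sums_summable[OF S] nn])
  thus ?thesis by (simp only: s_def)
qed

end

section \<open>The zero detector\<close>

lemma Arctan_bounded_ball:
  assumes "r < 1"
  shows "\<exists>C>0. \<forall>u. norm u \<le> r \<longrightarrow> norm (Arctan u) \<le> C"
proof -
  have "cball 0 r \<subseteq> ball (0 :: complex) 1" using assms by auto
  hence "compact (Arctan ` cball 0 r)"
    by (intro compact_continuous_image holomorphic_on_imp_continuous_on holomorphic_on_subset[OF Arctan_holomorphic_ball]) auto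
  then obtain C where "C > 0" "\<And>z. z \<in> Arctan ` cball 0 r \<Longrightarrow> norm z \<le> C"
    using compact_imp_bounded bounded_pos by metis
  thus ?thesis by (intro exI[of _ C]) auto
qed

lemma Im_shift: "Im (shift \<eta> y u) = y + 4 * \<eta> / pi * Im (Arctan u)"
  by (simp add: shift_def)

lemma shift_has_derivative:
  assumes "norm u < 1"
  shows "(shift \<eta> y has_field_derivative of_real (4 * \<eta> / pi) * inverse (1 + u\<^sup>2)) (at u)"
proof -
  have "(Arctan has_field_derivative inverse (1 + u\<^sup>2)) (at u)"
  proof (rule has_field_derivative_Arctan)
    show "\<bar>Im u\<bar> < 1" using assms abs_Im_le_cmod[of u] by linarith
  qed
  from DERIV_add[OF DERIV_const[of "1 + \<i> * of_real y"] DERIV_cmult[OF this, of "of_real (4 * \<eta> / pi)"]] show ?thesis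
    unfolding shift_def[abs_def] by (simp only: add_0)
qed

lemma zeta_shift_holomorphic:
  assumes "r \<le> 1" "\<And>u. norm u < r \<Longrightarrow> shift \<eta> y u \<noteq> 1"
  shows "(\<lambda>u. zeta (shift \<eta> y u)) holomorphic_on ball 0 r"
proof (rule holomorphic_on_compose_gen[OF _ zeta_holomorphic, unfolded o_def])
  show "shift \<eta> y holomorphic_on ball 0 r"
    unfolding shift_def[abs_def] using assms(1)
    by (intro holomorphic_intros holomorphic_on_subset[OF Arctan_holomorphic_ball]) auto
  show "shift \<eta> y ` ball 0 r \<subseteq> - {1}" using assms(2) by auto
qed

section \<open>The pole term and the passage from the strip to the disc\<close>

context smoothing
begin

text \<open>The k-th sample point differs from the pole by \<mu> (a k - x), so the principal parts
  add up to F (- x) / \<mu>.\<close>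

lemma pole_bound:
  "\<exists>C \<mu>0. C > 0 \<and> \<mu>0 > 0 \<and> (\<forall>\<mu> x. 0 < \<mu> \<longrightarrow> \<mu> < \<mu>0 \<longrightarrow> 0 \<le> x \<longrightarrow> x \<le> 1 \<longrightarrow>
     Re (\<Sum>k\<in>I. c k * dirichlet_series mangoldt (sample_point \<mu> x k)) \<le> Re (F (- of_real x)) / \<mu> + C)"
proof -
  obtain C r where r: "r > 0" and C: "\<And>s. Re s > 1 \<Longrightarrow> norm (s - 1) < r \<Longrightarrow> norm (dirichlet_series mangoldt s - 1 / (s - 1)) \<le> C"
    by (rule mangoldt_series_near_1) (rule that, assumption+)
  define A where "A = (\<Sum>k\<in>I. norm (a k)) + 1"
  have A1: "A \<ge> 1" by (simp add: A_def sum_nonneg)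
  show ?thesis
  proof (rule exI[of _ "coeff_norm * \<bar>C\<bar> + 1"], rule exI[of _ "r / A"], intro conjI allI impI)
    show "coeff_norm * \<bar>C\<bar> + 1 > 0" using coeff_norm_nonneg by (simp add: add_nonneg_pos)
    show "r / A > 0" using r A1 by simp
    fix \<mu> x :: real assume \<mu>: "0 < \<mu>" "\<mu> < r / A" and x: "0 \<le> x" "x \<le> 1"
    have b: "norm (dirichlet_series mangoldt (sample_point \<mu> x k) - of_real (1 / \<mu>) * (1 / (- of_real x + a k))) \<le> \<bar>C\<bar>" if k: "k \<in> I" for k
    proof -
      have R: "Re (sample_point \<mu> x k) > 1" using a_gt[OF k] \<mu> x by (simp add: sample_point_def)
      have "norm (a k) \<le> (\<Sum>k\<in>I. norm (a k))" by (rule member_le_sum[OF k]) (auto simp: fin)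
      hence "norm (a k - of_real x) \<le> A" using norm_triangle_ineq4[of "a k" "of_real x"] x by (simp add: A_def)
      hence "norm (sample_point \<mu> x k - 1) \<le> \<mu> * A" using \<mu> by (simp add: sample_point_def norm_mult mult_left_mono)
      also have "\<dots> < r" using \<mu> A1 by (simp add: field_simps)
      finally have "norm (dirichlet_series mangoldt (sample_point \<mu> x k) - 1 / (sample_point \<mu> x k - 1)) \<le> C" by (rule C[OF R])
      moreover have "1 / (sample_point \<mu> x k - 1) = of_real (1 / \<mu>) * (1 / (- of_real x + a k))"
        using \<mu> by (simp add: sample_point_def)
      ultimately show ?thesis by simp
    qed
    have e: "(\<Sum>k\<in>I. c k * (of_real (1 / \<mu>) * (1 / (- of_real x + a k)))) = of_real (1 / \<mu>) * F (- of_real x)"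
      unfolding F_def sum_distrib_left by (intro sum.cong refl) simp
    have "norm ((\<Sum>k\<in>I. c k * dirichlet_series mangoldt (sample_point \<mu> x k)) - of_real (1 / \<mu>) * F (- of_real x)) \<le> coeff_norm * \<bar>C\<bar>"
      unfolding e[symmetric] by (rule norm_weighted_sum_le) (rule b)
    hence "Re ((\<Sum>k\<in>I. c k * dirichlet_series mangoldt (sample_point \<mu> x k)) - of_real (1 / \<mu>) * F (- of_real x)) \<le> coeff_norm * \<bar>C\<bar>"
      by (rule order_trans[OF complex_Re_le_cmod])
    moreover have "Re (of_real (1 / \<mu>) * F (- of_real x)) = Re (F (- of_real x)) / \<mu>"
      by (simp only: times_complex.sel Re_complex_of_real Im_complex_of_real) simp
    ultimately show "Re (\<Sum>k\<in>I. c k * dirichlet_series mangoldt (sample_point \<mu> x k)) \<le> Re (F (- of_real x)) / \<mu> + (coeff_norm * \<bar>C\<bar> + 1)"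
      by (simp only: minus_complex.sel)
  qed
qed

lemma mangoldt_disc_point:
  fixes \<epsilon> \<eta> x y :: real
  assumes k: "k \<in> I" and \<epsilon>: "\<epsilon> > 0" and \<eta>: "\<eta> > 0" and x: "x \<le> 1"
    and z: "norm (of_real \<epsilon> * (a k - of_real x)) \<le> 1" and u: "norm (disc_point \<epsilon> x k) < 1"
  defines "g \<equiv> (\<lambda>u. zeta (shift \<eta> y u))"
  shows "dirichlet_series mangoldt (sample_point (4 * \<eta> * \<epsilon> / pi) x k + \<i> * of_real y) =
    of_real (pi / (4 * \<eta>)) * ((1 + (disc_point \<epsilon> x k)\<^sup>2) * - (deriv g (disc_point \<epsilon> x k) / g (disc_point \<epsilon> x k)))"
proof -
  define v where "v = disc_point \<epsilon> x k"
  have "\<bar>Re (of_real \<epsilon> * (a k - of_real x))\<bar> < pi / 2"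
    using abs_Re_le_cmod[of "of_real \<epsilon> * (a k - of_real x)"] z pi_gt3 by linarith
  hence A: "Arctan v = of_real \<epsilon> * (a k - of_real x)" unfolding v_def disc_point_def by (rule Arctan_tan)
  have s: "shift \<eta> y v = sample_point (4 * \<eta> * \<epsilon> / pi) x k + \<i> * of_real y"
    unfolding shift_def A sample_point_def by (simp add: mult_ac)
  have p: "4 * \<eta> * \<epsilon> / pi * (Re (a k) - x) > 0" using a_gt[OF k] \<eta> \<epsilon> x by simp
  have R: "Re (shift \<eta> y v) > 1" unfolding s sample_point_def using p by simp
  have n: "norm (v\<^sup>2) < 1" using u unfolding v_def norm_power by (simp add: power_less_one_iff)
  have v1: "1 + v\<^sup>2 \<noteq> 0"
  proof
    assume "1 + v\<^sup>2 = 0"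
    hence "v\<^sup>2 = - 1" by (simp add: eq_neg_iff_add_eq_0 add.commute)
    thus False using n by simp
  qed
  have "(g has_field_derivative - (dirichlet_series mangoldt (shift \<eta> y v) * zeta (shift \<eta> y v)) * (of_real (4 * \<eta> / pi) * inverse (1 + v\<^sup>2))) (at v)"
    unfolding g_def
    by (rule DERIV_chain2[OF zeta_deriv_mangoldt[OF R, THEN has_field_derivative_at_within, of UNIV, simplified] shift_has_derivative])
       (use u in \<open>simp add: v_def\<close>)
  hence d: "deriv g v = - (dirichlet_series mangoldt (shift \<eta> y v) * g v) * (of_real (4 * \<eta> / pi) * inverse (1 + v\<^sup>2))"
    unfolding g_def by (rule DERIV_imp_deriv)
  have gv: "g v \<noteq> 0" unfolding g_def by (rule zeta_nonzero_gt1[OF R])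
  have gen: "D = of_real (pi / (4 * \<eta>)) * (q * - (- (D * G) * (of_real (4 * \<eta> / pi) * inverse q) / G))" if "q \<noteq> 0" "G \<noteq> 0" for D q G :: complex
    using that \<eta> by (simp add: field_simps)
  show ?thesis unfolding v_def[symmetric] d s[symmetric] by (rule gen[OF v1 gv])
qed

end

text \<open>Finitely many zeros in a compact disc exclude finitely many radii. One radius has to
  serve all \<open>j\<close>, because \<open>right_bound\<close> combines the functions on a single
  circle. The value at the real point \<open>R0\<close> rules out that some \<open>g j\<close>
  vanishes identically.\<close>

lemma zero_free_radius:
  fixes g :: "nat \<Rightarrow> complex \<Rightarrow> complex"
  assumes g: "\<And>j. j \<in> J \<Longrightarrow> g j holomorphic_on ball 0 r" and J: "finite J"
    and nz: "\<And>j. j \<in> J \<Longrightarrow> g j (of_real R0) \<noteq> 0" and R: "0 \<le> R0" "R0 < R1" "R1 < r"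
  shows "\<exists>R. R0 < R \<and> R < R1 \<and> (\<forall>j\<in>J. \<forall>w. norm w = R \<longrightarrow> g j w \<noteq> 0)"
proof -
  have f: "finite {z \<in> cball 0 R1. g j z = 0}" if j: "j \<in> J" for j
  proof (cases "g j constant_on ball 0 r")
    case True
    have "of_real R0 \<in> ball (0 :: complex) r" using R by simp
    hence "g j z \<noteq> 0" if "z \<in> cball 0 R1" for z
      using True nz[OF j] that R unfolding constant_on_def by (metis le_less_trans mem_ball_0 mem_cball_0)
    thus ?thesis by (simp add: Collect_conj_eq[symmetric] cong: conj_cong)
  next
    case False
    show ?thesis by (rule holomorphic_compact_finite_zeros[OF g[OF j] _ _ _ _ False]) (use R in auto)
  qed
  have fin: "finite (norm ` (\<Union>j\<in>J. {z \<in> cball 0 R1. g j z = 0}))" using J f by auto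
  have "infinite {R0<..<R1}" using R(2) by (rule infinite_Ioo)
  then obtain R where R': "R \<in> {R0<..<R1}" "R \<notin> norm ` (\<Union>j\<in>J. {z \<in> cball 0 R1. g j z = 0})"
    using finite_subset[OF _ fin] by blast
  show ?thesis
  proof (intro exI[of _ R] conjI ballI allI impI)
    fix j and w :: complex assume j: "j \<in> J" and w: "norm w = R"
    show "g j w \<noteq> 0"
    proof
      assume "g j w = 0"
      hence "w \<in> (\<Union>j\<in>J. {z \<in> cball 0 R1. g j z = 0})" using j w R' by auto
      thus False using R'(2) w by blast
    qed
  qed (use R' in auto)
qed

section \<open>Assembly of the detector inequality\<close>

context smoothing
begin

text \<open>\<open>M\<close> and \<open>e1\<close> depend only on the smoothing function,
  \<open>b\<close>, \<open>N\<close> and \<open>R0\<close>. With \<mu> = 4 \<eta> \<epsilon> / pi,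
  the chosen zero is (z0 + x) \<mu> to the left of the line \<open>Re s = 1\<close> and every zero
  near the heights j t at least x \<mu>; measured from 1 - x \<mu> the pole lies at - x and the zero
  at z0, whence the two values of \<open>F\<close>. The actual radius varies with t, but it exceeds
  \<open>R0\<close>, which bounds the factor 1 / R.\<close>

lemma detector_inequality:
  fixes b :: "nat \<Rightarrow> real" and N :: nat
  assumes b: "\<And>j. b j \<ge> 0" and P: "\<And>\<theta>. (\<Sum>j\<le>N. b j * cos (real j * \<theta>)) \<ge> 0"
    and N: "N \<ge> 1" and R0: "1 / 2 \<le> R0" "R0 < 1"
  shows "\<exists>M e1. M > 0 \<and> e1 > 0 \<and> (\<forall>t \<eta> \<epsilon> x \<delta> U z0. t \<ge> 2 \<longrightarrow> 0 < \<eta> \<longrightarrow> \<eta> < e1 \<longrightarrow> 0 < \<epsilon> \<longrightarrow> \<epsilon> < e1 \<longrightarrow>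
     0 \<le> x \<longrightarrow> x \<le> 1 \<longrightarrow> 0 < \<delta> \<longrightarrow> 0 \<le> U \<longrightarrow> 0 \<le> z0 \<longrightarrow> z0 \<le> 1 \<longrightarrow>
     (\<forall>j\<in>{1..N}. \<forall>\<rho>. zeta \<rho> = 0 \<longrightarrow> \<bar>Im \<rho> - real j * t\<bar> \<le> 1 \<longrightarrow> Re \<rho> \<le> 1 - x * (4 * \<eta> * \<epsilon> / pi)) \<longrightarrow>
     (\<forall>j\<in>{1..N}. \<forall>s. 1 - \<eta> \<le> Re s \<longrightarrow> Re s \<le> 1 \<longrightarrow> \<bar>Im s - real j * t\<bar> \<le> 1 \<longrightarrow> norm (zeta s) \<le> exp U) \<longrightarrow>
     zeta (Complex (1 - (z0 + x) * (4 * \<eta> * \<epsilon> / pi)) t) = 0 \<longrightarrow>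
     b 1 * Re (F (of_real z0)) - b 0 * Re (F (- of_real x)) \<le>
       \<epsilon> * (2 * f0 / (pi * R0) * ((\<Sum>j=1..N. b j) * U + b 0 * ln (1 / \<eta>)) +
            M * (1 + 1 / \<delta>\<^sup>2 + \<epsilon> * U + (\<delta> + \<epsilon>) * (ln (1 / \<eta>) + 1))))"
proof -
  \<comment> \<open>The circle is chosen with radius between \<open>R0\<close> and
    \<open>R1\<close>, the functions are holomorphic up to radius \<open>r\<close>, and r < 1 keeps
    \<open>Arctan\<close> bounded, hence the image within distance 1 of the height j t once \<eta>
    is small.\<close>
  define r where "r = (3 + R0) / 4"
  define R1 where "R1 = (1 + R0) / 2"
  have r: "R0 < R1" "R1 < r" "r < 1" using R0 by (auto simp: r_def R1_def)
  obtain CA where CA: "CA > 0" "\<And>u. norm u \<le> r \<Longrightarrow> norm (Arctan u) \<le> CA" using Arctan_bounded_ball[OF r(3)] by blast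
  from local_bound obtain CL eL where CL: "CL > 0" "eL > 0" and LBo: "\<forall>\<epsilon> x R r g U. 0 < \<epsilon> \<longrightarrow> \<epsilon> < eL \<longrightarrow> 0 \<le> x \<longrightarrow> x \<le> 1 \<longrightarrow> 1 / 2 \<le> R \<longrightarrow> R < 1 \<longrightarrow> R < r \<longrightarrow>
     g holomorphic_on ball 0 r \<longrightarrow> (\<forall>w. norm w = R \<longrightarrow> g w \<noteq> 0) \<longrightarrow>
     (\<forall>\<alpha>. norm \<alpha> < R \<longrightarrow> g \<alpha> = 0 \<longrightarrow> Re (Arctan \<alpha>) \<le> - (\<epsilon> * x)) \<longrightarrow>
     0 \<le> U \<longrightarrow> (\<forall>w. norm w = R \<longrightarrow> Re w \<le> 0 \<longrightarrow> norm (g w) \<le> exp U) \<longrightarrow>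
     (\<lambda>t. ln (norm (g (R * cis t))) * K \<epsilon> x R t) integrable_on {- pi / 2..pi / 2} \<and>
     (\<exists>Zs. Zs \<ge> 0 \<and> (\<forall>z0. 0 \<le> z0 \<longrightarrow> z0 \<le> 1 \<longrightarrow> g (tan (- of_real (\<epsilon> * (z0 + x)))) = 0 \<longrightarrow> Zs \<ge> Re (F (of_real z0)) / \<epsilon> - CL) \<and>
     Re (\<Sum>k\<in>I. c k * ((1 + (disc_point \<epsilon> x k)\<^sup>2) * - (deriv g (disc_point \<epsilon> x k) / g (disc_point \<epsilon> x k)))) \<le>
       (U * (2 * f0 / R + CL * \<epsilon>) - integral {- pi / 2..pi / 2} (\<lambda>t. ln (norm (g (R * cis t))) * K \<epsilon> x R t)) / pi - Zs)"
    by (elim exE conjE) (rule that)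
  obtain MR eR where MR: "MR > 0" "eR > 0" and RB: "\<And>\<epsilon> x R \<delta> \<eta> \<tau>. 0 < \<epsilon> \<Longrightarrow> \<epsilon> < eR \<Longrightarrow> 0 \<le> x \<Longrightarrow> x \<le> 1 \<Longrightarrow> 1 / 2 \<le> R \<Longrightarrow> R \<le> 1 \<Longrightarrow>
     0 < \<delta> \<Longrightarrow> 0 < \<eta> \<Longrightarrow> \<eta> \<le> 1 \<Longrightarrow>
     (\<forall>j\<in>{1..N}. (\<lambda>t. ln (norm (zeta (shift \<eta> (real j * \<tau>) (R * cis t)))) * K \<epsilon> x R t) integrable_on {- pi / 2..pi / 2}) \<Longrightarrow>
     (\<Sum>j=1..N. b j * - integral {- pi / 2..pi / 2} (\<lambda>t. ln (norm (zeta (shift \<eta> (real j * \<tau>) (R * cis t)))) * K \<epsilon> x R t)) \<le>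
       2 * f0 / R * b 0 * ln (1 / \<eta>) + MR * (1 + (1 - R) / \<delta>\<^sup>2 + (\<delta> + \<epsilon>) * (ln (1 / \<eta>) + 1))"
    using right_bound[of b N, OF b P] by blast
  obtain CP mP where CP: "CP > 0" "mP > 0" and PB: "\<And>\<mu> x. 0 < \<mu> \<Longrightarrow> \<mu> < mP \<Longrightarrow> 0 \<le> x \<Longrightarrow> x \<le> 1 \<Longrightarrow>
     Re (\<Sum>k\<in>I. c k * dirichlet_series mangoldt (sample_point \<mu> x k)) \<le> Re (F (- of_real x)) / \<mu> + CP"
    using pole_bound by blast
  obtain CU eU where CU: "CU \<ge> 1" "eU > 0" and UB: "\<And>\<epsilon> x k. 0 < \<epsilon> \<Longrightarrow> \<epsilon> < eU \<Longrightarrow> 0 \<le> x \<Longrightarrow> x \<le> 1 \<Longrightarrow> k \<in> I \<Longrightarrow>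
     norm (disc_point \<epsilon> x k) \<le> CU * \<epsilon> \<and> norm (of_real \<epsilon> * (a k - of_real x)) \<le> 1"
    using disc_point_approx by blast
  define Bs where "Bs = (\<Sum>j=1..N. b j)"
  have Bs0: "Bs \<ge> 0" unfolding Bs_def by (intro sum_nonneg b)
  \<comment> \<open>\<open>mP / 4\<close> forces \<mu> <= 2 \<eta> < mP, \<open>1 / (2 * CU)\<close>
    puts the sample points inside the disc, and \<open>1 / (2 * CA)\<close> bounds the vertical
    extent of the image of the disc.\<close>
  define e1 where "e1 = min (min (min eL eR) (min eU (mP / 4))) (min (min (1 / (2 * CU)) (1 / (2 * CA))) (1 / 4))"
  have e1: "e1 > 0" using CL MR CU CP CA by (simp add: e1_def)
  have e1l: "e1 \<le> eL" "e1 \<le> eR" "e1 \<le> eU" "e1 \<le> mP / 4" "e1 \<le> 1 / (2 * CU)" "e1 \<le> 1 / (2 * CA)" "e1 \<le> 1 / 4"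
    unfolding e1_def min_le_iff_disj by blast+
  define M where "M = 2 * b 0 * CP + Bs * CL + MR + b 1 * CL"
  have M: "M > 0" using b[of 0] b[of 1] CP CL MR Bs0 by (simp add: M_def add_nonneg_pos add_pos_nonneg)
  show ?thesis
  proof (rule exI[of _ M], rule exI[of _ e1], intro conjI[of "M > 0"] conjI[of "e1 > 0"] allI impI M e1)
    fix t \<eta> \<epsilon> x \<delta> U z0 :: real
    assume t: "t \<ge> 2" and \<eta>: "0 < \<eta>" "\<eta> < e1" and \<epsilon>: "0 < \<epsilon>" "\<epsilon> < e1" and x: "0 \<le> x" "x \<le> 1" and \<delta>: "0 < \<delta>"
      and U: "0 \<le> U" and z0: "0 \<le> z0" "z0 \<le> 1"
      and zf: "\<forall>j\<in>{1..N}. \<forall>\<rho>. zeta \<rho> = 0 \<longrightarrow> \<bar>Im \<rho> - real j * t\<bar> \<le> 1 \<longrightarrow> Re \<rho> \<le> 1 - x * (4 * \<eta> * \<epsilon> / pi)"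
      and ub: "\<forall>j\<in>{1..N}. \<forall>s. 1 - \<eta> \<le> Re s \<longrightarrow> Re s \<le> 1 \<longrightarrow> \<bar>Im s - real j * t\<bar> \<le> 1 \<longrightarrow> norm (zeta s) \<le> exp U"
      and zero: "zeta (Complex (1 - (z0 + x) * (4 * \<eta> * \<epsilon> / pi)) t) = 0"
    define \<mu> where "\<mu> = 4 * \<eta> * \<epsilon> / pi"
    have \<mu>0: "\<mu> > 0" using \<eta> \<epsilon> by (simp add: \<mu>_def)
    have p34: "4 * \<eta> / pi \<le> 2 * \<eta>" using \<eta> pi_gt3 by (simp add: field_simps)
    have "\<mu> = (4 * \<eta> / pi) * \<epsilon>" by (simp add: \<mu>_def)
    also have "\<dots> \<le> (2 * \<eta>) * \<epsilon>" using p34 \<epsilon> by (intro mult_right_mono) auto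
    also have "\<dots> \<le> (2 * \<eta>) * 1" using e1l(7) \<epsilon> \<eta> by (intro mult_left_mono) auto
    also have "\<dots> < mP" using e1l(4) \<eta> CP by simp
    finally have \<mu>P: "\<mu> < mP" .
    define g where "g = (\<lambda>j u. zeta (shift \<eta> (real j * t) u))"
    have Imb: "\<bar>Im (shift \<eta> y u) - y\<bar> \<le> 1" if "norm u \<le> r" for y u
    proof -
      have "\<bar>Im (Arctan u)\<bar> \<le> CA" using CA(2)[OF that] abs_Im_le_cmod[of "Arctan u"] by linarith
      hence "4 * \<eta> / pi * \<bar>Im (Arctan u)\<bar> \<le> (2 * \<eta>) * CA" using p34 \<eta> by (intro mult_mono) auto
      also have "\<dots> \<le> 1"
      proof -
        have "\<eta> * (2 * CA) \<le> 1 / (2 * CA) * (2 * CA)" using \<eta> e1l(6) CA(1) by (intro mult_right_mono) auto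
        thus ?thesis using CA(1) by (simp add: mult_ac)
      qed
      finally show ?thesis unfolding Im_shift using \<eta> by (simp add: abs_mult)
    qed
    have jt: "real j * t \<ge> 2" if "j \<in> {1..N}" for j
      using that t mult_mono[of 1 "real j" 2 t] by simp
    have holo: "g j holomorphic_on ball 0 r" if j: "j \<in> {1..N}" for j
      unfolding g_def
    proof (rule zeta_shift_holomorphic)
      fix u :: complex assume "norm u < r"
      hence "\<bar>Im (shift \<eta> (real j * t) u) - real j * t\<bar> \<le> 1" by (intro Imb) simp
      hence "Im (shift \<eta> (real j * t) u) > 0" using jt[OF j] by linarith
      thus "shift \<eta> (real j * t) u \<noteq> 1" by auto
    qed (use r in simp)
    have gnz: "g j (of_real R0) \<noteq> 0" for j
    proof -
      have "Re (shift \<eta> (real j * t) (of_real R0 * cis 0)) \<ge> 1 + \<eta> / pi * cos 0"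
        by (rule shift_right(1)) (use \<eta> R0 in auto)
      moreover have "\<eta> / pi > 0" using \<eta> by simp
      ultimately have "Re (shift \<eta> (real j * t) (of_real R0)) > 1" by simp
      thus ?thesis unfolding g_def by (rule zeta_nonzero_gt1)
    qed
    obtain R where R: "R0 < R" "R < R1" and Rnz: "\<And>j w. j \<in> {1..N} \<Longrightarrow> norm w = R \<Longrightarrow> g j w \<noteq> 0"
      using zero_free_radius[of "{1..N}" g r R0 R1] holo gnz R0 r by force
    have R': "1 / 2 \<le> R" "R < 1" "R < r" "R \<le> 1" using R R0 r by auto
    define Q where "Q = (\<lambda>j Z. Z \<ge> 0 \<and> (\<forall>z0. 0 \<le> z0 \<longrightarrow> z0 \<le> 1 \<longrightarrow> g j (tan (- of_real (\<epsilon> * (z0 + x)))) = 0 \<longrightarrow> Z \<ge> Re (F (of_real z0)) / \<epsilon> - CL) \<and>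
       Re (\<Sum>k\<in>I. c k * ((1 + (disc_point \<epsilon> x k)\<^sup>2) * - (deriv (g j) (disc_point \<epsilon> x k) / g j (disc_point \<epsilon> x k)))) \<le>
         (U * (2 * f0 / R + CL * \<epsilon>) - integral {- pi / 2..pi / 2} (\<lambda>s. ln (norm (g j (R * cis s))) * K \<epsilon> x R s)) / pi - Z)"
    have loc: "(\<lambda>s. ln (norm (g j (R * cis s))) * K \<epsilon> x R s) integrable_on {- pi / 2..pi / 2} \<and>
       (\<exists>Z. Q j Z)"
      if j: "j \<in> {1..N}" for j
      unfolding Q_def
    proof (rule LBo[rule_format, OF \<epsilon>(1) _ x R'(1,2,3) holo[OF j] _ _ U])
      show "\<epsilon> < eL" using \<epsilon> e1l by simp
      show "g j w \<noteq> 0" if "norm w = R" for w using Rnz[OF j that] .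
      show "Re (Arctan \<alpha>) \<le> - (\<epsilon> * x)" if \<alpha>: "norm \<alpha> < R" "g j \<alpha> = 0" for \<alpha>
      proof -
        have "\<bar>Im (shift \<eta> (real j * t) \<alpha>) - real j * t\<bar> \<le> 1" by (rule Imb) (use \<alpha> R' in simp)
        hence "Re (shift \<eta> (real j * t) \<alpha>) \<le> 1 - x * (4 * \<eta> * \<epsilon> / pi)" using zf j \<alpha>(2) unfolding g_def by blast
        hence "4 * \<eta> / pi * Re (Arctan \<alpha>) \<le> 4 * \<eta> / pi * (- (\<epsilon> * x))" unfolding Re_shift by (simp add: algebra_simps)
        moreover have "4 * \<eta> / pi > 0" using \<eta> by simp
        ultimately show "Re (Arctan \<alpha>) \<le> - (\<epsilon> * x)" by (rule mult_left_le_imp_le)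
      qed
      show "norm (g j w) \<le> exp U" if w: "norm w = R" "Re w \<le> 0" for w
      proof -
        have w1: "norm w < 1" using w R' by simp
        have 1: "\<bar>Im (shift \<eta> (real j * t) w) - real j * t\<bar> \<le> 1" by (rule Imb) (use w R' in simp)
        have "Re (- w) / 2 \<le> Re (Arctan (- w))" by (rule Re_Arctan_ge) (use w w1 in auto)
        hence A0: "Re (Arctan w) \<le> 0" unfolding Arctan_neg[OF w1] using w by simp
        have A1: "Re (Arctan w) \<ge> - pi / 4" using abs_Re_Arctan_less[OF w1] by simp
        have p: "4 * \<eta> / pi > 0" using \<eta> by simp
        have "4 * \<eta> / pi * (- pi / 4) \<le> 4 * \<eta> / pi * Re (Arctan w)" using A1 p by (intro mult_left_mono) auto
        hence 2: "1 - \<eta> \<le> Re (shift \<eta> (real j * t) w)" unfolding Re_shift by simp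
        have "4 * \<eta> / pi * Re (Arctan w) \<le> 0" using A0 p by (intro mult_nonneg_nonpos) auto
        hence 3: "Re (shift \<eta> (real j * t) w) \<le> 1" unfolding Re_shift by simp
        show "norm (g j w) \<le> exp U" unfolding g_def using ub j 1 2 3 by blast
      qed
    qed
    hence int: "\<And>j. j \<in> {1..N} \<Longrightarrow> (\<lambda>s. ln (norm (g j (R * cis s))) * K \<epsilon> x R s) integrable_on {- pi / 2..pi / 2}"
      and "\<forall>j\<in>{1..N}. \<exists>Z. Q j Z" by blast+
    from bchoice[OF this(2)] obtain Zs where Zs: "\<forall>j\<in>{1..N}. Q j (Zs j)" by (elim exE) (rule that)
    have Z0: "Zs j \<ge> 0" and Z1: "\<And>z0. 0 \<le> z0 \<Longrightarrow> z0 \<le> 1 \<Longrightarrow> g j (tan (- of_real (\<epsilon> * (z0 + x)))) = 0 \<Longrightarrow> Zs j \<ge> Re (F (of_real z0)) / \<epsilon> - CL"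
      and Z2: "Re (\<Sum>k\<in>I. c k * ((1 + (disc_point \<epsilon> x k)\<^sup>2) * - (deriv (g j) (disc_point \<epsilon> x k) / g j (disc_point \<epsilon> x k)))) \<le>
         (U * (2 * f0 / R + CL * \<epsilon>) - integral {- pi / 2..pi / 2} (\<lambda>s. ln (norm (g j (R * cis s))) * K \<epsilon> x R s)) / pi - Zs j"
      if j: "j \<in> {1..N}" for j
      using bspec[OF Zs j, unfolded Q_def] by blast+
    define J where "J = (\<lambda>j. integral {- pi / 2..pi / 2} (\<lambda>s. ln (norm (g j (R * cis s))) * K \<epsilon> x R s))"
    define H where "H = (\<lambda>j. Re (\<Sum>k\<in>I. c k * dirichlet_series mangoldt (sample_point \<mu> x k + \<i> * of_real (real j * t))))"
    have H0: "H 0 \<le> Re (F (- of_real x)) / \<mu> + CP" using PB[OF \<mu>0 \<mu>P x] by (simp add: H_def)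
    have Hj: "H j \<le> pi / (4 * \<eta>) * ((U * (2 * f0 / R + CL * \<epsilon>) - J j) / pi - Zs j)" if j: "j \<in> {1..N}" for j
    proof -
      have "(\<Sum>k\<in>I. c k * dirichlet_series mangoldt (sample_point \<mu> x k + \<i> * of_real (real j * t))) =
        (\<Sum>k\<in>I. c k * (of_real (pi / (4 * \<eta>)) * ((1 + (disc_point \<epsilon> x k)\<^sup>2) * - (deriv (g j) (disc_point \<epsilon> x k) / g j (disc_point \<epsilon> x k)))))"
      proof (intro sum.cong refl arg_cong[where f = "(*) (c _)"])
        fix k assume k: "k \<in> I"
        have u: "norm (disc_point \<epsilon> x k) \<le> CU * \<epsilon>" "norm (of_real \<epsilon> * (a k - of_real x)) \<le> 1"
          using UB[OF \<epsilon>(1) _ x k] \<epsilon> e1l by auto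
        have "CU * \<epsilon> \<le> CU * (1 / (2 * CU))" using \<epsilon> e1l(5) CU by (intro mult_left_mono) auto
        hence u1: "norm (disc_point \<epsilon> x k) < 1" using u(1) CU by simp
        show "dirichlet_series mangoldt (sample_point \<mu> x k + \<i> * of_real (real j * t)) =
          of_real (pi / (4 * \<eta>)) * ((1 + (disc_point \<epsilon> x k)\<^sup>2) * - (deriv (g j) (disc_point \<epsilon> x k) / g j (disc_point \<epsilon> x k)))"
          unfolding \<mu>_def g_def by (rule mangoldt_disc_point[OF k \<epsilon>(1) \<eta>(1) x(2) u(2) u1])
      qed
      also have "\<dots> = of_real (pi / (4 * \<eta>)) * (\<Sum>k\<in>I. c k * ((1 + (disc_point \<epsilon> x k)\<^sup>2) * - (deriv (g j) (disc_point \<epsilon> x k) / g j (disc_point \<epsilon> x k))))"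
        unfolding sum_distrib_left by (simp only: mult.left_commute)
      finally have "H j = pi / (4 * \<eta>) * Re (\<Sum>k\<in>I. c k * ((1 + (disc_point \<epsilon> x k)\<^sup>2) * - (deriv (g j) (disc_point \<epsilon> x k) / g j (disc_point \<epsilon> x k))))"
        unfolding H_def by (simp only: times_complex.sel Re_complex_of_real Im_complex_of_real mult_zero_left diff_zero)
      also have "\<dots> \<le> pi / (4 * \<eta>) * ((U * (2 * f0 / R + CL * \<epsilon>) - J j) / pi - Zs j)"
        unfolding J_def using Z2[OF j] \<eta> by (intro mult_left_mono) auto
      finally show ?thesis .
    qed
    have Zt: "Zs 1 \<ge> Re (F (of_real z0)) / \<epsilon> - CL"
    proof (rule Z1)
      have e4: "\<epsilon> * (z0 + x) \<le> 1 / 4 * 2" using \<epsilon> e1l(7) z0 x by (intro mult_mono) auto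
      have e0: "0 \<le> \<epsilon> * (z0 + x)" using \<epsilon> z0 x by simp
      have "\<bar>Re (- of_real (\<epsilon> * (z0 + x)))\<bar> < pi / 2"
        unfolding uminus_complex.sel Re_complex_of_real abs_minus_cancel using e4 e0 pi_gt3 by simp
      hence A: "Arctan (tan (- of_real (\<epsilon> * (z0 + x)))) = - of_real (\<epsilon> * (z0 + x))" by (rule Arctan_tan)
      have "shift \<eta> (real 1 * t) (tan (- of_real (\<epsilon> * (z0 + x)))) = Complex (1 - (z0 + x) * (4 * \<eta> * \<epsilon> / pi)) t"
        unfolding shift_def A by (simp add: complex_eq_iff algebra_simps add_divide_distrib)
      thus "g 1 (tan (- of_real (\<epsilon> * (z0 + x)))) = 0" unfolding g_def using zero by simp
    qed (use N z0 in auto)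
    have RJ: "(\<Sum>j=1..N. b j * - J j) \<le> 2 * f0 / R * b 0 * ln (1 / \<eta>) + MR * (1 + (1 - R) / \<delta>\<^sup>2 + (\<delta> + \<epsilon>) * (ln (1 / \<eta>) + 1))"
      unfolding J_def g_def
      by (rule RB[OF \<epsilon>(1) _ x R'(1,4) \<delta> \<eta>(1)]) (use \<epsilon> \<eta> e1l int in \<open>auto simp: g_def\<close>)
    have sp: "0 \<le> (\<Sum>j\<le>N. b j * H j)" unfolding H_def by (rule smoothed_positivity[OF b P \<mu>0 x(2)])
    have split: "(\<Sum>j\<le>N. b j * H j) = b 0 * H 0 + (\<Sum>j=1..N. b j * H j)"
      by (simp add: sum.atMost_shift atLeast0AtMost[symmetric] sum.atLeast_Suc_atMost lessThan_atLeast0 sum.shift_bounds_Suc_ivl sum.atLeast1_atMost_eq)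
    define V where "V = U * (2 * f0 / R + CL * \<epsilon>)"
    have S1: "(\<Sum>j=1..N. b j * H j) \<le> pi / (4 * \<eta>) * ((Bs * V + (\<Sum>j=1..N. b j * - J j)) / pi - b 1 * Zs 1)"
    proof -
      have "(\<Sum>j=1..N. b j * H j) \<le> (\<Sum>j=1..N. b j * (pi / (4 * \<eta>) * ((V - J j) / pi - Zs j)))"
        unfolding V_def by (intro sum_mono mult_left_mono Hj b) auto
      also have "\<dots> = pi / (4 * \<eta>) * ((Bs * V + (\<Sum>j=1..N. b j * - J j)) / pi - (\<Sum>j=1..N. b j * Zs j))"
      proof -
        have "(\<Sum>j=1..N. b j * (q * ((V - J j) / pi - Zs j))) = q * ((Bs * V + (\<Sum>j=1..N. b j * - J j)) / pi - (\<Sum>j=1..N. b j * Zs j))" for q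
          unfolding Bs_def
          by (simp add: sum_distrib_left sum_distrib_right sum_subtractf sum_negf sum_divide_distrib diff_divide_distrib right_diff_distrib mult_ac)
        thus ?thesis .
      qed
      also have "\<dots> \<le> pi / (4 * \<eta>) * ((Bs * V + (\<Sum>j=1..N. b j * - J j)) / pi - b 1 * Zs 1)"
      proof -
        \<comment> \<open>The chosen zero is at the height t, that is j = 1; the zeros at the other
          heights are discarded by positivity.\<close>
        have "b 1 * Zs 1 \<le> (\<Sum>j=1..N. b j * Zs j)"
          by (rule member_le_sum) (use N b Z0 in auto)
        thus ?thesis using \<eta> by (intro mult_left_mono) auto
      qed
      finally show ?thesis .
    qed
    define l where "l = ln (1 / \<eta>)"
    have l0: "l \<ge> 0" using \<eta> e1l(7) by (simp add: l_def)
    define X where "X = 1 + 1 / \<delta>\<^sup>2 + (\<delta> + \<epsilon>) * (l + 1)"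
    have X1: "X \<ge> 1" using \<delta> \<epsilon> l0 by (simp add: X_def)
    have RJ': "(\<Sum>j=1..N. b j * - J j) \<le> 2 * f0 / R * b 0 * l + MR * X"
    proof -
      have "(1 - R) / \<delta>\<^sup>2 \<le> 1 / \<delta>\<^sup>2" using R' by (intro divide_right_mono) auto
      hence "MR * (1 + (1 - R) / \<delta>\<^sup>2 + (\<delta> + \<epsilon>) * (l + 1)) \<le> MR * X"
        unfolding X_def using MR by (intro mult_left_mono) auto
      thus ?thesis using RJ unfolding l_def[symmetric] by linarith
    qed
    have fin1: "0 \<le> b 0 * (Re (F (- of_real x)) / \<mu> + CP) +
        pi / (4 * \<eta>) * ((Bs * V + (2 * f0 / R * b 0 * l + MR * X)) / pi - b 1 * (Re (F (of_real z0)) / \<epsilon> - CL))"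
    proof -
      have "b 0 * H 0 \<le> b 0 * (Re (F (- of_real x)) / \<mu> + CP)" by (rule mult_left_mono[OF H0 b])
      moreover have "b 1 * (Re (F (of_real z0)) / \<epsilon> - CL) \<le> b 1 * Zs 1" by (rule mult_left_mono[OF Zt b])
      have "pi / (4 * \<eta>) * ((Bs * V + (\<Sum>j=1..N. b j * - J j)) / pi - b 1 * Zs 1) \<le>
         pi / (4 * \<eta>) * ((Bs * V + (2 * f0 / R * b 0 * l + MR * X)) / pi - b 1 * (Re (F (of_real z0)) / \<epsilon> - CL))"
      proof (rule mult_left_mono)
        have gen: "p \<le> q \<Longrightarrow> y \<le> z \<Longrightarrow> (v + p) / pi - z \<le> (v + q) / pi - y" for p q v y z :: real
          by (intro diff_mono divide_right_mono) auto
        show "(Bs * V + (\<Sum>j=1..N. b j * - J j)) / pi - b 1 * Zs 1 \<le>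
           (Bs * V + (2 * f0 / R * b 0 * l + MR * X)) / pi - b 1 * (Re (F (of_real z0)) / \<epsilon> - CL)"
          by (rule gen) fact+
      qed (use \<eta> in simp)
      ultimately show ?thesis using sp S1 unfolding split by linarith
    qed
    have gen: "b1 * fz - b0 * fx \<le> \<epsilon> * (b0 * CP * (4 * \<eta> / pi) + Y / pi + b1 * CL)"
      if "0 \<le> b0 * (fx / \<mu> + CP) + pi / (4 * \<eta>) * (Y / pi - b1 * (fz / \<epsilon> - CL))" for b0 b1 fx fz Y
    proof -
      have "0 \<le> \<mu> * (b0 * (fx / \<mu> + CP) + pi / (4 * \<eta>) * (Y / pi - b1 * (fz / \<epsilon> - CL)))" using that \<mu>0 by simp
      also have "\<dots> = b0 * fx + \<epsilon> * (b0 * CP * (4 * \<eta> / pi)) + (\<mu> * (pi / (4 * \<eta>))) * (Y / pi - b1 * (fz / \<epsilon> - CL))"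
      proof -
        have "m * (b0 * (fx / m + CP) + y) = b0 * fx + m * b0 * CP + m * y" if "m \<noteq> 0" for m y
          using that by (simp add: field_simps)
        from this[of \<mu>] \<mu>0 have "\<mu> * (b0 * (fx / \<mu> + CP) + pi / (4 * \<eta>) * (Y / pi - b1 * (fz / \<epsilon> - CL))) =
          b0 * fx + \<mu> * b0 * CP + \<mu> * (pi / (4 * \<eta>) * (Y / pi - b1 * (fz / \<epsilon> - CL)))" by simp
        moreover have "\<mu> * b0 * CP = \<epsilon> * (b0 * CP * (4 * \<eta> / pi))" by (simp add: \<mu>_def)
        ultimately show ?thesis by (simp only: mult.assoc)
      qed
      also have "\<mu> * (pi / (4 * \<eta>)) = \<epsilon>" using \<eta> by (simp add: \<mu>_def)
      also have "\<epsilon> * (Y / pi - b1 * (fz / \<epsilon> - CL)) = \<epsilon> * (Y / pi + b1 * CL) - b1 * fz"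
        using \<epsilon> by (simp add: algebra_simps)
      finally show ?thesis by (simp add: distrib_left)
    qed
    have "b 1 * Re (F (of_real z0)) - b 0 * Re (F (- of_real x)) \<le>
       \<epsilon> * (b 0 * CP * (4 * \<eta> / pi) + (Bs * V + (2 * f0 / R * b 0 * l + MR * X)) / pi + b 1 * CL)"
      by (rule gen[OF fin1])
    also have "\<dots> \<le> \<epsilon> * (2 * f0 / (pi * R0) * (Bs * U + b 0 * l) + M * (X + \<epsilon> * U))"
    proof (intro mult_left_mono)
      have q1: "b 0 * CP * (4 * \<eta> / pi) \<le> b 0 * CP * 2" using p34 \<eta> e1l(7) b[of 0] CP by (intro mult_left_mono) auto
      have q2: "2 * f0 / R * (Bs * U + b 0 * l) / pi \<le> 2 * f0 / (pi * R0) * (Bs * U + b 0 * l)"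
      proof -
        have "2 * f0 / (pi * R) \<le> 2 * f0 / (pi * R0)" using R R0 f0 by (intro divide_left_mono) auto
        hence "2 * f0 / (pi * R) * (Bs * U + b 0 * l) \<le> 2 * f0 / (pi * R0) * (Bs * U + b 0 * l)"
          using Bs0 U b[of 0] l0 by (intro mult_right_mono) auto
        thus ?thesis by (simp add: mult_ac)
      qed
      have pi1: "y / pi \<le> y" if "y \<ge> 0" for y using that pi_gt3 mult_left_mono[of 1 pi y] by (simp add: field_simps)
      have q3: "Bs * (U * (CL * \<epsilon>)) / pi \<le> Bs * CL * (\<epsilon> * U)"
        using pi1[of "Bs * (U * (CL * \<epsilon>))"] Bs0 U CL \<epsilon> by (simp add: mult_ac)
      have q4: "MR * X / pi \<le> MR * X" using MR X1 by (intro pi1) auto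
      have e: "(Bs * V + (2 * f0 / R * b 0 * l + MR * X)) / pi =
         2 * f0 / R * (Bs * U + b 0 * l) / pi + Bs * (U * (CL * \<epsilon>)) / pi + MR * X / pi"
      proof -
        have "(Bs * (U * (h + q)) + (h * b 0 * l + m)) = h * (Bs * U + b 0 * l) + Bs * (U * q) + m" for h q m
          by (simp add: algebra_simps)
        thus ?thesis unfolding V_def by (simp only: add_divide_distrib)
      qed
      have eU: "\<epsilon> * U \<ge> 0" using \<epsilon> U by simp
      have m1: "(2 * b 0 * CP + MR + b 1 * CL) * X \<ge> 2 * b 0 * CP + b 1 * CL + MR * X"
      proof -
        have "(2 * b 0 * CP + b 1 * CL) * 1 \<le> (2 * b 0 * CP + b 1 * CL) * X"
          using X1 b[of 0] b[of 1] CP CL by (intro mult_left_mono) auto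
        thus ?thesis by (simp add: algebra_simps)
      qed
      have m2: "M * (X + \<epsilon> * U) \<ge> (2 * b 0 * CP + MR + b 1 * CL) * X + Bs * CL * (\<epsilon> * U)"
      proof -
        have "M * X \<ge> (2 * b 0 * CP + MR + b 1 * CL) * X" using X1 Bs0 CL unfolding M_def by (intro mult_right_mono) auto
        moreover have "M * (\<epsilon> * U) \<ge> Bs * CL * (\<epsilon> * U)"
          using eU b[of 0] b[of 1] CP CL MR unfolding M_def by (intro mult_right_mono) auto
        moreover have gen: "p + q \<le> M * (X + \<epsilon> * U)" if "p \<le> M * X" "q \<le> M * (\<epsilon> * U)" for p q
          using that by (simp only: distrib_left)
        ultimately show ?thesis by (intro gen)
      qed
      show "b 0 * CP * (4 * \<eta> / pi) + (Bs * V + (2 * f0 / R * b 0 * l + MR * X)) / pi + b 1 * CL \<le>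
         2 * f0 / (pi * R0) * (Bs * U + b 0 * l) + M * (X + \<epsilon> * U)"
        unfolding e using q1 q2 q3 q4 m1 m2 by linarith
    qed (use \<epsilon> in auto)
    finally show "b 1 * Re (F (of_real z0)) - b 0 * Re (F (- of_real x)) \<le>
       \<epsilon> * (2 * f0 / (pi * R0) * ((\<Sum>j=1..N. b j) * U + b 0 * ln (1 / \<eta>)) +
            M * (1 + 1 / \<delta>\<^sup>2 + \<epsilon> * U + (\<delta> + \<epsilon>) * (ln (1 / \<eta>) + 1)))"
      unfolding Bs_def l_def X_def by (simp only: add_ac)
  qed
qed

end

section \<open>The choice of the smoothing function and of the cosine polynomial\<close>

text \<open>
  If \<open>\<phi> y = (\<Sum>i\<in>J. C i * exp (- \<beta> i * y))\<close> has non-increasing real part then \<open>Re (\<phi> 0) \<ge> lim Re (\<phi> y) = 0\<close>. This replaces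
  the evaluation of integrals over the half-line.
\<close>

lemma exp_sum_nonneg:
  fixes \<beta> C :: "'a \<Rightarrow> complex"
  assumes J: "finite J" and \<beta>: "\<And>i. i \<in> J \<Longrightarrow> Re (\<beta> i) > 0"
    and nn: "\<And>y :: real. y \<ge> 0 \<Longrightarrow> Re (\<Sum>i\<in>J. C i * \<beta> i * exp (- (\<beta> i * of_real y))) \<ge> 0"
  shows "Re (\<Sum>i\<in>J. C i) \<ge> 0"
proof -
  define \<phi> where "\<phi> = (\<lambda>y :: real. Re (\<Sum>i\<in>J. C i * exp (- (\<beta> i * of_real y))))"
  have d: "(\<phi> has_real_derivative - Re (\<Sum>i\<in>J. C i * \<beta> i * exp (- (\<beta> i * of_real y)))) (at y)" for y
  proof -
    have "((\<lambda>y. \<Sum>i\<in>J. C i * exp (- (\<beta> i * y))) has_field_derivative (\<Sum>i\<in>J. C i * (exp (- (\<beta> i * of_real y)) * - (\<beta> i)))) (at (of_real y))"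
      by (intro DERIV_sum DERIV_cmult) (auto intro!: derivative_eq_intros)
    hence "((\<lambda>y. \<Sum>i\<in>J. C i * exp (- (\<beta> i * of_real y))) has_vector_derivative (\<Sum>i\<in>J. C i * (exp (- (\<beta> i * of_real y)) * - (\<beta> i)))) (at y)"
      by (rule has_vector_derivative_real_field)
    hence "(\<phi> has_vector_derivative Re (\<Sum>i\<in>J. C i * (exp (- (\<beta> i * of_real y)) * - (\<beta> i)))) (at y)"
      unfolding \<phi>_def by (rule bounded_linear.has_vector_derivative[OF bounded_linear_Re])
    moreover have "Re (\<Sum>i\<in>J. C i * (exp (- (\<beta> i * of_real y)) * - (\<beta> i))) = - Re (\<Sum>i\<in>J. C i * \<beta> i * exp (- (\<beta> i * of_real y)))"
      unfolding uminus_complex.sel(1)[symmetric] sum_negf[symmetric]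
      by (rule arg_cong[where f = Re], rule sum.cong) (simp_all add: mult_ac)
    ultimately show ?thesis unfolding has_real_derivative_iff_has_vector_derivative by simp
  qed
  have mono: "\<phi> y \<le> \<phi> 0" if "y \<ge> 0" for y
    by (rule DERIV_nonpos_imp_nonincreasing[OF that]) (use d nn in force)
  have "(\<phi> \<longlongrightarrow> Re (\<Sum>i\<in>J. C i * 0)) at_top"
    unfolding \<phi>_def
  proof (intro tendsto_Re tendsto_sum tendsto_mult tendsto_const)
    fix i assume i: "i \<in> J"
    have "((\<lambda>y. exp (- (Re (\<beta> i) * y))) \<longlongrightarrow> 0) at_top"
      using \<beta>[OF i] by real_asymp
    thus "((\<lambda>y. exp (- (\<beta> i * of_real y))) \<longlongrightarrow> 0) at_top"
      by (subst tendsto_norm_zero_iff[symmetric]) simp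
  qed
  hence "(\<phi> \<longlongrightarrow> 0) at_top" by simp
  moreover have "eventually (\<lambda>y. \<phi> y \<le> \<phi> 0) at_top" using eventually_ge_at_top[of 0] by eventually_elim (rule mono)
  ultimately have "0 \<le> \<phi> 0" by (intro tendsto_upperbound) auto
  thus ?thesis by (simp add: \<phi>_def)
qed

text \<open>The Hermitian form is the integral over y >= 0 of the squared modulus of the sum of w j
  exp (- a j y).\<close>

lemma gram_nonneg:
  fixes a w :: "'a \<Rightarrow> complex"
  assumes K: "finite K" and a: "\<And>k. k \<in> K \<Longrightarrow> Re (a k) > 0"
  shows "Re (\<Sum>j\<in>K. \<Sum>k\<in>K. w j * cnj (w k) / (a j + cnj (a k))) \<ge> 0"
proof -
  define C where "C = (\<lambda>(j, k). w j * cnj (w k) / (a j + cnj (a k)))"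
  define \<beta> where "\<beta> = (\<lambda>(j, k). a j + cnj (a k))"
  have "Re (\<Sum>i\<in>K \<times> K. C i) \<ge> 0"
  proof (rule exp_sum_nonneg)
    show \<beta>: "Re (\<beta> i) > 0" if "i \<in> K \<times> K" for i
      using that a[of "fst i"] a[of "snd i"] by (auto simp: \<beta>_def)
    fix y :: real
    define s where "s = (\<Sum>j\<in>K. w j * exp (- (a j * of_real y)))"
    have "(\<Sum>i\<in>K \<times> K. C i * \<beta> i * exp (- (\<beta> i * of_real y))) =
        (\<Sum>(j, k)\<in>K \<times> K. (w j * exp (- (a j * of_real y))) * cnj (w k * exp (- (a k * of_real y))))"
    proof (rule sum.cong[OF refl])
      fix i assume i: "i \<in> K \<times> K"
      have nz: "\<beta> i \<noteq> 0" using \<beta>[OF i] by auto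
      have C: "C i * \<beta> i = w (fst i) * cnj (w (snd i))" using nz by (auto simp: C_def \<beta>_def split: prod.splits)
      have e: "exp (- (\<beta> i * of_real y)) = exp (- (a (fst i) * of_real y)) * exp (- cnj (a (snd i) * of_real y))"
        by (simp add: \<beta>_def exp_add[symmetric] algebra_simps split: prod.splits)
      show "C i * \<beta> i * exp (- (\<beta> i * of_real y)) = (case i of (j, k) \<Rightarrow> (w j * exp (- (a j * of_real y))) * cnj (w k * exp (- (a k * of_real y))))"
        unfolding C e by (simp add: exp_cnj mult_ac split: prod.splits)
    qed
    also have "\<dots> = s * cnj s"
      unfolding s_def cnj_sum sum_product by (simp only: sum.cartesian_product)
    finally show "Re (\<Sum>i\<in>K \<times> K. C i * \<beta> i * exp (- (\<beta> i * of_real y))) \<ge> 0"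
      by (simp add: complex_mult_cnj)
  qed (use K in auto)
  thus ?thesis unfolding C_def by (simp only: sum.cartesian_product)
qed

text \<open>
  For \<open>G x = (\<Sum>k\<in>K. g k * exp (- a k * x))\<close>, which the involution \<open>conj\<close> shows to be real, the function
  \<open>(\<Sum>k\<in>K. acoeff k * exp (- a k * t))\<close> defined below is the autocorrelation \<open>t \<mapsto> \<integral> G x * G (x + t) dx\<close> over the
  positive half-line.
\<close>

locale autocorrelation =
  fixes K :: "'a set" and g a :: "'a \<Rightarrow> complex" and conj :: "'a \<Rightarrow> 'a"
  assumes fin: "finite K" and a_pos: "\<And>k. k \<in> K \<Longrightarrow> Re (a k) > 0"
    and conj: "bij_betw conj K K" "\<And>k. k \<in> K \<Longrightarrow> g (conj k) = cnj (g k)" "\<And>k. k \<in> K \<Longrightarrow> a (conj k) = cnj (a k)"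
    and g_nonneg: "\<And>y :: real. Re (\<Sum>k\<in>K. g k * exp (- (a k * of_real y))) \<ge> 0"
begin

definition acoeff :: "'a \<Rightarrow> complex" where "acoeff k = g k * (\<Sum>j\<in>K. g j / (a j + a k))"

lemma sum_conj: "(\<Sum>k\<in>K. P (g k) (a k)) = (\<Sum>k\<in>K. P (cnj (g k)) (cnj (a k)))"
proof -
  have "(\<Sum>k\<in>K. P (g k) (a k)) = (\<Sum>k\<in>K. P (g (conj k)) (a (conj k)))"
    by (rule sum.reindex_bij_betw[OF conj(1), symmetric])
  thus ?thesis using conj(2,3) by simp
qed

lemma sum_real:
  assumes "\<And>x y. cnj (P x y) = P (cnj x) (cnj y)"
  shows "(\<Sum>k\<in>K. P (g k) (a k)) \<in> \<real>"
proof -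
  have "cnj (\<Sum>k\<in>K. P (g k) (a k)) = (\<Sum>k\<in>K. P (g k) (a k))"
    unfolding cnj_sum assms by (rule sum_conj[symmetric])
  thus ?thesis by (simp add: Reals_cnj_iff)
qed

lemma acoeff_sum_real:
  assumes "\<And>x. cnj (Q x) = Q (cnj x)"
  shows "(\<Sum>k\<in>K. acoeff k * Q (a k)) \<in> \<real>"
proof -
  define R where "R = (\<lambda>y. \<Sum>j\<in>K. g j / (a j + y))"
  have R: "cnj (R y) = R (cnj y)" for y
    unfolding R_def cnj_sum using sum_conj[of "\<lambda>x z. x / (z + cnj y)"] by simp
  have "(\<Sum>k\<in>K. g k * R (a k) * Q (a k)) \<in> \<real>"
    by (rule sum_real) (simp add: R assms)
  thus ?thesis by (simp add: acoeff_def R_def)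
qed

lemma acoeff_exp_real: "(\<Sum>k\<in>K. acoeff k * exp (- (a k * of_real t))) \<in> \<real>"
  by (rule acoeff_sum_real) (simp add: exp_cnj)

lemma acoeff_exp_nonneg: "Re (\<Sum>k\<in>K. acoeff k * exp (- (a k * of_real t))) \<ge> 0"
proof -
  define C where "C = (\<lambda>(j, k). g j * g k * exp (- (a k * of_real t)) / (a j + a k))"
  define \<beta> where "\<beta> = (\<lambda>(j, k). a j + a k)"
  have "Re (\<Sum>i\<in>K \<times> K. C i) \<ge> 0"
  proof (rule exp_sum_nonneg)
    show \<beta>: "Re (\<beta> i) > 0" if "i \<in> K \<times> K" for i
      using that a_pos[of "fst i"] a_pos[of "snd i"] by (auto simp: \<beta>_def)
    fix y :: real
    define s where "s = (\<lambda>y :: real. \<Sum>j\<in>K. g j * exp (- (a j * of_real y)))"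
    have s: "s y \<in> \<real>" for y unfolding s_def by (rule sum_real) (simp add: exp_cnj)
    have "(\<Sum>i\<in>K \<times> K. C i * \<beta> i * exp (- (\<beta> i * of_real y))) =
        (\<Sum>(j, k)\<in>K \<times> K. (g j * exp (- (a j * of_real y))) * (g k * exp (- (a k * of_real (y + t)))))"
    proof (rule sum.cong[OF refl])
      fix i assume i: "i \<in> K \<times> K"
      have nz: "\<beta> i \<noteq> 0" using \<beta>[OF i] by auto
      have C: "C i * \<beta> i = g (fst i) * g (snd i) * exp (- (a (snd i) * of_real t))" using nz by (auto simp: C_def \<beta>_def split: prod.splits)
      have e: "exp (- (\<beta> i * of_real y)) = exp (- (a (fst i) * of_real y)) * exp (- (a (snd i) * of_real y))"
        by (simp add: \<beta>_def exp_add[symmetric] algebra_simps split: prod.splits)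
      have e2: "exp (- (a k * of_real (y + t))) = exp (- (a k * of_real y)) * exp (- (a k * of_real t))" for k
        by (simp add: exp_add[symmetric] algebra_simps)
      show "C i * \<beta> i * exp (- (\<beta> i * of_real y)) = (case i of (j, k) \<Rightarrow> (g j * exp (- (a j * of_real y))) * (g k * exp (- (a k * of_real (y + t)))))"
        unfolding C e e2 by (simp add: mult_ac split: prod.splits)
    qed
    also have "\<dots> = s y * s (y + t)"
      unfolding s_def sum_product by (simp only: sum.cartesian_product)
    also have "s y * s (y + t) = of_real (Re (s y)) * s (y + t)" using s[of y] by (simp only: of_real_Re)
    finally have "Re (\<Sum>i\<in>K \<times> K. C i * \<beta> i * exp (- (\<beta> i * of_real y))) = Re (s y) * Re (s (y + t))"
      by (simp only: times_complex.sel Re_complex_of_real Im_complex_of_real mult_zero_left diff_zero)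
    moreover have "Re (s y) \<ge> 0" for y unfolding s_def by (rule g_nonneg)
    ultimately show "Re (\<Sum>i\<in>K \<times> K. C i * \<beta> i * exp (- (\<beta> i * of_real y))) \<ge> 0"
      by (simp only: mult_nonneg_nonneg)
  qed (use fin in auto)
  moreover have "(\<Sum>i\<in>K \<times> K. C i) = (\<Sum>k\<in>K. acoeff k * exp (- (a k * of_real t)))"
    unfolding C_def sum.cartesian_product[symmetric]
    by (subst sum.swap) (simp add: acoeff_def sum_distrib_left sum_distrib_right mult_ac)
  ultimately show ?thesis by simp
qed

text \<open>Let W be the Laplace transform of G at z. Splitting a k + cnj (a j) + z + cnj z in the
  numerator shows that twice the real part is |W|^2 plus 2 Re z times a Gram form. On the imaginary
  axis this is the familiar fact that an autocorrelation has a non-negative Fourier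
  transform.\<close>

lemma acoeff_laplace_nonneg:
  assumes z: "Re z \<ge> 0"
  shows "Re (\<Sum>k\<in>K. acoeff k / (z + a k)) \<ge> 0"
proof -
  define w where "w = (\<lambda>k. g k / (z + a k))"
  define T where "T = (\<lambda>j k. w k * cnj (g j) / (a k + cnj (a j)))"
  have nz: "z + a k \<noteq> 0" "a k + cnj (a j) \<noteq> 0" if "j \<in> K" "k \<in> K" for j k
    using a_pos[OF that(1)] a_pos[OF that(2)] z by (auto simp: complex_eq_iff)
  define S where "S = (\<Sum>k\<in>K. acoeff k / (z + a k))"
  have S: "S = (\<Sum>k\<in>K. \<Sum>j\<in>K. T j k)"
    unfolding S_def
  proof (rule sum.cong[OF refl])
    fix k
    have "(\<Sum>j\<in>K. g j / (a j + a k)) = (\<Sum>j\<in>K. cnj (g j) / (cnj (a j) + a k))"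
      by (rule sum_conj)
    thus "acoeff k / (z + a k) = (\<Sum>j\<in>K. T j k)"
      by (simp add: acoeff_def T_def w_def sum_distrib_left sum_distrib_right sum_divide_distrib add.commute mult_ac)
  qed
  have cS: "cnj S = (\<Sum>k\<in>K. \<Sum>j\<in>K. cnj (T k j))"
    unfolding S cnj_sum by (rule sum.swap)
  have TT: "T j k + cnj (T k j) = w k * cnj (w j) + of_real (2 * Re z) * (w k * cnj (w j) / (a k + cnj (a j)))"
    if jk: "j \<in> K" "k \<in> K" for j k
  proof -
    have nzj: "z + a j \<noteq> 0" using nz(1) jk by blast
    have gj: "g k = w k * (z + a k)" "g j = w j * (z + a j)" using nz(1) jk by (auto simp: w_def)
    have zz: "of_real (2 * Re z) = z + cnj z" by (simp add: complex_add_cnj)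
    have d: "a k + cnj (a j) \<noteq> 0" "cnj (a j) + a k \<noteq> 0" using nz(2)[OF jk] by (auto simp: add.commute)
    have "T j k + cnj (T k j) = w k * (cnj (w j) * (cnj z + cnj (a j))) / (a k + cnj (a j)) + cnj (w j) * (w k * (z + a k)) / (a k + cnj (a j))"
      unfolding T_def gj by (simp add: add.commute)
    also have "\<dots> = w k * cnj (w j) * ((a k + cnj (a j)) + (z + cnj z)) / (a k + cnj (a j))"
      by (simp add: add_divide_distrib[symmetric] algebra_simps)
    also have "\<dots> = w k * cnj (w j) + (z + cnj z) * (w k * cnj (w j) / (a k + cnj (a j)))"
      using d by (simp add: field_simps)
    finally show ?thesis unfolding zz .
  qed
  have "S + cnj S = (\<Sum>k\<in>K. w k) * cnj (\<Sum>j\<in>K. w j) + of_real (2 * Re z) * (\<Sum>k\<in>K. \<Sum>j\<in>K. w k * cnj (w j) / (a k + cnj (a j)))"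
  proof -
    have "S + cnj S = (\<Sum>k\<in>K. \<Sum>j\<in>K. T j k + cnj (T k j))" unfolding cS unfolding S by (simp only: sum.distrib)
    also have "\<dots> = (\<Sum>k\<in>K. \<Sum>j\<in>K. w k * cnj (w j) + of_real (2 * Re z) * (w k * cnj (w j) / (a k + cnj (a j))))"
      by (intro sum.cong refl TT)
    also have "\<dots> = (\<Sum>k\<in>K. \<Sum>j\<in>K. w k * cnj (w j)) + of_real (2 * Re z) * (\<Sum>k\<in>K. \<Sum>j\<in>K. w k * cnj (w j) / (a k + cnj (a j)))"
      by (simp only: sum.distrib sum_distrib_left)
    also have "(\<Sum>k\<in>K. \<Sum>j\<in>K. w k * cnj (w j)) = (\<Sum>k\<in>K. w k) * cnj (\<Sum>j\<in>K. w j)"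
      by (simp only: cnj_sum sum_product)
    finally show ?thesis .
  qed
  hence "Re (S + cnj S) = Re (of_real ((norm (\<Sum>k\<in>K. w k))\<^sup>2) + of_real (2 * Re z) * (\<Sum>k\<in>K. \<Sum>j\<in>K. w k * cnj (w j) / (a k + cnj (a j))))"
    unfolding complex_norm_square by (rule arg_cong)
  hence "2 * Re S = (norm (\<Sum>k\<in>K. w k))\<^sup>2 + 2 * Re z * Re (\<Sum>k\<in>K. \<Sum>j\<in>K. w k * cnj (w j) / (a k + cnj (a j)))"
    unfolding complex_add_cnj by (simp only: plus_complex.sel times_complex.sel Re_complex_of_real Im_complex_of_real mult_zero_left diff_zero)
  moreover have "Re (\<Sum>k\<in>K. \<Sum>j\<in>K. w k * cnj (w j) / (a k + cnj (a j))) \<ge> 0"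
    by (rule gram_nonneg[OF fin a_pos])
  ultimately show ?thesis unfolding S_def[symmetric] using z by (smt (verit) mult_nonneg_nonneg zero_le_power2)
qed

text \<open>Minus the derivative of the autocorrelation at 0, the integral of - G G', is G(0)^2 / 2.
  Algebraically, exchanging j and k symmetrises a k / (a j + a k) to 1 / 2.\<close>

lemma acoeff_sum_a: "(\<Sum>k\<in>K. acoeff k * a k) = (\<Sum>k\<in>K. g k)\<^sup>2 / 2"
proof -
  define X where "X = (\<Sum>k\<in>K. \<Sum>j\<in>K. g k * g j / (a j + a k) * a k)"
  have nz: "a j + a k \<noteq> 0" if "j \<in> K" "k \<in> K" for j k
    using a_pos[OF that(1)] a_pos[OF that(2)] by (auto simp: complex_eq_iff)
  have X: "(\<Sum>k\<in>K. acoeff k * a k) = X"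
    by (simp add: X_def acoeff_def sum_distrib_left sum_distrib_right)
  have X2: "X = (\<Sum>k\<in>K. \<Sum>j\<in>K. g k * g j / (a j + a k) * a j)"
    unfolding X_def by (subst sum.swap) (simp add: mult_ac add.commute)
  have "X + X = (\<Sum>k\<in>K. \<Sum>j\<in>K. g k * g j / (a j + a k) * a k + g k * g j / (a j + a k) * a j)"
    unfolding sum.distrib unfolding X2[symmetric] unfolding X_def ..
  also have "\<dots> = (\<Sum>k\<in>K. \<Sum>j\<in>K. g k * g j)"
  proof (intro sum.cong refl)
    fix j k assume jk: "k \<in> K" "j \<in> K"
    have "g k * g j / (a j + a k) * a k + g k * g j / (a j + a k) * a j = g k * g j / (a j + a k) * (a j + a k)"
      by (simp only: distrib_left add.commute)
    thus "g k * g j / (a j + a k) * a k + g k * g j / (a j + a k) * a j = g k * g j" using nz[OF jk(2,1)] by simp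
  qed
  also have "\<dots> = (\<Sum>k\<in>K. g k)\<^sup>2" by (simp add: power2_eq_square sum_product)
  finally show ?thesis unfolding X by (simp add: eq_divide_eq mult.commute)
qed

end

text \<open>
  Here \<open>G x = exp (- 6 x) (h x)\<^sup>2\<close> with \<open>h x = 10 + 2 Re ((- 5 + 2 \<i>) exp (4 \<i> x)) - 2 Re (\<i> exp (8 \<i> x))\<close>. The coefficients, found
  numerically, satisfy \<open>h 0 = 0\<close>, so the autocorrelation has derivative 0 at 0.
\<close>

definition gcoef :: "nat \<Rightarrow> complex" where
  "gcoef k = [-1, Complex 4 (-10), Complex 21 40, Complex (-104) (-50), 160, Complex (-104) 50, Complex 21 (-40), Complex 4 10, -1] ! k"

definition afreq :: "nat \<Rightarrow> complex" where "afreq k = Complex 6 (16 - 4 * real k)"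

lemma less_9: "(k < 9) = (k = 0 \<or> k = 1 \<or> k = 2 \<or> k = 3 \<or> k = 4 \<or> k = 5 \<or> k = 6 \<or> k = 7 \<or> k = (8 :: nat))"
  by presburger

lemma sum_9: "(\<Sum>k<9 :: nat. f k) = f 0 + f 1 + f 2 + f 3 + f 4 + f 5 + f 6 + f 7 + (f 8 :: 'a :: comm_monoid_add)"
proof -
  have "{..<9} = {0, 1, 2, 3, 4, 5, 6, 7, 8 :: nat}" by (auto simp: less_9)
  show ?thesis unfolding \<open>{..<9} = _\<close> by (simp add: add.assoc)
qed

lemma gcoef_values:
  "gcoef 0 = -1" "gcoef 1 = Complex 4 (-10)" "gcoef 2 = Complex 21 40" "gcoef 3 = Complex (-104) (-50)" "gcoef 4 = 160"
  "gcoef 5 = Complex (-104) 50" "gcoef 6 = Complex 21 (-40)" "gcoef 7 = Complex 4 10" "gcoef 8 = -1"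
  by (simp_all add: gcoef_def)

text \<open>With E = cis (4 y) the exponentials are exp (- 6 y) E^(k - 4), and the nine coefficients
  are those of the square of the quartic with coefficients \<i>, -5 - 2 \<i>, 10, -5 + 2 \<i>,
  -\<i>. Divided by E^2 this quartic is real.\<close>

lemma gcoef_exp:
  "(\<Sum>k<9. gcoef k * exp (- (afreq k * of_real y))) =
     of_real (exp (- 6 * y) * (10 + 2 * Re (Complex (-5) 2 * cis (4 * y)) + 2 * Im ((cis (4 * y))\<^sup>2))\<^sup>2)"
proof -
  define E where "E = cis (4 * y)"
  have EE: "E * cnj E = 1" by (simp add: E_def complex_mult_cnj)
  have ex: "exp (- (afreq k * of_real y)) = of_real (exp (- 6 * y)) * (cnj E ^ 4 * E ^ k)" for k
  proof -
    have "- (afreq k * of_real y) = of_real (- 6 * y) + (of_nat 4 * (\<i> * of_real (- (4 * y))) + of_nat k * (\<i> * of_real (4 * y)))"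
      by (simp add: afreq_def complex_eq_iff algebra_simps)
    also have "exp \<dots> = of_real (exp (- 6 * y)) * (exp (\<i> * of_real (- (4 * y))) ^ 4 * exp (\<i> * of_real (4 * y)) ^ k)"
      unfolding exp_add exp_of_real exp_of_nat_mult ..
    finally show ?thesis unfolding E_def cis_conv_exp[symmetric] cis_cnj .
  qed
  define R where "R = 10 + Complex (-5) 2 * E + Complex (-5) (-2) * cnj E - \<i> * E\<^sup>2 + \<i> * (cnj E)\<^sup>2"
  have R: "R = of_real (10 + 2 * Re (Complex (-5) 2 * E) + 2 * Im (E\<^sup>2))"
    by (simp add: R_def complex_eq_iff power2_eq_square algebra_simps)
  have "(\<Sum>k<9. gcoef k * (cnj E ^ 4 * E ^ k)) = cnj E ^ 4 * (\<i> + Complex (-5) (-2) * E + 10 * E\<^sup>2 + Complex (-5) 2 * E ^ 3 - \<i> * E ^ 4)\<^sup>2"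
  proof -
    have z: "Complex x v = of_real x + \<i> * of_real v" for x v by (simp add: complex_eq_iff)
    have i2: "\<i> * (\<i> * u) = - u" for u by (simp add: mult.assoc[symmetric])
    show ?thesis unfolding sum_9 gcoef_values z
      by (simp add: power2_eq_square algebra_simps power_numeral_reduce i2)
  qed
  also have "cnj E ^ 4 * (\<i> + Complex (-5) (-2) * E + 10 * E\<^sup>2 + Complex (-5) 2 * E ^ 3 - \<i> * E ^ 4)\<^sup>2 = R\<^sup>2"
  proof -
    have gen: "G\<^sup>2 * (\<i> + p * E + 10 * E\<^sup>2 + q * E ^ 3 - \<i> * E ^ 4) =
        \<i> * G\<^sup>2 + p * (E * G) * G + 10 * (E * G)\<^sup>2 + q * ((E * G)\<^sup>2 * E) - \<i> * ((E * G)\<^sup>2 * E\<^sup>2)" for G p q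
      by (simp add: power2_eq_square power_numeral_reduce algebra_simps)
    have "(cnj E)\<^sup>2 * (\<i> + Complex (-5) (-2) * E + 10 * E\<^sup>2 + Complex (-5) 2 * E ^ 3 - \<i> * E ^ 4) = R"
      unfolding R_def gen EE by simp
    moreover have "cnj E ^ 4 * u\<^sup>2 = ((cnj E)\<^sup>2 * u)\<^sup>2" for u by (simp add: power_mult_distrib power2_eq_square power_numeral_reduce)
    ultimately show ?thesis by simp
  qed
  finally have S: "(\<Sum>k<9. gcoef k * (cnj E ^ 4 * E ^ k)) = R\<^sup>2" .
  have "(\<Sum>k<9. gcoef k * exp (- (afreq k * of_real y))) = of_real (exp (- 6 * y)) * (\<Sum>k<9. gcoef k * (cnj E ^ 4 * E ^ k))"
    unfolding ex sum_distrib_left by (simp only: mult.left_commute)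
  thus ?thesis unfolding S unfolding R E_def of_real_mult of_real_power .
qed

interpretation autocorr: autocorrelation "{..<9}" gcoef afreq "\<lambda>k. 8 - k"
proof
  show "bij_betw (\<lambda>k. 8 - k) {..<9} {..<9 :: nat}"
    by (rule bij_betw_byWitness[where f' = "\<lambda>k. 8 - k"]) auto
  show "gcoef (8 - k) = cnj (gcoef k)" if "k \<in> {..<9}" for k
    using that by (auto simp: less_9 gcoef_def complex_eq_iff)
  show "afreq (8 - k) = cnj (afreq k)" if "k \<in> {..<9}" for k
    using that by (auto simp: afreq_def complex_eq_iff of_nat_diff)
  show "Re (\<Sum>k<9. gcoef k * exp (- (afreq k * of_real y))) \<ge> 0" for y :: real
    unfolding gcoef_exp Re_complex_of_real by simp
qed (auto simp: afreq_def)

lemma afreq_values: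
  "afreq 0 = Complex 6 16" "afreq 1 = Complex 6 12" "afreq 2 = Complex 6 8" "afreq 3 = Complex 6 4" "afreq 4 = Complex 6 0"
  "afreq 5 = Complex 6 (-4)" "afreq 6 = Complex 6 (-8)" "afreq 7 = Complex 6 (-12)" "afreq 8 = Complex 6 (-16)"
  by (simp_all add: afreq_def)

lemma acoeff_values:
  "autocorr.acoeff 0 = Complex (1577/80665) (-3856/241995)"
  "autocorr.acoeff 1 = Complex (-847/5525) (7193/16575)"
  "autocorr.acoeff 2 = Complex (4117/5525) (-56948/16575)"
  "autocorr.acoeff 3 = Complex (-162821/16575) (69701/5525)"
  "autocorr.acoeff 4 = Complex (416/15) 0"
  "autocorr.acoeff 5 = Complex (-162821/16575) (-69701/5525)"
  "autocorr.acoeff 6 = Complex (4117/5525) (56948/16575)"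
  "autocorr.acoeff 7 = Complex (-847/5525) (-7193/16575)"
  "autocorr.acoeff 8 = Complex (1577/80665) (3856/241995)"
  unfolding autocorr.acoeff_def sum_9 gcoef_values afreq_values
  by (simp_all add: complex_eq_iff Re_divide Im_divide power2_eq_square)

text \<open>
  The summand \<open>m exp (- 1010 t)\<close> with \<open>m\<close> equal to a thousandth of the value of the autocorrelation at 0 is there
  to ensure \<open>S1 > f0\<close>.
\<close>

definition scoeff :: "nat \<Rightarrow> complex" where
  "scoeff k = (if k < 9 then autocorr.acoeff k else 866488/93075000)"

definition sfreq :: "nat \<Rightarrow> complex" where
  "sfreq k = (if k < 9 then afreq k else 1010)"

lemma sum_spike: "(\<Sum>k<10. P (scoeff k) (sfreq k)) = (\<Sum>k<9. P (autocorr.acoeff k) (afreq k)) + P (866488/93075000) 1010"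
proof -
  have "{..<10} = insert 9 {..<9 :: nat}" by auto
  thus ?thesis by (simp add: scoeff_def sfreq_def add.commute)
qed

lemma sum_acoeff: "(\<Sum>k<9. autocorr.acoeff k) = 866488/93075"
  unfolding sum_9 acoeff_values by (simp add: complex_eq_iff)

text \<open>With m = 866488/93075000 the autocorrelation has value 1000 m and derivative 0 at 0. The
  added summand contributes m to \<open>f0\<close> and 1010 m to \<open>S1\<close>, and 1010 > 1001
  is the inequality \<open>S1 > f0\<close>.\<close>

interpretation detector: smoothing "{..<10}" scoeff sfreq "1001 * (866488/93075000)" "1010 * (866488/93075000)"
proof
  show "(\<Sum>k<10. scoeff k) = of_real (1001 * (866488/93075000))"
    using sum_spike[of "\<lambda>x y. x"] by (simp add: sum_acoeff)
  have "(\<Sum>k<9. gcoef k) = 0" unfolding sum_9 gcoef_values by (simp add: complex_eq_iff)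
  thus "(\<Sum>k<10. scoeff k * sfreq k) = of_real (1010 * (866488/93075000))"
    using sum_spike[of "\<lambda>x y. x * y"] autocorr.acoeff_sum_a by simp
  show "Re (sfreq k) > 1" for k by (simp add: sfreq_def afreq_def)
  \<comment> \<open>Strictness comes from the added summand; the autocorrelation part is only known
    to be non-negative.\<close>
  show "Re (\<Sum>k<10. scoeff k / (z + sfreq k)) > 0" if z: "Re z \<ge> 0" for z
  proof -
    have "Re (of_real r / w) > 0" if "r > 0" "Re w > 0" for r :: real and w
      unfolding Re_divide using that by (intro divide_pos_pos) (auto intro: add_pos_nonneg)
    from this[of "866488/93075000" "z + 1010"] have "Re (866488/93075000 / (z + 1010)) > 0"
      using z by simp
    thus ?thesis using autocorr.acoeff_laplace_nonneg[OF z] sum_spike[of "\<lambda>x y. x / (z + y)"] by simp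
  qed
  fix t :: real
  have e: "exp (- (1010 * complex_of_real t)) = of_real (exp (- (1010 * t)))" by (simp flip: exp_of_real)
  show "(\<Sum>k<10. scoeff k * exp (- (sfreq k * of_real t))) \<in> \<real>"
    unfolding sum_spike[of "\<lambda>x y. x * exp (- (y * of_real t))"] e
    by (intro Reals_add autocorr.acoeff_exp_real) simp
  show "Re (\<Sum>k<10. scoeff k * exp (- (sfreq k * of_real t))) \<ge> 0"
    unfolding sum_spike[of "\<lambda>x y. x * exp (- (y * of_real t))"] e
    using autocorr.acoeff_exp_nonneg[of t] by simp
qed auto

text \<open>
  The autocorrelation of \<open>(14, 40, 61, 58, 35, 9, -3, -2, 2)\<close>, so that the cosine polynomial is the square of a modulus.
\<close>

definition tcoef :: "nat \<Rightarrow> real" where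
  "tcoef j = (if j < 9 then [10204, 17716, 11404, 5070, 1242, 0, 0, 104, 56] ! j else 0)"

lemma tcoef_nonneg: "tcoef j \<ge> 0"
  by (auto simp: tcoef_def less_9)

lemma tcoef_sum: "(\<Sum>j=1..8. tcoef j) = 35592"
  by (simp add: tcoef_def eval_nat_numeral atLeastAtMostSuc_conv)

lemma tcoef_cos_nonneg: "(\<Sum>j\<le>8. tcoef j * cos (real j * \<theta>)) \<ge> 0"
proof -
  define p :: "nat \<Rightarrow> real" where "p k = [14, 40, 61, 58, 35, 9, -3, -2, 2] ! k" for k
  define C where "C n = cos (real n * \<theta>)" for n
  have pv: "p 0 = 14" "p 1 = 40" "p 2 = 61" "p 3 = 58" "p 4 = 35" "p 5 = 9" "p 6 = -3" "p 7 = -2" "p 8 = 2"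
    by (simp_all add: p_def)
  have tv: "tcoef 0 = 10204" "tcoef 1 = 17716" "tcoef 2 = 11404" "tcoef 3 = 5070" "tcoef 4 = 1242" "tcoef 5 = 0" "tcoef 6 = 0" "tcoef 7 = 104" "tcoef 8 = 56"
    by (simp_all add: tcoef_def)
  have cd: "cos (real k * \<theta>) * cos (real l * \<theta>) + sin (real k * \<theta>) * sin (real l * \<theta>) = C (k - l + (l - k))" for k l
  proof (cases "k \<le> l")
    case True
    hence "real (k - l + (l - k)) * \<theta> = real l * \<theta> - real k * \<theta>" by (simp add: of_nat_diff left_diff_distrib)
    thus ?thesis unfolding C_def by (simp only: cos_diff) simp
  next
    case False
    hence "real (k - l + (l - k)) * \<theta> = real k * \<theta> - real l * \<theta>" by (simp add: of_nat_diff left_diff_distrib)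
    thus ?thesis unfolding C_def by (simp only: cos_diff)
  qed
  have "(\<Sum>k<9. p k * cos (real k * \<theta>))\<^sup>2 + (\<Sum>k<9. p k * sin (real k * \<theta>))\<^sup>2 =
     (\<Sum>k<9. \<Sum>l<9. p k * p l * (cos (real k * \<theta>) * cos (real l * \<theta>) + sin (real k * \<theta>) * sin (real l * \<theta>)))"
    unfolding power2_eq_square sum_product sum.distrib[symmetric] by (simp add: algebra_simps)
  also have "\<dots> = (\<Sum>k<9. \<Sum>l<9. p k * p l * C (k - l + (l - k)))" unfolding cd ..
  also have "\<dots> = (\<Sum>j<9. tcoef j * C j)"
    unfolding sum_9 pv tv by (simp add: numeral_2_eq_2)
  also have "\<dots> = (\<Sum>j\<le>8. tcoef j * cos (real j * \<theta>))"
    unfolding C_def by (intro sum.cong) auto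
  finally have "(\<Sum>j\<le>8. tcoef j * cos (real j * \<theta>)) = (\<Sum>k<9. p k * cos (real k * \<theta>))\<^sup>2 + (\<Sum>k<9. p k * sin (real k * \<theta>))\<^sup>2" ..
  thus ?thesis by (simp only: sum_power2_ge_zero)
qed

text \<open>The numerical hypothesis of \<open>zero_free_region\<close>, decided with exact
  rationals; 35592 is the sum of \<open>tcoef\<close> from 1 to 8. The choice of 6/5: with b0 =
  \<open>tcoef 0\<close> and S = 35592 the quantity (2 / 3 (S + b0) + S e^3) / e^2 is least at e^3 =
  4 / 3 (1 + b0 / S), where e is about 1.197.\<close>

lemma detector_constants:
  "tcoef 0 * Re (detector.F (- 1)) + (1001 * (866488/93075000)) * (55127/1000000 / (2 * (6/5)\<^sup>2)) *
      (2 / 3 * (35592 + tcoef 0) + 35592 * (6/5) ^ 3) < tcoef 1 * Re (detector.F 0)"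
proof -
  have "detector.F 0 = (\<Sum>k<9. autocorr.acoeff k / afreq k) + (866488/93075000) / 1010"
    unfolding detector.F_def using sum_spike[of "\<lambda>x y. x / (0 + y)"] by simp
  also have "(\<Sum>k<9. autocorr.acoeff k / afreq k) = 2185398272/562875625"
    unfolding sum_9 acoeff_values afreq_values by (simp add: complex_eq_iff Re_divide Im_divide)
  finally have "detector.F 0 = of_real (2185398272/562875625 + (866488/93075000) / 1010)" by simp
  hence F0: "Re (detector.F 0) = 2185398272/562875625 + (866488/93075000) / 1010" by (simp only: Re_complex_of_real)
  have "detector.F (-1) = (\<Sum>k<9. autocorr.acoeff k / (- 1 + afreq k)) + (866488/93075000) / 1009"
    unfolding detector.F_def using sum_spike[of "\<lambda>x y. x / (- 1 + y)"] by simp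
  also have "(\<Sum>k<9. autocorr.acoeff k / (- 1 + afreq k)) = 358528389366936/69891124875325"
    unfolding sum_9 acoeff_values afreq_values by (simp add: complex_eq_iff Re_divide Im_divide)
  finally have "detector.F (-1) = of_real (358528389366936/69891124875325 + (866488/93075000) / 1009)" by simp
  hence F1: "Re (detector.F (-1)) = 358528389366936/69891124875325 + (866488/93075000) / 1009" by (simp only: Re_complex_of_real)
  show ?thesis unfolding F0 F1 by (simp add: tcoef_def power2_eq_square power_numeral_reduce)
qed

section \<open>The zero-free region\<close>

definition width :: "real \<Rightarrow> real \<Rightarrow> real \<Rightarrow> real" where
  "width cc B t = cc / ((B * ln t) powr (2 / 3) * ln (ln t) powr (1 / 3))"

text \<open>The half-width of the strip; \<open>e\<close> is a free parameter (finally 6/5), not Euler's number.\<close>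

definition eta :: "real \<Rightarrow> real \<Rightarrow> real \<Rightarrow> real" where
  "eta e B t = e\<^sup>2 * (ln (ln t) / (B * ln t)) powr (2 / 3)"

lemma eta_tendsto_0:
  assumes "B > 0"
  shows "(eta e B \<longlongrightarrow> 0) at_top"
proof -
  have "((\<lambda>t :: real. (ln (ln t) / ln t) powr (2 / 3)) \<longlongrightarrow> 0) at_top" by real_asymp
  hence "((\<lambda>t :: real. e\<^sup>2 * (1 / B) powr (2 / 3) * (ln (ln t) / ln t) powr (2 / 3)) \<longlongrightarrow> e\<^sup>2 * (1 / B) powr (2 / 3) * 0) at_top"
    by (intro tendsto_mult_left)
  moreover have "eventually (\<lambda>t. e\<^sup>2 * (1 / B) powr (2 / 3) * (ln (ln t) / ln t) powr (2 / 3) = eta e B t) at_top"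
    using eventually_ge_at_top[of "exp 1"]
  proof eventually_elim
    case (elim t)
    hence "ln t \<ge> 1" using ln_ge_iff[of t 1] exp_gt_zero[of "1 :: real"] by linarith
    moreover have "ln (ln t) / (B * ln t) = (1 / B) * (ln (ln t) / ln t)" by simp
    ultimately show ?case unfolding eta_def using assms
      by (simp only: powr_mult[of "1 / B" "ln (ln t) / ln t"] mult.assoc)
  qed
  ultimately show ?thesis by (simp add: tendsto_cong)
qed

text \<open>The instance \<epsilon> = pi cc / (4 e^2) / ln (ln t) of \<mu> = 4 \<eta> \<epsilon> /
  pi: dividing (ln ln t)^(2/3) by ln ln t produces the exponent - 1/3 of the region.\<close>

lemma width_eta:
  assumes "B > 0" "e > 0" "ln t > 0" "ln (ln t) > 0"
  shows "width cc B t = 4 * eta e B t * (pi * cc / (4 * e\<^sup>2) / ln (ln t)) / pi"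
proof -
  define l where "l = ln (ln t)"
  have l: "l > 0" using assms by (simp add: l_def)
  have "l = l powr (2 / 3) * l powr (1 / 3)" using l by (simp flip: powr_add)
  hence e: "l powr (2 / 3) / l = 1 / l powr (1 / 3)" using l by (simp add: field_simps)
  have "(l / (B * ln t)) powr (2 / 3) = l powr (2 / 3) / (B * ln t) powr (2 / 3)"
    by (rule powr_divide)
  hence "4 * eta e B t * (pi * cc / (4 * e\<^sup>2) / l) / pi = cc * (l powr (2 / 3) / l) / (B * ln t) powr (2 / 3)"
    unfolding eta_def l_def[symmetric] using assms(2) by (simp add: field_simps)
  thus ?thesis unfolding e by (simp add: width_def l_def mult_ac)
qed

text \<open>The reason for the exponent 2/3 in \<open>eta\<close>: across the whole strip the factor
  t^(B \<eta>^(3/2)) is just (ln t)^(e^3), a power of ln t like the other factor of the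
  hypothesis.\<close>

lemma eta_powr:
  assumes "B > 0" "e > 0" "ln t > 0" "ln (ln t) > 0"
  shows "B * eta e B t powr (3 / 2) = e ^ 3 * ln (ln t) / ln t"
proof -
  have "(e\<^sup>2) powr (3 / 2) = e ^ 3"
    using assms by (simp add: powr_powr flip: powr_numeral)
  moreover have "((ln (ln t) / (B * ln t)) powr (2 / 3)) powr (3 / 2) = ln (ln t) / (B * ln t)"
    using assms by (simp add: powr_powr)
  ultimately have "eta e B t powr (3 / 2) = e ^ 3 * (ln (ln t) / (B * ln t))"
    unfolding eta_def using assms by (subst powr_mult) auto
  thus ?thesis using assms by simp
qed

text \<open>The term - 2 / 3 ln ln ln t is dropped, its sign being favourable.\<close>

lemma ln_inverse_eta:
  assumes "B > 0" "e > 0" "ln t > 0" "ln (ln t) \<ge> 1"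
  shows "ln (1 / eta e B t) \<le> 2 / 3 * ln (ln t) + (2 * \<bar>ln e\<bar> + \<bar>ln B\<bar>)"
proof -
  define L l where "L = ln t" and "l = ln L"
  have L: "L > 0" "l \<ge> 1" using assms by (auto simp: L_def l_def)
  have p: "(l / (B * L)) powr (2 / 3) > 0" using L assms by simp
  have gen: "ln ((m / (B * L)) powr (2 / 3)) = 2 / 3 * (ln m - (ln B + ln L))" if "m > 0" for m
    using that L(1) assms(1) by (simp add: ln_powr ln_div ln_mult)
  have "ln ((l / (B * L)) powr (2 / 3)) = 2 / 3 * (ln l - (ln B + l))"
    using gen[of l] L(2) unfolding l_def[symmetric] by simp
  hence "ln (eta e B t) = 2 * ln e + 2 / 3 * (ln l - (ln B + l))"
    using p assms(2) by (simp add: eta_def L_def[symmetric] l_def[symmetric] ln_mult ln_realpow)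
  moreover have "ln (1 / eta e B t) = - ln (eta e B t)"
    using p assms(2) by (simp add: ln_div eta_def L_def[symmetric] l_def[symmetric])
  moreover have "ln l \<ge> 0" using L by simp
  moreover have "- ln e \<le> \<bar>ln e\<bar>" "2 / 3 * ln B \<le> \<bar>ln B\<bar>" by simp_all
  moreover have "2 / 3 * (ln l - (ln B + l)) = 2 / 3 * ln l - 2 / 3 * ln B - 2 / 3 * l" by simp
  ultimately have "ln (1 / eta e B t) \<le> 2 / 3 * l + (2 * \<bar>ln e\<bar> + \<bar>ln B\<bar>)" by argo
  thus ?thesis by (simp only: L_def l_def)
qed

text \<open>In the coefficient of ln (ln t) the summand 2 / 3 comes from the logarithmic factor of
  the hypothesis and e^3 from the power of T, by \<open>eta_powr\<close>. Everything else is bounded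
  in t.\<close>

lemma zeta_left_bound:
  fixes A B e t :: real and N :: nat and s :: complex
  assumes AB: "A > 0" "B > 0" and e: "e > 0"
    and hz: "\<And>T \<sigma> y :: real. T \<ge> 3 \<Longrightarrow> 1 \<le> \<bar>y\<bar> \<Longrightarrow> \<bar>y\<bar> \<le> T \<Longrightarrow> 1 / 2 \<le> \<sigma> \<Longrightarrow> \<sigma> \<le> 1 \<Longrightarrow>
      norm (zeta (Complex \<sigma> y)) \<le> A * T powr (B * (1 - \<sigma>) powr (3 / 2)) * ln T powr (2 / 3)"
    and t: "t \<ge> 3" "ln t \<ge> 1" "ln (ln t) \<ge> 1" and \<eta>: "eta e B t \<le> 1 / 2"
    and j: "j \<in> {1..N}" and s: "1 - eta e B t \<le> Re s" "Re s \<le> 1" "\<bar>Im s - real j * t\<bar> \<le> 1"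
  shows "norm (zeta s) \<le> exp ((2 / 3 + e ^ 3) * ln (ln t) + (\<bar>ln A\<bar> + e ^ 3 * ln (real N + 1) + ln (1 + ln (real N + 1))))"
proof -
  define n where "n = ln (real N + 1)"
  have n0: "n \<ge> 0" by (simp add: n_def)
  \<comment> \<open>All heights within 1 of j t, j <= N, are below (N + 1) t; replacing t by T
    changes ln t only by a constant.\<close>
  define T where "T = (real N + 1) * t"
  have jt: "t \<le> real j * t" "real j * t \<le> real N * t" using j t by auto
  have T: "T \<ge> 3" using t mult_mono[of 1 "real N + 1" 3 t] by (simp add: T_def)
  have Im: "1 \<le> \<bar>Im s\<bar>" "\<bar>Im s\<bar> \<le> T"
  proof -
    have "T = real N * t + t" by (simp add: T_def algebra_simps)
    thus "1 \<le> \<bar>Im s\<bar>" "\<bar>Im s\<bar> \<le> T" using s(3) jt t by linarith+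
  qed
  have lT: "ln T = n + ln t" using t by (simp add: T_def n_def ln_mult)
  have lT1: "ln T \<ge> 1" using lT n0 t by simp
  define L where "L = ln t"
  define l where "l = ln L"
  have L: "L \<ge> 1" "l \<ge> 1" using t by (auto simp: L_def l_def)
  have lL: "l \<le> L" using ln_le_minus_one[of L] L by (simp add: l_def)
  have ex: "B * (1 - Re s) powr (3 / 2) * ln T \<le> e ^ 3 * l + e ^ 3 * n"
  proof -
    have "B * (1 - Re s) powr (3 / 2) \<le> B * eta e B t powr (3 / 2)"
      using s AB by (intro mult_left_mono powr_mono2) auto
    also have "\<dots> = e ^ 3 * l / L" unfolding L_def l_def by (rule eta_powr) (use AB e t in linarith)+
    finally have "B * (1 - Re s) powr (3 / 2) * ln T \<le> (e ^ 3 * l / L) * ln T"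
      using lT1 by (intro mult_right_mono) auto
    also have "\<dots> = e ^ 3 * l + e ^ 3 * (n * (l / L))"
      unfolding lT L_def[symmetric] using L by (simp add: field_simps)
    also have "\<dots> \<le> e ^ 3 * l + e ^ 3 * (n * 1)"
      using e n0 L lL by (intro add_left_mono mult_left_mono) auto
    finally show ?thesis by simp
  qed
  have ll: "2 / 3 * ln (ln T) \<le> 2 / 3 * l + ln (1 + n)"
  proof -
    have "ln T \<le> L * (1 + n)" unfolding lT L_def[symmetric] using n0 L mult_right_mono[of 1 L n] by (simp add: algebra_simps)
    hence "ln (ln T) \<le> ln (L * (1 + n))" using lT1 by (intro ln_mono) auto
    also have "\<dots> = l + ln (1 + n)" using L n0 by (simp add: l_def ln_mult)
    finally have "ln (ln T) \<le> l + ln (1 + n)" .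
    moreover have "ln (1 + n) \<ge> 0" using n0 by simp
    ultimately show ?thesis by linarith
  qed
  have "norm (zeta s) = norm (zeta (Complex (Re s) (Im s)))" by simp
  also have "\<dots> \<le> A * T powr (B * (1 - Re s) powr (3 / 2)) * ln T powr (2 / 3)"
    by (rule hz[OF T Im]) (use s \<eta> in auto)
  also have "\<dots> = exp (ln A + B * (1 - Re s) powr (3 / 2) * ln T + 2 / 3 * ln (ln T))"
    using T lT1 AB by (simp add: exp_add powr_def)
  also have "\<dots> \<le> exp ((2 / 3 + e ^ 3) * l + (\<bar>ln A\<bar> + e ^ 3 * n + ln (1 + n)))"
  proof -
    have "ln A + B * (1 - Re s) powr (3 / 2) * ln T + 2 / 3 * ln (ln T) \<le> \<bar>ln A\<bar> + (e ^ 3 * l + e ^ 3 * n) + (2 / 3 * l + ln (1 + n))"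
      using ex ll by (intro add_mono) auto
    also have "\<dots> = (2 / 3 + e ^ 3) * l + (\<bar>ln A\<bar> + e ^ 3 * n + ln (1 + n))" by (simp add: algebra_simps)
    finally show ?thesis by simp
  qed
  finally show ?thesis unfolding n_def l_def L_def .
qed

text \<open>Up to the height (N + 1) t both ln and ln ln grow at most by the factor 1 + \<delta>,
  and the exponents 2 / 3 and 1 / 3 add up to 1. This compares the widths at the heights near j t
  with the one at t.\<close>

lemma width_slowly_varying:
  fixes N :: nat
  assumes "B > 0" "cc > 0" "\<delta> > 0" and t: "t \<ge> 1" "ln t \<ge> 1" "ln (ln t) \<ge> 1" "ln (real N + 1) \<le> \<delta> * ln t"
    and y: "1 < ln y" "y \<le> (real N + 1) * t" "y > 0"
  shows "width cc B t \<le> (1 + \<delta>) * width cc B y"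
proof -
  define q where "q = 1 + \<delta>"
  have q: "q > 1" using assms by (simp add: q_def)
  have y1: "y > 1" using y(1,3) ln_gt_zero_iff[of y] by linarith
  have pos: "(B * L) powr (2 / 3) * l powr (1 / 3) > 0" if "L > 0" "l > 0" for L l
    using that assms(1) by simp
  have ly: "ln y \<le> q * ln t"
  proof -
    have "ln y \<le> ln ((real N + 1) * t)" using y by (intro ln_mono) auto
    also have "\<dots> = ln (real N + 1) + ln t" using t by (simp add: ln_mult)
    also have "\<dots> \<le> q * ln t" using t by (simp add: q_def algebra_simps)
    finally show ?thesis .
  qed
  have lly: "ln (ln y) \<le> q * ln (ln t)"
  proof -
    have "ln (ln y) \<le> ln (q * ln t)" by (rule ln_mono[OF ly]) (use y in linarith)
    also have "\<dots> = ln q + ln (ln t)" by (rule ln_mult_pos) (use q t in linarith)+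
    also have "ln q \<le> \<delta> * 1" using ln_le_minus_one[of q] q by (simp add: q_def)
    also have "\<delta> * 1 \<le> \<delta> * ln (ln t)" using assms(3) t by (intro mult_left_mono) auto
    finally show ?thesis by (simp add: q_def algebra_simps)
  qed
  have lly0: "ln (ln y) > 0" using y(1) by (rule ln_gt_zero)
  have "(B * ln y) powr (2 / 3) * ln (ln y) powr (1 / 3) \<le> (q * (B * ln t)) powr (2 / 3) * (q * ln (ln t)) powr (1 / 3)"
  proof (rule mult_mono)
    have "B * ln y \<le> q * (B * ln t)" using mult_left_mono[OF ly, of B] assms(1) by (simp add: mult_ac)
    thus "(B * ln y) powr (2 / 3) \<le> (q * (B * ln t)) powr (2 / 3)"
      using assms(1) y(1) by (intro powr_mono2) auto
    show "ln (ln y) powr (1 / 3) \<le> (q * ln (ln t)) powr (1 / 3)" using lly lly0 by (intro powr_mono2) auto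
  qed auto
  also have "\<dots> = (q powr (2 / 3) * q powr (1 / 3)) * ((B * ln t) powr (2 / 3) * ln (ln t) powr (1 / 3))"
    using q t assms(1) by (simp add: powr_mult mult_ac)
  also have "q powr (2 / 3) * q powr (1 / 3) = q" using q by (simp flip: powr_add)
  finally have le: "(B * ln y) powr (2 / 3) * ln (ln y) powr (1 / 3) \<le> q * ((B * ln t) powr (2 / 3) * ln (ln t) powr (1 / 3))" .
  have p: "(B * ln y) powr (2 / 3) * ln (ln y) powr (1 / 3) > 0" by (rule pos) (use y lly0 in linarith)+
  have p2: "(B * ln t) powr (2 / 3) * ln (ln t) powr (1 / 3) > 0" by (rule pos) (use t in linarith)+
  have gen: "c / u \<le> q * (c / v)" if "v \<le> q * u" "u > 0" "v > 0" "c > 0" for u v c :: real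
    using that q by (simp add: field_simps)
  show ?thesis unfolding width_def q_def[symmetric] by (rule gen[OF le p2 p assms(2)])
qed

section \<open>Passage to the limit and the final contradiction\<close>

context smoothing
begin

text \<open>F is the Laplace transform of the non-negative f, so the difference is the integral of
  (exp (- s y) - exp (- s' y)) f y. The doubled index set presents this difference as one
  exponential sum. It permits F (- x) to be replaced by F (- 1).\<close>

lemma F_decreasing:
  fixes s s' :: real
  assumes s: "-1 \<le> s" "s \<le> s'"
  shows "Re (F (of_real s')) \<le> Re (F (of_real s))"
proof -
  define C where "C = (\<lambda>(k, d). if d then c k / (of_real s + a k) else - c k / (of_real s' + a k))"
  define \<beta> where "\<beta> = (\<lambda>(k, d). if d then of_real s + a k else of_real s' + a k)"
  define J where "J = I \<times> (UNIV :: bool set)"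
  have \<beta>: "Re (\<beta> i) > 0" if "i \<in> J" for i
    using that s a_gt[of "fst i"] by (auto simp: \<beta>_def J_def split: prod.splits)
  have split: "(\<Sum>i\<in>J. h i) = (\<Sum>k\<in>I. h (k, True)) + (\<Sum>k\<in>I. h (k, False))" for h :: "nat \<times> bool \<Rightarrow> complex"
  proof -
    have "(\<Sum>i\<in>J. h i) = (\<Sum>k\<in>I. \<Sum>d\<in>UNIV. h (k, d))" unfolding J_def sum.cartesian_product by simp
    thus ?thesis by (simp add: UNIV_bool sum.distrib add.commute)
  qed
  have "Re (\<Sum>i\<in>J. C i) \<ge> 0"
  proof (rule exp_sum_nonneg[where \<beta> = \<beta>])
    fix y :: real assume y: "y \<ge> 0"
    define f where "f = (\<Sum>k\<in>I. c k * exp (- (a k * of_real y)))"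
    have *: "c k / z * z * exp (- (z * of_real y)) = c k * exp (- (z * of_real y))" if "z \<noteq> 0" for k z
      using that by simp
    have ex: "exp (- ((of_real r + a k) * of_real y)) = of_real (exp (- (r * y))) * exp (- (a k * of_real y))" for r k
      unfolding exp_of_real[symmetric] exp_add[symmetric] by (simp add: algebra_simps)
    have nz: "of_real r + a k \<noteq> 0" if "k \<in> I" "r \<ge> -1" for r k
      using a_gt[OF that(1)] that(2) by (auto simp: complex_eq_iff)
    have "(\<Sum>i\<in>J. C i * \<beta> i * exp (- (\<beta> i * of_real y))) =
       (\<Sum>k\<in>I. of_real (exp (- (s * y))) * (c k * exp (- (a k * of_real y)))) - (\<Sum>k\<in>I. of_real (exp (- (s' * y))) * (c k * exp (- (a k * of_real y))))"
      unfolding split C_def \<beta>_def prod.case if_True if_False ex sum_subtractf[symmetric] diff_conv_add_uminus sum_negf[symmetric]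
      by (intro arg_cong2[where f = "(+)"] sum.cong refl) (use nz s in auto)
    also have "\<dots> = of_real (exp (- (s * y)) - exp (- (s' * y))) * f"
      by (simp only: f_def sum_distrib_left[symmetric] of_real_diff left_diff_distrib)
    finally have e: "Re (\<Sum>i\<in>J. C i * \<beta> i * exp (- (\<beta> i * of_real y))) = (exp (- (s * y)) - exp (- (s' * y))) * Re f"
      by (simp only: times_complex.sel Re_complex_of_real Im_complex_of_real mult_zero_left diff_zero)
    have "exp (- (s' * y)) \<le> exp (- (s * y))" using s y by (simp add: mult_right_mono)
    thus "Re (\<Sum>i\<in>J. C i * \<beta> i * exp (- (\<beta> i * of_real y))) \<ge> 0"
      unfolding e using f_nonneg(2)[OF y] by (simp only: f_def mult_nonneg_nonneg diff_ge_0_iff_ge)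
  qed (use fin \<beta> in \<open>auto simp: J_def\<close>)
  moreover have "(\<Sum>i\<in>J. C i) = F (of_real s) - F (of_real s')"
    unfolding split C_def F_def by (simp add: sum_negf)
  ultimately show ?thesis by simp
qed

lemma F_near_0:
  assumes "d > 0"
  shows "\<exists>r>0. \<forall>z :: real. 0 \<le> z \<longrightarrow> z \<le> r \<longrightarrow> Re (F (of_real z)) \<ge> Re (F 0) - d"
proof -
  have "isCont (\<lambda>z :: real. Re (F (of_real z))) 0"
    unfolding F_def isCont_def by (intro tendsto_intros) (use a_gt in \<open>fastforce simp: complex_eq_iff\<close>)+
  then obtain r where r: "r > 0" "\<And>z. dist z 0 < r \<Longrightarrow> dist (Re (F (of_real z))) (Re (F (of_real 0))) < d"
    using assms unfolding continuous_at_eps_delta by blast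
  show ?thesis
  proof (intro exI[of _ "r / 2"] conjI allI impI)
    fix z :: real assume "0 \<le> z" "z \<le> r / 2"
    hence "dist z 0 < r" using r(1) by (simp add: dist_real_def)
    from r(2)[OF this] show "Re (F (of_real z)) \<ge> Re (F 0) - d" by (simp add: dist_real_def)
  qed (use r in simp)
qed

text \<open>By \<open>width_eta\<close>, \<open>zeta_left_bound\<close> and
  \<open>ln_inverse_eta\<close> the right-hand side of the detector inequality is at most a
  polynomial \<open>p\<close> in u = 1 / ln (ln t), and \<open>p 0\<close> is the main term plus d /
  3. The estimate is uniform in x and z0, which may vary with t.\<close>

lemma detector_limit:
  fixes b :: "nat \<Rightarrow> real" and N :: nat and A B cc e R0 d :: real
  assumes b: "\<And>j. b j \<ge> 0" and P: "\<And>\<theta>. (\<Sum>j\<le>N. b j * cos (real j * \<theta>)) \<ge> 0"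
    and N: "N \<ge> 1" and AB: "A > 0" "B > 0" and ce: "cc > 0" "e > 0" and R0: "1 / 2 \<le> R0" "R0 < 1" and d: "d > 0"
    and hz: "\<And>T \<sigma> y :: real. T \<ge> 3 \<Longrightarrow> 1 \<le> \<bar>y\<bar> \<Longrightarrow> \<bar>y\<bar> \<le> T \<Longrightarrow> 1 / 2 \<le> \<sigma> \<Longrightarrow> \<sigma> \<le> 1 \<Longrightarrow>
      norm (zeta (Complex \<sigma> y)) \<le> A * T powr (B * (1 - \<sigma>) powr (3 / 2)) * ln T powr (2 / 3)"
  shows "\<forall>\<^sub>F t in at_top. \<forall>x z0. 0 \<le> x \<longrightarrow> x \<le> 1 \<longrightarrow> 0 \<le> z0 \<longrightarrow> z0 \<le> 1 \<longrightarrow>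
     (\<forall>j\<in>{1..N}. \<forall>\<rho>. zeta \<rho> = 0 \<longrightarrow> \<bar>Im \<rho> - real j * t\<bar> \<le> 1 \<longrightarrow> Re \<rho> \<le> 1 - x * width cc B t) \<longrightarrow>
     zeta (Complex (1 - (z0 + x) * width cc B t) t) = 0 \<longrightarrow>
     b 1 * Re (F (of_real z0)) - b 0 * Re (F (- of_real x)) \<le>
       f0 * (cc / (2 * e\<^sup>2)) * (2 / 3 * ((\<Sum>j=1..N. b j) + b 0) + (\<Sum>j=1..N. b j) * e ^ 3) / R0 + d"
proof -
  define Bs where "Bs = (\<Sum>j=1..N. b j)"
  have Bs0: "Bs \<ge> 0" unfolding Bs_def by (intro sum_nonneg b)
  define \<kappa> where "\<kappa> = pi * cc / (4 * e\<^sup>2)"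
  have \<kappa>: "\<kappa> > 0" using ce by (simp add: \<kappa>_def)
  define CU where "CU = \<bar>ln A\<bar> + e ^ 3 * ln (real N + 1) + ln (1 + ln (real N + 1))"
  have CU: "CU \<ge> 0" using ce by (simp add: CU_def)
  define Cl where "Cl = 2 * \<bar>ln e\<bar> + \<bar>ln B\<bar>"
  define main where "main = f0 * (cc / (2 * e\<^sup>2)) * (2 / 3 * (Bs + b 0) + Bs * e ^ 3) / R0"
  obtain M e1 where M: "M > 0" "e1 > 0" and D: "\<forall>t \<eta> \<epsilon> x \<delta> U z0. t \<ge> 2 \<longrightarrow> 0 < \<eta> \<longrightarrow> \<eta> < e1 \<longrightarrow> 0 < \<epsilon> \<longrightarrow> \<epsilon> < e1 \<longrightarrow>
     0 \<le> x \<longrightarrow> x \<le> 1 \<longrightarrow> 0 < \<delta> \<longrightarrow> 0 \<le> U \<longrightarrow> 0 \<le> z0 \<longrightarrow> z0 \<le> 1 \<longrightarrow>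
     (\<forall>j\<in>{1..N}. \<forall>\<rho>. zeta \<rho> = 0 \<longrightarrow> \<bar>Im \<rho> - real j * t\<bar> \<le> 1 \<longrightarrow> Re \<rho> \<le> 1 - x * (4 * \<eta> * \<epsilon> / pi)) \<longrightarrow>
     (\<forall>j\<in>{1..N}. \<forall>s. 1 - \<eta> \<le> Re s \<longrightarrow> Re s \<le> 1 \<longrightarrow> \<bar>Im s - real j * t\<bar> \<le> 1 \<longrightarrow> norm (zeta s) \<le> exp U) \<longrightarrow>
     zeta (Complex (1 - (z0 + x) * (4 * \<eta> * \<epsilon> / pi)) t) = 0 \<longrightarrow>
     b 1 * Re (F (of_real z0)) - b 0 * Re (F (- of_real x)) \<le>
       \<epsilon> * (2 * f0 / (pi * R0) * ((\<Sum>j=1..N. b j) * U + b 0 * ln (1 / \<eta>)) +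
            M * (1 + 1 / \<delta>\<^sup>2 + \<epsilon> * U + (\<delta> + \<epsilon>) * (ln (1 / \<eta>) + 1)))"
    using detector_inequality[of b N R0, OF b P N R0] by (elim exE conjE) (rule that)
  \<comment> \<open>The part of the error proportional to \<delta> is the only one that survives at
    u = 0; this choice makes it M \<kappa> \<delta> 2 / 3 = d / 3.\<close>
  define \<delta> where "\<delta> = d / (2 * M * \<kappa>)"
  have \<delta>: "\<delta> > 0" using d M \<kappa> by (simp add: \<delta>_def)
  define p where "p = (\<lambda>u. \<kappa> * (2 * f0 / (pi * R0) * (Bs * ((2 / 3 + e ^ 3) + CU * u) + b 0 * (2 / 3 + Cl * u)) +
      M * ((1 + 1 / \<delta>\<^sup>2) * u + \<kappa> * u * ((2 / 3 + e ^ 3) + CU * u) + (\<delta> + \<kappa> * u) * (2 / 3 + (Cl + 1) * u))))"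
  have p0: "p 0 < main + d"
  proof -
    have "2 * f0 / (pi * R0) * \<kappa> = f0 * (cc / (2 * e\<^sup>2)) / R0" by (simp add: \<kappa>_def mult.commute mult.left_commute)
    moreover have "M * \<delta> * \<kappa> = d / 2" using M \<kappa> by (simp add: \<delta>_def)
    moreover have "p 0 = (2 * f0 / (pi * R0) * \<kappa>) * (Bs * (2 / 3 + e ^ 3) + b 0 * (2 / 3)) + (M * \<delta> * \<kappa>) * (2 / 3)"
      by (simp add: p_def algebra_simps)
    moreover have "(f0 * (cc / (2 * e\<^sup>2)) / R0) * (Bs * (2 / 3 + e ^ 3) + b 0 * (2 / 3)) = main"
    proof -
      have "Bs * (2 / 3 + e ^ 3) + b 0 * (2 / 3) = 2 / 3 * (Bs + b 0) + Bs * e ^ 3" by (simp add: algebra_simps)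
      thus ?thesis unfolding main_def by (simp only: times_divide_eq_left)
    qed
    ultimately show ?thesis using d by simp
  qed
  have "isCont p 0" unfolding p_def by (intro continuous_intros)
  moreover have "((\<lambda>t :: real. 1 / ln (ln t)) \<longlongrightarrow> 0) at_top" by real_asymp
  ultimately have "((\<lambda>t. p (1 / ln (ln t))) \<longlongrightarrow> p 0) at_top" by (rule isCont_tendsto_compose)
  hence evp: "\<forall>\<^sub>F t in at_top. p (1 / ln (ln t)) < main + d" using p0 by (rule order_tendstoD)
  have "((\<lambda>t. \<kappa> * (1 / ln (ln t))) \<longlongrightarrow> \<kappa> * 0) at_top" by (intro tendsto_mult_left) real_asymp
  hence eve: "\<forall>\<^sub>F t in at_top. \<kappa> * (1 / ln (ln t)) < e1" by (rule order_tendstoD) (use M in simp)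
  have ev\<eta>: "\<forall>\<^sub>F t in at_top. eta e B t < min e1 (1 / 2)"
    by (rule order_tendstoD[OF eta_tendsto_0[OF AB(2)]]) (use M in simp)
  have evl: "\<forall>\<^sub>F t :: real in at_top. ln (ln t) \<ge> 1" "\<forall>\<^sub>F t :: real in at_top. ln t \<ge> 1"
    by real_asymp+
  show ?thesis
    using evp eve ev\<eta> evl eventually_ge_at_top[of 3]
  proof eventually_elim
    case (elim t)
    define \<eta> where "\<eta> = eta e B t"
    define l where "l = ln (ln t)"
    define \<epsilon> where "\<epsilon> = \<kappa> / l"
    have l: "l \<ge> 1" using elim by (simp add: l_def)
    have lpos: "ln t > 0" "ln (ln t) > 0" using elim by linarith+
    have \<eta>: "\<eta> > 0"
      unfolding \<eta>_def eta_def using ce AB lpos by (intro mult_pos_pos) (simp_all only: powr_gt_zero zero_less_power, simp)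
    have \<epsilon>: "0 < \<epsilon>" "\<epsilon> < e1" using \<kappa> l elim(2) by (auto simp: \<epsilon>_def l_def)
    have w: "width cc B t = 4 * \<eta> * \<epsilon> / pi"
      unfolding \<eta>_def \<epsilon>_def \<kappa>_def l_def by (rule width_eta) (use AB ce lpos in auto)
    define U where "U = (2 / 3 + e ^ 3) * l + CU"
    have U: "U \<ge> 0" using ce l CU by (simp add: U_def)
    have lb: "\<forall>j\<in>{1..N}. \<forall>s. 1 - \<eta> \<le> Re s \<longrightarrow> Re s \<le> 1 \<longrightarrow> \<bar>Im s - real j * t\<bar> \<le> 1 \<longrightarrow> norm (zeta s) \<le> exp U"
      unfolding U_def CU_def l_def \<eta>_def
      by (intro ballI allI impI, rule zeta_left_bound[OF AB ce(2) hz]) (use elim in auto)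
    define q where "q = ln (1 / \<eta>)"
    have q: "q \<le> 2 / 3 * l + Cl" unfolding q_def \<eta>_def l_def Cl_def
      by (rule ln_inverse_eta) (use AB ce lpos elim in auto)
    show ?case
    proof (intro allI impI)
      fix x z0 :: real
      assume x: "0 \<le> x" "x \<le> 1" and z0: "0 \<le> z0" "z0 \<le> 1"
        and zf: "\<forall>j\<in>{1..N}. \<forall>\<rho>. zeta \<rho> = 0 \<longrightarrow> \<bar>Im \<rho> - real j * t\<bar> \<le> 1 \<longrightarrow> Re \<rho> \<le> 1 - x * width cc B t"
        and zero: "zeta (Complex (1 - (z0 + x) * width cc B t) t) = 0"
      have "b 1 * Re (F (of_real z0)) - b 0 * Re (F (- of_real x)) \<le>
         \<epsilon> * (2 * f0 / (pi * R0) * (Bs * U + b 0 * q) + M * (1 + 1 / \<delta>\<^sup>2 + \<epsilon> * U + (\<delta> + \<epsilon>) * (q + 1)))"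
        unfolding q_def Bs_def
        by (rule D[THEN spec, THEN spec, THEN spec, THEN spec, THEN spec, THEN spec, THEN spec, THEN mp, THEN mp, THEN mp, THEN mp, THEN mp,
              THEN mp, THEN mp, THEN mp, THEN mp, THEN mp, THEN mp, THEN mp, THEN mp, THEN mp])
           (use elim \<eta> \<epsilon> x z0 \<delta> U zf lb zero in \<open>simp_all add: w \<eta>_def\<close>)
      also have "\<dots> \<le> \<epsilon> * (2 * f0 / (pi * R0) * (Bs * U + b 0 * (2 / 3 * l + Cl)) + M * (1 + 1 / \<delta>\<^sup>2 + \<epsilon> * U + (\<delta> + \<epsilon>) * (2 / 3 * l + Cl + 1)))"
        using q \<epsilon> f0 R0 b[of 0] M \<delta> Bs0 by (intro mult_left_mono add_mono) auto
      also have "\<dots> = p (1 / l)"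
      proof -
        define u where "u = 1 / l"
        have lu: "u * l = 1" and eu: "\<epsilon> = \<kappa> * u" using l by (auto simp: u_def \<epsilon>_def)
        have r: "u * (X * l + Y) = X + Y * u" for X Y using lu by (simp add: algebra_simps)
        have gen: "(\<kappa> * u) * (G * (Bs * V + b 0 * Q) + M * (1 + D + (\<kappa> * u) * V + (\<delta> + \<kappa> * u) * W)) =
            \<kappa> * (G * (Bs * (u * V) + b 0 * (u * Q)) + M * ((1 + D) * u + \<kappa> * u * (u * V) + (\<delta> + \<kappa> * u) * (u * W)))" for G V Q D W
          by (simp add: algebra_simps)
        show ?thesis unfolding p_def u_def[symmetric] eu gen U_def r add.assoc[of "2 / 3 * l" Cl 1] ..
      qed
      also have "\<dots> < main + d" using elim(1) by (simp only: l_def)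
      finally show "b 1 * Re (F (of_real z0)) - b 0 * Re (F (- of_real x)) \<le>
          f0 * (cc / (2 * e\<^sup>2)) * (2 / 3 * ((\<Sum>j=1..N. b j) + b 0) + (\<Sum>j=1..N. b j) * e ^ 3) / R0 + d"
        unfolding main_def Bs_def by (rule less_imp_le)
    qed
  qed
qed

text \<open>
  \<open>X\<close> is the limit inferior of \<open>(1 - Re \<rho>) / width\<close> over the zeros. With \<open>x = max 0 (X - 2 \<delta>)\<close> no zero at a comparable
  height lies to the right of \<open>1 - x width\<close>, because the width varies slowly, while the chosen zero is within
  \<open>3 \<delta> width\<close> of that line.
\<close>

theorem zero_free_region:
  fixes b :: "nat \<Rightarrow> real" and N :: nat and A B cc e :: real
  assumes b: "\<And>j. b j \<ge> 0" and P: "\<And>\<theta>. (\<Sum>j\<le>N. b j * cos (real j * \<theta>)) \<ge> 0"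
    and N: "N \<ge> 1" and AB: "A > 0" "B > 0" and ce: "cc > 0" "e > 0"
    and hz: "\<And>T \<sigma> y :: real. T \<ge> 3 \<Longrightarrow> 1 \<le> \<bar>y\<bar> \<Longrightarrow> \<bar>y\<bar> \<le> T \<Longrightarrow> 1 / 2 \<le> \<sigma> \<Longrightarrow> \<sigma> \<le> 1 \<Longrightarrow>
      norm (zeta (Complex \<sigma> y)) \<le> A * T powr (B * (1 - \<sigma>) powr (3 / 2)) * ln T powr (2 / 3)"
    and star: "b 0 * Re (F (- 1)) + f0 * (cc / (2 * e\<^sup>2)) * (2 / 3 * ((\<Sum>j=1..N. b j) + b 0) + (\<Sum>j=1..N. b j) * e ^ 3) < b 1 * Re (F 0)"
  shows "\<exists>t0. \<forall>t \<beta>. t \<ge> t0 \<longrightarrow> \<beta> \<ge> 1 - width cc B t \<longrightarrow> zeta (Complex \<beta> t) \<noteq> 0"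
proof (rule ccontr)
  assume contra: "\<nexists>t0. \<forall>t \<beta>. t \<ge> t0 \<longrightarrow> \<beta> \<ge> 1 - width cc B t \<longrightarrow> zeta (Complex \<beta> t) \<noteq> 0"
  define Q where "Q = (\<lambda>y. \<forall>T. \<exists>\<rho>. zeta \<rho> = 0 \<and> Im \<rho> \<ge> T \<and> 1 - Re \<rho> \<le> y * width cc B (Im \<rho>))"
  have "Q 1"
    unfolding Q_def
  proof
    fix T
    obtain t \<beta> where "t \<ge> T" "\<beta> \<ge> 1 - width cc B t" "zeta (Complex \<beta> t) = 0" using contra by blast
    thus "\<exists>\<rho>. zeta \<rho> = 0 \<and> Im \<rho> \<ge> T \<and> 1 - Re \<rho> \<le> 1 * width cc B (Im \<rho>)"
      by (intro exI[of _ "Complex \<beta> t"]) simp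
  qed
  have evw: "\<forall>\<^sub>F t in at_top. width cc B t > 0"
  proof -
    have "\<forall>\<^sub>F t :: real in at_top. ln (ln t) \<ge> 1" "\<forall>\<^sub>F t :: real in at_top. ln t \<ge> 1" by real_asymp+
    thus ?thesis
    proof eventually_elim
      case (elim t)
      have "B * ln t \<noteq> 0" "ln (ln t) \<noteq> 0" using elim AB(2) by auto
      hence "(B * ln t) powr (2 / 3) > 0" "ln (ln t) powr (1 / 3) > 0" unfolding powr_gt_zero .
      thus ?case unfolding width_def using ce(1) by (intro divide_pos_pos mult_pos_pos)
    qed
  qed
  have Re1: "Re \<rho> \<le> 1" if "zeta \<rho> = 0" for \<rho> using zeta_nonzero_gt1[of \<rho>] that by force
  have Q0: "y \<ge> 0" if y: "Q y" for y
  proof -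
    obtain T where T: "\<And>t. t \<ge> T \<Longrightarrow> width cc B t > 0" using evw unfolding eventually_at_top_linorder by blast
    from y[unfolded Q_def, rule_format, of T]
    obtain \<rho> where "zeta \<rho> = 0" "Im \<rho> \<ge> T" "1 - Re \<rho> \<le> y * width cc B (Im \<rho>)" by (elim exE conjE) (rule that)
    hence "0 \<le> y * width cc B (Im \<rho>)" "width cc B (Im \<rho>) > 0" using Re1[of \<rho>] T[of "Im \<rho>"] by auto
    thus ?thesis by (simp add: zero_le_mult_iff)
  qed
  have bdd: "bdd_below {y. Q y}" by (rule bdd_belowI[of _ 0]) (use Q0 in auto)
  define X where "X = Inf {y. Q y}"
  have X0: "X \<ge> 0" unfolding X_def by (rule cInf_greatest) (use Q0 \<open>Q 1\<close> in auto)
  have X1: "X \<le> 1" unfolding X_def by (rule cInf_lower[OF _ bdd]) (use \<open>Q 1\<close> in auto)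
  define main where "main = f0 * (cc / (2 * e\<^sup>2)) * (2 / 3 * ((\<Sum>j=1..N. b j) + b 0) + (\<Sum>j=1..N. b j) * e ^ 3)"
  have main0: "main \<ge> 0" unfolding main_def using f0 ce b by (intro mult_nonneg_nonneg add_nonneg_nonneg sum_nonneg) auto
  \<comment> \<open>\<open>G\<close> is the available margin. It pays G / 4 for the factor 1 / R0, G
    / 8 for the error of \<open>detector_limit\<close> and G / 4 for replacing F z0 by F 0,
    altogether less than G.\<close>
  define G where "G = b 1 * Re (F 0) - b 0 * Re (F (- 1)) - main"
  have G: "G > 0" using star by (simp add: G_def main_def)
  define k where "k = G / (4 * (main + 1)) / 2"
  have k: "k > 0" using G main0 by (simp add: k_def)
  define R0 where "R0 = 1 - min (1 / 2) k"
  have R0: "1 / 2 \<le> R0" "R0 < 1" using k by (auto simp: R0_def min_def)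
  have mR: "main / R0 \<le> main + G / 4"
  proof -
    have "1 - R0 \<le> k" by (simp add: R0_def)
    hence "(main + 1) * (1 - R0) \<le> (main + 1) * k" using main0 by (intro mult_left_mono) auto
    also have "(main + 1) * k = G / 8" unfolding k_def
    proof -
      have gen: "m * (G / (4 * m) / 2) = G / 8" if "m \<noteq> 0" for m using that by simp
      show "(main + 1) * (G / (4 * (main + 1)) / 2) = G / 8" by (rule gen) (use main0 in simp)
    qed
    finally have "main * (1 - R0) + (1 - R0) \<le> G / 8" by (simp add: algebra_simps)
    hence "main * (1 - R0) \<le> G / 8" using R0 by linarith
    moreover have "G / 8 \<le> G / 4 * R0" using R0 G mult_left_mono[of "1/2" R0 "G / 4"] by simp
    ultimately have "main \<le> (main + G / 4) * R0" by (simp add: algebra_simps)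
    thus ?thesis using R0 by (simp add: divide_le_eq)
  qed
  define d where "d = G / (4 * (b 1 + 1))"
  have d: "d > 0" "b 1 * d \<le> G / 4"
  proof -
    show "d > 0" using G b[of 1] by (simp add: d_def add_nonneg_pos)
    have "b 1 * d \<le> (b 1 + 1) * d" using \<open>d > 0\<close> by (simp add: distrib_right)
    also have "\<dots> = G / 4"
    proof -
      have gen: "m * (G / (4 * m)) = G / 4" if "m \<noteq> 0" for m using that by simp
      show ?thesis unfolding d_def by (rule gen) (use b[of 1] in simp)
    qed
    finally show "b 1 * d \<le> G / 4" .
  qed
  obtain r where r: "r > 0" and Fr: "\<And>z :: real. 0 \<le> z \<Longrightarrow> z \<le> r \<Longrightarrow> Re (F (of_real z)) \<ge> Re (F 0) - d"
    using F_near_0[OF d(1)] by blast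
  \<comment> \<open>The offset z0 will be at most 3 \<delta>, which has to stay below
    \<open>r\<close>, where F is close to F 0, and below 1.\<close>
  define \<delta> where "\<delta> = min (r / 3) (1 / 3)"
  have \<delta>: "\<delta> > 0" "3 * \<delta> \<le> r" "3 * \<delta> \<le> 1" using r by (auto simp: \<delta>_def)
  have "\<not> Q (X - \<delta>)"
  proof
    assume "Q (X - \<delta>)"
    hence "X \<le> X - \<delta>" unfolding X_def by (intro cInf_lower[OF _ bdd]) auto
    thus False using \<delta> by simp
  qed
  then obtain T1 where T1: "\<And>\<rho>. zeta \<rho> = 0 \<Longrightarrow> Im \<rho> \<ge> T1 \<Longrightarrow> 1 - Re \<rho> > (X - \<delta>) * width cc B (Im \<rho>)"
    unfolding Q_def by (meson not_less)
  obtain y where y: "Q y" "y < X + \<delta>"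
    using cInf_lessD[of "{y. Q y}" "X + \<delta>"] \<open>Q 1\<close> \<delta> unfolding X_def by auto
  define x where "x = max 0 (X - 2 * \<delta>)"
  have x: "0 \<le> x" "x \<le> 1" using X1 \<delta> by (auto simp: x_def)
  have ev1: "\<forall>\<^sub>F t :: real in at_top. ln (ln t) \<ge> 1" "\<forall>\<^sub>F t :: real in at_top. ln t \<ge> 1" "\<forall>\<^sub>F t :: real in at_top. ln (t - 1) > 1"
    by real_asymp+
  have ev2: "\<forall>\<^sub>F t in at_top. ln (real N + 1) \<le> \<delta> * ln t" using \<delta>(1) by real_asymp
  have "\<forall>\<^sub>F t in at_top. (width cc B t > 0 \<and> ln (ln t) \<ge> 1 \<and> ln t \<ge> 1 \<and> ln (t - 1) > 1 \<and> ln (real N + 1) \<le> \<delta> * ln t \<and> t \<ge> 3 \<and> t \<ge> T1 + 1) \<and>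
    (\<forall>x z0. 0 \<le> x \<longrightarrow> x \<le> 1 \<longrightarrow> 0 \<le> z0 \<longrightarrow> z0 \<le> 1 \<longrightarrow>
     (\<forall>j\<in>{1..N}. \<forall>\<rho>. zeta \<rho> = 0 \<longrightarrow> \<bar>Im \<rho> - real j * t\<bar> \<le> 1 \<longrightarrow> Re \<rho> \<le> 1 - x * width cc B t) \<longrightarrow>
     zeta (Complex (1 - (z0 + x) * width cc B t) t) = 0 \<longrightarrow>
     b 1 * Re (F (of_real z0)) - b 0 * Re (F (- of_real x)) \<le> main / R0 + G / 8)"
    unfolding main_def
    by (intro eventually_conj evw ev1 ev2 eventually_ge_at_top detector_limit[OF b P N AB ce R0 _ hz]) (use G in auto)
  then obtain T2 where T2: "\<And>t. t \<ge> T2 \<Longrightarrow> (width cc B t > 0 \<and> ln (ln t) \<ge> 1 \<and> ln t \<ge> 1 \<and> ln (t - 1) > 1 \<and> ln (real N + 1) \<le> \<delta> * ln t \<and> t \<ge> 3 \<and> t \<ge> T1 + 1) \<and>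
    (\<forall>x z0. 0 \<le> x \<longrightarrow> x \<le> 1 \<longrightarrow> 0 \<le> z0 \<longrightarrow> z0 \<le> 1 \<longrightarrow>
     (\<forall>j\<in>{1..N}. \<forall>\<rho>. zeta \<rho> = 0 \<longrightarrow> \<bar>Im \<rho> - real j * t\<bar> \<le> 1 \<longrightarrow> Re \<rho> \<le> 1 - x * width cc B t) \<longrightarrow>
     zeta (Complex (1 - (z0 + x) * width cc B t) t) = 0 \<longrightarrow>
     b 1 * Re (F (of_real z0)) - b 0 * Re (F (- of_real x)) \<le> main / R0 + G / 8)"
    unfolding eventually_at_top_linorder by blast
  obtain \<rho>0 where \<rho>0: "zeta \<rho>0 = 0" "Im \<rho>0 \<ge> T2" "1 - Re \<rho>0 \<le> y * width cc B (Im \<rho>0)"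
    using y(1) unfolding Q_def by blast
  define t where "t = Im \<rho>0"
  define \<mu> where "\<mu> = width cc B t"
  have t: "\<mu> > 0" "ln (ln t) \<ge> 1" "ln t \<ge> 1" "ln (t - 1) > 1" "ln (real N + 1) \<le> \<delta> * ln t" "t \<ge> 3" "t \<ge> T1 + 1"
    using T2[OF \<rho>0(2)] unfolding t_def[symmetric] \<mu>_def by blast+
  define x0 where "x0 = (1 - Re \<rho>0) / \<mu>"
  have x0: "x0 \<ge> 0" "x0 < X + \<delta>" "x0 > X - \<delta>"
  proof -
    show "x0 \<ge> 0" using Re1[OF \<rho>0(1)] t(1) by (simp add: x0_def)
    have "x0 \<le> y" using \<rho>0(3) t(1) by (simp add: x0_def t_def[symmetric] \<mu>_def[symmetric] divide_le_eq)
    thus "x0 < X + \<delta>" using y by simp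
    have "1 - Re \<rho>0 > (X - \<delta>) * \<mu>" using T1[OF \<rho>0(1)] t(7) by (simp add: t_def[symmetric] \<mu>_def)
    thus "x0 > X - \<delta>" using t(1) by (simp add: x0_def less_divide_eq)
  qed
  define z0 where "z0 = x0 - x"
  have z0: "0 \<le> z0" "z0 \<le> 3 * \<delta>" using x0 \<delta>(1) by (auto simp: z0_def x_def)
  have zf: "Re \<rho> \<le> 1 - x * \<mu>" if j: "j \<in> {1..N}" and \<rho>: "zeta \<rho> = 0" "\<bar>Im \<rho> - real j * t\<bar> \<le> 1" for j \<rho>
  proof (cases "x = 0")
    case True
    thus ?thesis using Re1[OF \<rho>(1)] by simp
  next
    case False
    hence xX: "x = X - 2 * \<delta>" "x > 0" by (auto simp: x_def max_def split: if_splits)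
    have jt: "t \<le> real j * t" "real j * t \<le> real N * t" using j t(6) by auto
    have Im: "t - 1 \<le> Im \<rho>" "Im \<rho> \<le> (real N + 1) * t"
      using \<rho>(2) jt t(6) unfolding distrib_right by linarith+
    have lI: "ln (Im \<rho>) > 1" using t(4) ln_mono[OF Im(1)] t(6) by linarith
    have w: "\<mu> \<le> (1 + \<delta>) * width cc B (Im \<rho>)"
      unfolding \<mu>_def by (rule width_slowly_varying[of B cc \<delta> t N "Im \<rho>"]) (use AB ce \<delta> t lI Im in linarith)+
    have wp: "width cc B (Im \<rho>) > 0" using w t(1) \<delta>(1) by (smt (verit) mult_nonneg_nonpos)
    have "x * \<mu> \<le> x * ((1 + \<delta>) * width cc B (Im \<rho>))" using w xX(2) by (intro mult_left_mono) auto
    also have "\<dots> = (x + x * \<delta>) * width cc B (Im \<rho>)" by (simp add: algebra_simps)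
    \<comment> \<open>Since x <= 1, the factor 1 + \<delta> from the variation of the width uses up
      one of the two \<delta> in x = X - 2 \<delta>.\<close>
    also have "\<dots> \<le> (X - \<delta>) * width cc B (Im \<rho>)"
      using wp x mult_right_mono[of x 1 \<delta>] \<delta>(1) xX(1) by (intro mult_right_mono) auto
    also have "\<dots> < 1 - Re \<rho>" by (rule T1[OF \<rho>(1)]) (use Im t(7) in linarith)
    finally show ?thesis by simp
  qed
  have zero: "zeta (Complex (1 - (z0 + x) * \<mu>) t) = 0"
  proof -
    have "Complex (1 - (z0 + x) * \<mu>) t = \<rho>0" using t(1) by (simp add: z0_def x0_def t_def)
    thus ?thesis using \<rho>0(1) by simp
  qed
  have z01: "z0 \<le> 1" "z0 \<le> r" using z0 \<delta> by linarith+
  have "\<forall>x z0. 0 \<le> x \<longrightarrow> x \<le> 1 \<longrightarrow> 0 \<le> z0 \<longrightarrow> z0 \<le> 1 \<longrightarrow>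
     (\<forall>j\<in>{1..N}. \<forall>\<rho>. zeta \<rho> = 0 \<longrightarrow> \<bar>Im \<rho> - real j * t\<bar> \<le> 1 \<longrightarrow> Re \<rho> \<le> 1 - x * \<mu>) \<longrightarrow>
     zeta (Complex (1 - (z0 + x) * \<mu>) t) = 0 \<longrightarrow>
     b 1 * Re (F (of_real z0)) - b 0 * Re (F (- of_real x)) \<le> main / R0 + G / 8"
    using T2[OF \<rho>0(2)] unfolding t_def[symmetric] \<mu>_def by blast
  hence ineq: "b 1 * Re (F (of_real z0)) - b 0 * Re (F (- of_real x)) \<le> main / R0 + G / 8"
    using x z0(1) z01(1) zf zero by blast
  have "b 1 * (Re (F 0) - d) \<le> b 1 * Re (F (of_real z0))" by (rule mult_left_mono[OF Fr[OF z0(1) z01(2)] b])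
  moreover have "b 0 * Re (F (- of_real x)) \<le> b 0 * Re (F (- 1))"
    using F_decreasing[of "-1" "-x"] x b[of 0] by (intro mult_left_mono) auto
  moreover have "b 1 * (Re (F 0) - d) = b 1 * Re (F 0) - b 1 * d" by (simp add: algebra_simps)
  moreover have "b 1 * Re (F 0) = G + main + b 0 * Re (F (- 1))" by (simp add: G_def)
  ultimately show False using ineq mR d(2) G by linarith
qed

end

theorem mainTheorem1:
  fixes A B :: real
  assumes "A > 0" and "B > 0"
    and "\<And>T \<sigma> y :: real. T \<ge> 3 \<Longrightarrow> 1 \<le> \<bar>y\<bar> \<Longrightarrow> \<bar>y\<bar> \<le> T \<Longrightarrow> 1 / 2 \<le> \<sigma> \<Longrightarrow> \<sigma> \<le> 1 \<Longrightarrow>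
      norm (zeta (Complex \<sigma> y)) \<le> A * T powr (B * (1 - \<sigma>) powr (3 / 2)) * ln T powr (2 / 3)"
  shows "\<exists>t0 :: real. \<forall>t \<beta> :: real. t \<ge> t0 \<longrightarrow>
      \<beta> \<ge> 1 - 0.055127 / ((B * ln t) powr (2 / 3) * ln (ln t) powr (1 / 3)) \<longrightarrow>
      zeta (Complex \<beta> t) \<noteq> 0"
proof -
  have "\<exists>t0. \<forall>t \<beta>. t \<ge> t0 \<longrightarrow> \<beta> \<ge> 1 - width 0.055127 B t \<longrightarrow> zeta (Complex \<beta> t) \<noteq> 0"
  proof (rule detector.zero_free_region[where b = tcoef and N = 8 and e = "6 / 5", OF tcoef_nonneg tcoef_cos_nonneg _ assms(1,2) _ _ assms(3)])
    show "tcoef 0 * Re (detector.F (- 1)) + 1001 * (866488/93075000) * (0.055127 / (2 * (6 / 5)\<^sup>2)) *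
        (2 / 3 * ((\<Sum>j=1..8. tcoef j) + tcoef 0) + (\<Sum>j=1..8. tcoef j) * (6 / 5) ^ 3) < tcoef 1 * Re (detector.F 0)"
      using detector_constants unfolding tcoef_sum by simp
  qed auto
  thus ?thesis by (simp only: width_def)
qed

end
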